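(* Suppose there is an algorithm solving the All-Edges Monochromatic Triangle problem (\textsf{AE-Mono}$\Delta$) on $n$-node graphs in time $T(n)$. Then All-Pairs Shortest Paths in $n$-node directed unweighted graphs (\textsf{UnweightedAPSP}) can be solved in $O(T(n)\log^2 n)$ time.
   Context: All-Edges Monochromatic Triangle (\textsf{AE-Mono}$\Delta$): given an $n$-node graph $G$ in which each edge has a color from $\{1,\dots,n^2\}$, decide for each edge whether it belongs to a monochromatic triangle, i.e. a triangle all three of whose edges have the same color. \textsf{UnweightedAPSP}: given an $n$-node unweighted directed graph $G=(V,E)$, compute for each pair $u,v\in V$ the length of a shortest path from $u$ to $v$ (a value in $\{0,1,\dots,n-1\}\cup\{\infty\}$). Running times are measured in the word-RAM model with $O(\log n)$-bit words. *)

theory Defs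
  imports Graph_Theory.Pair_Digraph "HOL-Library.Extended_Nat" "HOL-Library.Landau_Symbols"
begin

section \<open>Word RAM\<close>

text \<open>
  A program owns finitely many registers (those it mentions) and a random-access memory of words,
  addressed through registers. Words are natural numbers below \<open>2 ^ w\<close>. Subtraction is truncated
  at 0, division by 0 gives 0 and \<open>x mod 0 = x\<close>.

  Overflow is treated as an error: an instruction whose result needs more than \<open>w\<close> bits has no
  successor configuration. Hence a word length is only an upper bound on the sizes of the numbers
  handled, and enlarging it never changes a run (see \<open>step_mono\<close> below). Wrap-around
  arithmetic is recovered with \<open>Mod\<close> and \<open>And\<close>.
\<close>

type_synonym reg = nat

datatype binop = Add | Sub | Mul | Div | Mod | And | Or | Xor | Shl | Shr

datatype instr =
    Const reg nat            \<comment> \<open>\<open>r := k\<close>\<close>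
  | Bin binop reg reg reg    \<comment> \<open>\<open>r := a op b\<close>\<close>
  | Load reg reg             \<comment> \<open>\<open>r := mem[a]\<close>\<close>
  | Store reg reg            \<comment> \<open>\<open>mem[a] := b\<close>\<close>
  | JumpZ reg nat            \<comment> \<open>if \<open>a = 0\<close> go to instruction \<open>l\<close>\<close>
  | Halt

type_synonym prog = "instr list"

text \<open>Program counter, registers, memory.\<close>

type_synonym config = "nat \<times> (reg \<Rightarrow> nat) \<times> (nat \<Rightarrow> nat)"

fun sem_binop :: "binop \<Rightarrow> nat \<Rightarrow> nat \<Rightarrow> nat" where
  "sem_binop Add x y = x + y"
| "sem_binop Sub x y = x - y"
| "sem_binop Mul x y = x * y"
| "sem_binop Div x y = x div y"
| "sem_binop Mod x y = x mod y"
| "sem_binop And x y = Bit_Operations.and x y"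
| "sem_binop Or x y = Bit_Operations.or x y"
| "sem_binop Xor x y = Bit_Operations.xor x y"
| "sem_binop Shl x y = push_bit y x"
| "sem_binop Shr x y = drop_bit y x"

fun set_reg :: "nat \<Rightarrow> reg \<Rightarrow> nat \<Rightarrow> config \<Rightarrow> config option" where
  "set_reg w r x (pc, R, M) = (if x < 2 ^ w then Some (Suc pc, R(r := x), M) else None)"

fun exec :: "nat \<Rightarrow> instr \<Rightarrow> config \<Rightarrow> config option" where
  "exec w (Const r k) (pc, R, M) = set_reg w r k (pc, R, M)"
| "exec w (Bin f r a b) (pc, R, M) = set_reg w r (sem_binop f (R a) (R b)) (pc, R, M)"
| "exec w (Load r a) (pc, R, M) = set_reg w r (M (R a)) (pc, R, M)"
| "exec w (Store a b) (pc, R, M) = Some (Suc pc, R, M(R a := R b))"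
| "exec w (JumpZ a l) (pc, R, M) = Some (if R a = 0 then l else Suc pc, R, M)"
| "exec w Halt (pc, R, M) = None"

definition step :: "nat \<Rightarrow> prog \<Rightarrow> config \<Rightarrow> config option" where
  "step w P s = (if fst s < length P then exec w (P ! fst s) s else None)"

lemma step_mono:
  assumes "w \<le> w'" "step w P s = Some s'"
  shows "step w' P s = Some s'"
proof -
  have le: "x < 2 ^ w'" if "x < 2 ^ w" for x :: nat
    using that assms(1) by (meson less_le_trans one_le_numeral power_increasing)
  obtain pc R M where s: "s = (pc, R, M)" by (cases s)
  show ?thesis using assms(2) unfolding step_def s
    by (cases "P ! pc") (auto split: if_splits intro: le)
qed

text \<open>
  Started at instruction 0 with cleared registers and memory \<open>M\<close>, the program reaches a \<open>Halt\<close>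
  instruction after exactly \<open>t\<close> steps, with memory \<open>M'\<close>.
\<close>

definition halts_after :: "nat \<Rightarrow> prog \<Rightarrow> (nat \<Rightarrow> nat) \<Rightarrow> nat \<Rightarrow> (nat \<Rightarrow> nat) \<Rightarrow> bool" where
  "halts_after w P M t M' \<longleftrightarrow>
     (\<exists>pc R. ((\<lambda>s s'. step w P s = Some s') ^^ t) (0, \<lambda>_. 0, M) (pc, R, M') \<and>
             pc < length P \<and> P ! pc = Halt)"


section \<open>Matrix problems and their time complexity\<close>

text \<open>
  An element \<open>(n, A, S)\<close> of a problem is an instance of size \<open>n\<close>, given by the \<open>n \<times> n\<close> matrix
  \<open>A\<close>, together with the set \<open>S\<close> of its acceptable \<open>n \<times> n\<close> output matrices.

  Memory layout: \<open>n\<close> at address 0, then \<open>A\<close> in row-major order, then the output in row-major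
  order. All cells other than the input are initially 0.
\<close>

type_synonym matrix = "nat \<Rightarrow> nat \<Rightarrow> nat"

type_synonym problem = "(nat \<times> matrix \<times> matrix set) set"

definition input_mem :: "nat \<Rightarrow> matrix \<Rightarrow> nat \<Rightarrow> nat" where
  "input_mem n A a =
     (if a = 0 then n else if a \<le> n\<^sup>2 then A ((a - 1) div n) ((a - 1) mod n) else 0)"

definition output_matrix :: "nat \<Rightarrow> (nat \<Rightarrow> nat) \<Rightarrow> matrix" where
  "output_matrix n M u v = M (1 + n\<^sup>2 + u * n + v)"

definition solvable_in_time :: "problem \<Rightarrow> (nat \<Rightarrow> real) \<Rightarrow> bool" where
  "solvable_in_time prb T \<longleftrightarrow>
     (\<exists>P W. (\<lambda>n. real (W n)) \<in> O(\<lambda>n. log 2 (real n)) \<and>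
            (\<forall>(n, A, S) \<in> prb. \<exists>t M'. real t \<le> T n \<and>
               halts_after (W n) P (input_mem n A) t M' \<and> output_matrix n M' \<in> S))"


section \<open>All-Edges Monochromatic Triangle\<close>

text \<open>
  Nodes are \<open>0, \<dots>, n - 1\<close>. As in the graph library, an undirected simple graph is a symmetric
  loop-free digraph.
\<close>

definition edge_coloured_graph :: "nat \<Rightarrow> nat pair_pre_digraph \<Rightarrow> (nat \<times> nat \<Rightarrow> nat) \<Rightarrow> bool" where
  "edge_coloured_graph n G c \<longleftrightarrow>
     n \<ge> 1 \<and> pair_graph G \<and> pverts G = {..<n} \<and>
     (\<forall>(u, v) \<in> parcs G. c (u, v) \<in> {1..n\<^sup>2} \<and> c (v, u) = c (u, v))"

definition monochromatic_triangle ::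
    "nat pair_pre_digraph \<Rightarrow> (nat \<times> nat \<Rightarrow> nat) \<Rightarrow> nat \<Rightarrow> nat \<Rightarrow> nat \<Rightarrow> bool" where
  "monochromatic_triangle G c u v x \<longleftrightarrow>
     {(u, v), (v, x), (u, x)} \<subseteq> parcs G \<and> c (u, v) = c (v, x) \<and> c (v, x) = c (u, x)"

text \<open>Colours are positive, so 0 marks non-edges. Output entries of non-edges are irrelevant.\<close>

definition colour_matrix :: "nat pair_pre_digraph \<Rightarrow> (nat \<times> nat \<Rightarrow> nat) \<Rightarrow> matrix" where
  "colour_matrix G c u v = (if (u, v) \<in> parcs G then c (u, v) else 0)"

definition AE_Mono_Triangle :: problem where
  "AE_Mono_Triangle =
     {(n, colour_matrix G c,
       {B. \<forall>(u, v) \<in> parcs G. B u v = of_bool (\<exists>x. monochromatic_triangle G c u v x)}) | n G c.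
      edge_coloured_graph n G c}"


section \<open>Unweighted directed all-pairs shortest paths\<close>

text \<open>The infimum of the empty set of lengths is \<open>\<infinity>\<close>.\<close>

definition shortest_path_length :: "nat pair_pre_digraph \<Rightarrow> nat \<Rightarrow> nat \<Rightarrow> enat" where
  "shortest_path_length G u v =
     (INF p \<in> {p. pre_digraph.apath (with_proj G) u p v}. enat (length p))"

definition adjacency_matrix :: "nat pair_pre_digraph \<Rightarrow> matrix" where
  "adjacency_matrix G u v = of_bool ((u, v) \<in> parcs G)"

text \<open>Finite distances are below \<open>n\<close>, so the output word \<open>n\<close> is free to represent \<open>\<infinity>\<close>.\<close>

definition distance_word :: "nat \<Rightarrow> enat \<Rightarrow> nat" where
  "distance_word n d = (case d of enat k \<Rightarrow> k | \<infinity> \<Rightarrow> n)"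

definition UnweightedAPSP :: problem where
  "UnweightedAPSP =
     {(n, adjacency_matrix G,
       {B. \<forall>u<n. \<forall>v<n. B u v = distance_word n (shortest_path_length G u v)}) | n G.
      n \<ge> 1 \<and> pair_fin_digraph G \<and> pverts G = {..<n}}"

end

theory Submission
  imports Defs
begin

text \<open>
  Distances are computed by doubling. A round starts with a matrix that is exact for distances up
  to \<open>r\<close> and never too small, and with a set of hubs such that, whenever \<open>v\<close> is at finite distance
  at least \<open>r / 2\<close> from \<open>u\<close>, some shortest path from \<open>u\<close> to \<open>v\<close> has a hub within distance \<open>r / 2\<close>
  of \<open>u\<close>. Two min-plus products through the hubs make the matrix exact for distances up to \<open>2 r\<close>.
  Midpoints recorded in earlier rounds then recover shortest paths from their lengths, and a greedy
  hitting set of the short ones gives \<open>O(n log n / r)\<close> hubs for the next round.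

  A min-plus product is read off bit by bit from the top: the minimum of the sums
  \<open>x div 2 ^ j + y div 2 ^ j\<close> is one of \<open>2 \<mu>\<close>, \<open>2 \<mu> + 1\<close>, \<open>2 \<mu> + 2\<close> if \<open>\<mu>\<close> is the one for
  \<open>j + 1\<close>. A test \<open>x + y = c\<close> becomes a search for a monochromatic triangle whose third node is a
  pair of a hub and a residue. There are \<open>O(n log n)\<close> such pairs over all bits together, hence
  \<open>O(log n)\<close> calls on \<open>n\<close> nodes per round. The given triangle program is interpreted on a memory
  with time stamps, so that repeated calls need no clearing.

  All this takes \<open>O((T n + n\<^sup>2) (log n)\<^sup>2)\<close> steps, and \<open>n\<^sup>2\<close> is absorbed because on a complete
  graph with a single colour the triangle program has to write every output entry off the diagonal.
\<close>

section \<open>Structured programs and their compilation\<close>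

text \<open>\<open>T\<close> is an arbitrary function of \<open>n\<close>, and the word length
  granted to the triangle program varies with \<open>n\<close> as well. Nothing is known about its
  behaviour at neighbouring sizes, so every call is made at size exactly \<open>n\<close>, and a
  larger task means more calls instead of larger instances. The balance behind a round: a product
  with finite entries O(r) needs O(r / 2^j + 1) residues per hub at bit j, hence O(r + log n) per
  hub over all bits. With all \<open>n\<close> nodes as hubs this would be O(r + log n) calls; only
  the decline of the number of hubs like (n log n) / r brings it down to O(log n). The radius r / 2
  is what two products can afford: with hubs within g, a product extends exactness from r to 2 r -
  g, the next one to 4 r - 3 g, and this is at least 2 r for g \<le> r / 2. New hubs have to hit
  actual paths, but products deliver only lengths. Finding a midpoint is therefore posed as one more
  minimum search, over node numbers. Recording only paths that start at old hubs keeps their total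
  length O(n^2 log n).\<close>

datatype exp = N nat | V nat | Op binop exp exp | Ld nat exp exp

datatype com =
    Skip
  | Asg nat exp              (infix "::=" 61)
  | St nat exp exp exp
  | Seq com com              (infixr ";;" 60)
  | If exp com com
  | While exp com

type_synonym vars = "nat \<Rightarrow> nat"
type_synonym arrs = "nat \<Rightarrow> nat \<Rightarrow> nat \<Rightarrow> nat"

text \<open>Arrays are numbered 0 to 23; the last one stores the recorded paths.\<close>

definition K :: nat where "K = 24"

lemma K_pos [simp]: "0 < K" by (simp add: K_def)

text \<open>
  Cell \<open>(i, j)\<close> of array \<open>k < K\<close> lives at address \<open>(i * K + k) * S + j\<close>, where the
  stride \<open>S\<close> is the constant value of variable 0. Hence row 0 of array 0 is an initial segment
  of the raw memory, which is how input and output are accessed.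
\<close>

fun ev :: "exp \<Rightarrow> vars \<Rightarrow> arrs \<Rightarrow> nat" where
  "ev (N k) v a = k"
| "ev (V x) v a = v x"
| "ev (Op f e1 e2) v a = sem_binop f (ev e1 v a) (ev e2 v a)"
| "ev (Ld k e1 e2) v a = a k (ev e1 v a) (ev e2 v a)"

definition upd :: "arrs \<Rightarrow> nat \<Rightarrow> nat \<Rightarrow> nat \<Rightarrow> nat \<Rightarrow> arrs" where
  "upd a k i j x = a(k := (a k)(i := (a k i)(j := x)))"

lemma upd_apply: "upd a k i j x k' i' j' = (if k' = k \<and> i' = i \<and> j' = j then x else a k' i' j')"
  by (simp add: upd_def)

lemma upd_other [simp]: "k' \<noteq> k \<Longrightarrow> upd a k i j x k' = a k'"
  by (simp add: upd_def)

text \<open>Even register \<open>2 * d\<close> is cell \<open>d\<close> of an evaluation stack, odd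
  register \<open>2 * x + 1\<close> holds variable \<open>x\<close>. Thus register 1 always contains
  the stride, by which the address computation multiplies. The bitwise conjunction of a register
  with itself serves as a move.\<close>

fun ecode :: "exp \<Rightarrow> nat \<Rightarrow> instr list" where
  "ecode (N k) d = [Const (2 * d) k]"
| "ecode (V x) d = [Bin And (2 * d) (2 * x + 1) (2 * x + 1)]"
| "ecode (Op f e1 e2) d = ecode e1 d @ ecode e2 (Suc d) @ [Bin f (2 * d) (2 * d) (2 * d + 2)]"
| "ecode (Ld k e1 e2) d = ecode e1 d @ ecode e2 (Suc d) @
     [Const (2 * d + 4) K, Bin Mul (2 * d) (2 * d) (2 * d + 4), Const (2 * d + 4) k,
      Bin Add (2 * d) (2 * d) (2 * d + 4), Bin Mul (2 * d) (2 * d) 1,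
      Bin Add (2 * d) (2 * d) (2 * d + 2), Load (2 * d) (2 * d)]"

fun ecost :: "exp \<Rightarrow> nat" where
  "ecost (N k) = 1"
| "ecost (V x) = 1"
| "ecost (Op f e1 e2) = ecost e1 + ecost e2 + 1"
| "ecost (Ld k e1 e2) = ecost e1 + ecost e2 + 7"

lemma length_ecode [simp]: "length (ecode e d) = ecost e"
  by (induction e arbitrary: d) auto

text \<open>Jump targets are absolute, so the code depends on its position \<open>p\<close>.
  Clearing register 0 and then testing it gives an unconditional jump in two steps.\<close>

fun ccode :: "com \<Rightarrow> nat \<Rightarrow> instr list" where
  "ccode Skip p = []"
| "ccode (x ::= e) p = ecode e 0 @ [Bin And (2 * x + 1) 0 0]"
| "ccode (St k e1 e2 e3) p = ecode e1 0 @ ecode e2 1 @ ecode e3 2 @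
     [Const 6 K, Bin Mul 0 0 6, Const 6 k, Bin Add 0 0 6, Bin Mul 0 0 1, Bin Add 0 0 2, Store 0 4]"
| "ccode (c1 ;; c2) p = ccode c1 p @ ccode c2 (p + length (ccode c1 p))"
| "ccode (If b c1 c2) p =
     ecode b 0 @ [JumpZ 0 (p + ecost b + length (ccode c1 (p + ecost b + 1)) + 3)] @
     ccode c1 (p + ecost b + 1) @
     [Const 0 0, JumpZ 0 (p + ecost b + length (ccode c1 (p + ecost b + 1)) + 3 +
        length (ccode c2 (p + ecost b + length (ccode c1 (p + ecost b + 1)) + 3)))] @
     ccode c2 (p + ecost b + length (ccode c1 (p + ecost b + 1)) + 3)"
| "ccode (While b c) p =
     ecode b 0 @ [JumpZ 0 (p + ecost b + length (ccode c (p + ecost b + 1)) + 3)] @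
     ccode c (p + ecost b + 1) @ [Const 0 0, JumpZ 0 p]"

primrec wv :: "com \<Rightarrow> nat set" where
  "wv Skip = {}"
| "wv (x ::= e) = {x}"
| "wv (St k e1 e2 e3) = {}"
| "wv (c1 ;; c2) = wv c1 \<union> wv c2"
| "wv (If b c1 c2) = wv c1 \<union> wv c2"
| "wv (While b c) = wv c"

primrec wa :: "com \<Rightarrow> nat set" where
  "wa Skip = {}"
| "wa (x ::= e) = {}"
| "wa (St k e1 e2 e3) = {k}"
| "wa (c1 ;; c2) = wa c1 \<union> wa c2"
| "wa (If b c1 c2) = wa c1 \<union> wa c2"
| "wa (While b c) = wa c"

section \<open>Big-step semantics with overflow checks and exact step counts\<close>

locale lang =
  fixes B S :: nat
begin

text \<open>
  No overflow: words stay below \<open>B\<close>. Subtraction, division and remainder of words are words.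
\<close>

fun ok :: "exp \<Rightarrow> vars \<Rightarrow> arrs \<Rightarrow> bool" where
  "ok (N k) v a = (k < B)"
| "ok (V x) v a = True"
| "ok (Op f e1 e2) v a = (ok e1 v a \<and> ok e2 v a \<and>
     (f = Sub \<or> f = Div \<or> f = Mod \<or> sem_binop f (ev e1 v a) (ev e2 v a) < B))"
| "ok (Ld k e1 e2) v a = (ok e1 v a \<and> ok e2 v a \<and> k < K \<and> ev e2 v a < S)"

text \<open>The number is the exact count of machine steps of the compiled code. In conditionals and
  loops \<open>+ 1\<close> is the conditional jump and \<open>+ 2\<close> the unconditional one
  after a true branch or a loop body.\<close>

inductive big :: "com \<Rightarrow> vars \<Rightarrow> arrs \<Rightarrow> nat \<Rightarrow> vars \<Rightarrow> arrs \<Rightarrow> bool" where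
  Skip: "big Skip v a 0 v a"
| Asg: "ok e v a \<Longrightarrow> big (x ::= e) v a (ecost e + 1) (v(x := ev e v a)) a"
| St: "ok e1 v a \<Longrightarrow> ok e2 v a \<Longrightarrow> ok e3 v a \<Longrightarrow> k < K \<Longrightarrow> ev e2 v a < S \<Longrightarrow>
     big (St k e1 e2 e3) v a (ecost e1 + ecost e2 + ecost e3 + 7) v
       (upd a k (ev e1 v a) (ev e2 v a) (ev e3 v a))"
| Seq: "big c1 v a t1 v1 a1 \<Longrightarrow> big c2 v1 a1 t2 v2 a2 \<Longrightarrow> big (c1 ;; c2) v a (t1 + t2) v2 a2"
| IfT: "ok b v a \<Longrightarrow> ev b v a \<noteq> 0 \<Longrightarrow> big c1 v a t v' a' \<Longrightarrow>
     big (If b c1 c2) v a (ecost b + 1 + t + 2) v' a'"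
| IfF: "ok b v a \<Longrightarrow> ev b v a = 0 \<Longrightarrow> big c2 v a t v' a' \<Longrightarrow>
     big (If b c1 c2) v a (ecost b + 1 + t) v' a'"
| WhileF: "ok b v a \<Longrightarrow> ev b v a = 0 \<Longrightarrow> big (While b c) v a (ecost b + 1) v a"
| WhileT: "ok b v a \<Longrightarrow> ev b v a \<noteq> 0 \<Longrightarrow> big c v a t1 v1 a1 \<Longrightarrow>
     big (While b c) v1 a1 t2 v2 a2 \<Longrightarrow>
     big (While b c) v a (ecost b + 1 + t1 + 2 + t2) v2 a2"

definition valid :: "vars \<Rightarrow> arrs \<Rightarrow> bool" where
  "valid v a \<longleftrightarrow> (\<forall>x. v x < B) \<and> (\<forall>k i j. a k i j < B)"

lemma valid_ev: "valid v a \<Longrightarrow> ok e v a \<Longrightarrow> ev e v a < B"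
proof (induction e)
  case (Op f e1 e2)
  have "sem_binop f (ev e1 v a) (ev e2 v a) < B" if "f = Sub \<or> f = Div \<or> f = Mod"
    using that Op by (auto intro: le_less_trans[OF diff_le_self] le_less_trans[OF div_le_dividend]
        le_less_trans[OF mod_less_eq_dividend])
  then show ?case using Op by auto
qed (auto simp: valid_def)

lemma big_valid: "big c v a t v' a' \<Longrightarrow> valid v a \<Longrightarrow> valid v' a'"
proof (induction rule: big.induct)
  case (Asg e v a x)
  then show ?case using valid_ev[of v a e] by (auto simp: valid_def)
next
  case (St e1 v a e2 e3 k)
  then show ?case using valid_ev[of v a e3] by (auto simp: valid_def upd_apply)
qed auto

text \<open>Variables and arrays are allocated globally by number. What a piece of code preserves is
  therefore a syntactic matter, and specifications need only mention what changes.\<close>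

lemma big_frame:
  "big c v a t v' a' \<Longrightarrow> (\<forall>x. x \<notin> wv c \<longrightarrow> v' x = v x) \<and> (\<forall>k. k \<notin> wa c \<longrightarrow> a' k = a k)"
  by (induction rule: big.induct) auto

end

section \<open>Runs of jump-free instruction sequences inside a larger program\<close>

fun exec1 :: "nat \<Rightarrow> instr \<Rightarrow> (reg \<Rightarrow> nat) \<times> (nat \<Rightarrow> nat) \<Rightarrow> ((reg \<Rightarrow> nat) \<times> (nat \<Rightarrow> nat)) option" where
  "exec1 w (Const r k) (R, M) = (if k < 2 ^ w then Some (R(r := k), M) else None)"
| "exec1 w (Bin f r x y) (R, M) =
     (if sem_binop f (R x) (R y) < 2 ^ w then Some (R(r := sem_binop f (R x) (R y)), M) else None)"
| "exec1 w (Load r x) (R, M) = (if M (R x) < 2 ^ w then Some (R(r := M (R x)), M) else None)"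
| "exec1 w (Store x y) (R, M) = Some (R, M(R x := R y))"
| "exec1 w (JumpZ x l) s = None"
| "exec1 w Halt s = None"

fun execs :: "nat \<Rightarrow> instr list \<Rightarrow> (reg \<Rightarrow> nat) \<times> (nat \<Rightarrow> nat) \<Rightarrow> ((reg \<Rightarrow> nat) \<times> (nat \<Rightarrow> nat)) option" where
  "execs w [] s = Some s"
| "execs w (i # is) s = Option.bind (exec1 w i s) (execs w is)"

lemma execs_append: "execs w (xs @ ys) s = Option.bind (execs w xs s) (execs w ys)"
  by (induction xs arbitrary: s) (auto simp: bind_eq_Some_conv split: option.splits Option.bind_splits)

definition code_at :: "prog \<Rightarrow> nat \<Rightarrow> instr list \<Rightarrow> bool" where
  "code_at Q p is \<longleftrightarrow> (\<exists>xs ys. Q = xs @ is @ ys \<and> length xs = p)"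

lemma code_at_append:
  "code_at Q p (is1 @ is2) \<longleftrightarrow> code_at Q p is1 \<and> code_at Q (p + length is1) is2"
proof
  assume "code_at Q p (is1 @ is2)"
  then obtain xs ys where "Q = xs @ (is1 @ is2) @ ys" "length xs = p" by (auto simp: code_at_def)
  then have "Q = xs @ is1 @ (is2 @ ys)" "Q = (xs @ is1) @ is2 @ ys" by auto
  with \<open>length xs = p\<close> show "code_at Q p is1 \<and> code_at Q (p + length is1) is2"
    unfolding code_at_def by (metis length_append)
next
  assume "code_at Q p is1 \<and> code_at Q (p + length is1) is2"
  then have "code_at Q p is1" "code_at Q (p + length is1) is2" by auto
  then obtain xs ys xs' ys' where 1: "Q = xs @ is1 @ ys" "length xs = p"
    and 2: "Q = xs' @ is2 @ ys'" "length xs' = p + length is1"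
    unfolding code_at_def by blast
  have "xs' = take (p + length is1) Q" using 2 by simp
  also have "\<dots> = xs @ is1" using 1 by simp
  finally show "code_at Q p (is1 @ is2)" using 1 2 unfolding code_at_def by auto
qed

lemma code_at_Cons:
  "code_at Q p (i # is) \<longleftrightarrow> p < length Q \<and> Q ! p = i \<and> code_at Q (Suc p) is"
proof -
  have "code_at Q p [i] \<longleftrightarrow> p < length Q \<and> Q ! p = i"
  proof
    assume "p < length Q \<and> Q ! p = i"
    then have "Q = take p Q @ [i] @ drop (Suc p) Q" by (metis append_Cons append_Nil id_take_nth_drop)
    moreover have "length (take p Q) = p" using \<open>p < length Q \<and> Q ! p = i\<close> by simp
    ultimately show "code_at Q p [i]" unfolding code_at_def by blast
  qed (auto simp: code_at_def)
  then show ?thesis using code_at_append[of Q p "[i]" "is"] by simp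
qed

lemma code_at_Nil [simp]: "code_at Q p [] \<longleftrightarrow> p \<le> length Q"
proof
  assume "p \<le> length Q"
  then have "Q = take p Q @ [] @ drop p Q" "length (take p Q) = p" by auto
  then show "code_at Q p []" unfolding code_at_def by blast
qed (auto simp: code_at_def)

definition reach :: "nat \<Rightarrow> prog \<Rightarrow> config \<Rightarrow> nat \<Rightarrow> config \<Rightarrow> bool" where
  "reach w Q s t s' \<longleftrightarrow> ((\<lambda>s s'. step w Q s = Some s') ^^ t) s s'"

lemma reach_0 [simp]: "reach w Q s 0 s' \<longleftrightarrow> s = s'"
  by (auto simp: reach_def)

lemma reach_Suc: "reach w Q s (Suc t) s' \<longleftrightarrow> (\<exists>s1. step w Q s = Some s1 \<and> reach w Q s1 t s')"
  unfolding reach_def by (auto simp: relpowp_Suc_left OO_def simp del: relpowp.simps(2))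

lemma reach_trans: "reach w Q s t s' \<Longrightarrow> reach w Q s' t' s'' \<Longrightarrow> reach w Q s (t + t') s''"
  unfolding reach_def by (auto simp: relpowp_add)

lemma exec1_exec: "exec1 w i (R, M) = Some (R', M') \<Longrightarrow> exec w i (p, R, M) = Some (Suc p, R', M')"
  by (cases i) (auto split: if_splits)

lemma reach_execs:
  "execs w is (R, M) = Some (R', M') \<Longrightarrow> code_at Q p is \<Longrightarrow>
   reach w Q (p, R, M) (length is) (p + length is, R', M')"
proof (induction "is" arbitrary: p R M)
  case (Cons i "is")
  then obtain R1 M1 where 1: "exec1 w i (R, M) = Some (R1, M1)" "execs w is (R1, M1) = Some (R', M')"
    by (auto simp: bind_eq_Some_conv)
  have "step w Q (p, R, M) = Some (Suc p, R1, M1)"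
    using Cons.prems(2) exec1_exec[OF 1(1)] by (simp add: step_def code_at_Cons)
  moreover have "reach w Q (Suc p, R1, M1) (length is) (Suc p + length is, R', M')"
    by (rule Cons.IH[OF 1(2)]) (use Cons.prems(2) in \<open>simp add: code_at_Cons\<close>)
  ultimately show ?case by (auto simp: reach_Suc)
qed auto

lemma reach_jump:
  assumes "code_at Q p [JumpZ r l]"
  shows "reach w Q (p, R, M) 1 (if R r = 0 then l else Suc p, R, M)"
  using assms by (auto simp: reach_Suc step_def code_at_Cons)

section \<open>Correctness of the compilation\<close>

locale compiled = lang +
  fixes w :: nat
  assumes S_pos: "0 < S" and fits: "(B * K + K) * S + S \<le> 2 ^ w"
begin

definition rel :: "vars \<Rightarrow> arrs \<Rightarrow> (reg \<Rightarrow> nat) \<Rightarrow> (nat \<Rightarrow> nat) \<Rightarrow> bool" where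
  "rel v a R M \<longleftrightarrow> (\<forall>x. R (2 * x + 1) = v x) \<and>
     (\<forall>k<K. \<forall>i. \<forall>j<S. M ((i * K + k) * S + j) = a k i j)"

lemma addr_inj:
  assumes "(i * K + k) * S + j = (i' * K + k') * S + j'" "k < K" "k' < K" "j < S" "j' < S"
  shows "i = i' \<and> k = k' \<and> j = j'"
proof -
  have "((i * K + k) * S + j) div S = i * K + k" "((i' * K + k') * S + j') div S = i' * K + k'"
    using assms(4,5) by auto
  then have 1: "i * K + k = i' * K + k'" using assms(1) by simp
  have "(i * K + k) div K = i" "(i' * K + k') div K = i'" using assms(2,3) by auto
  then show ?thesis using 1 assms(1) by auto
qed

text \<open>A row index may be any word below \<open>B\<close>, because the memory of the simulated
  program is laid out with one row per address. The assumption \<open>fits\<close> therefore covers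
  all such rows and not only the matrix sizes.\<close>

lemma addr_fits:
  assumes "i < B" "k < K" "j < S"
  shows "i * K < 2 ^ w" "i * K + k < 2 ^ w" "(i * K + k) * S < 2 ^ w" "(i * K + k) * S + j < 2 ^ w"
proof -
  have "i * K + k \<le> B * K + K" using assms by (intro add_mono mult_right_mono) auto
  then have "(i * K + k) * S \<le> (B * K + K) * S" by (intro mult_right_mono) auto
  then show 4: "(i * K + k) * S + j < 2 ^ w" using assms fits by linarith
  then show 3: "(i * K + k) * S < 2 ^ w" by linarith
  have "i * K + k \<le> (i * K + k) * S" using S_pos by simp
  then show "i * K + k < 2 ^ w" using 3 by linarith
  then show "i * K < 2 ^ w" by linarith
qed

lemma B_le: "B \<le> 2 ^ w" "K < 2 ^ w"
proof -
  have "B * K + K \<le> (B * K + K) * S" using S_pos by simp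
  then have 1: "B * K + K + S \<le> 2 ^ w" using fits by linarith
  then show "K < 2 ^ w" using S_pos by linarith
  have "B \<le> B * K" by (simp add: Suc_le_eq)
  then show "B \<le> 2 ^ w" using 1 by linarith
qed

text \<open>Besides the variables in the odd registers, the stack below \<open>2 * d\<close> is
  protected; otherwise the first operand would not survive the evaluation of the second.\<close>

lemma ecode_correct:
  assumes "valid v a" "rel v a R M" "v 0 = S" "ok e v a"
  shows "\<exists>R'. execs w (ecode e d) (R, M) = Some (R', M) \<and> R' (2 * d) = ev e v a \<and>
    (\<forall>r. odd r \<or> r < 2 * d \<longrightarrow> R' r = R r)"
  using assms(2,4)
proof (induction e arbitrary: d R)
  case (N k)
  then have "k < 2 ^ w" using B_le by simp
  then show ?case by auto
next
  case (V x)
  then have "R (2 * x + 1) = v x" by (auto simp: rel_def)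
  moreover have "v x < 2 ^ w" using assms(1) B_le by (auto simp: valid_def intro: less_le_trans)
  ultimately show ?case by auto
next
  case (Op f e1 e2)
  from Op.IH(1)[of R d] Op.prems obtain R1 where 1: "execs w (ecode e1 d) (R, M) = Some (R1, M)"
    "R1 (2 * d) = ev e1 v a" "\<forall>r. odd r \<or> r < 2 * d \<longrightarrow> R1 r = R r" by auto
  have "rel v a R1 M" using Op.prems(1) 1(3) by (auto simp: rel_def)
  from Op.IH(2)[OF this, of "Suc d"] Op.prems obtain R2
    where 2: "execs w (ecode e2 (Suc d)) (R1, M) = Some (R2, M)"
    "R2 (2 * Suc d) = ev e2 v a" "\<forall>r. odd r \<or> r < 2 * Suc d \<longrightarrow> R2 r = R1 r" by auto
  have 3: "R2 (2 * d) = ev e1 v a" using 1 2 by auto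
  have "ev (Op f e1 e2) v a < 2 ^ w" using valid_ev[OF assms(1) Op.prems(2)] B_le by linarith
  then show ?case using 1 2 3 by (auto simp: execs_append)
next
  case (Ld k e1 e2)
  from Ld.IH(1)[of R d] Ld.prems obtain R1 where 1: "execs w (ecode e1 d) (R, M) = Some (R1, M)"
    "R1 (2 * d) = ev e1 v a" "\<forall>r. odd r \<or> r < 2 * d \<longrightarrow> R1 r = R r" by auto
  have "rel v a R1 M" using Ld.prems(1) 1(3) by (auto simp: rel_def)
  from Ld.IH(2)[OF this, of "Suc d"] Ld.prems obtain R2
    where 2: "execs w (ecode e2 (Suc d)) (R1, M) = Some (R2, M)"
    "R2 (2 * Suc d) = ev e2 v a" "\<forall>r. odd r \<or> r < 2 * Suc d \<longrightarrow> R2 r = R1 r" by auto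
  have 3: "R2 (2 * d) = ev e1 v a" using 1 2 by auto
  have R1S: "R2 1 = S" using 1 2 Ld.prems(1) assms(3)
    by (auto simp: rel_def) (metis One_nat_def mult_0_right)
  have i: "ev e1 v a < B" using Ld.prems assms(1) valid_ev by auto
  have jk: "k < K" "ev e2 v a < S" using Ld.prems by auto
  have M: "M ((ev e1 v a * K + k) * S + ev e2 v a) = a k (ev e1 v a) (ev e2 v a)"
    using Ld.prems(1) jk by (auto simp: rel_def)
  have b: "a k (ev e1 v a) (ev e2 v a) < 2 ^ w"
    using assms(1) B_le(1) unfolding valid_def by (meson less_le_trans)
  have kw: "k < 2 ^ w" using jk B_le by linarith
  note f = addr_fits[OF i jk]
  have ne: "(1::nat) \<noteq> 2 * d" "(1::nat) \<noteq> 2 * d + 4" by presburger+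
  show ?case using 1 2 3 R1S M b kw f B_le ne by (auto simp: execs_append)
qed

lemma big_zero:
  "big c v a t v' a' \<Longrightarrow> 0 \<notin> wv c \<Longrightarrow> v' 0 = v 0"
  using big_frame by blast

lemma test_reach:
  assumes "valid v a" "rel v a R M" "v 0 = S" "ok b v a" "code_at Q p (ecode b 0 @ [JumpZ 0 l])"
  shows "\<exists>R'. reach w Q (p, R, M) (ecost b + 1)
    (if ev b v a = 0 then l else p + ecost b + 1, R', M) \<and> rel v a R' M"
proof -
  from ecode_correct[OF assms(1-4), of 0] obtain R' where
    1: "execs w (ecode b 0) (R, M) = Some (R', M)" "R' 0 = ev b v a" "\<forall>r. odd r \<longrightarrow> R' r = R r" by auto
  have "reach w Q (p, R, M) (ecost b) (p + ecost b, R', M)"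
    using reach_execs[OF 1(1), of Q p] assms(5) by (simp add: code_at_append)
  moreover have "reach w Q (p + ecost b, R', M) 1 (if R' 0 = 0 then l else Suc (p + ecost b), R', M)"
    by (rule reach_jump) (use assms(5) in \<open>simp add: code_at_append\<close>)
  ultimately have "reach w Q (p, R, M) (ecost b + 1) (if R' 0 = 0 then l else Suc (p + ecost b), R', M)"
    by (rule reach_trans)
  moreover have "rel v a R' M" using assms(2) 1(3) by (auto simp: rel_def)
  ultimately show ?thesis using 1(2) by (auto intro!: exI[of _ R'])
qed

lemma goto_reach:
  assumes "rel v a R M" "code_at Q p [Const 0 0, JumpZ 0 l]"
  shows "\<exists>R'. reach w Q (p, R, M) 2 (l, R', M) \<and> rel v a R' M"
proof -
  have "code_at Q p [Const 0 0]" using assms(2) code_at_append[of Q p "[Const 0 0]" "[JumpZ 0 l]"] by simp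
  from reach_execs[OF _ this, of w R M "R(0 := 0)" M]
  have 1: "reach w Q (p, R, M) 1 (p + 1, R(0 := 0), M)" by simp
  have 2: "reach w Q (p + 1, R(0 := 0), M) 1 (if (R(0 := 0)) 0 = 0 then l else Suc (p + 1), R(0 := 0), M)"
    by (rule reach_jump) (use assms(2) in \<open>simp add: code_at_Cons\<close>)
  have "reach w Q (p, R, M) 2 (l, R(0 := 0), M)" using reach_trans[OF 1 2] by (simp add: numeral_2_eq_2)
  moreover have "rel v a (R(0 := 0)) M" using assms(1) by (auto simp: rel_def)
  ultimately show ?thesis by blast
qed

text \<open>Induction on the derivation. Variable 0 must never be assigned, since every address
  computation reads the stride from its register.\<close>

theorem ccode_correct:
  assumes "big c v a t v' a'" "valid v a" "v 0 = S" "0 \<notin> wv c" "code_at Q p (ccode c p)" "rel v a R M"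
  shows "\<exists>R' M'. reach w Q (p, R, M) t (p + length (ccode c p), R', M') \<and> rel v' a' R' M'"
  using assms
proof (induction arbitrary: p R M rule: big.induct)
  case (Skip v a)
  then show ?case by auto
next
  case (Asg e v a x)
  from ecode_correct[of v a R M e 0] Asg obtain R' where
    1: "execs w (ecode e 0) (R, M) = Some (R', M)" "R' 0 = ev e v a" "\<forall>r. odd r \<longrightarrow> R' r = R r" by auto
  have b: "ev e v a < 2 ^ w" using valid_ev[of v a e] Asg B_le by (auto intro: less_le_trans)
  have "execs w (ccode (x ::= e) p) (R, M) = Some (R'(2 * x + 1 := ev e v a), M)"
    using 1 b by (simp add: execs_append)
  from reach_execs[OF this Asg.prems(4)] have
    "reach w Q (p, R, M) (ecost e + 1) (p + length (ccode (x ::= e) p), R'(2 * x + 1 := ev e v a), M)" by simp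
  moreover have "rel (v(x := ev e v a)) a (R'(2 * x + 1 := ev e v a)) M"
    using Asg.prems(5) 1(3) by (auto simp: rel_def)
  ultimately show ?case by blast
next
  case (St e1 v a e2 e3 k)
  from ecode_correct[of v a R M e1 0] St obtain R1 where
    1: "execs w (ecode e1 0) (R, M) = Some (R1, M)" "R1 0 = ev e1 v a" "\<forall>r. odd r \<longrightarrow> R1 r = R r" by auto
  have r1: "rel v a R1 M" using St.prems(5) 1(3) by (auto simp: rel_def)
  from ecode_correct[OF _ r1, of e2 1] St obtain R2 where
    2: "execs w (ecode e2 1) (R1, M) = Some (R2, M)" "R2 2 = ev e2 v a"
      "\<forall>r. odd r \<or> r < 2 \<longrightarrow> R2 r = R1 r" by auto
  have r2: "rel v a R2 M" using r1 2(3) by (auto simp: rel_def)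
  from ecode_correct[OF _ r2, of e3 2] St obtain R3 where
    3: "execs w (ecode e3 2) (R2, M) = Some (R3, M)" "R3 4 = ev e3 v a"
      "\<forall>r. odd r \<or> r < 4 \<longrightarrow> R3 r = R2 r" by auto
  have R3: "R3 0 = ev e1 v a" "R3 2 = ev e2 v a" "R3 1 = S"
    using 1 2 3 St.prems(2) r2 by (auto simp: rel_def) (metis One_nat_def mult_0_right)
  have i: "ev e1 v a < B" using St valid_ev by auto
  note jk = St.hyps(4,5)
  note f = addr_fits[OF i jk]
  have kw: "k < 2 ^ w" using jk B_le by linarith
  let ?ad = "(ev e1 v a * K + k) * S + ev e2 v a"
  let ?R = "R3(6 := k, 0 := ?ad)"
  have "execs w (ccode (St k e1 e2 e3) p) (R, M) = Some (?R, M(?ad := ev e3 v a))"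
    using 1(1) 2(1) 3(1,2) R3 f kw B_le by (simp add: execs_append fun_upd_twist)
  from reach_execs[OF this St.prems(4)] have
    "reach w Q (p, R, M) (ecost e1 + ecost e2 + ecost e3 + 7)
      (p + length (ccode (St k e1 e2 e3) p), ?R, M(?ad := ev e3 v a))" by (simp add: add_ac eval_nat_numeral)
  moreover have "rel v (upd a k (ev e1 v a) (ev e2 v a) (ev e3 v a)) ?R (M(?ad := ev e3 v a))"
    unfolding rel_def
  proof (intro conjI allI impI)
    fix x :: nat have "odd (2 * x + 1)" "2 * x + 1 \<noteq> 0" "2 * x + 1 \<noteq> 6" by presburger+
    then show "?R (2 * x + 1) = v x" using r2 3(3) by (auto simp: rel_def)
  next
    fix k' i' j' assume kj: "k' < K" "j' < S"
    show "(M(?ad := ev e3 v a)) ((i' * K + k') * S + j') =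
        upd a k (ev e1 v a) (ev e2 v a) (ev e3 v a) k' i' j'"
      using addr_inj[of i' k' j' "ev e1 v a" k "ev e2 v a"] kj jk r2
      by (auto simp: upd_apply rel_def)
  qed
  ultimately show ?case by blast
next
  case (Seq c1 v a t1 v1 a1 c2 t2 v2 a2)
  from Seq.IH(1)[of p R M] Seq.prems obtain R1 M1 where
    1: "reach w Q (p, R, M) t1 (p + length (ccode c1 p), R1, M1)" "rel v1 a1 R1 M1"
    by (auto simp: code_at_append)
  have "valid v1 a1" "v1 0 = S" using Seq big_valid big_zero by auto
  with Seq.IH(2)[of "p + length (ccode c1 p)" R1 M1] Seq.prems 1(2) obtain R2 M2 where
    2: "reach w Q (p + length (ccode c1 p), R1, M1) t2
       (p + length (ccode c1 p) + length (ccode c2 (p + length (ccode c1 p))), R2, M2)" "rel v2 a2 R2 M2"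
    by (auto simp: code_at_append)
  from reach_trans[OF 1(1) 2(1)] 2(2) show ?case by (auto simp: add.assoc)
next
  case (IfT b v a c1 t v' a' c2)
  let ?p1 = "p + ecost b + 1"
  let ?k1 = "ccode c1 ?p1"
  let ?l = "p + ecost b + length ?k1 + 3"
  have ca: "code_at Q p (ecode b 0 @ [JumpZ 0 ?l])" "code_at Q ?p1 ?k1"
    "code_at Q (?p1 + length ?k1) [Const 0 0, JumpZ 0 (?l + length (ccode c2 ?l))]"
    using IfT.prems(4) by (auto simp: code_at_append code_at_Cons numeral_3_eq_3)
  from test_reach[OF IfT.prems(1,5,2) IfT.hyps(1) ca(1)] IfT.hyps(2) obtain R1 where
    1: "reach w Q (p, R, M) (ecost b + 1) (?p1, R1, M)" "rel v a R1 M" by auto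
  from IfT.IH[OF IfT.prems(1,2) _ ca(2) 1(2)] IfT.prems(3) obtain R2 M2 where
    2: "reach w Q (?p1, R1, M) t (?p1 + length ?k1, R2, M2)" "rel v' a' R2 M2" by auto
  from goto_reach[OF 2(2) ca(3)] obtain R3 where
    3: "reach w Q (?p1 + length ?k1, R2, M2) 2 (?l + length (ccode c2 ?l), R3, M2)" "rel v' a' R3 M2" by auto
  from reach_trans[OF reach_trans[OF 1(1) 2(1)] 3(1)] 3(2) show ?case by (auto simp: add_ac eval_nat_numeral)
next
  case (IfF b v a c2 t v' a' c1)
  let ?p1 = "p + ecost b + 1"
  let ?k1 = "ccode c1 ?p1"
  let ?l = "p + ecost b + length ?k1 + 3"
  have ca: "code_at Q p (ecode b 0 @ [JumpZ 0 ?l])" "code_at Q ?l (ccode c2 ?l)"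
    using IfF.prems(4) by (auto simp: code_at_append code_at_Cons numeral_3_eq_3)
  from test_reach[OF IfF.prems(1,5,2) IfF.hyps(1) ca(1)] IfF.hyps(2) obtain R1 where
    1: "reach w Q (p, R, M) (ecost b + 1) (?l, R1, M)" "rel v a R1 M" by auto
  from IfF.IH[OF IfF.prems(1,2) _ ca(2) 1(2)] IfF.prems(3) obtain R2 M2 where
    2: "reach w Q (?l, R1, M) t (?l + length (ccode c2 ?l), R2, M2)" "rel v' a' R2 M2" by auto
  from reach_trans[OF 1(1) 2(1)] 2(2) show ?case by (auto simp: add_ac eval_nat_numeral)
next
  case (WhileF b v a c)
  let ?l = "p + ecost b + length (ccode c (p + ecost b + 1)) + 3"
  have ca: "code_at Q p (ecode b 0 @ [JumpZ 0 ?l])"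
    using WhileF.prems(4) by (simp add: code_at_append code_at_Cons)
  from test_reach[OF WhileF.prems(1,5,2) WhileF.hyps(1) ca(1)] WhileF.hyps(2) show ?case
    by (auto simp: add_ac eval_nat_numeral)
next
  case (WhileT b v a c t1 v1 a1 t2 v2 a2)
  let ?p1 = "p + ecost b + 1"
  let ?k1 = "ccode c ?p1"
  let ?l = "p + ecost b + length ?k1 + 3"
  have ca: "code_at Q p (ecode b 0 @ [JumpZ 0 ?l])" "code_at Q ?p1 ?k1"
    "code_at Q (?p1 + length ?k1) [Const 0 0, JumpZ 0 p]"
    using WhileT.prems(4) by (auto simp: code_at_append code_at_Cons numeral_3_eq_3)
  from test_reach[OF WhileT.prems(1,5,2) WhileT.hyps(1) ca(1)] WhileT.hyps(2) obtain R1 where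
    1: "reach w Q (p, R, M) (ecost b + 1) (?p1, R1, M)" "rel v a R1 M" by auto
  from WhileT.IH(1)[OF WhileT.prems(1,2) _ ca(2) 1(2)] WhileT.prems(3) obtain R2 M2 where
    2: "reach w Q (?p1, R1, M) t1 (?p1 + length ?k1, R2, M2)" "rel v1 a1 R2 M2" by auto
  from goto_reach[OF 2(2) ca(3)] obtain R3 where
    3: "reach w Q (?p1 + length ?k1, R2, M2) 2 (p, R3, M2)" "rel v1 a1 R3 M2" by auto
  have "valid v1 a1" "v1 0 = S" using WhileT big_valid big_zero by auto
  from WhileT.IH(2)[OF this WhileT.prems(3,4) 3(2)] obtain R4 M4 where
    4: "reach w Q (p, R3, M2) t2 (p + length (ccode (While b c) p), R4, M4)" "rel v2 a2 R4 M4" by auto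
  from reach_trans[OF reach_trans[OF reach_trans[OF 1(1) 2(1)] 3(1)] 4(1)] 4(2) show ?case
    by (auto simp: add_ac eval_nat_numeral)
qed

end

section \<open>Weakest preconditions with time bounds\<close>

text \<open>Meant for loop-free programs. The value for loops is a dummy, harmless because
  \<open>sp\<close> rejects loops.\<close>

primrec ccost :: "com \<Rightarrow> nat" where
  "ccost Skip = 0"
| "ccost (x ::= e) = ecost e + 1"
| "ccost (St k e1 e2 e3) = ecost e1 + ecost e2 + ecost e3 + 7"
| "ccost (c1 ;; c2) = ccost c1 + ccost c2"
| "ccost (If b c1 c2) = ecost b + 3 + ccost c1 + ccost c2"
| "ccost (While b c) = 0"

text \<open>Truncated subtraction is nonzero exactly if the first value is the smaller one, and any
  nonzero value counts as true.\<close>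

abbreviation Less :: "exp \<Rightarrow> exp \<Rightarrow> exp" where
  "Less e1 e2 \<equiv> Op Sub e2 e1"

definition IfEq :: "exp \<Rightarrow> exp \<Rightarrow> com \<Rightarrow> com \<Rightarrow> com" where
  "IfEq e1 e2 c1 c2 = If (Op Sub e1 e2) c2 (If (Op Sub e2 e1) c2 c1)"

text \<open>The bound is evaluated once, into variable \<open>Suc x\<close>. Hence nested loops use
  counters at least two apart, and the body may change what \<open>e\<close> refers to.\<close>

definition For :: "nat \<Rightarrow> exp \<Rightarrow> com \<Rightarrow> com" where
  "For x e c = (Suc x ::= e ;; x ::= N 0 ;;
     While (Less (V x) (V (Suc x))) (c ;; x ::= Op Add (V x) (N 1)))"

lemma IfEq_simps [simp]:
  "ccost (IfEq e1 e2 c1 c2) = 2 * (ecost e1 + ecost e2 + 4 + ccost c2) + ccost c1"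
  "wv (IfEq e1 e2 c1 c2) = wv c1 \<union> wv c2"
  "wa (IfEq e1 e2 c1 c2) = wa c1 \<union> wa c2"
  by (auto simp: IfEq_def)

lemma For_simps [simp]:
  "wv (For x e c) = insert x (insert (Suc x) (wv c))"
  "wa (For x e c) = wa c"
  by (auto simp: For_def)

context lang
begin

definition wp :: "com \<Rightarrow> nat \<Rightarrow> (vars \<Rightarrow> arrs \<Rightarrow> bool) \<Rightarrow> vars \<Rightarrow> arrs \<Rightarrow> bool" where
  "wp c t Q v a \<longleftrightarrow> (\<exists>t' v' a'. big c v a t' v' a' \<and> t' \<le> t \<and> Q v' a')"

lemma wp_frame:
  assumes "wp c t Q v a"
    and "\<And>v' a'. Q v' a' \<Longrightarrow> (\<And>x. x \<notin> wv c \<Longrightarrow> v' x = v x) \<Longrightarrow> (\<And>k. k \<notin> wa c \<Longrightarrow> a' k = a k) \<Longrightarrow> Q' v' a'"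
    and "t \<le> t'"
  shows "wp c t' Q' v a"
proof -
  obtain t1 v' a' where 1: "big c v a t1 v' a'" "t1 \<le> t" "Q v' a'" using assms(1) by (auto simp: wp_def)
  have "Q' v' a'" by (rule assms(2)) (use big_frame[OF 1(1)] 1(3) in auto)
  then show ?thesis unfolding wp_def using 1(1,2) assms(3) by (meson le_trans)
qed

lemma wp_conseq:
  assumes "wp c t Q v a" "\<And>v' a'. Q v' a' \<Longrightarrow> Q' v' a'" "t \<le> t'"
  shows "wp c t' Q' v a"
  by (rule wp_frame[OF assms(1) _ assms(3)]) (rule assms(2))

lemma wp_seq:
  assumes "wp c1 ta (wp c2 tb Q) v a" "ta + tb \<le> t"
  shows "wp (c1 ;; c2) t Q v a"
  using assms unfolding wp_def by (meson big.Seq add_mono le_trans)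

lemma wp_seq_frame:
  assumes "wp c1 ta Q1 v a"
    and "\<And>v' a'. Q1 v' a' \<Longrightarrow> (\<And>x. x \<notin> wv c1 \<Longrightarrow> v' x = v x) \<Longrightarrow> (\<And>k. k \<notin> wa c1 \<Longrightarrow> a' k = a k) \<Longrightarrow>
           wp c2 tb Q v' a'"
    and "ta + tb \<le> t"
  shows "wp (c1 ;; c2) t Q v a"
  by (rule wp_seq[OF wp_frame[OF assms(1)] assms(3)]) (use assms(2) in auto)

lemma wp_If:
  assumes "ok b v a" "ev b v a \<noteq> 0 \<Longrightarrow> wp c1 ta Q v a" "ev b v a = 0 \<Longrightarrow> wp c2 ta Q v a" "ecost b + 3 + ta \<le> t"
  shows "wp (If b c1 c2) t Q v a"
proof (cases "ev b v a = 0")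
  case True
  then obtain t' v' a' where "big c2 v a t' v' a'" "t' \<le> ta" "Q v' a'" using assms(3) by (auto simp: wp_def)
  with big.IfF[OF assms(1) True this(1)] assms(4) show ?thesis unfolding wp_def
    by (intro exI conjI) (assumption, auto)
next
  case False
  then obtain t' v' a' where "big c1 v a t' v' a'" "t' \<le> ta" "Q v' a'" using assms(2) by (auto simp: wp_def)
  with big.IfT[OF assms(1) False this(1)] assms(4) show ?thesis unfolding wp_def
    by (intro exI conjI) (assumption, auto)
qed

lemma wp_IfEq:
  assumes "ok e1 v a" "ok e2 v a" "ev e1 v a = ev e2 v a \<Longrightarrow> wp c1 ta Q v a"
    "ev e1 v a \<noteq> ev e2 v a \<Longrightarrow> wp c2 ta Q v a" "2 * (ecost e1 + ecost e2 + 4) + ta \<le> t"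
  shows "wp (IfEq e1 e2 c1 c2) t Q v a"
  unfolding IfEq_def
  by (rule wp_If[where ta = "ecost e1 + ecost e2 + 4 + ta"], use assms in simp,
      rule wp_conseq[OF assms(4)], simp, simp, simp,
      rule wp_If[where ta = ta], use assms in auto)

text \<open>A weakest precondition that the simplifier can execute on loop-free code. Time is left
  to \<open>ccost\<close>. The postcondition may itself be the \<open>wp\<close> of the remaining
  program, as in \<open>wp_sp_seq\<close>.\<close>

primrec sp :: "com \<Rightarrow> (vars \<Rightarrow> arrs \<Rightarrow> bool) \<Rightarrow> vars \<Rightarrow> arrs \<Rightarrow> bool" where
  "sp Skip Q v a = Q v a"
| "sp (x ::= e) Q v a = (ok e v a \<and> Q (v(x := ev e v a)) a)"
| "sp (St k e1 e2 e3) Q v a = (ok e1 v a \<and> ok e2 v a \<and> ok e3 v a \<and> k < K \<and> ev e2 v a < S \<and>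
     Q v (upd a k (ev e1 v a) (ev e2 v a) (ev e3 v a)))"
| "sp (c1 ;; c2) Q v a = sp c1 (sp c2 Q) v a"
| "sp (If b c1 c2) Q v a = (ok b v a \<and> (if ev b v a \<noteq> 0 then sp c1 Q v a else sp c2 Q v a))"
| "sp (While b c) Q v a = False"

lemma sp_IfEq [simp]:
  "sp (IfEq e1 e2 c1 c2) Q v a =
     (ok e1 v a \<and> ok e2 v a \<and> (if ev e1 v a = ev e2 v a then sp c1 Q v a else sp c2 Q v a))"
  by (auto simp: IfEq_def)

lemma sp_mono: "sp c Q v a \<Longrightarrow> (\<And>v' a'. Q v' a' \<Longrightarrow> Q' v' a') \<Longrightarrow> sp c Q' v a"
  by (induction c arbitrary: Q Q' v a) (auto split: if_splits)

lemma sp_seqI: "sp c1 R v a \<Longrightarrow> (\<And>v' a'. R v' a' \<Longrightarrow> sp c2 Q v' a') \<Longrightarrow> sp (c1 ;; c2) Q v a"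
  by (auto intro: sp_mono)

lemma wp_sp: "sp c Q v a \<Longrightarrow> ccost c \<le> t \<Longrightarrow> wp c t Q v a"
proof (induction c arbitrary: Q v a t)
  case Skip
  then show ?case by (auto simp: wp_def intro: big.intros)
next
  case (Asg x e)
  then show ?case by (auto simp: wp_def intro!: exI big.Asg)
next
  case (St k e1 e2 e3)
  then show ?case by (auto simp: wp_def intro!: exI big.St)
next
  case (Seq c1 c2)
  have "wp c1 (ccost c1) (sp c2 Q) v a" using Seq by simp
  then have "wp c1 (ccost c1) (wp c2 (ccost c2) Q) v a" by (rule wp_conseq) (use Seq in auto)
  then show ?case by (rule wp_seq) (use Seq in auto)
next
  case (If b c1 c2)
  show ?case by (rule wp_If[where ta = "ccost c1 + ccost c2"]) (use If in \<open>auto split: if_splits\<close>)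
qed auto

lemma wp_sp_seq: "sp c1 (wp c2 tb Q) v a \<Longrightarrow> ccost c1 + tb \<le> t \<Longrightarrow> wp (c1 ;; c2) t Q v a"
  by (rule wp_seq[OF wp_sp]) auto

text \<open>Induction on the potential \<open>k\<close>, which strictly drops in each iteration and
  so gives termination too. Unspent potential is reported in the postcondition, because an enclosing
  loop may have to pay with it.\<close>

lemma wp_while_pot:
  assumes "I k v a"
    and step: "\<And>k v a. I k v a \<Longrightarrow> ok b v a \<and> (ev b v a \<noteq> 0 \<longrightarrow>
          (\<exists>t. wp c t (\<lambda>v' a'. \<exists>k'. I k' v' a' \<and> t + ecost b + 3 + k' \<le> k) v a))"
  shows "\<exists>t. wp (While b c) t (\<lambda>v' a'. ev b v' a' = 0 \<and> (\<exists>k'. I k' v' a' \<and> t + k' \<le> k + ecost b + 1)) v a"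
  using assms(1)
proof (induction k arbitrary: v a rule: less_induct)
  case (less k)
  show ?case
  proof (cases "ev b v a = 0")
    case True
    then show ?thesis using step[OF less.prems] less.prems unfolding wp_def
      by (intro exI[of _ "ecost b + 1"] exI[of _ v] exI[of _ a]) (auto intro: big.WhileF[of b v a c, simplified])
  next
    case False
    then obtain t where "wp c t (\<lambda>v' a'. \<exists>k'. I k' v' a' \<and> t + ecost b + 3 + k' \<le> k) v a"
      using step[OF less.prems] by auto
    then obtain t1 v1 a1 k1 where 1: "big c v a t1 v1 a1" "t1 \<le> t" "I k1 v1 a1" "t + ecost b + 3 + k1 \<le> k"
      by (auto simp: wp_def)
    then have "k1 < k" by linarith
    from less.IH[OF this 1(3)] obtain t2 where "wp (While b c) t2
      (\<lambda>v' a'. ev b v' a' = 0 \<and> (\<exists>k'. I k' v' a' \<and> t2 + k' \<le> k1 + ecost b + 1)) v1 a1" by blast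
    then obtain t3 v2 a2 k2 where
      2: "big (While b c) v1 a1 t3 v2 a2" "t3 \<le> t2" "ev b v2 a2 = 0" "I k2 v2 a2" "t2 + k2 \<le> k1 + ecost b + 1"
      by (auto simp: wp_def)
    have "big (While b c) v a (ecost b + 1 + t1 + 2 + t3) v2 a2"
      by (rule big.WhileT[OF _ False 1(1) 2(1)]) (use step[OF less.prems] in blast)
    moreover have "ecost b + 1 + t1 + 2 + t3 \<le> ecost b + 1 + t + 2 + t2" using 1(2) 2(2) by linarith
    moreover have "(ecost b + 1 + t + 2 + t2) + k2 \<le> k + ecost b + 1" using 1 2 by linarith
    ultimately show ?thesis using 2(3,4) unfolding wp_def by blast
  qed
qed

lemma wp_while:
  assumes "I k v a"
    and step: "\<And>k v a. I k v a \<Longrightarrow> ok b v a \<and> (ev b v a \<noteq> 0 \<longrightarrow>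
          (\<exists>t. wp c t (\<lambda>v' a'. \<exists>k'. I k' v' a' \<and> t + ecost b + 3 + k' \<le> k) v a))"
  shows "wp (While b c) (k + ecost b + 1) (\<lambda>v' a'. ev b v' a' = 0 \<and> (\<exists>k'. I k' v' a')) v a"
proof -
  obtain t where "wp (While b c) t (\<lambda>v' a'. ev b v' a' = 0 \<and> (\<exists>k'. I k' v' a' \<and> t + k' \<le> k + ecost b + 1)) v a"
    using wp_while_pot[of I, OF assms] by blast
  then show ?thesis unfolding wp_def by fastforce
qed

text \<open>
  The potential \<open>pot\<close> pays for the remaining iterations, which allows amortised bounds.
\<close>

lemma wp_for_pot:
  assumes e: "ok e v a" "ev e v a = n" "1 < B" "n < B"
    and vars: "wv c \<subseteq> {Suc (Suc x)..}"
    and init: "I 0 a"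
    and body: "\<And>i v' a'. i < n \<Longrightarrow> I i a' \<Longrightarrow> v' x = i \<Longrightarrow> v' (Suc x) = n \<Longrightarrow>
       (\<And>z. z < x \<Longrightarrow> v' z = v z) \<Longrightarrow> (\<And>k. k \<notin> wa c \<Longrightarrow> a' k = a k) \<Longrightarrow>
       \<exists>t. wp c t (\<lambda>v'' a''. I (Suc i) a'' \<and> t + 10 + pot (Suc i) a'' \<le> pot i a') v' a'"
    and post: "\<And>v' a'. I n a' \<Longrightarrow> (\<And>z. z < x \<Longrightarrow> v' z = v z) \<Longrightarrow> (\<And>k. k \<notin> wa c \<Longrightarrow> a' k = a k) \<Longrightarrow> Q v' a'"
  shows "\<exists>t. wp (For x e c) t (\<lambda>v' a'. Q v' a' \<and> t + pot n a' \<le> pot 0 a + ecost e + 7) v a"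
proof -
  define J where "J k v' a' \<longleftrightarrow> v' x \<le> n \<and> v' (Suc x) = n \<and> I (v' x) a' \<and> (\<forall>z<x. v' z = v z) \<and>
      (\<forall>k. k \<notin> wa c \<longrightarrow> a' k = a k) \<and> pot (v' x) a' \<le> k" for k v' a'
  let ?b = "Less (V x) (V (Suc x))"
  let ?v = "v(Suc x := n, x := 0)"
  have "\<exists>t. wp (While ?b (c ;; x ::= Op Add (V x) (N 1))) t
     (\<lambda>v' a'. ev ?b v' a' = 0 \<and> (\<exists>k'. J k' v' a' \<and> t + k' \<le> pot 0 a + ecost ?b + 1)) ?v a"
  proof (rule wp_while_pot)
    show "J (pot 0 a) ?v a" using init by (auto simp: J_def)
  next
    fix k v1 a1 assume J: "J k v1 a1"
    show "ok ?b v1 a1 \<and> (ev ?b v1 a1 \<noteq> 0 \<longrightarrow> (\<exists>t. wp (c ;; x ::= Op Add (V x) (N 1)) t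
       (\<lambda>v' a'. \<exists>k'. J k' v' a' \<and> t + ecost ?b + 3 + k' \<le> k) v1 a1))"
    proof (intro conjI impI)
      assume "ev ?b v1 a1 \<noteq> 0"
      then have lt: "v1 x < n" using J by (auto simp: J_def)
      from body[OF lt, of a1 v1] J obtain t where
        t: "wp c t (\<lambda>v'' a''. I (Suc (v1 x)) a'' \<and> t + 10 + pot (Suc (v1 x)) a'' \<le> pot (v1 x) a1) v1 a1"
        by (auto simp: J_def)
      \<comment> \<open>The charge of 10 per iteration: 4 for the increment, 6 for the test with its
        branch and the jump back.\<close>
      have "wp (c ;; x ::= Op Add (V x) (N 1)) (t + 4) (\<lambda>v' a'. \<exists>k'. J k' v' a' \<and> (t + 4) + ecost ?b + 3 + k' \<le> k) v1 a1"
      proof (rule wp_seq_frame[OF t, where tb = 4])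
        fix v2 a2 assume 2: "I (Suc (v1 x)) a2 \<and> t + 10 + pot (Suc (v1 x)) a2 \<le> pot (v1 x) a1"
          and fr: "\<And>x. x \<notin> wv c \<Longrightarrow> v2 x = v1 x" "\<And>k. k \<notin> wa c \<Longrightarrow> a2 k = a1 k"
        have v2: "v2 x = v1 x" "v2 (Suc x) = v1 (Suc x)" "\<And>z. z < x \<Longrightarrow> v2 z = v1 z" using vars by (auto intro!: fr)
        let ?v2 = "v2(x := Suc (v1 x))"
        have "J (pot (Suc (v1 x)) a2) ?v2 a2" using J 2 v2 fr lt by (auto simp: J_def)
        moreover have "(t + 4) + ecost ?b + 3 + pot (Suc (v1 x)) a2 \<le> k" using 2 J by (auto simp: J_def)
        ultimately show "wp (x ::= Op Add (V x) (N 1)) 4 (\<lambda>v' a'. \<exists>k'. J k' v' a' \<and> (t + 4) + ecost ?b + 3 + k' \<le> k) v2 a2"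
          using v2 lt e(3,4) by (intro wp_sp) (auto simp del: J_def)
      qed simp
      then show "\<exists>t. wp (c ;; x ::= Op Add (V x) (N 1)) t (\<lambda>v' a'. \<exists>k'. J k' v' a' \<and> t + ecost ?b + 3 + k' \<le> k) v1 a1" by blast
    qed auto
  qed
  then obtain t where "wp (While ?b (c ;; x ::= Op Add (V x) (N 1))) t
     (\<lambda>v' a'. ev ?b v' a' = 0 \<and> (\<exists>k'. J k' v' a' \<and> t + k' \<le> pot 0 a + ecost ?b + 1)) ?v a" by blast
  then have "wp (While ?b (c ;; x ::= Op Add (V x) (N 1))) t (\<lambda>v' a'. Q v' a' \<and> t + pot n a' \<le> pot 0 a + 4) ?v a"
    by (rule wp_conseq) (auto simp: J_def intro!: post)
  then obtain t1 v1 a1 where 1: "big (While ?b (c ;; x ::= Op Add (V x) (N 1))) ?v a t1 v1 a1" "t1 \<le> t"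
    "Q v1 a1" "t + pot n a1 \<le> pot 0 a + 4" by (auto simp: wp_def)
  have "big (Suc x ::= e) v a (ecost e + 1) (v(Suc x := n)) a"
    using big.Asg[OF e(1), of "Suc x"] e(2) by simp
  moreover have "big (x ::= N 0) (v(Suc x := n)) a 2 ?v a"
    using big.Asg[of "N 0" "v(Suc x := n)" a x] e(3) by (simp add: numeral_2_eq_2)
  ultimately have "big (For x e c) v a ((ecost e + 1) + (2 + t1)) v1 a1"
    unfolding For_def using 1(1) by (blast intro: big.Seq)
  then have "wp (For x e c) (t + ecost e + 3) (\<lambda>v' a'. Q v' a' \<and> (t + ecost e + 3) + pot n a' \<le> pot 0 a + ecost e + 7) v a"
    unfolding wp_def using 1(2,3,4) by (intro exI conjI) (assumption, auto)
  then show ?thesis by blast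
qed

lemma wp_for:
  assumes e: "ok e v a" "ev e v a = n" "1 < B" "n < B"
    and vars: "wv c \<subseteq> {Suc (Suc x)..}"
    and init: "I 0 a"
    and body: "\<And>i v' a'. i < n \<Longrightarrow> I i a' \<Longrightarrow> v' x = i \<Longrightarrow> v' (Suc x) = n \<Longrightarrow>
       (\<And>z. z < x \<Longrightarrow> v' z = v z) \<Longrightarrow> (\<And>k. k \<notin> wa c \<Longrightarrow> a' k = a k) \<Longrightarrow>
       \<exists>t. wp c t (\<lambda>v'' a''. I (Suc i) a'' \<and> t + 10 + pot (Suc i) a'' \<le> pot i a') v' a'"
    and post: "\<And>v' a'. I n a' \<Longrightarrow> (\<And>z. z < x \<Longrightarrow> v' z = v z) \<Longrightarrow> (\<And>k. k \<notin> wa c \<Longrightarrow> a' k = a k) \<Longrightarrow> Q v' a'"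
    and time: "pot 0 a + ecost e + 7 \<le> T"
  shows "wp (For x e c) T Q v a"
proof -
  obtain t where "wp (For x e c) t (\<lambda>v' a'. Q v' a' \<and> t + pot n a' \<le> pot 0 a + ecost e + 7) v a"
    using wp_for_pot[where I = I and Q = Q and pot = pot, OF e vars init body post] by blast
  then show ?thesis unfolding wp_def using time by fastforce
qed

lemma wp_for_sum:
  assumes e: "ok e v a" "ev e v a = n" "1 < B" "n < B"
    and vars: "wv c \<subseteq> {Suc (Suc x)..}"
    and init: "I 0 a"
    and body: "\<And>i v' a'. i < n \<Longrightarrow> I i a' \<Longrightarrow> v' x = i \<Longrightarrow> v' (Suc x) = n \<Longrightarrow>
       (\<And>z. z < x \<Longrightarrow> v' z = v z) \<Longrightarrow> (\<And>k. k \<notin> wa c \<Longrightarrow> a' k = a k) \<Longrightarrow>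
       wp c (t i) (\<lambda>v'' a''. I (Suc i) a'') v' a'"
    and post: "\<And>v' a'. I n a' \<Longrightarrow> (\<And>z. z < x \<Longrightarrow> v' z = v z) \<Longrightarrow> (\<And>k. k \<notin> wa c \<Longrightarrow> a' k = a k) \<Longrightarrow> Q v' a'"
    and time: "(\<Sum>i<n. t i + 10) + ecost e + 7 \<le> T"
  shows "wp (For x e c) T Q v a"
proof (rule wp_for[where I = I and pot = "\<lambda>i _. \<Sum>k=i..<n. t k + 10", OF e vars init _ post])
  fix i v' a' assume i: "i < n" and *: "I i a'" "v' x = i" "v' (Suc x) = n"
       "\<And>z. z < x \<Longrightarrow> v' z = v z" "\<And>k. k \<notin> wa c \<Longrightarrow> a' k = a k"
  have "(\<Sum>k=i..<n. t k + 10) = t i + 10 + (\<Sum>k=Suc i..<n. t k + 10)"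
    using i by (rule sum.atLeast_Suc_lessThan)
  then show "\<exists>s. wp c s (\<lambda>v'' a''. I (Suc i) a'' \<and> s + 10 + (\<Sum>k=Suc i..<n. t k + 10) \<le> (\<Sum>k=i..<n. t k + 10)) v' a'"
    by (intro exI[of _ "t i"] wp_conseq[OF body[OF i *]]) auto
qed (use time in \<open>auto simp: atLeast0LessThan\<close>)

lemma wp_for_const:
  assumes e: "ok e v a" "ev e v a = n" "1 < B" "n < B"
    and vars: "wv c \<subseteq> {Suc (Suc x)..}"
    and init: "I 0 a"
    and body: "\<And>i v' a'. i < n \<Longrightarrow> I i a' \<Longrightarrow> v' x = i \<Longrightarrow> v' (Suc x) = n \<Longrightarrow>
       (\<And>z. z < x \<Longrightarrow> v' z = v z) \<Longrightarrow> (\<And>k. k \<notin> wa c \<Longrightarrow> a' k = a k) \<Longrightarrow>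
       wp c t (\<lambda>v'' a''. I (Suc i) a'') v' a'"
    and post: "\<And>v' a'. I n a' \<Longrightarrow> (\<And>z. z < x \<Longrightarrow> v' z = v z) \<Longrightarrow> (\<And>k. k \<notin> wa c \<Longrightarrow> a' k = a k) \<Longrightarrow> Q v' a'"
    and time: "n * (t + 10) + ecost e + 7 \<le> T"
  shows "wp (For x e c) T Q v a"
  by (rule wp_for_sum[where I = I and t = "\<lambda>_. t", OF e vars init body post]) (use time in auto)

end

section \<open>Simulation with a clearable memory\<close>

text \<open>
  The memory of the simulated machine is kept in arrays 21 (values) and 22 (epoch of the last
  write). A cell not written in the current epoch, held in variable 33, counts as 0, so that
  starting a new epoch clears the memory in constant time. Variable 60 is the program counter,
  variable 61 is cleared on halting, and register \<open>r\<close> is variable \<open>62 + r\<close>.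
\<close>

fun sim_instr :: "nat \<Rightarrow> instr \<Rightarrow> com" where
  "sim_instr l (Const r c) = (62 + r ::= N c ;; 60 ::= N (Suc l))"
| "sim_instr l (Bin f r x y) = (62 + r ::= Op f (V (62 + x)) (V (62 + y)) ;; 60 ::= N (Suc l))"
| "sim_instr l (Load r x) =
     (IfEq (Ld 22 (V (62 + x)) (N 0)) (V 33) (62 + r ::= Ld 21 (V (62 + x)) (N 0)) (62 + r ::= N 0) ;;
      60 ::= N (Suc l))"
| "sim_instr l (Store x y) =
     (St 21 (V (62 + x)) (N 0) (V (62 + y)) ;; St 22 (V (62 + x)) (N 0) (V 33) ;; 60 ::= N (Suc l))"
| "sim_instr l (JumpZ x l') = If (V (62 + x)) (60 ::= N (Suc l)) (60 ::= N l')"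
| "sim_instr l Halt = (61 ::= N 0)"

text \<open>Dispatch by linear search for the program counter. The cost is a constant, as the
  simulated program is fixed.\<close>

fun sim_branch :: "nat \<Rightarrow> prog \<Rightarrow> com" where
  "sim_branch l [] = Skip"
| "sim_branch l (i # is) = IfEq (V 60) (N l) (sim_instr l i) (sim_branch (Suc l) is)"

primrec clear_regs :: "nat \<Rightarrow> com" where
  "clear_regs 0 = Skip"
| "clear_regs (Suc k) = (clear_regs k ;; 62 + k ::= N 0)"

definition sim :: "prog \<Rightarrow> nat \<Rightarrow> com" where
  "sim P k = ((clear_regs k ;; 60 ::= N 0 ;; 61 ::= N 1) ;; While (V 61) (sim_branch 0 P))"

definition sim_cost :: "prog \<Rightarrow> nat \<Rightarrow> nat" where
  "sim_cost P k = ccost (clear_regs k) + ccost (sim_branch 0 P) + 10"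

fun regs_below :: "nat \<Rightarrow> instr \<Rightarrow> bool" where
  "regs_below k (Const r c) = (r < k)"
| "regs_below k (Bin f r x y) = (r < k \<and> x < k \<and> y < k)"
| "regs_below k (Load r x) = (r < k \<and> x < k)"
| "regs_below k (Store x y) = (x < k \<and> y < k)"
| "regs_below k (JumpZ x l) = (x < k)"
| "regs_below k Halt = True"

lemma regs_below_mono: "regs_below k i \<Longrightarrow> k \<le> k' \<Longrightarrow> regs_below k' i"
  by (cases i) auto

lemma regs_below_exists: "\<exists>k. \<forall>i\<in>set P. regs_below k i"
proof (induction P)
  case (Cons i P)
  then obtain k where k: "\<forall>i\<in>set P. regs_below k i" by auto
  have "\<exists>k'. regs_below k' i"
  proof (cases i)
    case (Bin f r x y)
    then show ?thesis by (intro exI[of _ "Suc (r + x + y)"]) auto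
  next
    case (Load r x)
    then show ?thesis by (intro exI[of _ "Suc (r + x)"]) auto
  next
    case (Store x y)
    then show ?thesis by (intro exI[of _ "Suc (x + y)"]) auto
  qed auto
  then obtain k' where "regs_below k' i" by blast
  then have "\<forall>i\<in>set (i # P). regs_below (max k k') i" using k regs_below_mono by fastforce
  then show ?case by blast
qed auto

text \<open>All other code stays below variable 60, so any finite number of simulated registers fits
  above it.\<close>

lemma wv_sim: "wv (sim P k) \<subseteq> {60..}"
proof -
  have i: "wv (sim_instr l i) \<subseteq> {60..}" for l i by (cases i) auto
  have "wv (sim_branch l P) \<subseteq> {60..}" for l by (induction P arbitrary: l) (use i in auto)
  moreover have "wv (clear_regs k) \<subseteq> {60..}" by (induction k) auto
  ultimately show ?thesis by (auto simp: sim_def)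
qed

lemma wa_sim: "wa (sim P k) \<subseteq> {21, 22}"
proof -
  have i: "wa (sim_instr l i) \<subseteq> {21, 22}" for l i by (cases i) auto
  have "wa (sim_branch l P) \<subseteq> {21, 22}" for l by (induction P arbitrary: l) (use i in fastforce)+
  moreover have "wa (clear_regs k) = {}" by (induction k) auto
  ultimately show ?thesis by (auto simp: sim_def)
qed

definition sim_mem :: "vars \<Rightarrow> arrs \<Rightarrow> nat \<Rightarrow> nat" where
  "sim_mem v a x = (if a 22 x 0 = v 33 then a 21 x 0 else 0)"

context lang
begin

text \<open>The last conjunct excludes stamps from future epochs. The next epoch number is then
  fresh, and moving to it empties the memory.\<close>

definition sim_rel :: "nat \<Rightarrow> config \<Rightarrow> vars \<Rightarrow> arrs \<Rightarrow> bool" where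
  "sim_rel k s v a \<longleftrightarrow> v 60 = fst s \<and> (\<forall>r<k. v (62 + r) = fst (snd s) r) \<and> sim_mem v a = snd (snd s) \<and>
     (\<forall>x. a 22 x 0 \<le> v 33)"

lemma sp_sim_branch:
  assumes "l \<le> v 60" "v 60 < l + length is" "l + length is < B" "sp (sim_instr (v 60) (is ! (v 60 - l))) Q v a"
  shows "sp (sim_branch l is) Q v a"
  using assms
proof (induction "is" arbitrary: l)
  case (Cons i "is")
  show ?case
  proof (cases "v 60 = l")
    case True
    then show ?thesis using Cons.prems by simp
  next
    case False
    then have "sp (sim_branch (Suc l) is) Q v a"
      using Cons.prems by (intro Cons.IH) (auto simp: nth_Cons' split: if_splits)
    then show ?thesis using Cons.prems False by simp
  qed
qed auto

text \<open>As \<open>2 ^ w \<le> B\<close>, a step that the machine can take does not overflow here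
  either. The premise \<open>fst s' < length P\<close> keeps a jump target, which is a literal of
  the simulating code, below \<open>B\<close>.\<close>

lemma sp_sim_step:
  assumes step: "step w P s = Some s'" and rel: "sim_rel k s v a" and s': "fst s' < length P"
    and B: "2 ^ w \<le> B" "length P < B" "1 < B" and S: "0 < S" and regs: "\<forall>i\<in>set P. regs_below k i"
  shows "sp (sim_branch 0 P) (\<lambda>v' a'. sim_rel k s' v' a' \<and> v' 61 = v 61 \<and> v' 33 = v 33) v a"
proof -
  obtain pc R M where s: "s = (pc, R, M)" by (cases s)
  have pc: "pc < length P" "v 60 = pc" "exec w (P ! pc) (pc, R, M) = Some s'"
    using step rel by (auto simp: step_def s sim_rel_def split: if_splits)
  have R: "r < k \<Longrightarrow> v (62 + r) = R r" for r using rel by (auto simp: sim_rel_def s)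
  have M: "M x = (if a 22 x 0 = v 33 then a 21 x 0 else 0)" for x
    using rel by (auto simp: sim_rel_def s sim_mem_def fun_eq_iff)
  have ep: "a 22 x 0 \<le> v 33" for x using rel by (auto simp: sim_rel_def)
  have rb: "regs_below k (P ! pc)" using regs pc(1) by simp
  have B': "x < 2 ^ w \<Longrightarrow> x < B" for x using B by linarith
  have "sp (sim_instr (v 60) (P ! pc)) (\<lambda>v' a'. sim_rel k s' v' a' \<and> v' 61 = v 61 \<and> v' 33 = v 33) v a"
    using pc rb B S s' R M ep B'
    by (cases "P ! pc")
      (auto simp: sim_rel_def sim_mem_def K_def upd_apply fun_eq_iff split: if_splits)
  then show ?thesis using pc B(2) by (intro sp_sim_branch) auto
qed

lemma sp_sim_halt:
  assumes "sim_rel k s v a" "fst s < length P" "P ! fst s = Halt" "length P < B"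
  shows "sp (sim_branch 0 P) (\<lambda>v' a'. v' 61 = 0 \<and> a' = a \<and> v' 33 = v 33) v a"
  by (rule sp_sim_branch) (use assms in \<open>auto simp: sim_rel_def\<close>)

lemma wp_sim_loop:
  assumes "reach w P s t (pc, R, M')" "pc < length P" "P ! pc = Halt"
    and "sim_rel k s v a" "v 61 \<noteq> 0"
    and B: "2 ^ w \<le> B" "length P < B" "1 < B" and S: "0 < S" and regs: "\<forall>i\<in>set P. regs_below k i"
  shows "wp (While (V 61) (sim_branch 0 P)) ((ccost (sim_branch 0 P) + 6) * (t + 1))
    (\<lambda>v' a'. sim_mem v' a' = M' \<and> v' 33 = v 33 \<and> (\<forall>x. a' 22 x 0 \<le> v 33)) v a"
proof -
  let ?c = "ccost (sim_branch 0 P) + 4"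
  define I where "I n v' a' \<longleftrightarrow> v' 33 = v 33 \<and>
     ((v' 61 = 0 \<and> sim_mem v' a' = M' \<and> (\<forall>x. a' 22 x 0 \<le> v 33)) \<or>
      (v' 61 \<noteq> 0 \<and> (\<exists>t s. sim_rel k s v' a' \<and> reach w P s t (pc, R, M') \<and> ?c * (t + 1) \<le> n)))" for n v' a'
  have "wp (While (V 61) (sim_branch 0 P)) (?c * (t + 1) + ecost (V 61) + 1)
    (\<lambda>v' a'. ev (V 61) v' a' = 0 \<and> (\<exists>n. I n v' a')) v a"
  proof (rule wp_while)
    have "\<exists>t' s. sim_rel k s v a \<and> reach w P s t' (pc, R, M') \<and> ?c * (t' + 1) \<le> ?c * (t + 1)"
      using assms by blast
    then show "I (?c * (t + 1)) v a" using assms unfolding I_def by blast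
  next
    fix n v1 a1 assume I: "I n v1 a1"
    show "ok (V 61) v1 a1 \<and> (ev (V 61) v1 a1 \<noteq> 0 \<longrightarrow> (\<exists>t. wp (sim_branch 0 P) t
        (\<lambda>v' a'. \<exists>n'. I n' v' a' \<and> t + ecost (V 61) + 3 + n' \<le> n) v1 a1))"
    proof (intro conjI impI)
      assume "ev (V 61) v1 a1 \<noteq> 0"
      then obtain t1 s1 where 1: "v1 61 \<noteq> 0" "v1 33 = v 33" "sim_rel k s1 v1 a1" "reach w P s1 t1 (pc, R, M')"
        "?c * (t1 + 1) \<le> n" using I by (auto simp: I_def)
      have "sp (sim_branch 0 P)
        (\<lambda>v' a'. \<exists>n'. I n' v' a' \<and> ccost (sim_branch 0 P) + ecost (V 61) + 3 + n' \<le> n) v1 a1"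
      proof (cases t1)
        case 0
        then have s1: "s1 = (pc, R, M')" using 1(4) by simp
        show ?thesis
        proof (rule sp_mono[OF sp_sim_halt])
          show "sim_rel k s1 v1 a1" by (rule 1)
        next
          fix v' :: vars and a' :: arrs assume 2: "v' 61 = 0 \<and> a' = a1 \<and> v' 33 = v1 33"
          then have "sim_mem v' a' = sim_mem v1 a1" by (auto simp: sim_mem_def)
          then have "sim_mem v' a' = M'" "\<forall>x. a' 22 x 0 \<le> v 33"
            using 1(2,3) 2 s1 by (auto simp: sim_rel_def)
          then have "I 0 v' a'" using 1 2 by (auto simp: I_def)
          then show "\<exists>n'. I n' v' a' \<and> ccost (sim_branch 0 P) + ecost (V 61) + 3 + n' \<le> n"
            using 1(5) 0 by (intro exI[of _ 0]) auto
        qed (use s1 assms in auto)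
      next
        case (Suc t2)
        then obtain s2 where 2: "step w P s1 = Some s2" "reach w P s2 t2 (pc, R, M')"
          using 1(4) by (auto simp: reach_Suc)
        \<comment> \<open>The run still goes on to a halting configuration or is one already, so
          this program counter lies inside the program.\<close>
        have s2: "fst s2 < length P"
        proof (cases t2)
          case 0
          then show ?thesis using 2 assms(2) by simp
        next
          case (Suc t3)
          then show ?thesis using 2 by (auto simp: reach_Suc step_def split: if_splits)
        qed
        show ?thesis
        proof (rule sp_mono[OF sp_sim_step[OF 2(1) 1(3) s2 B S regs]])
          fix v' a' assume 3: "sim_rel k s2 v' a' \<and> v' 61 = v1 61 \<and> v' 33 = v1 33"
          then have "\<exists>t s. sim_rel k s v' a' \<and> reach w P s t (pc, R, M') \<and> ?c * (t + 1) \<le> ?c * (t2 + 1)"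
            using 2 by blast
          then have "I (?c * (t2 + 1)) v' a'" using 1 3 unfolding I_def by simp
          moreover have "ccost (sim_branch 0 P) + ecost (V 61) + 3 + ?c * (t2 + 1) \<le> n"
            using 1(5) Suc by simp
          ultimately show "\<exists>n'. I n' v' a' \<and> ccost (sim_branch 0 P) + ecost (V 61) + 3 + n' \<le> n" by blast
        qed
      qed
      then show "\<exists>t. wp (sim_branch 0 P) t (\<lambda>v' a'. \<exists>n'. I n' v' a' \<and> t + ecost (V 61) + 3 + n' \<le> n) v1 a1"
        by (intro exI wp_sp) auto
    qed auto
  qed
  then show ?thesis by (rule wp_conseq) (auto simp: I_def)
qed

lemma sp_clear_regs:
  "0 < B \<Longrightarrow> (\<And>v'. (\<forall>r<k. v' (62 + r) = 0) \<Longrightarrow> (\<forall>x<62. v' x = v x) \<Longrightarrow> Q v' a) \<Longrightarrow> sp (clear_regs k) Q v a"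
proof (induction k arbitrary: Q)
  case (Suc k)
  have "sp (clear_regs k) (\<lambda>v a. ok (N 0) v a \<and> Q (v(62 + k := ev (N 0) v a)) a) v a"
  proof (rule Suc.IH)
    fix v' assume "\<forall>r<k. v' (62 + r) = 0" "\<forall>x<62. v' x = v x"
    then have "Q (v'(62 + k := 0)) a" by (intro Suc.prems(2)) (auto simp: less_Suc_eq)
    then show "ok (N 0) v' a \<and> Q (v'(62 + k := ev (N 0) v' a)) a" using Suc.prems by simp
  qed (rule Suc.prems)
  moreover have "sp (62 + k ::= N 0) Q = (\<lambda>v a. ok (N 0) v a \<and> Q (v(62 + k := ev (N 0) v a)) a)"
    by (intro ext) simp
  ultimately show ?case by simp
qed auto

text \<open>The overhead is a constant factor: \<open>sim_cost\<close> depends on the program and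
  its registers only.\<close>

theorem wp_sim:
  assumes "halts_after w P (sim_mem v a) t M'" "\<forall>x. a 22 x 0 \<le> v 33"
    and B: "2 ^ w \<le> B" "length P < B" "1 < B" and S: "0 < S" and regs: "\<forall>i\<in>set P. regs_below k i"
  shows "wp (sim P k) (sim_cost P k * (t + 1))
    (\<lambda>v' a'. sim_mem v' a' = M' \<and> (\<forall>x. a' 22 x 0 \<le> v 33)) v a"
proof -
  obtain pc R where h: "reach w P (0, \<lambda>_. 0, sim_mem v a) t (pc, R, M')" "pc < length P" "P ! pc = Halt"
    using assms(1) by (auto simp: halts_after_def reach_def)
  let ?W = "wp (While (V 61) (sim_branch 0 P)) ((ccost (sim_branch 0 P) + 6) * (t + 1))
    (\<lambda>v' a'. sim_mem v' a' = M' \<and> (\<forall>x. a' 22 x 0 \<le> v 33))"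
  have "sp (clear_regs k ;; 60 ::= N 0 ;; 61 ::= N 1) ?W v a"
  proof (simp only: sp.simps, rule sp_clear_regs)
    fix v' assume 1: "\<forall>r<k. v' (62 + r) = 0" "\<forall>x<62. v' x = v x"
    let ?v = "v'(60 := 0, 61 := 1)"
    have "sim_rel k (0, \<lambda>_. 0, sim_mem v a) ?v a"
      using 1 assms(2) by (auto simp: sim_rel_def sim_mem_def fun_eq_iff)
    from wp_sim_loop[OF h this _ B S regs] have "?W ?v a"
      by (rule wp_conseq) (use 1 in auto)
    then show "sp (60 ::= N 0 ;; 61 ::= N 1) ?W v' a" using B by simp
  qed (use B in auto)
  then show ?thesis unfolding sim_def
    by (rule wp_sp_seq) (auto simp: sim_cost_def algebra_simps)
qed

end

section \<open>Equality products from monochromatic triangles\<close>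

abbreviation plus_exp (infixl "\<oplus>" 65) where "e1 \<oplus> e2 \<equiv> Op Add e1 e2"
abbreviation minus_exp (infixl "\<ominus>" 65) where "e1 \<ominus> e2 \<equiv> Op Sub e1 e2"
abbreviation times_exp (infixl "\<otimes>" 70) where "e1 \<otimes> e2 \<equiv> Op Mul e1 e2"
abbreviation cell :: "nat \<Rightarrow> exp" where "cell k \<equiv> Ld k (N 0) (N 0)"
abbreviation set_cell :: "nat \<Rightarrow> exp \<Rightarrow> com" where "set_cell k e \<equiv> St k (N 0) (N 0) e"
abbreviation When :: "exp \<Rightarrow> com \<Rightarrow> com" where "When b c \<equiv> If b c Skip"

text \<open>
  Variables 2 to 6 hold \<open>n\<^sup>2\<close>, the part size \<open>m = n div 3\<close>, the number \<open>L\<close> of bits, the number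
  of blocks and \<open>n\<close>. Array 5 is the current distance matrix, 4 the midpoints, 2 and 3 the hubs and
  their number. An equality product asks for which \<open>u, v\<close> there is some \<open>x\<close> such that array 15 at
  \<open>(u, x)\<close>, array 16 at \<open>(v, x)\<close> and array 18 at \<open>(u, v)\<close> agree; array 17 holds the range of \<open>x\<close>
  and array 19 receives the answers. It is split into blocks of \<open>m\<close> values of \<open>u\<close>, of \<open>v\<close> and
  of \<open>x\<close>, each of which is one tripartite instance with exactly \<open>n\<close> nodes. Arrays 20 to 22 belong
  to the simulator.
\<close>

definition order_code :: com where
  "order_code = If (Less (V 34) (V 36)) (38 ::= V 34 ;; 39 ::= V 36) (38 ::= V 36 ;; 39 ::= V 34)"

text \<open>Nodes below \<open>m\<close> stand for the block of \<open>u\<close>, the next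
  \<open>m\<close> for the block of \<open>v\<close>, the next \<open>m\<close> for the block of
  \<open>x\<close>. Nodes from \<open>3 * m\<close> on are isolated and only pad the instance to
  size \<open>n\<close>.\<close>

definition edge_code :: com where
  "edge_code =
     (40 ::= N 0 ;;
      If (Less (V 38) (V 3))
        (If (Less (V 39) (V 3)) Skip
          (If (Less (V 39) (V 3 \<oplus> V 3))
            (41 ::= V 30 \<oplus> V 38 ;; 42 ::= V 31 \<oplus> (V 39 \<ominus> V 3) ;;
             When (Less (V 41) (V 6)) (When (Less (V 42) (V 6)) (40 ::= Ld 18 (V 41) (V 42))))
            (When (Less (V 39) (V 3 \<oplus> V 3 \<oplus> V 3))
              (41 ::= V 30 \<oplus> V 38 ;; 43 ::= V 32 \<oplus> (V 39 \<ominus> (V 3 \<oplus> V 3)) ;;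
               When (Less (V 41) (V 6)) (When (Less (V 43) (cell 17)) (40 ::= Ld 15 (V 41) (V 43)))))))
        (When (Less (V 38) (V 3 \<oplus> V 3))
          (If (Less (V 39) (V 3 \<oplus> V 3)) Skip
            (When (Less (V 39) (V 3 \<oplus> V 3 \<oplus> V 3))
              (42 ::= V 31 \<oplus> (V 38 \<ominus> V 3) ;; 43 ::= V 32 \<oplus> (V 39 \<ominus> (V 3 \<oplus> V 3)) ;;
               When (Less (V 42) (V 6)) (When (Less (V 43) (cell 17)) (40 ::= Ld 16 (V 42) (V 43))))))))"

text \<open>The triangle problem admits colours up to \<open>n * n\<close> only; larger values
  become non-edges.\<close>

definition colour_code :: com where
  "colour_code = (order_code ;; edge_code ;; When (Less (V 2) (V 40)) (40 ::= N 0))"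

definition fill_instance :: com where
  "fill_instance = For 34 (V 6) (For 36 (V 6)
     (colour_code ;; 45 ::= N 1 \<oplus> (V 34 \<otimes> V 6 \<oplus> V 36) ;; St 21 (V 45) (N 0) (V 40) ;; St 22 (V 45) (N 0) (V 33)))"

text \<open>Answers for non-edges are unspecified, so an entry is read only where the pair has a
  legal colour. A cell with an old stamp counts as 0. Positive answers accumulate over the blocks of
  \<open>x\<close>.\<close>

definition read_answers :: com where
  "read_answers = For 34 (V 3) (For 36 (V 3)
     (41 ::= V 30 \<oplus> V 34 ;; 42 ::= V 31 \<oplus> V 36 ;;
      When (Less (V 41) (V 6)) (When (Less (V 42) (V 6))
        (43 ::= Ld 18 (V 41) (V 42) ;;
         When (V 43) (If (Less (V 2) (V 43)) Skip
          (45 ::= (N 1 \<oplus> V 2) \<oplus> (V 34 \<otimes> V 6 \<oplus> (V 3 \<oplus> V 36)) ;;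
           IfEq (Ld 22 (V 45) (N 0)) (V 33) (When (Ld 21 (V 45) (N 0)) (St 19 (V 41) (V 42) (N 1))) Skip))))))"

definition eq_block :: "prog \<Rightarrow> nat \<Rightarrow> com" where
  "eq_block P k =
     ((30 ::= V 24 \<otimes> V 3 ;; 31 ::= V 26 \<otimes> V 3 ;; 32 ::= V 28 \<otimes> V 3 ;;
       33 ::= cell 20 \<oplus> N 1 ;; set_cell 20 (V 33) ;;
       St 21 (N 0) (N 0) (V 6) ;; St 22 (N 0) (N 0) (V 33)) ;;
      fill_instance ;; sim P k ;; read_answers)"

definition eq_prod :: "prog \<Rightarrow> nat \<Rightarrow> com" where
  "eq_prod P k = (For 24 (V 6) (For 26 (V 6) (St 19 (V 24) (V 26) (N 0))) ;;
     For 24 (V 5) (For 26 (V 5) (For 28 (Op Div (cell 17) (V 3) \<oplus> N 1) (eq_block P k))))"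

text \<open>One size \<open>n\<close> is fixed; \<open>\<tau>\<close> bounds the time of the given
  program at this size and \<open>w\<close> is its word length there. The stride leaves room for
  rows of \<open>3 * (n * n)\<close> entries and for input and output in row 0. The bound
  \<open>10000 * n ^ 4\<close> leaves room for counting all epochs.\<close>

locale ae = lang +
  fixes n m L w \<tau> :: nat and P :: prog and k :: nat
  assumes n3: "3 \<le> n" and m: "m = n div 3" and L: "L \<le> n"
    and S: "S = 4 * (n + 1) * (n + 1)"
    and B: "2 ^ w \<le> B" "length P < B" "10000 * n ^ 4 < B"
    and regs: "\<forall>i\<in>set P. regs_below k i"
    and AE: "\<And>A. (\<And>i j. i < n \<Longrightarrow> j < n \<Longrightarrow> A i j = A j i) \<Longrightarrow> (\<And>i. i < n \<Longrightarrow> A i i = 0) \<Longrightarrow>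
       (\<And>i j. i < n \<Longrightarrow> j < n \<Longrightarrow> A i j \<le> n * n) \<Longrightarrow>
       \<exists>t M'. t \<le> \<tau> \<and> halts_after w P (input_mem n A) t M' \<and>
         (\<forall>i<n. \<forall>j<n. A i j \<noteq> 0 \<longrightarrow>
            M' (1 + n * n + (i * n + j)) = of_bool (\<exists>x<n. A i j = A j x \<and> A j x = A i x))"
begin

definition nb :: nat where "nb = n div m + 1"
text \<open>Unit of cost: one call of the triangle program together with writing its instance and
  reading its answers.\<close>

definition X :: nat where "X = n * n + \<tau> + 1"

definition glob :: "vars \<Rightarrow> bool" where
  "glob v \<longleftrightarrow> v 6 = n \<and> v 2 = n * n \<and> v 3 = m \<and> v 4 = L \<and> v 5 = nb"

lemma m_pos: "1 \<le> m" "3 * m \<le> n" "n \<le> 5 * m" "nb \<le> 6"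
proof -
  show 1: "1 \<le> m" "3 * m \<le> n" using n3 m by auto
  have "n = m * 3 + n mod 3" "n mod 3 < 3" using m by simp_all
  \<comment> \<open>The extreme case is \<open>n = 5\<close>, \<open>m = 1\<close>, which yields six
    blocks.\<close>
  then show 2: "n \<le> 5 * m" using 1 by linarith
  have "n div m \<le> (5 * m) div m" using 2 by (rule div_le_mono)
  also have "\<dots> = 5" using 1 by simp
  finally show "nb \<le> 6" by (simp add: nb_def)
qed

lemma n_le: "n \<le> n * n" "n * n \<le> n ^ 4" "n \<le> n ^ 4" "1 < n" "m \<le> n"
proof -
  show 1: "n \<le> n * n" "m \<le> n" using m by auto
  have "n * n * 1 \<le> n * n * (n * n)" using n3 by (intro mult_left_mono) (auto simp: Suc_le_eq)
  then show 2: "n * n \<le> n ^ 4" by (simp add: power4_eq_xxxx)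
  show "n \<le> n ^ 4" using 1(1) 2 by linarith
  show "1 < n" using n3 by simp
qed

lemma B_big: "10000 * (n * n) < B" "10000 * n < B" "10000 < B"
  using B(3) n_le by linarith+

lemma S_big: "4 * (n * n) + 8 * n + 4 = S"
  by (simp add: S algebra_simps)

lemma S_pos: "0 < S" "n < S" using S_big by auto

section \<open>The tripartite instance of one block\<close>

definition edge_colour :: "nat \<Rightarrow> nat \<Rightarrow> nat \<Rightarrow> nat \<Rightarrow> arrs \<Rightarrow> nat \<Rightarrow> nat \<Rightarrow> nat" where
  "edge_colour M a0 b0 c0 a p q =
     (if p < m then
        (if q < m then 0
         else if q < m + m then (if a0 + p < n \<and> b0 + (q - m) < n then a 18 (a0 + p) (b0 + (q - m)) else 0)
         else if q < m + m + m then (if a0 + p < n \<and> c0 + (q - (m + m)) < M then a 15 (a0 + p) (c0 + (q - (m + m))) else 0)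
         else 0)
      else if p < m + m then
        (if q < m + m then 0
         else if q < m + m + m then (if b0 + (p - m) < n \<and> c0 + (q - (m + m)) < M then a 16 (b0 + (p - m)) (c0 + (q - (m + m))) else 0)
         else 0)
      else 0)"

text \<open>Sorting the two nodes makes the matrix symmetric by construction.\<close>

definition cm :: "nat \<Rightarrow> nat \<Rightarrow> nat \<Rightarrow> nat \<Rightarrow> arrs \<Rightarrow> nat \<Rightarrow> nat \<Rightarrow> nat" where
  "cm M a0 b0 c0 a i j =
     (if n * n < edge_colour M a0 b0 c0 a (min i j) (max i j) then 0
      else edge_colour M a0 b0 c0 a (min i j) (max i j))"

lemma cm_sym: "cm M a0 b0 c0 a i j = cm M a0 b0 c0 a j i"
  by (simp add: cm_def min.commute max.commute)

lemma cm_diag: "cm M a0 b0 c0 a i i = 0"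
  by (simp add: cm_def edge_colour_def)

lemma cm_le: "cm M a0 b0 c0 a i j \<le> n * n"
  by (simp add: cm_def)

definition tri :: "nat \<Rightarrow> arrs \<Rightarrow> nat \<Rightarrow> nat \<Rightarrow> nat \<Rightarrow> bool" where
  "tri M a u v x \<longleftrightarrow> u < n \<and> v < n \<and> x < M \<and> a 18 u v \<noteq> 0 \<and> a 18 u v \<le> n * n \<and>
     a 15 u x = a 18 u v \<and> a 16 v x = a 18 u v"

lemma cm_UV:
  "i < m \<Longrightarrow> j < m \<Longrightarrow> cm M a0 b0 c0 a i (m + j) =
     (if a0 + i < n \<and> b0 + j < n \<and> a 18 (a0 + i) (b0 + j) \<le> n * n then a 18 (a0 + i) (b0 + j) else 0)"
  by (simp add: cm_def edge_colour_def min_def max_def)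

lemma cm_UX:
  "i < m \<Longrightarrow> t < m \<Longrightarrow> cm M a0 b0 c0 a i (m + m + t) =
     (if a0 + i < n \<and> c0 + t < M \<and> a 15 (a0 + i) (c0 + t) \<le> n * n then a 15 (a0 + i) (c0 + t) else 0)"
  by (simp add: cm_def edge_colour_def min_def max_def)

lemma cm_VX:
  "j < m \<Longrightarrow> t < m \<Longrightarrow> cm M a0 b0 c0 a (m + j) (m + m + t) =
     (if b0 + j < n \<and> c0 + t < M \<and> a 16 (b0 + j) (c0 + t) \<le> n * n then a 16 (b0 + j) (c0 + t) else 0)"
  by (simp add: cm_def edge_colour_def min_def max_def)

lemma cm_UU: "i < m \<Longrightarrow> x < m \<Longrightarrow> cm M a0 b0 c0 a i x = 0"
  by (simp add: cm_def edge_colour_def min_def max_def)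

lemma cm_VV: "m \<le> i \<Longrightarrow> i < m + m \<Longrightarrow> m \<le> x \<Longrightarrow> x < m + m \<Longrightarrow> cm M a0 b0 c0 a i x = 0"
  by (simp add: cm_def edge_colour_def min_def max_def)

lemma cm_out: "m + m + m \<le> x \<Longrightarrow> cm M a0 b0 c0 a i x = 0"
  by (simp add: cm_def edge_colour_def min_def max_def)

text \<open>No edge runs inside a part or meets a padding node. The third node of a triangle over an
  edge between the first two parts therefore lies in the third part, at some
  \<open>m + m + t\<close>.\<close>

lemma cm_tri:
  assumes ij: "i < m" "j < m" and g: "cm M a0 b0 c0 a i (m + j) \<noteq> 0"
  shows "(\<exists>x<n. cm M a0 b0 c0 a i (m + j) = cm M a0 b0 c0 a (m + j) x \<and>
            cm M a0 b0 c0 a (m + j) x = cm M a0 b0 c0 a i x) \<longleftrightarrow>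
         (\<exists>t<m. tri M a (a0 + i) (b0 + j) (c0 + t))"
proof
  assume "\<exists>x<n. cm M a0 b0 c0 a i (m + j) = cm M a0 b0 c0 a (m + j) x \<and>
            cm M a0 b0 c0 a (m + j) x = cm M a0 b0 c0 a i x"
  then obtain x where x: "x < n" "cm M a0 b0 c0 a (m + j) x = cm M a0 b0 c0 a i (m + j)"
    "cm M a0 b0 c0 a i x = cm M a0 b0 c0 a i (m + j)" by auto
  have "\<not> x < m" using cm_UU[OF ij(1), of x] x(3) g by metis
  moreover have "\<not> (m \<le> x \<and> x < m + m)" using cm_VV[of "m + j" x] ij x(2) g by (metis add_less_cancel_left le_add1)
  moreover have "\<not> m + m + m \<le> x" using cm_out[of x] x(3) g by metis
  ultimately have t: "x = m + m + (x - (m + m))" "x - (m + m) < m" by auto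
  define t where "t = x - (m + m)"
  have "x = m + m + t" "t < m" using t by (auto simp: t_def)
  then have "tri M a (a0 + i) (b0 + j) (c0 + t)"
    using x(2,3) g ij by (auto simp: tri_def cm_UV cm_UX cm_VX split: if_splits)
  then show "\<exists>t<m. tri M a (a0 + i) (b0 + j) (c0 + t)" using \<open>t < m\<close> by blast
next
  assume "\<exists>t<m. tri M a (a0 + i) (b0 + j) (c0 + t)"
  then obtain t where "t < m" "tri M a (a0 + i) (b0 + j) (c0 + t)" by auto
  then show "\<exists>x<n. cm M a0 b0 c0 a i (m + j) = cm M a0 b0 c0 a (m + j) x \<and>
            cm M a0 b0 c0 a (m + j) x = cm M a0 b0 c0 a i x"
    using ij m_pos by (intro exI[of _ "m + m + t"]) (auto simp: tri_def cm_UV cm_UX cm_VX)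
qed

lemma sp_edge_code:
  assumes "glob v" "v 30 = a0" "v 31 = b0" "v 32 = c0" "v 38 = p" "v 39 = q" "p \<le> n" "q \<le> n" "a 17 0 0 = M"
    "a0 \<le> n" "b0 \<le> n" "c0 \<le> M" "M \<le> 3 * (n * n)"
  shows "sp edge_code (\<lambda>v' a'. a' = a \<and> v' 40 = edge_colour M a0 b0 c0 a p q \<and>
    (\<forall>z<38. v' z = v z) \<and> v' 33 = v 33) v a"
proof -
  have 1: "M < S" "n < S" "M + 4 * n < B" "5 * n < B"
    using B_big n_le(1,5) assms S_big by linarith+
  note 2 = 1 assms(7,8,10-12) n_le(5)
  have s: "0 < S" "0 < B" using S_pos B_big by auto
  have g: "v 6 = n" "v 3 = m" using assms by (auto simp: glob_def)
  note [simp] = g assms(2-6,9) s edge_code_def edge_colour_def K_def not_less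
  consider "p < m" "q < m" | "p < m" "m \<le> q" "q < m + m" | "p < m" "m + m \<le> q" "q < m + m + m"
    | "p < m" "m + m + m \<le> q" | "m \<le> p" "p < m + m" "q < m + m"
    | "m \<le> p" "p < m + m" "m + m \<le> q" "q < m + m + m" | "m \<le> p" "p < m + m" "m + m + m \<le> q" | "m + m \<le> p"
    by linarith
  then show ?thesis by cases (auto, (use 2 in linarith)+)
qed

lemma sp_colour_code:
  assumes "glob v" "v 30 = a0" "v 31 = b0" "v 32 = c0" "v 34 < n" "v 36 < n" "a 17 0 0 = M"
    "a0 \<le> n" "b0 \<le> n" "c0 \<le> M" "M \<le> 3 * (n * n)"
  shows "sp colour_code (\<lambda>v' a'. a' = a \<and> v' 40 = cm M a0 b0 c0 a (v 34) (v 36) \<and>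
    (\<forall>z<38. v' z = v z) \<and> v' 33 = v 33) v a"
  unfolding colour_code_def
proof (rule sp_seqI[where R = "\<lambda>v' a'. a' = a \<and> v' 38 = min (v 34) (v 36) \<and> v' 39 = max (v 34) (v 36) \<and>
    (\<forall>z<38. v' z = v z) \<and> v' 33 = v 33"], goal_cases)
  case 1
  show ?case using B_big by (auto simp: order_code_def)
next
  case (2 v1 a1)
  have a1: "a1 = a" using 2 by simp
  show ?case unfolding a1
  proof (rule sp_seqI[OF sp_edge_code[of v1 a0 b0 c0 "min (v 34) (v 36)" "max (v 34) (v 36)" a M]])
    fix v2 a2 assume 3: "a2 = a \<and> v2 40 = edge_colour M a0 b0 c0 a (min (v 34) (v 36)) (max (v 34) (v 36)) \<and>
      (\<forall>z<38. v2 z = v1 z) \<and> v2 33 = v1 33"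
    then have "a2 = a" by simp
    then show "sp (When (Less (V 2) (V 40)) (40 ::= N 0)) (\<lambda>v' a'. a' = a \<and>
       v' 40 = cm M a0 b0 c0 a (v 34) (v 36) \<and> (\<forall>z<38. v' z = v z) \<and> v' 33 = v 33) v2 a2"
      using 3 2 assms(1) B_big by (auto simp: cm_def glob_def)
  qed (use 2 assms in \<open>auto simp: glob_def\<close>)
qed

end

section \<open>Writing instances, reading answers, and assembling all blocks\<close>

context ae
begin

definition ep_ok :: "arrs \<Rightarrow> bool" where
  "ep_ok a \<longleftrightarrow> (\<forall>x. a 22 x 0 \<le> a 20 0 0)"

lemma tri_cong: "a' 15 = a 15 \<Longrightarrow> a' 16 = a 16 \<Longrightarrow> a' 18 = a 18 \<Longrightarrow> tri M a' = tri M a"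
  unfolding tri_def by simp

lemma cm_cong: "a' 15 = a 15 \<Longrightarrow> a' 16 = a 16 \<Longrightarrow> a' 18 = a 18 \<Longrightarrow> cm M a0 b0 c0 a' = cm M a0 b0 c0 a"
  unfolding cm_def edge_colour_def by (simp cong: if_cong)

text \<open>Read through its stamps, the simulated memory is the input memory cut off after
  \<open>t\<close> matrix entries; \<open>t = n * n\<close> gives the complete instance.\<close>

definition filled :: "nat \<Rightarrow> (nat \<Rightarrow> nat \<Rightarrow> nat) \<Rightarrow> nat \<Rightarrow> arrs \<Rightarrow> bool" where
  "filled e A t a \<longleftrightarrow> (\<forall>x. (if a 22 x 0 = e then a 21 x 0 else 0) =
     (if x = 0 then n else if x \<le> t then A ((x - 1) div n) ((x - 1) mod n) else 0)) \<and> (\<forall>x. a 22 x 0 \<le> e)"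

lemma filled_step:
  assumes "filled e A (i * n + j) a" "j < n"
  shows "filled e A (i * n + Suc j) (upd (upd a 21 (Suc (i * n + j)) 0 (A i j)) 22 (Suc (i * n + j)) 0 e)"
proof -
  have "(i * n + j) div n = i" "(i * n + j) mod n = j" using assms(2) by auto
  note d = this
  show ?thesis unfolding filled_def
  proof (intro conjI allI)
    fix x
    show "(if upd (upd a 21 (Suc (i * n + j)) 0 (A i j)) 22 (Suc (i * n + j)) 0 e 22 x 0 = e
         then upd (upd a 21 (Suc (i * n + j)) 0 (A i j)) 22 (Suc (i * n + j)) 0 e 21 x 0 else 0) =
        (if x = 0 then n else if x \<le> i * n + Suc j then A ((x - 1) div n) ((x - 1) mod n) else 0)"
      using spec[OF conjunct1[OF assms(1)[unfolded filled_def]], of x] d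
      by (cases "x = Suc (i * n + j)") (auto simp: upd_apply le_Suc_eq)
  qed (use assms(1) in \<open>auto simp: filled_def upd_apply\<close>)
qed

lemma idx_bound: "i < n \<Longrightarrow> j < n \<Longrightarrow> i * n + j < n * n"
proof -
  assume "i < n" "j < n"
  then have "Suc i * n \<le> n * n" by (intro mult_right_mono) auto
  then show ?thesis using \<open>j < n\<close> by simp
qed

lemma wv_colour: "wv colour_code = {38, 39, 40, 41, 42, 43}" "wa colour_code = {}"
  by (auto simp: colour_code_def order_code_def edge_code_def)

lemma ccost_colour: "ccost colour_code \<le> 250"
  by (simp add: colour_code_def order_code_def edge_code_def)

lemma wp_fill_instance:
  assumes "glob v" "v 30 = a0" "v 31 = b0" "v 32 = c0" "a 17 0 0 = M"
    "a0 \<le> n" "b0 \<le> n" "c0 \<le> M" "M \<le> 3 * (n * n)" "v 33 = e" "filled e (cm M a0 b0 c0 a) 0 a"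
  shows "wp fill_instance (400 * X) (\<lambda>v' a'. filled e (cm M a0 b0 c0 a) (n * n) a') v a"
proof -
  let ?A = "cm M a0 b0 c0 a"
  have B1: "1 < B" "n < B" "n * n + 1 < B" using B_big n_le by linarith+
  show ?thesis unfolding fill_instance_def
  proof (rule wp_for_const[where n = n and I = "\<lambda>i. filled e ?A (i * n)" and t = "n * 290 + 8"], goal_cases)
    case (7 i v1 a1)
    have g: "glob v1" "v1 30 = a0" "v1 31 = b0" "v1 32 = c0" "v1 33 = e" "v1 6 = n"
      using assms 7(5) by (auto simp: glob_def)
    show ?case
    proof (rule wp_for_const[where n = n and I = "\<lambda>j. filled e ?A (i * n + j)" and t = 280], goal_cases)
      case (7 j v2 a2)
      note inner = this
      have g2: "glob v2" "v2 30 = a0" "v2 31 = b0" "v2 32 = c0" "v2 33 = e" "v2 34 = i"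
        using g inner(5) \<open>v1 34 = i\<close> by (auto simp: glob_def)
      have eq: "a2 15 = a 15" "a2 16 = a 16" "a2 18 = a 18" "a2 17 = a 17"
        using inner(6) \<open>\<And>k. k \<notin> wa _ \<Longrightarrow> a1 k = a k\<close> by (auto simp: wv_colour)
      have A: "cm M a0 b0 c0 a2 = ?A" by (rule cm_cong) (use eq in auto)
      note ib = idx_bound[OF \<open>i < n\<close> \<open>j < n\<close>]
      have ib2: "i * n < B" "i * n + j < B" "Suc (i * n + j) < B" using ib B1 by linarith+
      show ?case
      proof (rule wp_sp, rule sp_seqI[OF sp_colour_code[of v2 a0 b0 c0 a2 M]])
        fix v3 a3 assume 3: "a3 = a2 \<and> v3 40 = cm M a0 b0 c0 a2 (v2 34) (v2 36) \<and> (\<forall>z<38. v3 z = v2 z) \<and> v3 33 = v2 33"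
        then have "a3 = a2" by simp
        have v3: "v3 34 = i" "v3 36 = j" "v3 6 = n" "v3 33 = e" "v3 40 = ?A i j"
          using 3 g2 inner(3) A by (auto simp: glob_def)
        show "sp (45 ::= N 1 \<oplus> (V 34 \<otimes> V 6 \<oplus> V 36) ;; St 21 (V 45) (N 0) (V 40) ;; St 22 (V 45) (N 0) (V 33))
           (\<lambda>v'' a''. filled e ?A (i * n + Suc j) a'') v3 a3"
          unfolding \<open>a3 = a2\<close>
          using filled_step[OF inner(2,1)] v3 ib2 B1 S_pos by (simp add: K_def)
      qed (use g2 inner eq assms ccost_colour \<open>i < n\<close> in auto)
    qed (use g 7 B1 in \<open>auto simp: wv_colour algebra_simps\<close>)
  next
    case 9
    have "n * (n * 290 + 8 + 10) + 8 = 290 * (n * n) + 18 * n + 8" by (simp add: algebra_simps)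
    also have "\<dots> \<le> 400 * X" using n_le(1) X_def by linarith
    finally have "n * (n * 290 + 8 + 10) + 8 \<le> 400 * X" .
    then show ?case by simp
  qed (use assms B1 in \<open>auto simp: glob_def wv_colour\<close>)
qed

lemma wp_read_answers:
  fixes v :: vars
  assumes "glob v" "v 30 = a0" "v 31 = b0" "v 32 = c0" "a0 \<le> n" "b0 \<le> n" "v 33 = e"
    and ans: "\<And>i j. i < m \<Longrightarrow> j < m \<Longrightarrow> cm M a0 b0 c0 a i (m + j) \<noteq> 0 \<Longrightarrow>
      sim_mem v a (1 + n * n + (i * n + (m + j))) = of_bool (\<exists>t<m. tri M a (a0 + i) (b0 + j) (c0 + t))"
  shows "wp read_answers (400 * X) (\<lambda>v' a'. \<forall>u v. a' 19 u v =
     (if \<exists>i<m. \<exists>j<m. u = a0 + i \<and> v = b0 + j \<and> (\<exists>t<m. tri M a u v (c0 + t)) then 1 else a 19 u v)) v a"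
proof -
  let ?tr = "\<lambda>u v. \<exists>t<m. tri M a u v (c0 + t)"
  let ?I = "\<lambda>i (a' :: arrs). \<forall>u v. a' 19 u v = (if \<exists>i'<i. \<exists>j'<m. u = a0 + i' \<and> v = b0 + j' \<and> ?tr u v then 1 else a 19 u v)"
  let ?J = "\<lambda>i j (a' :: arrs). \<forall>u v. a' 19 u v = (if (\<exists>i'<i. \<exists>j'<m. u = a0 + i' \<and> v = b0 + j' \<and> ?tr u v)
      \<or> (u = a0 + i \<and> (\<exists>j'<j. v = b0 + j' \<and> ?tr u v)) then 1 else a 19 u v)"
  have B1: "1 < B" "n < B" "m < B" "3 * (n * n) + 5 * n + 1 < B" using B_big n_le by linarith+
  show ?thesis unfolding read_answers_def
  proof (rule wp_for_const[where n = m and I = ?I and t = "m * 190 + 8"], goal_cases)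
    case (7 i v1 a1)
    have g: "glob v1" "v1 30 = a0" "v1 31 = b0" "v1 32 = c0" "v1 33 = e" "v1 3 = m"
      using assms 7(5) by (auto simp: glob_def)
    show ?case
    proof (rule wp_for_const[where n = m and I = "?J i" and t = 180], goal_cases)
      case (7 j v2 a2)
      note inner = this
      have g2: "v2 2 = n * n" "v2 3 = m" "v2 6 = n" "v2 30 = a0" "v2 31 = b0" "v2 33 = e" "v2 34 = i"
        using g inner(5) \<open>v1 34 = i\<close> by (auto simp: glob_def)
      have eq: "a2 18 = a 18" "a2 21 = a 21" "a2 22 = a 22"
        using inner(6) \<open>\<And>k. k \<notin> wa _ \<Longrightarrow> a1 k = a k\<close> by auto
      have "i * n + (m + j) < n * n"
        using idx_bound[of i "m + j"] m_pos \<open>i < m\<close> \<open>j < m\<close> by linarith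
      then have bd: "i * n < B" "i * n + (m + j) < B" "Suc (n * n) < B" "Suc (n * n + (i * n + (m + j))) < B"
         "a0 + i < B" "b0 + j < B" "m + j < B"
        using B1 assms(5,6) m_pos \<open>i < m\<close> \<open>j < m\<close> by linarith+
      let ?u = "a0 + i" and ?v = "b0 + j"
      have tr: "?tr ?u ?v \<Longrightarrow> ?u < n \<and> ?v < n \<and> a 18 ?u ?v \<noteq> 0 \<and> a 18 ?u ?v \<le> n * n" by (auto simp: tri_def)
      have ans': "?u < n \<Longrightarrow> ?v < n \<Longrightarrow> a 18 ?u ?v \<noteq> 0 \<Longrightarrow> a 18 ?u ?v \<le> n * n \<Longrightarrow>
        (if a 22 (Suc (n * n + (i * n + (m + j)))) 0 = e then a 21 (Suc (n * n + (i * n + (m + j)))) 0 else 0) = of_bool (?tr ?u ?v)"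
        using ans[OF \<open>i < m\<close> \<open>j < m\<close>] \<open>i < m\<close> \<open>j < m\<close> assms(7) by (simp add: cm_UV sim_mem_def)
      have J1: "?tr ?u ?v \<Longrightarrow> ?J i (Suc j) (upd a2 19 ?u ?v 1)"
        using inner(2) by (auto simp: upd_apply less_Suc_eq)
      have J0: "\<not> ?tr ?u ?v \<Longrightarrow> ?J i (Suc j) a2"
        using inner(2) by (auto simp: less_Suc_eq)
      define G where "G = ?J i (Suc j)"
      have G1: "?tr ?u ?v \<Longrightarrow> G (upd a2 19 ?u ?v 1)" and G0: "\<not> ?tr ?u ?v \<Longrightarrow> G a2"
        using J1 J0 unfolding G_def by blast+
      define c where "c = Suc (n * n + (i * n + (m + j)))"
      have sSB: "?v < n \<Longrightarrow> ?v < S" "0 < S" "0 < B" "Suc 0 < B" using S_pos B1 by auto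
      note [simp] = g2 inner(3) eq bd sSB K_def
      have "sp (41 ::= V 30 \<oplus> V 34 ;; 42 ::= V 31 \<oplus> V 36 ;;
         When (Less (V 41) (V 6)) (When (Less (V 42) (V 6))
        (43 ::= Ld 18 (V 41) (V 42) ;;
         When (V 43) (If (Less (V 2) (V 43)) Skip
          (45 ::= (N 1 \<oplus> V 2) \<oplus> (V 34 \<otimes> V 6 \<oplus> (V 3 \<oplus> V 36)) ;;
           IfEq (Ld 22 (V 45) (N 0)) (V 33) (When (Ld 21 (V 45) (N 0)) (St 19 (V 41) (V 42) (N 1))) Skip)))))
        (\<lambda>_. G) v2 a2"
      proof -
        \<comment> \<open>In the first four cases the pair has no legal colour, so there is neither
          a triangle nor anything to read.\<close>
        consider "n \<le> ?u" | "?u < n" "n \<le> ?v" | "?u < n" "?v < n" "a 18 ?u ?v = 0"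
          | "?u < n" "?v < n" "0 < a 18 ?u ?v" "n * n < a 18 ?u ?v"
          | "?u < n" "?v < n" "0 < a 18 ?u ?v" "a 18 ?u ?v \<le> n * n" by linarith
        then show ?thesis
        proof cases
          case 1
          then have "\<not> ?tr ?u ?v" using tr by (meson not_le)
          from G0[OF this] 1 show ?thesis by simp
        next
          case 2
          then have "\<not> ?tr ?u ?v" using tr by (meson not_le)
          from G0[OF this] 2 show ?thesis by simp
        next
          case 3
          then have "\<not> ?tr ?u ?v" using tr by blast
          from G0[OF this] 3 show ?thesis by simp
        next
          case 4
          then have "\<not> ?tr ?u ?v" using tr by (meson not_le)
          from G0[OF this] 4 show ?thesis by simp
        next
          case 5
          note an = ans'[OF 5(1,2) _ 5(4)]
          show ?thesis
          proof (cases "?tr ?u ?v")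
            case True
            then have "a 22 c 0 = e \<and> a 21 c 0 = 1"
              using an 5(3) unfolding c_def by (auto split: if_splits)
            with 5 G1[OF True] show ?thesis unfolding c_def by simp
          next
            case False
            then have "a 22 c 0 \<noteq> e \<or> a 21 c 0 = 0"
              using an 5(3) unfolding c_def by auto
            with 5 G0[OF False] show ?thesis unfolding c_def by auto
          qed
        qed
      qed
      then show ?case unfolding G_def by (rule wp_sp) simp
    qed (use g 7 B1 in \<open>auto simp: less_Suc_eq\<close>)
  next
    case 9
    have "m * (m * 190 + 8 + 10) \<le> n * (n * 190 + 8 + 10)" using n_le(5) by (intro mult_mono) auto
    also have "\<dots> = 190 * (n * n) + 18 * n" by (simp add: algebra_simps)
    finally have "m * (m * 190 + 8 + 10) + 8 \<le> 400 * X" using n_le(1) X_def by linarith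
    then show ?case by simp
  qed (use assms B1 in \<open>auto simp: glob_def\<close>)
qed

lemma wv_eq_parts:
  "wv fill_instance \<subseteq> {34..}" "wa fill_instance = {21, 22}"
  "wv read_answers \<subseteq> {34..}" "wa read_answers = {19}"
  by (auto simp: fill_instance_def read_answers_def wv_colour)

lemma wv_eq_block: "wv (eq_block P k) \<subseteq> {30..}" "wa (eq_block P k) \<subseteq> {19, 20, 21, 22}"
  using wv_eq_parts wv_sim[of P k] wa_sim[of P k] by (fastforce simp: eq_block_def)+

definition block_cost :: nat where "block_cost = sim_cost P k + 1000"

lemma div_block: "u div m = a \<longleftrightarrow> (\<exists>i<m. u = a * m + i)"
proof
  assume "u div m = a"
  then show "\<exists>i<m. u = a * m + i" using m_pos
    by (intro exI[of _ "u mod m"]) auto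
qed (use m_pos in auto)

text \<open>\<open>R\<close> collects the triples of block numbers processed so far; array 19 is the
  disjunction of their answers.\<close>

definition zinv :: "nat \<Rightarrow> arrs \<Rightarrow> (nat \<times> nat \<times> nat) set \<Rightarrow> arrs \<Rightarrow> bool" where
  "zinv M a R a' \<longleftrightarrow> (\<forall>u<n. \<forall>v<n. a' 19 u v = of_bool (\<exists>x. tri M a u v x \<and> (u div m, v div m, x div m) \<in> R))"

lemma wp_eq_block:
  assumes "glob v" and abc: "v 24 < nb" "v 26 < nb" "v 28 \<le> M div m" and M: "a 17 0 0 = M" "M \<le> 3 * (n * n)"
    and ep: "ep_ok a" "a 20 0 0 + 1 < B" and z: "zinv M a R a"
  shows "wp (eq_block P k) (block_cost * X) (\<lambda>v' a'. zinv M a (insert (v 24, v 26, v 28) R) a' \<and>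
     ep_ok a' \<and> a' 20 0 0 = a 20 0 0 + 1) v a"
proof -
  have B1: "1 < B" "n < B" "3 * (n * n) < B" using B_big n_le by linarith+
  define a0 where "a0 = v 24 * m"
  define b0 where "b0 = v 26 * m"
  define c0 where "c0 = v 28 * m"
  define e where "e = a 20 0 0 + 1"
  have "a0 \<le> n div m * m" "b0 \<le> n div m * m" "c0 \<le> M div m * m"
    unfolding a0_def b0_def c0_def using abc by (auto simp: nb_def intro!: mult_right_mono)
  then have le: "a0 \<le> n" "b0 \<le> n" "c0 \<le> M" using div_times_less_eq_dividend le_trans by blast+
  let ?v = "v(30 := a0, 31 := b0, 32 := c0, 33 := e)"
  let ?a = "upd (upd (upd a 20 0 0 e) 21 0 0 n) 22 0 0 e"
  let ?A = "cm M a0 b0 c0 a"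
  have eA: "cm M a0 b0 c0 ?a = ?A" by (rule cm_cong) auto
  have g: "glob ?v" "v 6 = n" "v 3 = m" using assms(1) by (auto simp: glob_def)
  \<comment> \<open>All old stamps are at most \<open>a 20 0 0\<close>, so in epoch \<open>e\<close>
    only the freshly written cell 0 is visible.\<close>
  have fl: "filled e ?A 0 ?a"
    using ep(1) unfolding filled_def ep_ok_def e_def by (auto simp: upd_apply le_Suc_eq) (metis Suc_n_not_le_n)
  show ?thesis unfolding eq_block_def
  proof (rule wp_sp_seq)
    have "wp (fill_instance ;; sim P k ;; read_answers) (800 * X + sim_cost P k * (\<tau> + 1))
      (\<lambda>v' a'. zinv M a (insert (v 24, v 26, v 28) R) a' \<and> ep_ok a' \<and> a' 20 0 0 = a 20 0 0 + 1) ?v ?a"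
    proof (rule wp_seq_frame[OF wp_fill_instance[of ?v a0 b0 c0 ?a M e]])
      fix v1 a1 assume 1: "filled e (cm M a0 b0 c0 ?a) (n * n) a1"
        and fr: "\<And>x. x \<notin> wv fill_instance \<Longrightarrow> v1 x = ?v x" "\<And>k. k \<notin> wa fill_instance \<Longrightarrow> a1 k = ?a k"
      have fv: "x < 34 \<Longrightarrow> v1 x = ?v x" for x using fr(1)[of x] wv_eq_parts(1) by fastforce
      have fa: "k \<noteq> 21 \<Longrightarrow> k \<noteq> 22 \<Longrightarrow> a1 k = ?a k" for k using fr(2)[of k] wv_eq_parts(2) by auto
      have sm: "sim_mem v1 a1 = input_mem n ?A"
        using 1 fv[of 33] unfolding eA filled_def by (auto simp: sim_mem_def input_mem_def power2_eq_square fun_eq_iff)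
      have "\<exists>t M'. t \<le> \<tau> \<and> halts_after w P (input_mem n ?A) t M' \<and>
         (\<forall>i<n. \<forall>j<n. ?A i j \<noteq> 0 \<longrightarrow>
            M' (1 + n * n + (i * n + j)) = of_bool (\<exists>x<n. ?A i j = ?A j x \<and> ?A j x = ?A i x))"
        by (rule AE) (auto simp: cm_diag cm_le intro: cm_sym)
      then obtain t M' where t: "t \<le> \<tau>" "halts_after w P (input_mem n ?A) t M'"
        "\<And>i j. i < n \<Longrightarrow> j < n \<Longrightarrow> ?A i j \<noteq> 0 \<Longrightarrow>
            M' (1 + n * n + (i * n + j)) = of_bool (\<exists>x<n. ?A i j = ?A j x \<and> ?A j x = ?A i x)" by blast
      have "wp (sim P k) (sim_cost P k * (t + 1)) (\<lambda>v' a'. sim_mem v' a' = M' \<and> (\<forall>x. a' 22 x 0 \<le> v1 33)) v1 a1"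
        by (rule wp_sim[OF _ _ B(1,2) B1(1) S_pos(1) regs]) (use t(2) sm 1 fv[of 33] in \<open>auto simp: filled_def\<close>)
      then show "wp (sim P k ;; read_answers) (sim_cost P k * (\<tau> + 1) + 400 * X)
        (\<lambda>v' a'. zinv M a (insert (v 24, v 26, v 28) R) a' \<and> ep_ok a' \<and> a' 20 0 0 = a 20 0 0 + 1) v1 a1"
      proof (rule wp_seq_frame)
        fix v2 a2 assume 2: "sim_mem v2 a2 = M' \<and> (\<forall>x. a2 22 x 0 \<le> v1 33)"
          and fr2: "\<And>x. x \<notin> wv (sim P k) \<Longrightarrow> v2 x = v1 x" "\<And>k'. k' \<notin> wa (sim P k) \<Longrightarrow> a2 k' = a1 k'"
        have fv2: "x < 34 \<Longrightarrow> v2 x = ?v x" for x using fr2(1)[of x] fv[of x] wv_sim[of P k] by fastforce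
        have fa2: "k \<noteq> 21 \<Longrightarrow> k \<noteq> 22 \<Longrightarrow> a2 k = ?a k" for k using fr2(2)[of k] fa[of k] wa_sim[of P] by fastforce
        have trc: "tri M a2 = tri M a" by (rule tri_cong) (auto simp: fa2)
        have A2: "cm M a0 b0 c0 a2 = ?A" by (rule cm_cong) (auto simp: fa2)
        have ans: "sim_mem v2 a2 (1 + n * n + (i * n + (m + j))) = of_bool (\<exists>t<m. tri M a2 (a0 + i) (b0 + j) (c0 + t))"
          if "i < m" "j < m" "cm M a0 b0 c0 a2 i (m + j) \<noteq> 0" for i j
        proof -
          have "i < n" "m + j < n" using that m_pos by linarith+
          from t(3)[OF this] that(3) A2 cm_tri[OF that] 2 show ?thesis by (simp only: trc) simp
        qed
        show "wp read_answers (400 * X) (\<lambda>v' a'. zinv M a (insert (v 24, v 26, v 28) R) a' \<and> ep_ok a' \<and> a' 20 0 0 = a 20 0 0 + 1) v2 a2"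
        proof (rule wp_frame[OF wp_read_answers[where M = M and a = a2 and v = v2 and ?a0.0 = a0 and ?b0.0 = b0 and ?c0.0 = c0 and e = e]])
          fix v3 a3
          assume 3: "\<forall>u v. a3 19 u v = (if \<exists>i<m. \<exists>j<m. u = a0 + i \<and> v = b0 + j \<and> (\<exists>t<m. tri M a2 u v (c0 + t)) then 1 else a2 19 u v)"
            and fr3: "\<And>k. k \<notin> wa read_answers \<Longrightarrow> a3 k = a2 k"
          have fa3: "k \<noteq> 19 \<Longrightarrow> a3 k = a2 k" for k using fr3[of k] wv_eq_parts by auto
          have "a3 20 0 0 = e" "\<forall>x. a3 22 x 0 \<le> e"
            using 2 fv[of 33] by (auto simp: fa3 fa2 upd_apply)
          moreover have "zinv M a (insert (v 24, v 26, v 28) R) a3"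
            unfolding zinv_def
          proof (intro allI impI)
            fix u' v' assume uv: "u' < n" "v' < n"
            have e1: "(\<exists>i<m. \<exists>j<m. u' = a0 + i \<and> v' = b0 + j \<and> (\<exists>t<m. tri M a2 u' v' (c0 + t))) \<longleftrightarrow>
               (\<exists>x. tri M a u' v' x \<and> (u' div m, v' div m, x div m) = (v 24, v 26, v 28))"
              unfolding trc prod.inject div_block a0_def b0_def c0_def by blast
            have e2: "a2 19 u' v' = of_bool (\<exists>x. tri M a u' v' x \<and> (u' div m, v' div m, x div m) \<in> R)"
              using z uv by (simp add: fa2 zinv_def)
            show "a3 19 u' v' = of_bool (\<exists>x. tri M a u' v' x \<and> (u' div m, v' div m, x div m) \<in> insert (v 24, v 26, v 28) R)"
              using 3[rule_format, of u' v', unfolded e1 e2] by (auto simp: of_bool_def)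
          qed
          ultimately show "zinv M a (insert (v 24, v 26, v 28) R) a3 \<and> ep_ok a3 \<and> a3 20 0 0 = a 20 0 0 + 1"
            by (auto simp: ep_ok_def e_def)
        qed (use fv2 le g ans in \<open>auto simp: glob_def\<close>)
      qed (use t(1) in auto)
    qed (use g le M fl eA in auto)
    then show "sp (30 ::= V 24 \<otimes> V 3 ;; 31 ::= V 26 \<otimes> V 3 ;; 32 ::= V 28 \<otimes> V 3 ;;
       33 ::= cell 20 \<oplus> N 1 ;; set_cell 20 (V 33) ;; St 21 (N 0) (N 0) (V 6) ;; St 22 (N 0) (N 0) (V 33))
      (wp (fill_instance ;; sim P k ;; read_answers) (800 * X + sim_cost P k * (\<tau> + 1))
      (\<lambda>v' a'. zinv M a (insert (v 24, v 26, v 28) R) a' \<and> ep_ok a' \<and> a' 20 0 0 = a 20 0 0 + 1)) v a"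
      using g le M B1 S_pos ep(2) by (simp add: a0_def b0_def c0_def e_def K_def)
  next
    have "\<tau> + 1 \<le> X" "1 \<le> X" by (auto simp: X_def)
    then have "sim_cost P k * (\<tau> + 1) \<le> sim_cost P k * X" by (intro mult_left_mono) auto
    with \<open>1 \<le> X\<close> show "ccost (30 ::= V 24 \<otimes> V 3 ;; 31 ::= V 26 \<otimes> V 3 ;; 32 ::= V 28 \<otimes> V 3 ;;
       33 ::= cell 20 \<oplus> N 1 ;; set_cell 20 (V 33) ;; St 21 (N 0) (N 0) (V 6) ;; St 22 (N 0) (N 0) (V 33)) +
      (800 * X + sim_cost P k * (\<tau> + 1)) \<le> block_cost * X"
      by (simp add: block_cost_def algebra_simps)
  qed
qed

end

section \<open>Entrywise filling of a matrix\<close>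

context lang
begin

text \<open>Serves the double loops that fill a matrix entry by entry. In \<open>body\<close>, the
  premise \<open>a' k i j = a k i j\<close> lets the code read the old value of the entry it is
  about to write.\<close>

lemma wp_matrix:
  assumes v: "v p = N1" "v q = N2" "p < x" "q < x" and y: "y = Suc (Suc x)" and B: "1 < B" "N1 < B" "N2 < B"
    and c: "wv c \<subseteq> {Suc (Suc y)..}" "wa c \<subseteq> {k}" "ccost c \<le> cc"
    and body: "\<And>i j v' a'. i < N1 \<Longrightarrow> j < N2 \<Longrightarrow> v' x = i \<Longrightarrow> v' y = j \<Longrightarrow>
       (\<And>z. z < x \<Longrightarrow> v' z = v z) \<Longrightarrow> (\<And>k'. k' \<noteq> k \<Longrightarrow> a' k' = a k') \<Longrightarrow> a' k i j = a k i j \<Longrightarrow>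
       sp c (\<lambda>_ a''. a'' = upd a' k i j (F i j)) v' a'"
    and t: "N1 * (N2 * (cc + 10) + 18) + 8 \<le> t"
  shows "wp (For x (V p) (For y (V q) c)) t
    (\<lambda>v' a'. a' = a(k := \<lambda>i j. if i < N1 \<and> j < N2 then F i j else a k i j)) v a"
proof (rule wp_for_const[where n = N1 and t = "N2 * (cc + 10) + 8"
      and I = "\<lambda>i a'. a' = a(k := \<lambda>i' j. if i' < i \<and> j < N2 then F i' j else a k i' j)"], goal_cases)
  case (7 i v1 a1)
  note o = this
  show ?case
  proof (rule wp_for_const[where n = N2 and t = cc
      and I = "\<lambda>j a'. a' = a(k := \<lambda>i' j'. if (i' < i \<and> j' < N2) \<or> (i' = i \<and> j' < j) then F i' j' else a k i' j')"], goal_cases)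
    case (7 j v2 a2)
    show ?case
    proof (rule wp_sp[OF sp_mono[OF body[of i j]]])
      fix a'' :: arrs assume "a'' = upd a2 k i j (F i j)"
      with 7(2) show "a'' = a(k := \<lambda>i' j'. if (i' < i \<and> j' < N2) \<or> (i' = i \<and> j' < Suc j) then F i' j' else a k i' j')"
        by (auto simp: upd_def fun_eq_iff less_Suc_eq)
    qed (use 7 o v c y in auto)
  next
    case (8 v' a')
    then show ?case by (auto simp: fun_eq_iff less_Suc_eq)
  qed (use v B c y o in \<open>auto simp: fun_eq_iff\<close>)
next
  case 9
  then show ?case using t by (simp add: algebra_simps)
qed (use v y B c in auto)

end

context ae
begin

definition eq_cost :: nat where "eq_cost = 36 * block_cost + 1700"

lemma zinv_cong: "a' 15 = a 15 \<Longrightarrow> a' 16 = a 16 \<Longrightarrow> a' 18 = a 18 \<Longrightarrow> zinv M a' = zinv M a"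
  by (intro ext) (simp add: zinv_def tri_cong[of a' a])

lemma wv_eq_prod: "wv (eq_prod P k) \<subseteq> {24..}" "wa (eq_prod P k) \<subseteq> {19, 20, 21, 22}"
  using wv_eq_block by (fastforce simp: eq_prod_def)+

text \<open>There are \<open>M div m + 1\<close> blocks of \<open>x\<close> and at most 36 pairs of
  blocks of \<open>u\<close> and \<open>v\<close>. A larger range \<open>M\<close> means
  proportionally more calls at the same size.\<close>

theorem wp_eq:
  assumes g: "glob v" and M: "a 17 0 0 = M" "M \<le> 3 * (n * n)"
    and ep: "ep_ok a" "a 20 0 0 + 150 * (n * n) < B"
  shows "wp (eq_prod P k) (eq_cost * ((M div m + 1) * X))
    (\<lambda>v' a'. (\<forall>u<n. \<forall>v<n. a' 19 u v = of_bool (\<exists>x. tri M a u v x)) \<and> ep_ok a' \<and>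
       a' 20 0 0 \<le> a 20 0 0 + 150 * (n * n)) v a"
proof -
  define q where "q = M div m + 1"
  define e0 where "e0 = a 20 0 0"
  have B1: "1 < B" "n < B" "nb < B" using B_big n_le m_pos(4) by linarith+
  have Mm: "M div m \<le> M" by simp
  have q: "q \<le> 3 * (n * n) + 1" "q < B" using M(2) B_big Mm unfolding q_def by linarith+
  \<comment> \<open>Each call uses one epoch. There are at most \<open>36 * q\<close> calls with
    \<open>q \<le> 3 * (n * n) + 1\<close>, and \<open>9 \<le> n * n\<close> absorbs the remaining
    36.\<close>
  have cnt: "i * (nb * q) + j * q + c + 1 \<le> 150 * (n * n)" if "i < nb" "j < nb" "c < q" for i j c
  proof -
    have "j * q + q \<le> nb * q" using that(2) by (metis Suc_leI mult_Suc mult_le_mono1 add.commute)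
    moreover have "i * (nb * q) + nb * q \<le> nb * (nb * q)" using that(1) by (metis Suc_leI mult_Suc mult_le_mono1 add.commute)
    moreover have "nb * (nb * q) \<le> 6 * (6 * q)" using m_pos(4) by (intro mult_mono) auto
    moreover have "9 \<le> n * n" using mult_le_mono[OF n3 n3] by simp
    ultimately show ?thesis using that(3) q(1) by linarith
  qed
  have cntN: "nb * (nb * q) \<le> 150 * (n * n)"
  proof -
    have "nb * (nb * q) \<le> 6 * (6 * q)" using m_pos(4) by (intro mult_mono) auto
    moreover have "9 \<le> n * n" using mult_le_mono[OF n3 n3] by simp
    ultimately show ?thesis using q(1) by linarith
  qed
  have v: "v 6 = n" "v 3 = m" "v 5 = nb" using g by (auto simp: glob_def)
  let ?Q = "\<lambda>v' a'. (\<forall>u<n. \<forall>v<n. a' 19 u v = of_bool (\<exists>x. tri M a u v x)) \<and> ep_ok a' \<and>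
       a' 20 0 0 \<le> a 20 0 0 + 150 * (n * n)"
  let ?loop = "For 24 (V 5) (For 26 (V 5) (For 28 (Op Div (cell 17) (V 3) \<oplus> N 1) (eq_block P k)))"
  let ?t3 = "q * (block_cost * X + 10) + 20"
  let ?t2 = "nb * (?t3 + 10) + 8"
  let ?t1 = "nb * (?t2 + 10) + 8"
  let ?a = "a(19 := \<lambda>i j. if i < n \<and> j < n then 0 else a 19 i j)"
  have tri0: "tri M ?a = tri M a" by (rule tri_cong) auto
  have loop: "wp ?loop ?t1 ?Q v1 ?a" if v1: "\<And>z. z < 24 \<Longrightarrow> v1 z = v z" for v1
  proof (rule wp_for_const[where n = nb and t = ?t2 and
      I = "\<lambda>i a'. zinv M a {(x, y, z). x < i} a' \<and> ep_ok a' \<and> a' 20 0 0 = e0 + i * (nb * q)"], goal_cases)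
    case (7 i v2 a2)
    note o1 = this
    have wae: "k' \<notin> {19, 20, 21, 22} \<Longrightarrow> a2 k' = a k'" for k' using o1(6)[of k'] wv_eq_block(2) by auto
    show ?case
    proof (rule wp_for_const[where n = nb and t = ?t3 and
        I = "\<lambda>j a'. zinv M a {(x, y, z). x < i \<or> (x = i \<and> y < j)} a' \<and> ep_ok a' \<and> a' 20 0 0 = e0 + (i * (nb * q) + j * q)"], goal_cases)
      case (7 j v3 a3)
      note o2 = this
      have wae2: "k' \<notin> {19, 20, 21, 22} \<Longrightarrow> a3 k' = a k'" for k' using o2(6)[of k'] wae[of k'] wv_eq_block(2) by auto
      have v3: "v3 3 = m" "v3 24 = i" using o2(5) o1(3,5) v1 v by auto
      show ?case
      proof (rule wp_for_const[where n = q and t = "block_cost * X" and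
          I = "\<lambda>c a'. zinv M a {(x, y, z). x < i \<or> (x = i \<and> y < j) \<or> (x = i \<and> y = j \<and> z < c)} a' \<and> ep_ok a' \<and>
             a' 20 0 0 = e0 + (i * (nb * q) + j * q + c)"], goal_cases)
        case (7 c v4 a4)
        note o3 = this
        have wae3: "k' \<notin> {19, 20, 21, 22} \<Longrightarrow> a4 k' = a k'" for k' using o3(6)[of k'] wae2[of k'] wv_eq_block(2) by auto
        have v4: "z < 24 \<Longrightarrow> v4 z = v z" for z using o3(5)[of z] o2(5)[of z] o1(5)[of z] v1[of z] by simp
        have v4': "v4 24 = i" "v4 26 = j" "v4 28 = c" using o3(3,5) o2(3,5) o1(3) by auto
        have zc: "zinv M a4 = zinv M a" by (rule zinv_cong) (auto simp: wae3)
        have ins: "insert (i, j, c) {(x, y, z). x < i \<or> (x = i \<and> y < j) \<or> (x = i \<and> y = j \<and> z < c)} =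
          {(x, y, z). x < i \<or> (x = i \<and> y < j) \<or> (x = i \<and> y = j \<and> z < Suc c)}" by auto
        have "wp (eq_block P k) (block_cost * X) (\<lambda>v' a'. zinv M a4 (insert (v4 24, v4 26, v4 28)
           {(x, y, z). x < i \<or> (x = i \<and> y < j) \<or> (x = i \<and> y = j \<and> z < c)}) a' \<and>
           ep_ok a' \<and> a' 20 0 0 = a4 20 0 0 + 1) v4 a4"
          by (rule wp_eq_block)
            (use v4 v4' g o1(1) o2(1) o3(1,2) M cnt[OF o1(1) o2(1) o3(1)] ep(2) in
              \<open>auto simp: glob_def wae3 q_def zc e0_def\<close>)
        then show ?case
          by (rule wp_conseq) (use o3(2) in \<open>auto simp: zc v4' ins\<close>)
      next
        case 5
        then show ?case using wv_eq_block by auto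
      next
        case 6
        then show ?case using o2(2) by simp
      next
        case (8 v' a')
        have "zinv M a {(x, y, z). x < i \<or> (x = i \<and> y < Suc j)} a' = zinv M a {(x, y, z). x < i \<or> (x = i \<and> y < j) \<or> (x = i \<and> y = j \<and> z < q)} a'"
        proof -
          \<comment> \<open>Every solution has \<open>x < M\<close>, so after \<open>q\<close>
            blocks the range is exhausted.\<close>
          have "x div m < q" if "tri M a u v x" for u v x
            using that unfolding tri_def q_def by (simp add: div_le_mono less_Suc_eq_le)
          then have *: "(tri M a u v x \<and> (u div m, v div m, x div m) \<in> {(x, y, z). x < i \<or> (x = i \<and> y < Suc j)}) \<longleftrightarrow>
            (tri M a u v x \<and> (u div m, v div m, x div m) \<in> {(x, y, z). x < i \<or> (x = i \<and> y < j) \<or> (x = i \<and> y = j \<and> z < q)})" for u v x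
            by auto
          show ?thesis unfolding zinv_def * ..
        qed
        then show ?case using 8(1) by simp
      qed (use v3 B1 q M wae2 S_pos in \<open>auto simp: q_def K_def\<close>)
    next
      case 5
      then show ?case using wv_eq_block by auto
    next
      case (8 v' a')
      have "v div m < nb" if "v < n" for v using that by (simp add: nb_def div_le_mono less_Suc_eq_le)
      then have "zinv M a {(x, y, z). x < Suc i} a' = zinv M a {(x, y, z). x < i \<or> (x = i \<and> y < nb)} a'"
        unfolding zinv_def by (intro all_cong imp_cong arg_cong[where f = of_bool] refl) (auto simp: less_Suc_eq)
      then show ?case using 8(1) by simp
    qed (use v1 v B1 o1 in auto)
  next
    case 5
    then show ?case using wv_eq_block by auto
  next
    case 6
    have "zinv M a {(x, y, z). x < 0} ?a" by (auto simp: zinv_def)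
    then show ?case using ep(1) by (auto simp: ep_ok_def e0_def)
  next
    case (8 v' a')
    have "u div m < nb" if "u < n" for u using that by (simp add: nb_def div_le_mono less_Suc_eq_le)
    then show ?case using 8(1) cntN by (auto simp: zinv_def e0_def)
  qed (use v1 v B1 in auto)
  show ?thesis unfolding eq_prod_def
  proof (rule wp_seq_frame[OF wp_matrix[where ?N1.0 = n and ?N2.0 = n and k = 19 and cc = 10 and F = "\<lambda>_ _. 0"]])
    fix v1 a1 assume "a1 = ?a" "\<And>x. x \<notin> wv (For 24 (V 6) (For 26 (V 6) (St 19 (V 24) (V 26) (N 0)))) \<Longrightarrow> v1 x = v x"
    then show "wp ?loop ?t1 ?Q v1 a1" using loop by simp
  next
    show "n * (n * 20 + 18) + 8 + ?t1 \<le> eq_cost * ((M div m + 1) * X)"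
    proof -
      have 1: "1 \<le> q * X" by (simp add: q_def X_def)
      have qq: "q \<le> q * X" by (simp add: X_def)
      have "?t3 = block_cost * (q * X) + (10 * q + 20)" by (simp add: algebra_simps)
      also have "\<dots> \<le> block_cost * (q * X) + 30 * (q * X)" using 1 qq by linarith
      finally have t3: "?t3 \<le> (block_cost + 30) * (q * X)" by (simp only: add_mult_distrib)
      have st: "6 * (t + 10) + 8 \<le> (6 * c + 68) * y" if "t \<le> c * y" "1 \<le> y" for t c y :: nat
      proof -
        have "(6 * c + 68) * y = 6 * (c * y) + 68 * y" by (simp add: algebra_simps)
        moreover have "6 * (t + 10) + 8 \<le> 6 * z + 68 * y" if "t \<le> z" "1 \<le> y" for z :: nat
          using that by simp
        ultimately show ?thesis using that by simp
      qed
      have "?t2 \<le> 6 * (?t3 + 10) + 8" using m_pos(4) by (intro add_mono mult_right_mono) auto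
      also have "\<dots> \<le> (6 * (block_cost + 30) + 68) * (q * X)" by (rule st[OF t3 1])
      finally have t2: "?t2 \<le> (6 * (block_cost + 30) + 68) * (q * X)" .
      have "?t1 \<le> 6 * (?t2 + 10) + 8" using m_pos(4) by (intro add_mono mult_right_mono) auto
      also have "\<dots> \<le> (6 * (6 * (block_cost + 30) + 68) + 68) * (q * X)" by (rule st[OF t2 1])
      also have "\<dots> = (36 * block_cost + 1556) * (q * X)" by simp
      finally have t1: "?t1 \<le> (36 * block_cost + 1556) * (q * X)" .
      have "n * (n * 20 + 18) + 8 = 20 * (n * n) + 18 * n + 8" by (simp add: algebra_simps)
      also have "\<dots> \<le> 40 * X" using n_le(1) X_def by linarith
      also have "\<dots> \<le> 40 * (q * X)" by (simp add: q_def)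
      finally have "n * (n * 20 + 18) + 8 + ?t1 \<le> 40 * (q * X) + (36 * block_cost + 1556) * (q * X)"
        using t1 by (rule add_mono)
      also have "\<dots> \<le> eq_cost * (q * X)" by (simp add: eq_cost_def add_mult_distrib)
      finally show ?thesis by (simp add: q_def)
    qed
  qed (use v B1 S_pos in \<open>auto simp: K_def\<close>)
qed

end

section \<open>Bitwise search for a minimum\<close>

text \<open>Array 13 holds one plus the current minimum, so the expression is one plus
  \<open>2 * \<mu> + (2 - i)\<close>, with \<open>i\<close> in variable 16. Larger candidates are
  tested first: a later, smaller hit overwrites an earlier one in array 14.\<close>

definition bit_test_code :: "prog \<Rightarrow> nat \<Rightarrow> com" where
  "bit_test_code P k =
     (For 18 (V 6) (For 20 (V 6)
        (If (Ld 13 (V 18) (V 20))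
          (St 18 (V 18) (V 20) (((Ld 13 (V 18) (V 20) \<oplus> Ld 13 (V 18) (V 20)) \<ominus> N 1) \<oplus> (N 2 \<ominus> V 16)))
          (St 18 (V 18) (V 20) (N 0)))) ;;
      eq_prod P k ;;
      For 18 (V 6) (For 20 (V 6) (When (Ld 19 (V 18) (V 20)) (St 14 (V 18) (V 20) (Ld 18 (V 18) (V 20))))))"

text \<open>Variable 14 is the bit position, running down from \<open>L - 1\<close>, and variable 15
  its power of two. The parameter \<open>fill\<close> has to prepare the operands for values shifted
  by that many bits.\<close>

definition descent_step :: "prog \<Rightarrow> nat \<Rightarrow> com \<Rightarrow> com" where
  "descent_step P k fill =
     ((14 ::= (V 4 \<ominus> N 1) \<ominus> V 12 ;; 15 ::= Op Shl (N 1) (V 14)) ;;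
      fill ;;
      For 18 (V 6) (For 20 (V 6) (St 14 (V 18) (V 20) (N 0))) ;;
      For 16 (N 3) (bit_test_code P k) ;;
      For 18 (V 6) (For 20 (V 6) (St 13 (V 18) (V 20) (Ld 14 (V 18) (V 20)))))"

definition descent :: "prog \<Rightarrow> nat \<Rightarrow> com \<Rightarrow> com" where
  "descent P k fill =
     (For 12 (V 6) (For 14 (V 6) (St 13 (V 12) (V 14) (N 1))) ;;
      For 12 (V 4) (descent_step P k fill))"

text \<open>The three tests as a function: test \<open>i\<close> tries \<open>g (2 - i)\<close>, and
  a later hit overrides an earlier one.\<close>

primrec least_hit :: "(nat \<Rightarrow> bool) \<Rightarrow> (nat \<Rightarrow> nat) \<Rightarrow> nat \<Rightarrow> nat" where
  "least_hit h g 0 = 0"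
| "least_hit h g (Suc i) = (if h (g (2 - i)) then g (2 - i) else least_hit h g i)"

text \<open>The encoding used in array 13: one plus the minimum, and 0 if there is none. The shift
  matches the colours, where 0 means no edge.\<close>

definition opt :: "'a set \<Rightarrow> ('a \<Rightarrow> nat) \<Rightarrow> nat" where
  "opt W f = (if W = {} then 0 else Suc (LEAST c. \<exists>s\<in>W. c = f s))"

lemma opt_le: "s \<in> W \<Longrightarrow> opt W f \<le> Suc (f s)"
  unfolding opt_def by (auto intro: Least_le)

lemma opt_attained: "W \<noteq> {} \<Longrightarrow> \<exists>s\<in>W. opt W f = Suc (f s)"
proof -
  assume W: "W \<noteq> {}"
  then have "\<exists>c. \<exists>s\<in>W. c = f s" by auto
  then have "\<exists>s\<in>W. (LEAST c. \<exists>s\<in>W. c = f s) = f s" by (rule LeastI_ex)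
  then show ?thesis using W by (simp add: opt_def)
qed

text \<open>The pointwise bounds \<open>2 * f' \<le> f \<le> 2 * f' + 2\<close> pass to the minima,
  so one of the three candidates is right. For empty \<open>W\<close> no candidate can hit, whatever
  \<open>cs\<close> is; this permits starting the search with the same value everywhere.\<close>

lemma opt_step:
  assumes f: "\<And>s. s \<in> W \<Longrightarrow> 2 * f' s \<le> f s \<and> f s \<le> 2 * f' s + 2"
    and cs: "W \<noteq> {} \<Longrightarrow> cs = opt W f'"
    and g: "\<And>t. g t = (if cs = 0 then 0 else 2 * cs - 1 + t)"
    and h: "\<And>c. h c \<longleftrightarrow> c \<noteq> 0 \<and> (\<exists>s\<in>W. f s + 1 = c)"
  shows "least_hit h g 3 = opt W f"
proof (cases "W = {}")
  case True
  then have "h c = False" for c using h by auto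
  then have "least_hit h g i = 0" for i by (induction i) auto
  then show ?thesis using True by (simp add: opt_def)
next
  case False
  obtain s1 where s1: "s1 \<in> W" "cs = Suc (f' s1)" using opt_attained[OF False, of f'] cs[OF False] by auto
  obtain s2 where s2: "s2 \<in> W" "opt W f = Suc (f s2)" using opt_attained[OF False, of f] by auto
  have "f s2 \<le> f s1" using opt_le[OF s1(1), of f] s2 by simp
  then have ub: "f s2 \<le> 2 * f' s1 + 2" using f[OF s1(1)] by linarith
  have "f' s1 \<le> f' s2" using opt_le[OF s2(1), of f'] s1(2) cs[OF False] by simp
  then have lb: "2 * f' s1 \<le> f s2" using f[OF s2(1)] by linarith
  have gt: "g t = Suc (2 * f' s1 + t)" for t using g[of t] s1(2) by simp
  have hit: "h (Suc c) \<longleftrightarrow> (\<exists>s\<in>W. f s = c)" for c using h by auto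
  have no: "\<not> h (Suc c)" if "c < f s2" for c
  proof
    assume "h (Suc c)"
    then obtain s where "s \<in> W" "f s = c" using hit by auto
    then show False using opt_le[of s W f] s2(2) that by simp
  qed
  have yes: "h (Suc (f s2))" using hit s2(1) by auto
  consider "f s2 = 2 * f' s1" | "f s2 = 2 * f' s1 + 1" | "f s2 = 2 * f' s1 + 2" using ub lb by linarith
  then show ?thesis
    by cases (use gt no yes s2(2) in \<open>auto simp: numeral_3_eq_3\<close>)
qed

locale aeL = ae +
  assumes L2: "n \<le> 2 ^ L" "2 ^ L < 2 * n"
begin

lemma L_pos: "1 \<le> L"
  using L2(1) n3 by (cases L) auto

lemma pow_lt: "j < L \<Longrightarrow> 2 ^ j < n"
proof -
  assume "j < L"
  then have "(2::nat) ^ Suc j \<le> 2 ^ L" by (intro power_increasing) auto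
  then show ?thesis using L2(2) by simp
qed

lemma matrix_cost: "n * (n * (c + 10) + 18) + 8 \<le> (c + 40) * X"
proof -
  have "n * (n * (c + 10) + 18) + 8 = (c + 10) * (n * n) + 18 * n + 8" by (simp add: algebra_simps)
  also have "\<dots> \<le> (c + 10) * X + 30 * X" 
  proof -
    have "(c + 10) * (n * n) \<le> (c + 10) * X" by (rule mult_left_mono) (auto simp: X_def)
    moreover have "18 * n + 8 \<le> 30 * X" using n_le(1) X_def by linarith
    ultimately show ?thesis by linarith
  qed
  also have "\<dots> = (c + 40) * X" by (simp add: algebra_simps)
  finally show ?thesis .
qed

lemma wv_test: "wv (bit_test_code P k) \<subseteq> {18..}" "wa (bit_test_code P k) \<subseteq> {14, 18, 19, 20, 21, 22}"
  using wv_eq_prod by (fastforce simp: bit_test_code_def)+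

text \<open>The bound on array 13 keeps the doubled candidates below \<open>B\<close>.\<close>

lemma wp_bit_test_code:
  assumes g: "glob v" and M: "a 17 0 0 = M" "M \<le> 3 * (n * n)" and ep: "ep_ok a" "a 20 0 0 + 150 * (n * n) < B"
    and t: "v 16 = i" and cs: "\<And>u v. u < n \<Longrightarrow> v < n \<Longrightarrow> a 13 u v \<le> n * n"
  shows "wp (bit_test_code P k) (eq_cost * ((M div m + 1) * X) + 300 * X)
    (\<lambda>v' a'. (\<forall>u<n. \<forall>v<n. let c = (if a 13 u v = 0 then 0 else 2 * a 13 u v - 1 + (2 - i)) in
        a' 14 u v = (if c \<noteq> 0 \<and> c \<le> n * n \<and> (\<exists>x<M. a 15 u x = c \<and> a 16 v x = c) then c else a 14 u v)) \<and>
      ep_ok a' \<and> a' 20 0 0 \<le> a 20 0 0 + 150 * (n * n)) v a"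
proof -
  have B1: "1 < B" "n < B" "3 * (n * n) < B" using B_big n_le by linarith+
  have gv: "v 6 = n" "v 3 = m" using g by (auto simp: glob_def)
  let ?c = "\<lambda>u v. if a 13 u v = 0 then 0 else 2 * a 13 u v - 1 + (2 - i)"
  let ?a = "a(18 := \<lambda>u v. if u < n \<and> v < n then ?c u v else a 18 u v)"
  have b: "2 * a 13 u v + 2 < B" if "u < n" "v < n" for u v
  proof -
    have "a 13 u v \<le> n * n" using cs that by blast
    moreover have "2 * (n * n) + 2 < B" using B_big n_le by linarith
    ultimately show ?thesis by linarith
  qed
  show ?thesis unfolding bit_test_code_def
  proof (rule wp_seq_frame[where tb = "eq_cost * ((M div m + 1) * X) + 100 * X", OF wp_matrix[where ?N1.0 = n and ?N2.0 = n and k = 18 and cc = 100 and F = ?c and t = "n * (n * (100 + 10) + 18) + 8"]], goal_cases)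
    case (12 i' j v' a')
    have "v' 16 = i" using 12(5)[of 16] t by simp
    moreover have "a' 13 = a 13" using 12(6) by simp
    ultimately show ?case using 12 S_pos B1 b[OF 12(1,2)] by (auto simp: K_def mult_2)
  next
    case 13
    show ?case by (rule le_refl)
  next
    case (14 v1 a1)
    have a1: "a1 = ?a" using 14 by simp
    have v1: "z < 18 \<Longrightarrow> v1 z = v z" for z using 14(2)[of z] by simp
    show ?case
    proof (rule wp_seq_frame[OF wp_eq[where M = M]])
      fix v2 a2 assume 2: "(\<forall>u<n. \<forall>v<n. a2 19 u v = of_bool (\<exists>x. tri M a1 u v x)) \<and> ep_ok a2 \<and>
         a2 20 0 0 \<le> a1 20 0 0 + 150 * (n * n)"
        and fr: "\<And>x. x \<notin> wv (eq_prod P k) \<Longrightarrow> v2 x = v1 x" "\<And>k'. k' \<notin> wa (eq_prod P k) \<Longrightarrow> a2 k' = a1 k'"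
      have v2: "z < 18 \<Longrightarrow> v2 z = v z" for z using fr(1)[of z] v1[of z] wv_eq_prod(1) by fastforce
      have a2: "k' \<notin> {19, 20, 21, 22} \<Longrightarrow> a2 k' = ?a k'" for k' using fr(2)[of k'] wv_eq_prod(2) a1 by fastforce
      show "wp (For 18 (V 6) (For 20 (V 6) (When (Ld 19 (V 18) (V 20)) (St 14 (V 18) (V 20) (Ld 18 (V 18) (V 20))))))
         (100 * X) (\<lambda>v' a'. (\<forall>u<n. \<forall>v<n. let c = ?c u v in
        a' 14 u v = (if c \<noteq> 0 \<and> c \<le> n * n \<and> (\<exists>x<M. a 15 u x = c \<and> a 16 v x = c) then c else a 14 u v)) \<and>
      ep_ok a' \<and> a' 20 0 0 \<le> a 20 0 0 + 150 * (n * n)) v2 a2"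
      proof (rule wp_conseq[OF wp_matrix[where ?N1.0 = n and ?N2.0 = n and k = 14 and cc = 50 and t = "n * (n * (50 + 10) + 18) + 8"
            and F = "\<lambda>u v. if a2 19 u v \<noteq> 0 then a2 18 u v else a2 14 u v"]], goal_cases)
        case (12 i' j v' a')
        have "a' 19 = a2 19" "a' 18 = a2 18" using 12(6) by simp_all
        moreover have "upd a' 14 i' j (a2 14 i' j) = a'"
          using 12(7) by (simp add: upd_def fun_eq_iff)
        ultimately show ?case using 12 S_pos B1 by (auto simp: K_def)
      next
        case 13
        show ?case by (rule le_refl)
      next
        case (14 v' a')
        have "a' 14 u v = (if ?c u v \<noteq> 0 \<and> ?c u v \<le> n * n \<and> (\<exists>x<M. a 15 u x = ?c u v \<and> a 16 v x = ?c u v) then ?c u v else a 14 u v)"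
          if uv: "u < n" "v < n" for u v
        proof -
          have e: "a2 19 u v = of_bool (\<exists>x. tri M a1 u v x)" "a2 18 u v = ?c u v" "a2 14 = a 14"
            using 2 uv a2[of 18] a2[of 14] by auto
          have "(\<exists>x. tri M a1 u v x) \<longleftrightarrow> ?c u v \<noteq> 0 \<and> ?c u v \<le> n * n \<and> (\<exists>x<M. a 15 u x = ?c u v \<and> a 16 v x = ?c u v)"
            using uv unfolding tri_def a1 by auto
          note iff = this
          have A: "a' 14 u v = (if a2 19 u v \<noteq> 0 then a2 18 u v else a2 14 u v)" using 14 uv by simp
          show ?thesis unfolding A e iff by (simp only: of_bool_eq_0_iff not_not)
        qed
        moreover have "ep_ok a'" "a' 20 0 0 = a2 20 0 0" using 14 2 by (auto simp: ep_ok_def)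
        ultimately show ?case using 2 a1 by (auto simp: Let_def)
      next
        case 15
        show ?case using matrix_cost[of 50] by simp
      qed (use v2[of 6] gv B1 in auto)
    qed (use v1 g M ep a1 in \<open>auto simp: glob_def ep_ok_def\<close>)
  next
    case 15
    show ?case using matrix_cost[of 100] by simp
  qed (use gv B1 in auto)
qed

end

section \<open>The descent through all bits\<close>

context aeL
begin

text \<open>Contract between operands and descent: the legal colours on which the two operands meet
  are the values of \<open>f\<close> on the witnesses, shifted by one.\<close>

definition hits :: "nat \<Rightarrow> ('s \<Rightarrow> nat) \<Rightarrow> 's set \<Rightarrow> arrs \<Rightarrow> nat \<Rightarrow> nat \<Rightarrow> bool" where
  "hits M f W a u v \<longleftrightarrow> (\<forall>c. c \<noteq> 0 \<longrightarrow> c \<le> n * n \<longrightarrow>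
     ((\<exists>x<M. a 15 u x = c \<and> a 16 v x = c) \<longleftrightarrow> (\<exists>s\<in>W. f s + 1 = c)))"

lemma wp_descent_step:
  fixes W :: "nat \<Rightarrow> nat \<Rightarrow> 's set" and f f' :: "nat \<Rightarrow> nat \<Rightarrow> 's \<Rightarrow> nat"
  assumes g: "glob v" and i: "v 12 = i" "i < L" "j = L - 1 - i"
    and ep: "ep_ok a" "a 20 0 0 + 450 * (n * n) < B"
    and cs: "\<And>u v. u < n \<Longrightarrow> v < n \<Longrightarrow> a 13 u v \<le> n * n \<and> (W u v \<noteq> {} \<longrightarrow> a 13 u v = opt (W u v) (f' u v))"
    and fill_frame: "wv fill \<subseteq> {18..}" "wa fill \<subseteq> {15, 16, 17}"
    and fill: "wp fill tf (\<lambda>_ a'. a' 17 0 0 = M \<and> (\<forall>u<n. \<forall>v<n. hits M (f u v) (W u v) a' u v)) (v(14 := j, 15 := 2 ^ j)) a"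
    and M: "M \<le> 3 * (n * n)"
    and f: "\<And>u v s. u < n \<Longrightarrow> v < n \<Longrightarrow> s \<in> W u v \<Longrightarrow> f u v s + 1 \<le> n * n \<and> 2 * f' u v s \<le> f u v s \<and> f u v s \<le> 2 * f' u v s + 2"
  shows "wp (descent_step P k fill) (tf + 3 * (eq_cost * ((M div m + 1) * X)) + 1300 * X)
    (\<lambda>v' a'. (\<forall>u<n. \<forall>v<n. a' 13 u v = opt (W u v) (f u v)) \<and> ep_ok a' \<and>
      a' 20 0 0 \<le> a 20 0 0 + 450 * (n * n)) v a"
proof -
  let ?E = "eq_cost * ((M div m + 1) * X)"
  let ?Q = "\<lambda>v' a'. (\<forall>u<n. \<forall>v<n. a' 13 u v = opt (W u v) (f u v)) \<and> ep_ok a' \<and>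
      a' 20 0 0 \<le> a 20 0 0 + 450 * (n * n)"
  let ?v = "v(14 := j, 15 := 2 ^ j)"
  have B1: "1 < B" "n < B" "3 < B" "3 * (n * n) < B" using B_big n_le by linarith+
  have gv: "v 6 = n" "v 4 = L" using g by (auto simp: glob_def)
  have jL: "j < L" using i by auto
  have X1: "1 \<le> X" by (simp add: X_def)
  have main: "wp (fill ;; For 18 (V 6) (For 20 (V 6) (St 14 (V 18) (V 20) (N 0))) ;;
      For 16 (N 3) (bit_test_code P k) ;; For 18 (V 6) (For 20 (V 6) (St 13 (V 18) (V 20) (Ld 14 (V 18) (V 20)))))
      (tf + (50 * X + ((3 * (?E + 300 * X + 10) + 8) + 70 * X))) ?Q ?v a"
  proof (rule wp_seq_frame[where tb = "50 * X + ((3 * (?E + 300 * X + 10) + 8) + 70 * X)", OF fill])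
    fix v1 a1 assume 1: "a1 17 0 0 = M \<and> (\<forall>u<n. \<forall>v<n. hits M (f u v) (W u v) a1 u v)"
      and fr1: "\<And>x. x \<notin> wv fill \<Longrightarrow> v1 x = ?v x" "\<And>k'. k' \<notin> wa fill \<Longrightarrow> a1 k' = a k'"
    have v1: "z < 14 \<Longrightarrow> v1 z = v z" for z using fr1(1)[of z] fill_frame(1) by fastforce
    have a1: "k' \<notin> {15, 16, 17} \<Longrightarrow> a1 k' = a k'" for k' using fr1(2)[of k'] fill_frame(2) by fastforce
    show "wp (For 18 (V 6) (For 20 (V 6) (St 14 (V 18) (V 20) (N 0))) ;;
      For 16 (N 3) (bit_test_code P k) ;; For 18 (V 6) (For 20 (V 6) (St 13 (V 18) (V 20) (Ld 14 (V 18) (V 20)))))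
      (50 * X + ((3 * (?E + 300 * X + 10) + 8) + 70 * X)) ?Q v1 a1"
    proof (rule wp_seq_frame[where tb = "(3 * (?E + 300 * X + 10) + 8) + 70 * X",
          OF wp_matrix[where ?N1.0 = n and ?N2.0 = n and k = 14 and cc = 10 and F = "\<lambda>_ _. 0"
            and t = "n * (n * (10 + 10) + 18) + 8"]], goal_cases)
      case (14 v2 a2)
      have v2: "z < 14 \<Longrightarrow> v2 z = v z" for z using 14(2)[of z] v1[of z] by simp
      have a2: "k' \<noteq> 14 \<Longrightarrow> a2 k' = a1 k'" for k' using 14(1) by simp
      have a2n: "u < n \<Longrightarrow> v < n \<Longrightarrow> a2 14 u v = 0" for u v using 14(1) by simp
      let ?g = "\<lambda>u v t. (if a 13 u v = 0 then 0 else 2 * a 13 u v - 1 + t)"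
      let ?h = "\<lambda>u v c. c \<noteq> 0 \<and> (\<exists>s\<in>W u v. f u v s + 1 = c)"
      have fin: "least_hit (?h u v) (?g u v) 3 = opt (W u v) (f u v)" if uv: "u < n" "v < n" for u v
        by (rule opt_step[where f' = "f' u v" and cs = "a 13 u v"]) (use f cs uv in auto)
      show ?case
      proof (rule wp_seq_frame[where tb = "70 * X", OF wp_for_const[where n = 3 and t = "?E + 300 * X" and
            I = "\<lambda>i a'. (\<forall>u<n. \<forall>v<n. a' 14 u v = least_hit (?h u v) (?g u v) i) \<and> ep_ok a' \<and>
              a' 20 0 0 \<le> a 20 0 0 + i * (150 * (n * n))" and
            Q = "\<lambda>v' a'. (\<forall>u<n. \<forall>v<n. a' 14 u v = least_hit (?h u v) (?g u v) 3) \<and> ep_ok a' \<and>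
              a' 20 0 0 \<le> a 20 0 0 + 450 * (n * n)" and T = "3 * (?E + 300 * X + 10) + 8"]], goal_cases)
        case 6
        then show ?case using a2n ep(1) a2 a1 by (auto simp: ep_ok_def)
      next
        case (7 i3 v3 a3)
        have v3: "z < 14 \<Longrightarrow> v3 z = v z" for z using 7(5)[of z] v2[of z] by simp
        have a3: "k' \<notin> {14, 18, 19, 20, 21, 22} \<Longrightarrow> a3 k' = a1 k'" for k' using 7(6)[of k'] wv_test(2) a2[of k'] by fastforce
        have bnd: "i3 * (150 * (n * n)) + 150 * (n * n) \<le> 450 * (n * n)"
          using mult_le_mono1[of "Suc i3" 3 "150 * (n * n)"] 7(1) by simp
        have "a3 20 0 0 + 150 * (n * n) < B" using 7(2) bnd ep(2) by linarith
        then have "wp (bit_test_code P k) (?E + 300 * X)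
          (\<lambda>v' a'. (\<forall>u<n. \<forall>v<n. let c = (if a3 13 u v = 0 then 0 else 2 * a3 13 u v - 1 + (2 - i3)) in
              a' 14 u v = (if c \<noteq> 0 \<and> c \<le> n * n \<and> (\<exists>x<M. a3 15 u x = c \<and> a3 16 v x = c) then c else a3 14 u v)) \<and>
            ep_ok a' \<and> a' 20 0 0 \<le> a3 20 0 0 + 150 * (n * n)) v3 a3"
          using 7(2) by (intro wp_bit_test_code) (use 7(1,3) v3 g 1 a3 a1 M cs in \<open>auto simp: glob_def\<close>)
        then show ?case
        proof (rule wp_conseq)
          fix v4 a4 assume 4: "(\<forall>u<n. \<forall>v<n. let c = (if a3 13 u v = 0 then 0 else 2 * a3 13 u v - 1 + (2 - i3)) in
              a4 14 u v = (if c \<noteq> 0 \<and> c \<le> n * n \<and> (\<exists>x<M. a3 15 u x = c \<and> a3 16 v x = c) then c else a3 14 u v)) \<and>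
            ep_ok a4 \<and> a4 20 0 0 \<le> a3 20 0 0 + 150 * (n * n)"
          have "a4 14 u v = least_hit (?h u v) (?g u v) (Suc i3)" if uv: "u < n" "v < n" for u v
          proof -
            let ?c = "?g u v (2 - i3)"
            have eqs: "a3 13 = a 13" "a3 15 = a1 15" "a3 16 = a1 16" using a3 a1 by auto
            have e: "a4 14 u v = (if ?c \<noteq> 0 \<and> ?c \<le> n * n \<and> (\<exists>x<M. a1 15 u x = ?c \<and> a1 16 v x = ?c) then ?c else a3 14 u v)"
              by (rule 4[THEN conjunct1, rule_format, OF uv, unfolded Let_def eqs])
            have H: "hits M (f u v) (W u v) a1 u v" using 1 uv by simp
            have "c \<noteq> 0 \<and> c \<le> n * n \<and> (\<exists>x<M. a1 15 u x = c \<and> a1 16 v x = c) \<longleftrightarrow> ?h u v c" for c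
            proof (cases "c \<noteq> 0 \<and> c \<le> n * n")
              case True
              with H show ?thesis unfolding hits_def by simp
            next
              case False
              \<comment> \<open>The tests ignore colours above \<open>n * n\<close>, but no witness
                has such a value.\<close>
              then have "\<not> ?h u v c" using f[OF uv] by auto
              with False show ?thesis by blast
            qed
            note iff = this[of ?c]
            show ?thesis unfolding e iff least_hit.simps using 7(2) uv by (auto simp del: One_nat_def)
          qed
          then show "(\<forall>u<n. \<forall>v<n. a4 14 u v = least_hit (?h u v) (?g u v) (Suc i3)) \<and> ep_ok a4 \<and>
              a4 20 0 0 \<le> a 20 0 0 + Suc i3 * (150 * (n * n))" using 4 7(2) by auto
        qed simp
      next
        case 5
        then show ?case using wv_test by auto
      next
        case (10 v3 a3)
        have v3: "z < 14 \<Longrightarrow> v3 z = v z" for z using 10(2)[of z] v2[of z] wv_test(1) by fastforce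
        show ?case
        proof (rule wp_conseq[OF wp_matrix[where ?N1.0 = n and ?N2.0 = n and k = 13 and cc = 20
                and F = "\<lambda>u v. a3 14 u v" and t = "n * (n * (20 + 10) + 18) + 8"]], goal_cases)
          case (14 v4 a4)
          then show ?case using 10(1) fin by (auto simp: ep_ok_def)
        qed (use v3[of 6] gv B1 S_pos matrix_cost[of 20] X1 in \<open>auto simp: K_def\<close>)
      qed (use B1 in auto)
    next
      case 15
      show ?case using matrix_cost[of 10] by simp
    qed (use v1[of 6] gv B1 S_pos in \<open>auto simp: K_def\<close>)
  qed simp
  have jB: "2 ^ j < B" using pow_lt[OF jL] B1 by linarith
  have "sp (14 ::= (V 4 \<ominus> N 1) \<ominus> V 12 ;; 15 ::= Op Shl (N 1) (V 14)) (wp (fill ;; For 18 (V 6) (For 20 (V 6) (St 14 (V 18) (V 20) (N 0))) ;;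
      For 16 (N 3) (bit_test_code P k) ;; For 18 (V 6) (For 20 (V 6) (St 13 (V 18) (V 20) (Ld 14 (V 18) (V 20)))))
      (tf + (50 * X + ((3 * (?E + 300 * X + 10) + 8) + 70 * X))) ?Q) v a"
    using main gv i jB B1 by (simp add: push_bit_eq_mult)
  then show ?thesis unfolding descent_step_def
    by (rule wp_sp_seq) (use X1 in simp)
qed

lemma wv_descent:
  assumes "wv fill \<subseteq> {18..}" "wa fill \<subseteq> {15, 16, 17}"
  shows "wv (descent P k fill) \<subseteq> {12..}" "wa (descent P k fill) \<subseteq> {13..22}"
  using assms wv_test by (fastforce simp: descent_def descent_step_def)+

text \<open>At level \<open>L\<close> all values are 0, so the start value 1 is the correct optimum
  wherever a witness exists. Each step passes from level \<open>Suc j\<close> to level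
  \<open>j\<close>, and level 0 is the function to be minimised.\<close>

theorem wp_descent:
  fixes W :: "nat \<Rightarrow> nat \<Rightarrow> 's set" and f :: "nat \<Rightarrow> nat \<Rightarrow> nat \<Rightarrow> 's \<Rightarrow> nat"
  assumes g: "glob v" and ep: "ep_ok a" "a 20 0 0 + L * (450 * (n * n)) < B"
    and fill_frame: "wv fill \<subseteq> {18..}" "wa fill \<subseteq> {15, 16, 17}"
    and fill: "\<And>j v' a'. j < L \<Longrightarrow> v' 14 = j \<Longrightarrow> v' 15 = 2 ^ j \<Longrightarrow> (\<And>z. z < 12 \<Longrightarrow> v' z = v z) \<Longrightarrow>
       (\<And>k. k < 13 \<Longrightarrow> a' k = a k) \<Longrightarrow>
       wp fill (tf j) (\<lambda>_ a''. a'' 17 0 0 = M j \<and> (\<forall>u<n. \<forall>v<n. hits (M j) (f j u v) (W u v) a'' u v)) v' a'"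
    and M: "\<And>j. j < L \<Longrightarrow> M j \<le> 3 * (n * n)"
    and f: "\<And>j u v s. j < L \<Longrightarrow> u < n \<Longrightarrow> v < n \<Longrightarrow> s \<in> W u v \<Longrightarrow>
       f j u v s + 1 \<le> n * n \<and> 2 * f (Suc j) u v s \<le> f j u v s \<and> f j u v s \<le> 2 * f (Suc j) u v s + 2"
    and fL: "\<And>u v s. u < n \<Longrightarrow> v < n \<Longrightarrow> s \<in> W u v \<Longrightarrow> f L u v s = 0"
    and T: "(\<Sum>j<L. tf j + 3 * (eq_cost * ((M j div m + 1) * X)) + 1310 * X) + 60 * X \<le> T"
  shows "wp (descent P k fill) T
    (\<lambda>v' a'. (\<forall>u<n. \<forall>v<n. a' 13 u v = opt (W u v) (f 0 u v)) \<and> ep_ok a' \<and>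
      a' 20 0 0 \<le> a 20 0 0 + L * (450 * (n * n))) v a"
proof -
  have B1: "1 < B" "n < B" "L < B" using B_big n_le L by linarith+
  have gv: "v 6 = n" "v 4 = L" using g by (auto simp: glob_def)
  have X1: "1 \<le> X" by (simp add: X_def)
  let ?t = "\<lambda>j. tf j + 3 * (eq_cost * ((M j div m + 1) * X)) + 1300 * X"
  let ?T2 = "(\<Sum>i<L. ?t (L - 1 - i) + 10) + 8"
  have n2: "1 \<le> n * n" using n3 by auto
  show ?thesis unfolding descent_def
  proof (rule wp_seq_frame[where tb = ?T2, OF wp_matrix[where ?N1.0 = n and ?N2.0 = n and k = 13 and cc = 10
          and F = "\<lambda>_ _. 1" and t = "n * (n * (10 + 10) + 18) + 8"]], goal_cases)
    case (14 v1 a1)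
    have v1: "z < 12 \<Longrightarrow> v1 z = v z" for z using 14(2)[of z] by simp
    show ?case
    \<comment> \<open>Before the first step array 13 is 1 even where there is no witness, hence the
      case distinction in the invariant.\<close>
    proof (rule wp_for_sum[where n = L and t = "\<lambda>i. ?t (L - 1 - i)" and I = "\<lambda>i a'.
          (\<forall>u<n. \<forall>v<n. if i = 0 then a' 13 u v = 1 else a' 13 u v = opt (W u v) (f (L - i) u v)) \<and> ep_ok a' \<and>
          a' 20 0 0 \<le> a 20 0 0 + i * (450 * (n * n))"], goal_cases)
      case (7 i v2 a2)
      define j where "j = L - 1 - i"
      have j: "Suc j = L - i" "j = L - Suc i" "j < L" using 7(1) by (auto simp: j_def)
      have v2: "z < 12 \<Longrightarrow> v2 z = v z" for z using 7(5)[of z] v1[of z] by simp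
      have "wa (descent_step P k fill) \<subseteq> {13..22}"
        using fill_frame wv_test by (fastforce simp: descent_step_def)
      then have a2: "k' < 13 \<Longrightarrow> a2 k' = a k'" for k' using 7(6)[of k'] 14(1) by fastforce
      have fl: "wp fill (tf j) (\<lambda>_ a''. a'' 17 0 0 = M j \<and> (\<forall>u<n. \<forall>v<n. hits (M j) (f j u v) (W u v) a'' u v)) (v2(14 := j, 15 := 2 ^ j)) a2"
        by (rule fill) (use j(3) v2 a2 in auto)
      have cs: "a2 13 u v \<le> n * n \<and> (W u v \<noteq> {} \<longrightarrow> a2 13 u v = opt (W u v) (f (Suc j) u v))" if uv: "u < n" "v < n" for u v
      proof (cases "i = 0")
        case True
        have "opt (W u v) (f L u v) = 1" if "W u v \<noteq> {}"
          using opt_attained[OF that, of "f L u v"] fL[OF uv] by auto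
        then show ?thesis using 7(2) uv True n2 j(1) by auto
      next
        case False
        then have e: "a2 13 u v = opt (W u v) (f (Suc j) u v)" using 7(2) uv j(1) by auto
        have "opt (W u v) (f (Suc j) u v) \<le> n * n"
        proof (cases "W u v = {}")
          case False
          from opt_attained[OF this, of "f (Suc j) u v"]
          obtain s where "s \<in> W u v" "opt (W u v) (f (Suc j) u v) = Suc (f (Suc j) u v s)" ..
          moreover have "Suc j < L" using j(1) 7(1) \<open>i \<noteq> 0\<close> by arith
          ultimately show ?thesis using f[of "Suc j" u v s] uv by auto
        qed (simp add: opt_def)
        then show ?thesis using e by simp
      qed
      have bnd: "i * (450 * (n * n)) + 450 * (n * n) \<le> L * (450 * (n * n))"
        using mult_le_mono1[of "Suc i" L "450 * (n * n)"] 7(1) by simp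
      have "wp (descent_step P k fill) (?t j)
        (\<lambda>v' a'. (\<forall>u<n. \<forall>v<n. a' 13 u v = opt (W u v) (f j u v)) \<and> ep_ok a' \<and>
          a' 20 0 0 \<le> a2 20 0 0 + 450 * (n * n)) v2 a2"
      proof (rule wp_descent_step[where f' = "f (Suc j)", OF _ 7(3,1) j_def _ _ cs fill_frame fl M[OF j(3)] f[OF j(3)]])
        show "glob v2" using v2 g by (auto simp: glob_def)
        show "ep_ok a2" "a2 20 0 0 + 450 * (n * n) < B" using 7(2) bnd ep(2) by auto
      qed
      then show ?case unfolding j_def[symmetric]
        by (rule wp_conseq) (use 7(2) j(2) in auto)
    next
      case 5
      then show ?case using fill_frame wv_test by (fastforce simp: descent_step_def)
    next
      case 6
      then show ?case using 14(1) ep(1) by (auto simp: ep_ok_def)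
    next
      case (8 v' a')
      then show ?case using L_pos by auto
    qed (use v1[of 4] gv B1 in auto)
  next
    case 15
    have "(\<Sum>i<L. ?t (L - 1 - i) + 10) = (\<Sum>j<L. ?t j + 10)"
      using sum.nat_diff_reindex[of "\<lambda>j. ?t j + 10" L] by simp
    also have "\<dots> \<le> (\<Sum>j<L. tf j + 3 * (eq_cost * ((M j div m + 1) * X)) + 1310 * X)"
      using X1 by (intro sum_mono) simp
    finally have "(\<Sum>i<L. ?t (L - 1 - i) + 10) + 60 * X \<le> T" using T by linarith
    moreover have "p + (q + 8) \<le> T" if "q + 60 * X \<le> T" "p \<le> (10 + 40) * X" for p q using that X1 by simp
    ultimately show ?case using matrix_cost[of 10] by blast
  qed (use gv B1 S_pos in \<open>auto simp: K_def\<close>)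
qed

end

section \<open>Min-plus products through hubs\<close>

text \<open>Index \<open>x\<close> stands for hub number \<open>x div p\<close> and residue
  \<open>x mod p\<close>, where \<open>p = 2 * q + 3\<close> exceeds every sum of two shifted
  entries, each at most \<open>q\<close>. Entries above the cap get colour 0 and match
  nothing.\<close>

definition fill_prod :: com where
  "fill_prod =
     ((18 ::= Op Div (V 10) (V 15) ;; 19 ::= (V 18 \<oplus> V 18) \<oplus> N 3 ;; 20 ::= cell 3 \<otimes> V 19 ;; set_cell 17 (V 20)) ;;
      For 22 (V 6) (For 24 (V 20)
        (26 ::= Ld 2 (Op Div (V 24) (V 19)) (N 0) ;; 27 ::= Op Mod (V 24) (V 19) ;; 28 ::= Ld 5 (V 22) (V 26) ;;
         If (Less (V 10) (V 28)) (St 15 (V 22) (V 24) (N 0))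
           (St 15 (V 22) (V 24) (N 1 \<oplus> Op Mod ((V 27 \<oplus> V 19) \<ominus> Op Div (V 28) (V 15)) (V 19))))) ;;
      For 22 (V 6) (For 24 (V 20)
        (26 ::= Ld 2 (Op Div (V 24) (V 19)) (N 0) ;; 27 ::= Op Mod (V 24) (V 19) ;; 28 ::= Ld 5 (V 26) (V 22) ;;
         If (Less (V 10) (V 28)) (St 16 (V 22) (V 24) (N 0))
           (St 16 (V 22) (V 24) (N 1 \<oplus> Op Mod ((Op Div (V 28) (V 15) \<oplus> V 27) \<otimes> (V 18 \<oplus> N 2)) (V 19))))))"

definition prod_code :: "prog \<Rightarrow> nat \<Rightarrow> com" where
  "prod_code P k = (descent P k fill_prod ;;
     For 12 (V 6) (For 14 (V 6)
       (16 ::= Ld 13 (V 12) (V 14) ;;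
        When (V 16) (When (Less (V 16) (Ld 5 (V 12) (V 14) \<oplus> N 1)) (St 5 (V 12) (V 14) (V 16 \<ominus> N 1))))))"

text \<open>
  Modulo the odd number \<open>p = 2q + 3\<close> the number \<open>q + 2\<close> is the inverse of 2. Hence the two colours
  agree with \<open>c\<close> for some residue \<open>e\<close> exactly if \<open>e = c + x\<close> and \<open>2 c = y + e\<close>, that is
  \<open>c = x + y\<close>.
\<close>

lemma residue_colours:
  fixes x y q c :: nat
  assumes "x \<le> q" "y \<le> q"
  defines "p \<equiv> 2 * q + 3"
  shows "(\<exists>e<p. (e + p - x) mod p = c \<and> ((y + e) * (q + 2)) mod p = c) \<longleftrightarrow> c = x + y"
proof
  assume "\<exists>e<p. (e + p - x) mod p = c \<and> ((y + e) * (q + 2)) mod p = c"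
  then obtain e where e: "e < p" "(e + p - x) mod p = c" "((y + e) * (q + 2)) mod p = c" by auto
  have "p > 0" by (simp add: p_def)
  then have c: "c < p" using e(2) by auto
  have "int p dvd int (e + p - x) - int c" using e(2) by (metis of_nat_mod mod_eq_dvd_iff mod_mod_trivial)
  then have 1: "int p dvd int e + int p - int x - int c" using assms(1) by (simp add: of_nat_diff p_def)
  have "int p dvd int ((y + e) * (q + 2)) - int c" using e(3) by (metis of_nat_mod mod_eq_dvd_iff mod_mod_trivial)
  \<comment> \<open>Doubling removes the factor, as \<open>2 * (q + 2) = p + 1\<close>.\<close>
  then have "int p dvd 2 * (int ((y + e) * (q + 2)) - int c)" by (rule dvd_mult)
  moreover have "2 * (int ((y + e) * (q + 2)) - int c) = (int y + int e) * int p + (int y + int e - 2 * int c)"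
    by (simp add: p_def algebra_simps)
  ultimately have "int p dvd (int y + int e) * int p + (int y + int e - 2 * int c)" by (simp only:)
  then have 2: "int p dvd int y + int e - 2 * int c" by (rule dvd_add_right_iff[OF dvd_triv_right, THEN iffD1])
  have "int p dvd (int y + int e - 2 * int c) - (int e + int p - int x - int c)" using 1 2 by (rule dvd_diff[rotated])
  then have "int p dvd (int x + int y - int c) - int p" by (simp add: algebra_simps)
  from dvd_add[OF this dvd_refl] have 3: "int p dvd int x + int y - int c" by simp
  \<comment> \<open>Both \<open>x + y \<le> 2 * q\<close> and \<open>c\<close> lie below
    \<open>p\<close>, so a difference divisible by \<open>p\<close> must vanish.\<close>
  have "\<bar>int x + int y - int c\<bar> < int p" using assms c by auto
  then have "int x + int y - int c = 0" using dvd_imp_le_int[OF _ 3] by force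
  then show "c = x + y" by linarith
next
  assume c: "c = x + y"
  \<comment> \<open>Forced by the first colour. Then \<open>y + ?e\<close> is \<open>2 * c\<close>
    modulo \<open>p\<close>, which the second colour halves.\<close>
  let ?e = "(c + x) mod p"
  have p: "0 < p" "c < p" "x \<le> p" using assms c by auto
  have "(?e + p - x) mod p = (?e + (p - x)) mod p" using p by simp
  also have "\<dots> = (c + x + (p - x)) mod p" by (simp add: mod_add_left_eq)
  also have "\<dots> = c" using p by simp
  finally have 1: "(?e + p - x) mod p = c" .
  have "((y + ?e) * (q + 2)) mod p = ((y + (c + x)) * (q + 2)) mod p" by (metis mod_add_right_eq mod_mult_left_eq)
  also have "(y + (c + x)) * (q + 2) = c + c * p" using c by (simp add: p_def algebra_simps)
  also have "(c + c * p) mod p = c" using p by simp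
  finally have "((y + ?e) * (q + 2)) mod p = c" .
  with 1 p show "\<exists>e<p. (e + p - x) mod p = c \<and> ((y + e) * (q + 2)) mod p = c" by (intro exI[of _ ?e]) auto
qed

lemma dvd_step: "2 * (x div 2 ^ Suc j) \<le> x div 2 ^ j \<and> x div 2 ^ j \<le> 2 * (x div 2 ^ Suc j) + (1::nat)"
proof -
  have "x div 2 ^ Suc j = (x div 2 ^ j) div 2" by (simp add: div_mult2_eq[symmetric] mult.commute)
  then show ?thesis by auto
qed

text \<open>Geometric decay: up to an additive constant per bit, the residues of all bits together
  are at most twice as many as those of bit 0.\<close>

lemma sum_div_pow: "(\<Sum>j<L. x div 2 ^ j) \<le> 2 * (x::nat)"
proof (induction L arbitrary: x)
  case (Suc L)
  have "(\<Sum>j<Suc L. x div 2 ^ j) = x + (\<Sum>j<L. x div 2 ^ Suc j)" by (subst sum.lessThan_Suc_shift) simp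
  also have "(\<Sum>j<L. x div 2 ^ Suc j) = (\<Sum>j<L. (x div 2) div 2 ^ j)" by (simp add: div_mult2_eq)
  also have "\<dots> \<le> 2 * (x div 2)" by (rule Suc)
  finally show ?case by linarith
qed simp

section \<open>Correctness and cost of a capped min-plus product\<close>

context aeL
begin

definition Hset :: "arrs \<Rightarrow> nat set" where
  "Hset a = {a 2 i 0 | i. i < a 3 0 0}"

definition prod_wit :: "nat \<Rightarrow> arrs \<Rightarrow> nat \<Rightarrow> nat \<Rightarrow> nat set" where
  "prod_wit cap a u v = {s \<in> Hset a. a 5 u s \<le> cap \<and> a 5 s v \<le> cap}"

definition prod_size :: "nat \<Rightarrow> arrs \<Rightarrow> nat \<Rightarrow> nat" where
  "prod_size cap a j = a 3 0 0 * (2 * (cap div 2 ^ j) + 3)"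

definition wf_state :: "arrs \<Rightarrow> bool" where
  "wf_state a \<longleftrightarrow> a 3 0 0 \<le> n \<and> (\<forall>i<a 3 0 0. a 2 i 0 < n) \<and> (\<forall>u<n. \<forall>v<n. a 5 u v \<le> n)"

lemma prod_size_le:
  assumes "a 3 0 0 \<le> n" "cap < n"
  shows "prod_size cap a j \<le> 2 * (n * n) + n"
proof -
  have "cap div 2 ^ j \<le> cap" by simp
  then have "2 * (cap div 2 ^ j) + 3 \<le> 2 * n + 1" using assms(2) by linarith
  then have "prod_size cap a j \<le> n * (2 * n + 1)" unfolding prod_size_def using assms(1) by (intro mult_mono) auto
  then show ?thesis by (simp add: algebra_simps)
qed

text \<open>Writing an operand is paid for by the calls that use it:
  \<open>M \<le> m * (M div m + 1)\<close>, \<open>m \<le> n\<close> and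
  \<open>n * n \<le> X\<close>.\<close>

lemma rect_cost: "n * (M * (c + 10) + 18) + 8 \<le> (c + 40) * ((M div m + 1) * X)"
proof -
  have "M \<le> m * (M div m + 1)" using m_pos(1) by (simp add: add.commute dividend_less_times_div less_imp_le)
  then have "n * M \<le> n * (n * (M div m + 1))" using n_le(5) by (meson mult_le_mono le_refl le_trans)
  also have "\<dots> \<le> (M div m + 1) * X" by (simp add: X_def algebra_simps)
  finally have 1: "(c + 10) * (n * M) \<le> (c + 10) * ((M div m + 1) * X)" by (rule mult_left_mono) simp
  have "18 * n + 8 \<le> 30 * X" using n_le(1) X_def by linarith
  also have "\<dots> \<le> 30 * ((M div m + 1) * X)" by simp
  finally have "(c + 10) * (n * M) + (18 * n + 8) \<le> (c + 10) * ((M div m + 1) * X) + 30 * ((M div m + 1) * X)"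
    using 1 by linarith
  also have "\<dots> = (c + 40) * ((M div m + 1) * X)" by (simp only: add_mult_distrib[symmetric]) simp
  finally show ?thesis by (simp add: algebra_simps)
qed

lemma wp_fill_prod:
  assumes v: "v 6 = n" "v 10 = cap" "v 15 = 2 ^ j" "cap < n" and wf: "wf_state a"
  shows "wp fill_prod (400 * ((prod_size cap a j div m + 1) * X))
    (\<lambda>_ a'. a' 17 0 0 = prod_size cap a j \<and>
      (\<forall>u<n. \<forall>v<n. hits (prod_size cap a j) (\<lambda>s. a 5 u s div 2 ^ j + a 5 s v div 2 ^ j) (prod_wit cap a u v) a' u v)) v a"
proof -
  define q where "q = cap div 2 ^ j"
  define p where "p = 2 * q + 3"
  define h where "h = a 3 0 0"
  define M where "M = h * p"
  have M_eq: "prod_size cap a j = M" by (simp add: M_def h_def p_def q_def prod_size_def)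
  have Mle: "M \<le> 2 * (n * n) + n" using prod_size_le[of a cap j] wf assms(4) M_eq by (simp add: wf_state_def)
  have qn: "q < n" using assms(4) unfolding q_def by (meson div_le_dividend le_less_trans)
  have pn: "p \<le> 2 * n + 1" using qn by (simp add: p_def)
  have p0: "0 < p" by (simp add: p_def)
  have nn: "9 \<le> n * n" using mult_le_mono[OF n3 n3] by simp
  have B1: "1 < B" "3 < B" "n < B" "M < B" "p < B" "n + 4 < B" "q + 2 < B" "q + q < B"
    using B_big n_le Mle pn qn by linarith+
  have MS: "M < S" using Mle S_big by linarith
  have HB: "(y + e) * (q + 2) < B" "y + e < B" "Suc ((y + e) * (q + 2) mod p) < B" if "y \<le> n" "e < p" for y e
  proof -
    have "y + e \<le> 4 * n" using that pn n3 by linarith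
    moreover have "q + 2 \<le> 2 * n" using qn n3 by linarith
    ultimately have "(y + e) * (q + 2) \<le> (4 * n) * (2 * n)" by (rule mult_le_mono)
    then have "(y + e) * (q + 2) \<le> 8 * (n * n)" by simp
    then show "(y + e) * (q + 2) < B" using B_big by linarith
    show "y + e < B" using \<open>y + e \<le> 4 * n\<close> B_big by linarith
    have "(y + e) * (q + 2) mod p < p" using p0 by simp
    then show "Suc ((y + e) * (q + 2) mod p) < B" using pn B_big by linarith
  qed
  have HB2: "e + p < B" "Suc ((e + p - y) mod p) < B" if "e < p" for y e
  proof -
    show "e + p < B" using that pn B_big by linarith
    have "(e + p - y) mod p < p" using p0 by simp
    then show "Suc ((e + p - y) mod p) < B" using pn B_big by linarith
  qed
  define s where "s x = a 2 (x div p) 0" for x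
  have sx: "x div p < h" "s x < n" if "x < M" for x
  proof -
    show "x div p < h" using that p0 by (simp add: M_def less_mult_imp_div_less)
    then show "s x < n" using wf by (simp add: s_def wf_state_def h_def)
  qed
  let ?F1 = "\<lambda>u x. if cap < a 5 u (s x) then 0 else 1 + (x mod p + p - a 5 u (s x) div 2 ^ j) mod p"
  let ?F2 = "\<lambda>u x. if cap < a 5 (s x) u then 0 else 1 + ((a 5 (s x) u div 2 ^ j + x mod p) * (q + 2)) mod p"
  let ?Q = "\<lambda>_ a'. a' 17 0 0 = M \<and>
      (\<forall>u<n. \<forall>v<n. hits M (\<lambda>s. a 5 u s div 2 ^ j + a 5 s v div 2 ^ j) (prod_wit cap a u v) a' u v)"
  let ?v = "v(18 := q, 19 := p, 20 := M)"
  let ?a = "upd a 17 0 0 M"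
  have S0: "0 < S" "n < S" using S_pos by auto
  have D: "a 5 u w \<le> n" if "u < n" "w < n" for u w using wf that by (simp add: wf_state_def)
  have Dd: "a 5 u w div 2 ^ j \<le> n" if "u < n" "w < n" for u w using D[OF that] by (meson div_le_dividend le_trans)
  have fin: "hits M (\<lambda>s. a 5 u s div 2 ^ j + a 5 s v div 2 ^ j) (prod_wit cap a u v) a' u v"
    if a': "\<And>u x. u < n \<Longrightarrow> x < M \<Longrightarrow> a' 15 u x = ?F1 u x" "\<And>u x. u < n \<Longrightarrow> x < M \<Longrightarrow> a' 16 u x = ?F2 u x"
      and uv: "u < n" "v < n" for a' u v
    unfolding hits_def
  proof (intro allI impI)
    fix c :: nat assume c: "c \<noteq> 0" "c \<le> n * n"
    then obtain c' where c': "c = Suc c'" by (cases c) auto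
    show "(\<exists>x<M. a' 15 u x = c \<and> a' 16 v x = c) \<longleftrightarrow>
       (\<exists>s\<in>prod_wit cap a u v. a 5 u s div 2 ^ j + a 5 s v div 2 ^ j + 1 = c)"
    proof
      assume "\<exists>x<M. a' 15 u x = c \<and> a' 16 v x = c"
      then obtain x where x: "x < M" "?F1 u x = c" "?F2 v x = c" using a' uv by auto
      have 1: "a 5 u (s x) \<le> cap" "a 5 (s x) v \<le> cap" using x c by (auto split: if_splits)
      then have 2: "a 5 u (s x) div 2 ^ j \<le> q" "a 5 (s x) v div 2 ^ j \<le> q" unfolding q_def by (auto intro: div_le_mono)
      have "\<exists>e<p. (e + p - a 5 u (s x) div 2 ^ j) mod p = c' \<and> ((a 5 (s x) v div 2 ^ j + e) * (q + 2)) mod p = c'"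
        using x(2,3) 1 c' p0 by (intro exI[of _ "x mod p"]) auto
      then have "c' = a 5 u (s x) div 2 ^ j + a 5 (s x) v div 2 ^ j"
        using residue_colours[OF 2, of c'] unfolding p_def by simp
      moreover have "s x \<in> prod_wit cap a u v" using 1 sx[OF x(1)] by (auto simp: prod_wit_def Hset_def s_def h_def)
      ultimately show "\<exists>s\<in>prod_wit cap a u v. a 5 u s div 2 ^ j + a 5 s v div 2 ^ j + 1 = c" using c' by auto
    next
      assume "\<exists>s\<in>prod_wit cap a u v. a 5 u s div 2 ^ j + a 5 s v div 2 ^ j + 1 = c"
      then obtain i where i: "i < h" "a 5 u (a 2 i 0) \<le> cap" "a 5 (a 2 i 0) v \<le> cap"
        "c' = a 5 u (a 2 i 0) div 2 ^ j + a 5 (a 2 i 0) v div 2 ^ j"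
        using c' by (auto simp: prod_wit_def Hset_def h_def)
      have 2: "a 5 u (a 2 i 0) div 2 ^ j \<le> q" "a 5 (a 2 i 0) v div 2 ^ j \<le> q" using i(2,3) unfolding q_def by (auto intro: div_le_mono)
      obtain e where e: "e < p" "(e + p - a 5 u (a 2 i 0) div 2 ^ j) mod p = c'" "((a 5 (a 2 i 0) v div 2 ^ j + e) * (q + 2)) mod p = c'"
        using residue_colours[OF 2, of c'] i(4) unfolding p_def by blast
      let ?x = "i * p + e"
      have d: "?x div p = i" "?x mod p = e" using e(1) by auto
      have "?x < M"
      proof -
        have "Suc i * p \<le> h * p" using i(1) by (intro mult_right_mono) auto
        then show ?thesis using e(1) by (simp add: M_def)
      qed
      moreover have "?F1 u ?x = c" "?F2 v ?x = c" using e i(2,3) c' d by (auto simp: s_def)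
      ultimately show "\<exists>x<M. a' 15 u x = c \<and> a' 16 v x = c" using a' uv by (intro exI[of _ ?x]) auto
    qed
  qed
  let ?c1 = "26 ::= Ld 2 (Op Div (V 24) (V 19)) (N 0) ;; 27 ::= Op Mod (V 24) (V 19) ;; 28 ::= Ld 5 (V 22) (V 26) ;;
         If (Less (V 10) (V 28)) (St 15 (V 22) (V 24) (N 0))
           (St 15 (V 22) (V 24) (N 1 \<oplus> Op Mod ((V 27 \<oplus> V 19) \<ominus> Op Div (V 28) (V 15)) (V 19)))"
  let ?c2 = "26 ::= Ld 2 (Op Div (V 24) (V 19)) (N 0) ;; 27 ::= Op Mod (V 24) (V 19) ;; 28 ::= Ld 5 (V 26) (V 22) ;;
         If (Less (V 10) (V 28)) (St 16 (V 22) (V 24) (N 0))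
           (St 16 (V 22) (V 24) (N 1 \<oplus> Op Mod ((Op Div (V 28) (V 15) \<oplus> V 27) \<otimes> (V 18 \<oplus> N 2)) (V 19)))"
  let ?R = "(100 + 40) * ((M div m + 1) * X)"
  have main: "wp (For 22 (V 6) (For 24 (V 20) ?c1) ;; For 22 (V 6) (For 24 (V 20) ?c2)) (?R + ?R) ?Q ?v ?a"
  proof (rule wp_seq_frame[where tb = ?R, OF wp_matrix[where ?N1.0 = n and ?N2.0 = M and k = 15 and cc = 100
          and F = ?F1 and t = ?R]], goal_cases)
    case (12 i x v' a')
    have v': "v' 10 = cap" "v' 15 = 2 ^ j" "v' 19 = p" using 12(5)[of 10] 12(5)[of 15] 12(5)[of 19] v by simp_all
    have a': "a' 5 = a 5" "a' 2 = a 2" using 12(6) by simp_all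
    have s: "a 2 (x div p) 0 = s x" by (simp add: s_def)
    have xm: "x mod p < p" using p0 by simp
    show ?case using 12(1-4) v' a' sx[OF 12(2)] s S0 MS B1 HB2[OF xm] by (simp add: K_def)
  next
    case 13
    show ?case by (rule rect_cost)
  next
    case (14 v1 a1)
    have v1: "z < 22 \<Longrightarrow> v1 z = ?v z" for z using 14(2)[of z] by simp
    show ?case
    proof (rule wp_conseq[OF wp_matrix[where ?N1.0 = n and ?N2.0 = M and k = 16 and cc = 100
          and F = ?F2 and t = ?R]], goal_cases)
      case (12 i x v' a')
      have v': "v' 10 = cap" "v' 15 = 2 ^ j" "v' 19 = p" "v' 18 = q"
        using 12(5)[of 10] 12(5)[of 15] 12(5)[of 19] 12(5)[of 18] v1 v by simp_all
      have a': "a' 5 = a 5" "a' 2 = a 2" using 12(6) 14(1) by simp_all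
      have s: "a 2 (x div p) 0 = s x" by (simp add: s_def)
      have xm: "x mod p < p" using p0 by simp
      have dd: "a 5 (s x) i div 2 ^ j \<le> n" using Dd sx[OF 12(2)] 12(1) by blast
      show ?case using 12(1-4) v' a' sx[OF 12(2)] s S0 MS B1 HB[OF dd xm] by (simp add: K_def)
    next
      case 13
      show ?case by (rule rect_cost)
    next
      case (14 v2 a2)
      have "a2 17 0 0 = M" using 14 \<open>a1 = _\<close> by (simp add: upd_apply)
      moreover have "a2 15 u x = ?F1 u x" "a2 16 u x = ?F2 u x" if "u < n" "x < M" for u x
        using that 14 \<open>a1 = _\<close> by simp_all
      ultimately show ?case using fin by simp
    qed (use v1 v B1 in auto)
  qed (use v B1 in auto)
  have "sp (18 ::= Op Div (V 10) (V 15) ;; 19 ::= (V 18 \<oplus> V 18) \<oplus> N 3 ;; 20 ::= cell 3 \<otimes> V 19 ;; set_cell 17 (V 20))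
    (wp (For 22 (V 6) (For 24 (V 20) ?c1) ;; For 22 (V 6) (For 24 (V 20) ?c2)) (?R + ?R) ?Q) v a"
  proof -
    have "q + q + 3 = p" "a 3 0 0 * p = M" by (simp_all add: p_def M_def h_def)
    then show ?thesis using main v B1 S0 by (simp add: q_def[symmetric] K_def del: One_nat_def)
  qed
  moreover define Y where "Y = (M div m + 1) * X"
  moreover have "1 \<le> Y" by (simp add: Y_def X_def)
  ultimately show ?thesis unfolding fill_prod_def M_eq Y_def[symmetric]
    by (intro wp_sp_seq[where tb = "(100 + 40) * Y + (100 + 40) * Y"]) auto
qed

definition prod_cost :: nat where
  "prod_cost = 1000 * (3 * eq_cost + 1800)"

text \<open>By the second assumption, which the hitting sets provide, hubs times cap is O(n log n).
  With the geometric sum, the ranges of all bits add up to O(n log n), and since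
  \<open>n \<le> 5 * m\<close> this is O(log n) blocks.\<close>

lemma prod_size_sum:
  assumes "a 3 0 0 \<le> n" "a 3 0 0 * cap \<le> 16 * (n * (2 * L + 1))"
  shows "(\<Sum>j<L. prod_size cap a j div m + 1) \<le> 977 * L"
proof -
  let ?h = "a 3 0 0"
  have L1: "1 \<le> L" by (rule L_pos)
  have "(\<Sum>j<L. prod_size cap a j) = ?h * (2 * (\<Sum>j<L. cap div 2 ^ j)) + 3 * L * ?h"
    by (simp add: prod_size_def sum_distrib_left sum.distrib algebra_simps)
  also have "\<dots> \<le> ?h * (2 * (2 * cap)) + 3 * L * n"
    using sum_div_pow[of cap L] assms(1) by (intro add_mono mult_left_mono) auto
  also have "\<dots> = 4 * (?h * cap) + 3 * (L * n)" by (simp add: algebra_simps)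
  also have "\<dots> \<le> 64 * (n * (2 * L + 1)) + 3 * (L * n)" using assms(2) by linarith
  also have "\<dots> = 131 * (L * n) + 64 * n" by (simp add: algebra_simps)
  also have "\<dots> \<le> 195 * (L * n)" using L1 by simp
  also have "\<dots> \<le> 195 * (L * (5 * m))" using m_pos(3) by (intro mult_left_mono) auto
  finally have 1: "(\<Sum>j<L. prod_size cap a j) \<le> m * (975 * L)" by (simp add: algebra_simps)
  have "m * (\<Sum>j<L. prod_size cap a j div m) \<le> (\<Sum>j<L. prod_size cap a j)"
    unfolding sum_distrib_left by (intro sum_mono) simp
  then have "m * (\<Sum>j<L. prod_size cap a j div m) \<le> m * (975 * L)" using 1 by (rule le_trans)
  then have "(\<Sum>j<L. prod_size cap a j div m) \<le> 975 * L" using m_pos(1) by simp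
  moreover have "(\<Sum>j<L. prod_size cap a j div m + 1) = (\<Sum>j<L. prod_size cap a j div m) + L"
    by (subst sum.distrib) simp
  ultimately show ?thesis by linarith
qed

lemma wv_fill_prod: "wv fill_prod \<subseteq> {18..}" "wa fill_prod \<subseteq> {15, 16, 17}"
  by (auto simp: fill_prod_def)

lemma wv_prod: "wv (prod_code P k) \<subseteq> {12..}" "wa (prod_code P k) \<subseteq> insert 5 {13..22}"
  using wv_descent[OF wv_fill_prod] by (auto simp: prod_code_def)

text \<open>The concluding disjunction matters for soundness: a new entry is an old one or the
  length of a genuine detour through a hub, so it cannot fall below the true distance.\<close>

theorem wp_prod:
  assumes g: "glob v" "v 10 = cap" "cap < n" and wf: "wf_state a"
    and ep: "ep_ok a" "a 20 0 0 + L * (450 * (n * n)) < B"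
    and size: "a 3 0 0 * cap \<le> 16 * (n * (2 * L + 1))"
  shows "wp (prod_code P k) (prod_cost * (L * X)) (\<lambda>v' a'.
    (\<forall>u<n. \<forall>v<n. a' 5 u v \<le> a 5 u v \<and>
       (\<forall>s\<in>prod_wit cap a u v. a' 5 u v \<le> a 5 u s + a 5 s v) \<and>
       (a' 5 u v = a 5 u v \<or> (\<exists>s\<in>prod_wit cap a u v. a' 5 u v = a 5 u s + a 5 s v))) \<and>
    ep_ok a' \<and> a' 20 0 0 \<le> a 20 0 0 + L * (450 * (n * n))) v a"
proof -
  let ?M = "prod_size cap a"
  let ?f = "\<lambda>j u v s. a 5 u s div 2 ^ j + a 5 s v div 2 ^ j"
  have hn: "a 3 0 0 \<le> n" using wf by (simp add: wf_state_def)
  have nn: "2 * n \<le> n * n + 1" using mult_le_mono1[OF n3, of n] n3 by linarith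
  let ?C = "3 * eq_cost + 1710"
  let ?T = "(\<Sum>j<L. 400 * ((?M j div m + 1) * X) + 3 * (eq_cost * ((?M j div m + 1) * X)) + 1310 * X) + 60 * X"
  have n_sq: "n \<le> n * n" using n_le by simp
  show ?thesis unfolding prod_code_def
  proof (rule wp_seq_frame[where tb = "140 * X", OF wp_descent[where T = ?T and f = ?f and M = ?M
        and W = "prod_wit cap a" and tf = "\<lambda>j. 400 * ((?M j div m + 1) * X)"]], goal_cases)
    case (6 j v' a')
    have "a' 5 = a 5" "a' 2 = a 2" "a' 3 = a 3" using 6(5) by simp_all
    then have c: "prod_size cap a' = ?M" "prod_wit cap a' = prod_wit cap a" "wf_state a'" "a' 5 = a 5"
      using wf by (auto simp: prod_size_def prod_wit_def Hset_def wf_state_def fun_eq_iff)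
    have "v' 6 = n" "v' 10 = cap" using 6(4) g by (auto simp: glob_def)
    from wp_fill_prod[OF this 6(3) g(3) c(3)] show ?case unfolding c .
  next
    case (7 j)
    have "prod_size cap a j \<le> 2 * (n * n) + n" by (rule prod_size_le[where a = a and cap = cap, OF hn g(3)])
    then show ?case using n_sq by linarith
  next
    case (8 j u v s)
    then have "a 5 u s \<le> cap" "a 5 s v \<le> cap" by (auto simp: prod_wit_def)
    then have "a 5 u s div 2 ^ j \<le> cap" "a 5 s v div 2 ^ j \<le> cap" by (meson div_le_dividend le_trans)+
    note le = this
    \<comment> \<open>Each of the two shifted entries can drop a bit, so their sum exceeds twice the
      coarser sum by 0, 1 or 2.\<close>
    have gen: "A + D + 1 \<le> n * n \<and> 2 * (A' + D') \<le> A + D \<and> A + D \<le> 2 * (A' + D') + 2"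
      if "A \<le> cap" "D \<le> cap" "2 * A' \<le> A \<and> A \<le> 2 * A' + 1" "2 * D' \<le> D \<and> D \<le> 2 * D' + 1" for A D A' D'
      using that g(3) nn by auto
    show ?case by (rule gen[OF le dvd_step dvd_step])
  next
    case (9 u v s)
    then have "a 5 u s \<le> cap" "a 5 s v \<le> cap" by (auto simp: prod_wit_def)
    then have "a 5 u s < 2 ^ L" "a 5 s v < 2 ^ L" using g(3) L2(1) by linarith+
    then show ?case by simp
  next
    case (11 v1 a1)
    have v1: "z < 12 \<Longrightarrow> v1 z = v z" for z using 11(2)[of z] wv_descent(1)[OF wv_fill_prod] by fastforce
    have a1: "k' < 13 \<Longrightarrow> a1 k' = a k'" for k' using 11(3)[of k'] wv_descent(2)[OF wv_fill_prod] by fastforce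
    let ?o = "\<lambda>u v. opt (prod_wit cap a u v) (?f 0 u v)"
    let ?F = "\<lambda>u v. if ?o u v \<noteq> 0 \<and> ?o u v < a 5 u v + 1 then ?o u v - 1 else a 5 u v"
    have v6: "v1 6 = n" using v1 g by (auto simp: glob_def)
    show ?case
    proof (rule wp_conseq[OF wp_matrix[where ?N1.0 = n and ?N2.0 = n and k = 5 and cc = 100
          and F = ?F and t = "n * (n * (100 + 10) + 18) + 8"]], goal_cases)
      case (12 i j v' a')
      have a': "a' 13 i j = ?o i j" "a' 5 i j = a 5 i j" using 12 11(1) a1 by simp_all
      have b: "a 5 i j \<le> n" using 12(1,2) wf by (simp add: wf_state_def)
      have "n + 1 < B" using B_big by linarith
      moreover have "upd a' 5 i j (a 5 i j) = a'" using a'(2) by (auto simp: upd_def fun_eq_iff)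
      moreover have "0 < S" "n < S" "1 < B" using S_pos B_big by auto
      ultimately show ?case using 12(1-4) a' b by (auto simp: K_def simp del: One_nat_def)
    next
      case (14 v2 a2)
      have "a2 5 u v \<le> a 5 u v \<and> (\<forall>s\<in>prod_wit cap a u v. a2 5 u v \<le> a 5 u s + a 5 s v) \<and>
       (a2 5 u v = a 5 u v \<or> (\<exists>s\<in>prod_wit cap a u v. a2 5 u v = a 5 u s + a 5 s v))" if uv: "u < n" "v < n" for u v
      proof -
        have e: "a2 5 u v = ?F u v" using 14 uv by simp
        have lo: "?o u v \<le> Suc (a 5 u s + a 5 s v)" if "s \<in> prod_wit cap a u v" for s
          using opt_le[OF that, of "?f 0 u v"] by simp
        have att: "\<exists>s\<in>prod_wit cap a u v. ?o u v - 1 = a 5 u s + a 5 s v" if "?o u v \<noteq> 0"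
        proof -
          have "prod_wit cap a u v \<noteq> {}" using that by (auto simp: opt_def)
          from opt_attained[OF this, of "?f 0 u v"] show ?thesis by auto
        qed
        have ne: "?o u v \<noteq> 0" if "s \<in> prod_wit cap a u v" for s using that by (auto simp: opt_def)
        show ?thesis unfolding e using lo att ne by (auto simp: le_Suc_eq) fastforce+
      qed
      then show ?case using 14 11(1) by (auto simp: ep_ok_def)
    qed (use v6 B_big matrix_cost[of 100] in auto)
  next
    case 12
    have "?T \<le> (\<Sum>j<L. ?C * ((?M j div m + 1) * X)) + 60 * X"
      by (intro add_mono sum_mono) (auto simp: algebra_simps)
    also have "(\<Sum>j<L. ?C * ((?M j div m + 1) * X)) = ?C * ((\<Sum>j<L. ?M j div m + 1) * X)"
      by (simp only: sum_distrib_left sum_distrib_right)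
    also have "\<dots> \<le> ?C * ((977 * L) * X)"
      using prod_size_sum[where a = a and cap = cap, OF hn size] by (intro mult_left_mono mult_right_mono) auto
    finally have 1: "?T \<le> 977 * (?C * (L * X)) + 60 * X" by (simp add: algebra_simps)
    have 2: "X \<le> L * X" using L_pos by simp
    have "?T + 140 * X \<le> 977 * (?C * (L * X)) + 200 * (L * X)" using 1 2 by linarith
    also have "\<dots> \<le> prod_cost * (L * X)" by (simp add: prod_cost_def algebra_simps)
    finally show ?case .
  qed (use g ep wv_fill_prod in auto)
qed

end

section \<open>Midpoints\<close>

text \<open>The quantity minimised is the number of the midpoint itself, so the descent spells out
  the least midpoint from its top bit on. Both colours depend on \<open>x\<close> alone and no
  residues are needed. The second operand reads array 5 transposed, as array 16 is indexed by the
  target.\<close>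

definition fill_mid :: com where
  "fill_mid =
     ((18 ::= Op Div (V 11) (N 2) ;; set_cell 17 (V 6)) ;;
      For 22 (V 6) (For 24 (V 6) (IfEq (Ld 5 (V 22) (V 24)) (V 18)
        (St 15 (V 22) (V 24) (N 1 \<oplus> Op Div (V 24) (V 15))) (St 15 (V 22) (V 24) (N 0)))) ;;
      For 22 (V 6) (For 24 (V 6) (IfEq (Ld 5 (V 24) (V 22)) (V 18)
        (St 16 (V 22) (V 24) (N 1 \<oplus> Op Div (V 24) (V 15))) (St 16 (V 22) (V 24) (N 0)))))"

text \<open>Different lengths \<open>l\<close> use disjoint rows \<open>l * n + u\<close>, so one
  array keeps the midpoints of all lengths.\<close>

definition mid_code :: "prog \<Rightarrow> nat \<Rightarrow> com" where
  "mid_code P k = (descent P k fill_mid ;;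
     For 12 (V 6) (For 14 (V 6) (St 4 (V 11 \<otimes> V 6 \<oplus> V 12) (V 14) (Ld 13 (V 12) (V 14) \<ominus> N 1))))"

context aeL
begin

definition mid_wit :: "nat \<Rightarrow> arrs \<Rightarrow> nat \<Rightarrow> nat \<Rightarrow> nat set" where
  "mid_wit l a u v = {s. s < n \<and> a 5 u s = l div 2 \<and> a 5 s v = l div 2}"

lemma wv_fill_mid: "wv fill_mid \<subseteq> {18..}" "wa fill_mid \<subseteq> {15, 16, 17}"
  by (auto simp: fill_mid_def)

lemma wv_mid: "wv (mid_code P k) \<subseteq> {12..}" "wa (mid_code P k) \<subseteq> insert 4 {13..22}"
  using wv_descent[OF wv_fill_mid] by (auto simp: mid_code_def)

lemma wp_fill_mid:
  assumes v: "v 6 = n" "v 11 = l" "v 15 = 2 ^ j"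
  shows "wp fill_mid (300 * X)
    (\<lambda>_ a'. a' 17 0 0 = n \<and> (\<forall>u<n. \<forall>v<n. hits n (\<lambda>s. s div 2 ^ j) (mid_wit l a u v) a' u v)) v a"
proof -
  let ?h = "l div 2"
  have B1: "1 < B" "2 < B" "n < B" "n + 1 < B" using B_big by linarith+
  have S0: "0 < S" "n < S" using S_pos by auto
  let ?F1 = "\<lambda>u x. if a 5 u x = ?h then 1 + x div 2 ^ j else 0"
  let ?F2 = "\<lambda>u x. if a 5 x u = ?h then 1 + x div 2 ^ j else 0"
  let ?Q = "\<lambda>_ a'. a' 17 0 0 = n \<and> (\<forall>u<n. \<forall>v<n. hits n (\<lambda>s. s div 2 ^ j) (mid_wit l a u v) a' u v)"
  let ?v = "v(18 := ?h)"
  let ?a = "upd a 17 0 0 n"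
  have bd: "Suc (x div 2 ^ j) < B" if "x < n" for x
    using that B1 div_le_dividend[of x "2 ^ j"] by linarith
  let ?c1 = "IfEq (Ld 5 (V 22) (V 24)) (V 18) (St 15 (V 22) (V 24) (N 1 \<oplus> Op Div (V 24) (V 15))) (St 15 (V 22) (V 24) (N 0))"
  let ?c2 = "IfEq (Ld 5 (V 24) (V 22)) (V 18) (St 16 (V 22) (V 24) (N 1 \<oplus> Op Div (V 24) (V 15))) (St 16 (V 22) (V 24) (N 0))"
  have main: "wp (For 22 (V 6) (For 24 (V 6) ?c1) ;; For 22 (V 6) (For 24 (V 6) ?c2)) (140 * X + 140 * X) ?Q ?v ?a"
  proof (rule wp_seq_frame[where tb = "140 * X", OF wp_matrix[where ?N1.0 = n and ?N2.0 = n and k = 15 and cc = 100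
          and F = ?F1 and t = "(100 + 40) * X"]], goal_cases)
    case (12 i x v' a')
    have v': "v' 15 = 2 ^ j" "v' 18 = ?h" using 12(5)[of 15] 12(5)[of 18] v by simp_all
    have a': "a' 5 = a 5" using 12(6) by simp
    show ?case using 12(1-4) v' a' S0 B1 bd by (simp add: K_def)
  next
    case 13
    show ?case by (rule matrix_cost)
  next
    case (14 v1 a1)
    note o = this
    have v1: "z < 22 \<Longrightarrow> v1 z = ?v z" for z using 14(2)[of z] by simp
    show ?case
    proof (rule wp_conseq[OF wp_matrix[where ?N1.0 = n and ?N2.0 = n and k = 16 and cc = 100
          and F = ?F2 and t = "(100 + 40) * X"]], goal_cases)
      case (12 i x v' a')
      have v': "v' 15 = 2 ^ j" "v' 18 = ?h" using 12(5)[of 15] 12(5)[of 18] v1 v by simp_all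
      have a': "a' 5 = a 5" using 12(6) o(1) by simp
      show ?case using 12(1-4) v' a' S0 B1 bd by (simp add: K_def)
    next
      case 13
      show ?case by (rule matrix_cost)
    next
      case (14 v2 a2)
      have "a2 17 0 0 = n" using 14 o(1) by (simp add: upd_apply)
      moreover have "(\<exists>x<n. a2 15 u x = c \<and> a2 16 v x = c) \<longleftrightarrow> (\<exists>s\<in>mid_wit l a u v. s div 2 ^ j + 1 = c)"
        if uv: "u < n" "v < n" "c \<noteq> 0" for u v c
      proof -
        have F: "a2 15 u x = ?F1 u x" "a2 16 v x = ?F2 v x" if "x < n" for x
          using that uv 14 o(1) by simp_all
        have "a2 15 u x = c \<and> a2 16 v x = c \<longleftrightarrow> a 5 u x = ?h \<and> a 5 x v = ?h \<and> x div 2 ^ j + 1 = c" if "x < n" for x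
          unfolding F[OF that] using uv(3) by auto
        then show ?thesis by (auto simp: mid_wit_def)
      qed
      ultimately show ?case by (simp add: hits_def)
    qed (use v1 v B1 in auto)
  qed (use v B1 in auto)
  have "sp (18 ::= Op Div (V 11) (N 2) ;; set_cell 17 (V 6))
    (wp (For 22 (V 6) (For 24 (V 6) ?c1) ;; For 22 (V 6) (For 24 (V 6) ?c2)) (140 * X + 140 * X) ?Q) v a"
    using main v B1 S0 by (simp add: K_def del: One_nat_def)
  moreover have "1 \<le> X" by (simp add: X_def)
  ultimately show ?thesis unfolding fill_mid_def
    by (intro wp_sp_seq[where tb = "140 * X + 140 * X"]) auto
qed

definition mid_cost :: nat where
  "mid_cost = 18 * eq_cost + 2000"

theorem wp_mid:
  assumes g: "glob v" "v 11 = l" "l \<le> n"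
    and ep: "ep_ok a" "a 20 0 0 + L * (450 * (n * n)) < B"
  shows "wp (mid_code P k) (mid_cost * (L * X)) (\<lambda>v' a'.
    (\<forall>u<n. \<forall>v<n. mid_wit l a u v \<noteq> {} \<longrightarrow> a' 4 (l * n + u) v \<in> mid_wit l a u v) \<and>
    (\<forall>r<l * n. a' 4 r = a 4 r) \<and>
    ep_ok a' \<and> a' 20 0 0 \<le> a 20 0 0 + L * (450 * (n * n))) v a"
proof -
  let ?f = "\<lambda>j u v s. s div 2 ^ j"
  let ?T = "(\<Sum>j<L. 300 * X + 3 * (eq_cost * ((n div m + 1) * X)) + 1310 * X) + 60 * X"
  have n_sq: "n \<le> n * n" using n_le by simp
  have B1: "1 < B" "n < B" using B_big by linarith+
  have ln: "l * n + u < B" if "u < n" for u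
  proof -
    have "l * n \<le> n * n" using g(3) by simp
    then show ?thesis using that B_big n_sq by linarith
  qed
  show ?thesis unfolding mid_code_def
  proof (rule wp_seq_frame[where tb = "140 * X", OF wp_descent[where T = ?T and f = ?f and M = "\<lambda>_. n"
        and W = "mid_wit l a" and tf = "\<lambda>j. 300 * X"]], goal_cases)
    case (6 j v' a')
    have "a' 5 = a 5" using 6(5) by simp
    then have c: "mid_wit l a' = mid_wit l a" by (simp add: mid_wit_def fun_eq_iff)
    have "v' 6 = n" "v' 11 = l" using 6(4) g by (auto simp: glob_def)
    from wp_fill_mid[OF this 6(3), of a'] show ?case unfolding c .
  next
    case (7 j)
    then show ?case using n_sq by linarith
  next
    case (8 j u v s)
    then have "s < n" by (simp add: mid_wit_def)
    then have "s div 2 ^ j < n" by (meson div_le_dividend le_less_trans)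
    then have "s div 2 ^ j + 1 \<le> n * n" using n_sq by linarith
    then show ?case using dvd_step[of s j] by auto
  next
    case (9 u v s)
    then show ?case using L2(1) by (auto simp: mid_wit_def)
  next
    case (11 v1 a1)
    have v1: "z < 12 \<Longrightarrow> v1 z = v z" for z using 11(2)[of z] wv_descent(1)[OF wv_fill_mid] by fastforce
    have a1: "k' < 13 \<Longrightarrow> a1 k' = a k'" for k' using 11(3)[of k'] wv_descent(2)[OF wv_fill_mid] by fastforce
    let ?Y = "\<lambda>u v. opt (mid_wit l a u v) (?f 0 u v) - 1"
    have g1: "v1 6 = n" "v1 11 = l" using v1 g by (auto simp: glob_def)
    show ?case
    proof (rule wp_for_const[where n = n and t = "n * 40 + 8" and
          I = "\<lambda>i a'. (\<forall>u<i. \<forall>v<n. a' 4 (l * n + u) v = ?Y u v) \<and> (\<forall>r<l * n. a' 4 r = a 4 r)"], goal_cases)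
      case (7 i v2 a2)
      note o = this
      show ?case
      proof (rule wp_for_const[where n = n and t = 30 and
            I = "\<lambda>j a'. (\<forall>u<i. \<forall>v<n. a' 4 (l * n + u) v = ?Y u v) \<and> (\<forall>v<j. a' 4 (l * n + i) v = ?Y i v) \<and>
               (\<forall>r<l * n. a' 4 r = a 4 r)"], goal_cases)
        case (7 j v3 a3)
        have v3: "v3 6 = n" "v3 11 = l" "v3 12 = i" "v3 14 = j" using 7(3,5) o(3,5) g1 by auto
        have "a3 13 = a1 13" using 7(6) o(6) by simp
        then have Y: "a3 13 i j - 1 = ?Y i j" using 11(1) 7(1) o(1) by simp
        have "j < S" "l * n < B" using S_pos(2) 7(1) ln[OF o(1)] by linarith+
        note b = this ln[OF o(1)] \<open>1 < B\<close> \<open>n < B\<close>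
        define G where "G = (\<lambda>a' :: arrs. (\<forall>u<i. \<forall>v<n. a' 4 (l * n + u) v = ?Y u v) \<and>
           (\<forall>v<Suc j. a' 4 (l * n + i) v = ?Y i v) \<and> (\<forall>r<l * n. a' 4 r = a 4 r))"
        have "G (upd a3 4 (l * n + i) j (?Y i j))"
          using 7(2) unfolding G_def by (auto simp: upd_def less_Suc_eq)
        then have "sp (St 4 (V 11 \<otimes> V 6 \<oplus> V 12) (V 14) (Ld 13 (V 12) (V 14) \<ominus> N 1)) (\<lambda>_. G) v3 a3"
          using v3 b Y by (simp add: K_def del: One_nat_def)
        then show ?case unfolding G_def by (rule wp_sp) simp
      next
        case (8 v' a')
        then show ?case by (auto simp: less_Suc_eq)
      qed (use o g1 B1 in auto)
    next
      case (8 v' a')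
      have "a' 4 (l * n + u) v \<in> mid_wit l a u v" if "u < n" "v < n" "mid_wit l a u v \<noteq> {}" for u v
        using opt_attained[OF that(3), of "?f 0 u v"] 8(1) that by auto
      moreover have "ep_ok a'" "a' 20 0 0 = a1 20 0 0" using 8(3) 11(1) by (auto simp: ep_ok_def)
      ultimately show ?case using 8(1) 11(1) by auto
    next
      case 9
      show ?case using matrix_cost[of 30] by (simp add: add.commute)
    next
      case 6
      then show ?case using a1 by simp
    qed (use g1 B1 in auto)
  next
    case 12
    have "(\<Sum>j<L. 300 * X + 3 * (eq_cost * ((n div m + 1) * X)) + 1310 * X) =
       L * (300 * X + 3 * (eq_cost * (nb * X)) + 1310 * X)" by (simp add: nb_def)
    also have "\<dots> \<le> L * (300 * X + 3 * (eq_cost * (6 * X)) + 1310 * X)"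
      using m_pos(4) by (intro mult_left_mono add_mono mult_right_mono) auto
    also have "\<dots> = (18 * eq_cost + 1610) * (L * X)" by (simp add: algebra_simps)
    finally have 1: "?T \<le> (18 * eq_cost + 1610) * (L * X) + 60 * X" by simp
    have 2: "X \<le> L * X" using L_pos by simp
    have gen: "t + 140 * x \<le> c + 200 * z" if "t \<le> c + 60 * x" "x \<le> z" for t c x z :: nat
      using that by simp
    have "?T + 140 * X \<le> (18 * eq_cost + 1610) * (L * X) + 200 * (L * X)" by (rule gen[OF 1 2])
    also have "\<dots> \<le> mid_cost * (L * X)" unfolding mid_cost_def add_mult_distrib[symmetric] by (rule mult_right_mono) auto
    finally show ?case .
  qed (use g ep wv_fill_mid in auto)
qed

end

section \<open>Recovering paths\<close>

text \<open>Level \<open>i\<close> bisects \<open>2 ^ i\<close> segments of length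
  \<open>l div 2 ^ i\<close>. The levels form a geometric series, so a path costs time linear in its
  length.\<close>

definition expand_code :: com where
  "expand_code =
     ((17 ::= cell 10 ;; St 23 (V 17) (N 0) (V 16) ;; St 23 (V 17) (V 11) (V 14)) ;;
      For 18 (V 9)
        ((20 ::= Op Shr (V 11) (V 18) ;; 21 ::= Op Div (V 20) (N 2)) ;;
         For 22 (Op Shl (N 1) (V 18))
           (24 ::= V 22 \<otimes> V 20 ;;
            St 23 (V 17) (V 24 \<oplus> V 21)
              (Ld 4 (V 20 \<otimes> V 6 \<oplus> Ld 23 (V 17) (V 24)) (Ld 23 (V 17) (V 24 \<oplus> V 20))))))"

text \<open>Incidences are kept in both directions: a row of array 23 lists the nodes of a path, a
  row of array 6 the paths through a node, with their number in array 7. Array 9 marks paths not yet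
  hit. The final endpoint is left out, so each set has exactly \<open>l\<close> elements.\<close>

definition register_code :: com where
  "register_code =
     (For 18 (V 11)
        (20 ::= Ld 23 (V 17) (V 18) ;; 21 ::= Ld 7 (V 20) (N 0) ;;
         St 6 (V 20) (V 21) (V 17) ;; St 7 (V 20) (N 0) (V 21 \<oplus> N 1)) ;;
      St 9 (V 17) (N 0) (N 1) ;; set_cell 10 (V 17 \<oplus> N 1))"

text \<open>Only paths that start at an old hub are recorded. This keeps their total length
  affordable, and \<open>bridge_step\<close> shows that they suffice.\<close>

definition build_code :: com where
  "build_code = For 12 (cell 3) (For 14 (V 6)
     (16 ::= Ld 2 (V 12) (N 0) ;; IfEq (Ld 5 (V 16) (V 14)) (V 11) (expand_code ;; register_code) Skip))"

lemma sum_pow2: "(\<Sum>i<e. (2::nat) ^ i) + 1 = 2 ^ e"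
  by (induction e) auto

context aeL
begin

definition good :: "nat \<Rightarrow> arrs \<Rightarrow> (nat \<Rightarrow> nat) \<Rightarrow> nat \<Rightarrow> nat \<Rightarrow> bool" where
  "good l a p x y \<longleftrightarrow> p 0 = x \<and> p l = y \<and> (\<forall>t\<le>l. p t < n) \<and> (\<forall>t<l. a 5 (p t) (p (Suc t)) = 1)"

definition mids :: "nat \<Rightarrow> arrs \<Rightarrow> bool" where
  "mids e a \<longleftrightarrow> (\<forall>i. 1 \<le> i \<longrightarrow> i \<le> e \<longrightarrow> (\<forall>u<n. \<forall>v<n. a 5 u v = 2 ^ i \<longrightarrow>
     a 4 (2 ^ i * n + u) v \<in> mid_wit (2 ^ i) a u v))"

lemma wp_expand:
  assumes v: "v 6 = n" "v 9 = e" "v 11 = l" "v 14 = y" "v 16 = x" "a 10 0 0 = q"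
    and xy: "x < n" "y < n" "a 5 x y = l" and l: "l = 2 ^ e" "l \<le> n" and q: "q < B" and md: "mids e a"
  shows "wp expand_code (420 * l) (\<lambda>v' a'. v' 17 = q \<and> good l a (a' 23 q) x y \<and> (\<forall>q'. q' \<noteq> q \<longrightarrow> a' 23 q' = a 23 q')) v a"
proof -
  have B1: "1 < B" "2 < B" "n < B" "3 * (n * n) < B" "2 * n < B" using B_big n_le by linarith+
  have S0: "0 < S" "3 * n < S" using S_big by linarith+
  have e: "e < 2 ^ e" by (rule less_exp)
  have e_lt: "e < B" using e l B1 by linarith
  define I where "I i a' \<longleftrightarrow> (\<forall>q'. q' \<noteq> q \<longrightarrow> a' 23 q' = a 23 q') \<and> a' 23 q 0 = x \<and> a' 23 q l = y \<and>
     (\<forall>j\<le>2 ^ i. a' 23 q (j * 2 ^ (e - i)) < n) \<and>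
     (\<forall>j<2 ^ i. a 5 (a' 23 q (j * 2 ^ (e - i))) (a' 23 q (Suc j * 2 ^ (e - i))) = 2 ^ (e - i))" for i and a' :: arrs
  let ?v = "v(17 := q)"
  let ?a = "upd (upd a 23 q 0 x) 23 q l y"
  let ?body = "(20 ::= Op Shr (V 11) (V 18) ;; 21 ::= Op Div (V 20) (N 2)) ;;
         For 22 (Op Shl (N 1) (V 18))
           (24 ::= V 22 \<otimes> V 20 ;;
            St 23 (V 17) (V 24 \<oplus> V 21)
              (Ld 4 (V 20 \<otimes> V 6 \<oplus> Ld 23 (V 17) (V 24)) (Ld 23 (V 17) (V 24 \<oplus> V 20))))"
  have lp: "0 < l" using l by simp
  have loop: "wp (For 18 (V 9) ?body) (380 * l) (\<lambda>v' a'. v' 17 = q \<and> I e a') ?v ?a"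
  proof (rule wp_for_sum[where n = e and I = I and t = "\<lambda>i. 2 ^ i * 90 + 30"], goal_cases)
    case 6
    show ?case using xy l lp by (auto simp: I_def upd_apply le_Suc_eq upd_def)
  next
    case (7 i v1 a1)
    note o = this
    define st where "st = (2::nat) ^ (e - i)"
    define h where "h = (2::nat) ^ (e - Suc i)"
    have "e - i = Suc (e - Suc i)" using 7(1) by simp
    then have st: "st = 2 * h" "0 < h" by (simp_all add: st_def h_def)
    have lst: "2 ^ i * st = l" using 7(1) l by (simp add: st_def power_add[symmetric])
    have v1: "v1 6 = n" "v1 11 = l" "v1 17 = q" "v1 18 = i" using o(3,5) v by auto
    have a1: "a1 4 = a 4" "a1 5 = a 5" using o(6) by simp_all
    let ?p = "a1 23 q"
    have shr: "drop_bit i l = st"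
      using 7(1) l by (simp add: drop_bit_eq_div st_def power_diff)
    have st_le: "st \<le> l" using lst by (metis le_add1 mult.commute mult_Suc_right mult_le_mono1 nat_mult_1 one_le_numeral one_le_power)
    have pi: "2 ^ i \<le> l" using 7(1) l by (simp add: power_increasing)
    then have pB: "2 ^ i < B" using l(2) B1 by linarith
    have lev: "a1 23 q (j * st) < n" if "j \<le> 2 ^ i" for j using o(2) that unfolding I_def st_def by blast
    have dst: "a 5 (?p (j * st)) (?p (Suc j * st)) = st" if "j < 2 ^ i" for j using o(2) that unfolding I_def st_def by blast
    let ?w = "\<lambda>j. a 4 (st * n + ?p (j * st)) (?p (Suc j * st))"
    have mw: "?w j \<in> mid_wit st a (?p (j * st)) (?p (Suc j * st))" if "j < 2 ^ i" for j
      using md lev[of j] lev[of "Suc j"] dst[OF that] that 7(1) unfolding mids_def st_def by (auto simp: Suc_le_eq)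
    let ?v1 = "v1(20 := st, 21 := h)"
    let ?in = "(24 ::= V 22 \<otimes> V 20 ;;
            St 23 (V 17) (V 24 \<oplus> V 21)
              (Ld 4 (V 20 \<otimes> V 6 \<oplus> Ld 23 (V 17) (V 24)) (Ld 23 (V 17) (V 24 \<oplus> V 20))))"
    have inner: "wp (For 22 (Op Shl (N 1) (V 18)) ?in) (2 ^ i * 90 + 20) (\<lambda>v' a'. I (Suc i) a') ?v1 a1"
    proof (rule wp_for_const[where n = "2 ^ i" and t = 80 and I = "\<lambda>j a'. (\<forall>q'. q' \<noteq> q \<longrightarrow> a' 23 q' = a 23 q') \<and>
          (\<forall>j'. a' 23 q (j' * st) = ?p (j' * st)) \<and> (\<forall>j'<j. a' 23 q (j' * st + h) = ?w j')"], goal_cases)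
      case 6
      show ?case using o(2) by (simp add: I_def)
    next
      case (7 j v2 a2)
      have v2: "v2 6 = n" "v2 17 = q" "v2 20 = st" "v2 21 = h" "v2 22 = j" using 7(3,5) v1 by auto
      have a2: "a2 4 = a 4" using 7(6) a1 by simp
      have "Suc j * st \<le> 2 ^ i * st" using 7(1) by (intro mult_right_mono) auto
      then have js: "j * st + st \<le> l" using lst by simp
      have p1: "a2 23 q (j * st) = ?p (j * st)" "a2 23 q (j * st + st) = ?p (Suc j * st)"
        using 7(2) by (auto simp: add.commute) (metis mult_Suc add.commute)
      have b1: "st * n \<le> n * n" using st_le l(2) by (intro mult_right_mono) auto
      have b2: "?p (j * st) < n" "?p (Suc j * st) < n" using lev[of j] lev[of "Suc j"] 7(1) by (auto simp: Suc_le_eq)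
      have b: "j * st < B" "j * st + h < B" "j * st + st < B" "j * st + h < S" "j * st + st < S" "j * st < S"
        "st * n < B" "st * n + ?p (j * st) < B" "?p (Suc j * st) < S"
        using js l(2) B1 S0 b1 b2 st by linarith+
      define G where "G = (\<lambda>a' :: arrs. (\<forall>q'. q' \<noteq> q \<longrightarrow> a' 23 q' = a 23 q') \<and>
          (\<forall>j'. a' 23 q (j' * st) = ?p (j' * st)) \<and> (\<forall>j'<Suc j. a' 23 q (j' * st + h) = ?w j'))"
      \<comment> \<open>New positions are odd multiples of \<open>h\<close>, old ones even
        multiples, so no old entry is overwritten.\<close>
      have ne: "j' * st \<noteq> j * st + h" for j'
      proof
        assume "j' * st = j * st + h"
        then have "(j' * st) mod st = (j * st + h) mod st" by simp
        then show False using st by simp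
      qed
      have G: "G (upd a2 23 q (j * st + h) (?w j))"
        unfolding G_def
      proof (intro conjI allI impI)
        fix q' assume "q' \<noteq> q"
        then show "upd a2 23 q (j * st + h) (?w j) 23 q' = a 23 q'" using 7(2) by (auto simp: upd_def)
      next
        fix j' show "upd a2 23 q (j * st + h) (?w j) 23 q (j' * st) = ?p (j' * st)"
          using 7(2) ne[of j'] by (simp add: upd_apply)
      next
        fix j' assume "j' < Suc j"
        then show "upd a2 23 q (j * st + h) (?w j) 23 q (j' * st + h) = ?w j'"
          using 7(2) st by (auto simp: upd_apply less_Suc_eq)
      qed
      have "sp ?in (\<lambda>_. G) v2 a2"
        using v2 a2 p1 b G by (simp add: K_def del: mult_Suc)
      then show ?case unfolding G_def by (rule wp_sp) simp
    next
      case (8 v' a')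
      have A: "a' 23 q (j * st) = ?p (j * st)" "j < 2 ^ i \<Longrightarrow> a' 23 q (j * st + h) = ?w j" for j using 8(1) by auto
      have even: "a' 23 q (2 * j * h) = ?p (j * st)" for j using A(1)[of j] st by (simp add: mult.assoc mult.left_commute)
      have odd: "a' 23 q (Suc (2 * j) * h) = ?w j" if "j < 2 ^ i" for j
        using A(2)[OF that] st by (simp add: mult.assoc mult.left_commute add.commute)
      have rg: "a' 23 q (j * h) < n" if "j \<le> 2 ^ Suc i" for j
      proof (cases "even j")
        case True
        then obtain j' where "j = 2 * j'" by (elim evenE)
        then show ?thesis using even[of j'] lev[of j'] that by simp
      next
        case False
        then obtain j' where j': "j = Suc (2 * j')" by (metis oddE Suc_eq_plus1)
        then have "j' < 2 ^ i" using that by simp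
        then show ?thesis using odd[of j'] mw[of j'] j' by (simp add: mid_wit_def)
      qed
      have ds: "a 5 (a' 23 q (j * h)) (a' 23 q (Suc j * h)) = h" if "j < 2 ^ Suc i" for j
      proof (cases "even j")
        case True
        then obtain j' where j': "j = 2 * j'" by (elim evenE)
        then have "j' < 2 ^ i" using that by simp
        then show ?thesis using even[of j'] odd[of j'] mw[of j'] st unfolding j' by (auto simp: mid_wit_def)
      next
        case False
        then obtain j' where j': "j = Suc (2 * j')" by (metis oddE Suc_eq_plus1)
        then have "j' < 2 ^ i" using that by simp
        moreover have "Suc j * h = 2 * Suc j' * h" using j' by simp
        ultimately show ?thesis using even[of "Suc j'"] odd[of j'] mw[of j'] st unfolding j' by (auto simp: mid_wit_def)
      qed
      have "a' 23 q 0 = x" using A(1)[of 0] o(2) by (simp add: I_def)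
      moreover have "a' 23 q l = y" using A(1)[of "2 ^ i"] o(2) lst by (simp add: I_def)
      ultimately show ?case using 8(1) rg ds unfolding I_def h_def[symmetric] by blast
    qed (use v1 B1 pB in \<open>auto simp: push_bit_eq_mult\<close>)
    have "sp (20 ::= Op Shr (V 11) (V 18) ;; 21 ::= Op Div (V 20) (N 2))
      (wp (For 22 (Op Shl (N 1) (V 18)) ?in) (2 ^ i * 90 + 20) (\<lambda>v' a'. I (Suc i) a')) v1 a1"
      using inner v1 shr st B1 st_le l(2) by simp
    then show ?case by (rule wp_sp_seq) simp
  next
    case (8 v' a')
    then show ?case by simp
  next
    case 9
    have "(\<Sum>i<e. 2 ^ i * 90 + 30 + 10) = (\<Sum>i<e. (2::nat) ^ i * 90) + 40 * e" by (simp add: sum.distrib)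
    moreover have "(\<Sum>i<e. (2::nat) ^ i * 90) = (\<Sum>i<e. 2 ^ i) * 90" by (rule sum_distrib_right[symmetric])
    moreover have "(\<Sum>i<e. (2::nat) ^ i) + 1 = l" using sum_pow2 l by simp
    moreover have "e < l" using e l by simp
    ultimately have "(\<Sum>i<e. 2 ^ i * 90 + 30 + 10) + 8 \<le> 380 * l" by linarith
    then show ?case by simp
  qed (use v B1 e_lt in auto)
  have "sp (17 ::= cell 10 ;; St 23 (V 17) (N 0) (V 16) ;; St 23 (V 17) (V 11) (V 14)) (wp (For 18 (V 9) ?body) (380 * l)
     (\<lambda>v' a'. v' 17 = q \<and> I e a')) v a"
  proof -
    have "l < S" using l S0 by linarith
    then show ?thesis using loop v S0 B1 by (simp add: K_def)
  qed
  then have "wp expand_code (420 * l) (\<lambda>v' a'. v' 17 = q \<and> I e a') v a"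
    unfolding expand_code_def by (rule wp_sp_seq) (use lp in simp)
  then show ?thesis
    by (rule wp_conseq) (use l in \<open>auto simp: I_def good_def\<close>)
qed

lemma wv_expand: "wv expand_code \<subseteq> {17..}" "wa expand_code = {23}"
  by (auto simp: expand_code_def)

lemma wv_register: "wv register_code \<subseteq> {17..}" "wa register_code = {6, 7, 9, 10}"
  by (auto simp: register_code_def)

lemma wv_build: "wv build_code \<subseteq> {12..}" "wa build_code \<subseteq> {6, 7, 9, 10, 23}"
  using wv_expand wv_register by (fastforce simp: build_code_def)+

text \<open>Injectivity matters: a node occurring twice on the path would be registered twice, and
  array 7 would no longer count sets.\<close>

lemma wp_register:
  assumes v: "v 11 = l" "v 17 = q" and q: "q < n * n" and l: "1 \<le> l" "l \<le> n"
    and inj: "inj_on (a 23 q) {..<l}" and rng: "\<And>t. t < l \<Longrightarrow> a 23 q t < n"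
    and len: "\<And>x. x < n \<Longrightarrow> a 7 x 0 \<le> q"
  shows "wp register_code (150 * l) (\<lambda>v' a'.
    (\<forall>x. a' 7 x 0 = a 7 x 0 + of_bool (x \<in> a 23 q ` {..<l})) \<and>
    (\<forall>x c. a' 6 x c = (if x \<in> a 23 q ` {..<l} \<and> c = a 7 x 0 then q else a 6 x c)) \<and>
    (\<forall>q'. a' 9 q' 0 = (if q' = q then 1 else a 9 q' 0)) \<and> a' 10 0 0 = Suc q) v a"
proof -
  have B1: "1 < B" "n < B" "n * n + 1 < B" using B_big n_le by linarith+
  have S0: "0 < S" "n * n < S" "n < S" using S_big by linarith+
  let ?p = "a 23 q"
  let ?I = "\<lambda>t (a' :: arrs). (\<forall>x. a' 7 x 0 = a 7 x 0 + of_bool (x \<in> ?p ` {..<t})) \<and>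
    (\<forall>x c. a' 6 x c = (if x \<in> ?p ` {..<t} \<and> c = a 7 x 0 then q else a 6 x c))"
  let ?c = "20 ::= Ld 23 (V 17) (V 18) ;; 21 ::= Ld 7 (V 20) (N 0) ;;
         St 6 (V 20) (V 21) (V 17) ;; St 7 (V 20) (N 0) (V 21 \<oplus> N 1)"
  show ?thesis unfolding register_code_def
  proof (rule wp_seq_frame[where ta = "l * 70 + 8" and tb = 60, OF wp_for_const[where n = l and t = 60 and I = ?I and
        Q = "\<lambda>v' a'. ?I l a'"]], goal_cases)
    case (7 t v1 a1)
    have v1: "v1 17 = q" "v1 18 = t" using 7(3,5) v by auto
    have a1: "a1 23 = a 23" using 7(6) by simp
    define x where "x = ?p t"
    have xt: "x \<notin> ?p ` {..<t}"
    proof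
      assume "x \<in> ?p ` {..<t}"
      then obtain t' where t': "t' < t" "?p t = ?p t'" by (auto simp: x_def)
      then have "t = t'" using inj_onD[OF inj t'(2)] 7(1) by simp
      then show False using t' by simp
    qed
    have l7: "a1 7 x 0 = a 7 x 0" using 7(2) xt by simp
    have xn: "x < n" using rng 7(1) by (simp add: x_def)
    have b: "a 7 x 0 < S" "a 7 x 0 + 1 < B" using len[OF xn] q S0 B1 by linarith+
    define G where "G = ?I (Suc t)"
    have "G (upd (upd a1 6 x (a 7 x 0) q) 7 x 0 (Suc (a 7 x 0)))"
      using 7(2) xt unfolding G_def by (auto simp: upd_apply lessThan_Suc x_def)
    then have "sp ?c (\<lambda>_. G) v1 a1" using v1 a1 l7 b S0 7(1) l B1 x_def by (simp add: K_def)
    then show ?case unfolding G_def by (rule wp_sp) simp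
  next
    case (10 v1 a1)
    have v1: "v1 17 = q" using 10(2) v by simp
    have a1: "a1 9 = a 9" using 10(3) by simp
    show ?case
    proof (rule wp_sp, goal_cases)
      case 1
      show ?case using 10(1) v1 a1 S0 B1 q by (auto simp: K_def upd_apply)
    qed simp
  qed (use v l B1 in auto)
qed

section \<open>The family of recorded paths and its incidence lists\<close>

definition nsets :: "arrs \<Rightarrow> nat" where "nsets a = a 10 0 0"
definition pset :: "nat \<Rightarrow> arrs \<Rightarrow> nat \<Rightarrow> nat set" where "pset l a q = a 23 q ` {..<l}"

definition built :: "nat \<Rightarrow> arrs \<Rightarrow> bool" where
  "built l a \<longleftrightarrow>
     (\<forall>x<n. a 7 x 0 = card {q. q < nsets a \<and> x \<in> pset l a q}) \<and>
     (\<forall>x<n. a 6 x ` {..<a 7 x 0} = {q. q < nsets a \<and> x \<in> pset l a q}) \<and>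
     (\<forall>q<nsets a. inj_on (a 23 q) {..<l} \<and> (\<forall>t<l. a 23 q t < n) \<and> a 9 q 0 = 1)"

lemma built_add:
  assumes b: "built l a" and q: "q = nsets a" and inj: "inj_on (a' 23 q) {..<l}" and rng: "\<And>t. t < l \<Longrightarrow> a' 23 q t < n"
    and 23: "\<And>q'. q' \<noteq> q \<Longrightarrow> a' 23 q' = a 23 q'"
    and 7: "\<And>x. a' 7 x 0 = a 7 x 0 + of_bool (x \<in> a' 23 q ` {..<l})"
    and 6: "\<And>x c. a' 6 x c = (if x \<in> a' 23 q ` {..<l} \<and> c = a 7 x 0 then q else a 6 x c)"
    and 9: "\<And>q'. a' 9 q' 0 = (if q' = q then 1 else a 9 q' 0)" and 10: "a' 10 0 0 = Suc q"
  shows "built l a'"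
proof -
  have N: "nsets a' = Suc q" using 10 by (simp add: nsets_def)
  have ps: "pset l a' q' = pset l a q'" if "q' < q" for q' using 23[of q'] that by (simp add: pset_def)
  have sets: "{q'. q' < nsets a' \<and> x \<in> pset l a' q'} =
     (if x \<in> pset l a' q then insert q {q'. q' < nsets a \<and> x \<in> pset l a q'} else {q'. q' < nsets a \<and> x \<in> pset l a q'})" for x
    unfolding N q[symmetric] using ps by (auto simp: less_Suc_eq)
  have fin: "finite {q'. q' < nsets a \<and> x \<in> pset l a q'}" for x by simp
  show ?thesis unfolding built_def
  proof (intro conjI allI impI)
    fix x assume x: "x < n"
    show "a' 7 x 0 = card {q. q < nsets a' \<and> x \<in> pset l a' q}"
    proof -
      have "x \<in> a' 23 q ` {..<l} \<longleftrightarrow> x \<in> pset l a' q" by (simp add: pset_def)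
      moreover have "q \<notin> {q'. q' < nsets a \<and> x \<in> pset l a q'}" using q by simp
      moreover have "a 7 x 0 = card {q'. q' < nsets a \<and> x \<in> pset l a q'}" using b x by (simp add: built_def)
      ultimately show ?thesis unfolding sets using 7[of x] fin[of x] by simp
    qed
    have e6: "a 6 x ` {..<a 7 x 0} = {q. q < nsets a \<and> x \<in> pset l a q}" using b x unfolding built_def by blast
    show "a' 6 x ` {..<a' 7 x 0} = {q. q < nsets a' \<and> x \<in> pset l a' q}"
    proof (cases "x \<in> pset l a' q")
      case True
      then have x': "x \<in> a' 23 q ` {..<l}" by (simp add: pset_def)
      have "a' 6 x ` {..<a' 7 x 0} = insert q (a 6 x ` {..<a 7 x 0})"
        using x' 7[of x] 6[of x] by (auto simp: lessThan_Suc)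
      then show ?thesis unfolding sets using True e6 by simp
    next
      case False
      then have x': "x \<notin> a' 23 q ` {..<l}" by (simp add: pset_def)
      have "a' 6 x ` {..<a' 7 x 0} = a 6 x ` {..<a 7 x 0}"
        using x' 7[of x] 6[of x] by (auto simp: lessThan_Suc)
      then show ?thesis unfolding sets using False e6 by simp
    qed
  next
    fix q' assume "q' < nsets a'"
    then consider "q' = q" | "q' < nsets a" "q' \<noteq> q" using N q by linarith
    then have "inj_on (a' 23 q') {..<l} \<and> (\<forall>t<l. a' 23 q' t < n) \<and> a' 9 q' 0 = 1"
      by cases (use b inj rng 23[of q'] 9[of q'] in \<open>auto simp: built_def\<close>)
    then show "inj_on (a' 23 q') {..<l}" "a' 9 q' 0 = 1" "\<And>t. t < l \<Longrightarrow> a' 23 q' t < n" by auto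
  qed
qed

definition covers :: "nat \<Rightarrow> arrs \<Rightarrow> nat \<Rightarrow> nat \<Rightarrow> arrs \<Rightarrow> bool" where
  "covers l a i y a' \<longleftrightarrow> (a 5 (a 2 i 0) y = l \<longrightarrow> (\<exists>q<nsets a'. good l a (a' 23 q) (a 2 i 0) y))"

text \<open>The premise \<open>inj\<close> expresses that shortest paths do not repeat nodes;
  \<open>walk_inj\<close> supplies it. The cost is the number of pairs of a hub and a node, times
  the path length.\<close>

theorem wp_build:
  assumes v: "v 6 = n" "v 9 = e" "v 11 = l" and l: "l = 2 ^ e" "l \<le> n" and md: "mids e a" and wf: "wf_state a"
    and init: "a 10 0 0 = 0" "\<And>x. x < n \<Longrightarrow> a 7 x 0 = 0"
    and inj: "\<And>p x y. x < n \<Longrightarrow> y < n \<Longrightarrow> good l a p x y \<Longrightarrow> a 5 x y = l \<Longrightarrow> inj_on p {..<l}"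
  shows "wp build_code (900 * (a 3 0 0 * (n * l)) + 100) (\<lambda>v' a'.
    built l a' \<and> nsets a' \<le> a 3 0 0 * n \<and> (\<forall>i<a 3 0 0. \<forall>y<n. covers l a i y a')) v a"
proof -
  let ?h = "a 3 0 0"
  have h: "?h \<le> n" "\<And>i. i < ?h \<Longrightarrow> a 2 i 0 < n" using wf by (auto simp: wf_state_def)
  have B1: "1 < B" "n < B" "n * n + 1 < B" "?h < B" using B_big n_le h by linarith+
  have S0: "0 < S" "n < S" using S_pos by auto
  have l1: "1 \<le> l" using l by simp
  let ?c = "16 ::= Ld 2 (V 12) (N 0) ;; IfEq (Ld 5 (V 16) (V 14)) (V 11) (expand_code ;; register_code) Skip"
  let ?t = "600 * l + 40"
  show ?thesis unfolding build_code_def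
  proof (rule wp_for_const[where n = ?h and t = "n * (?t + 10) + 8" and
        I = "\<lambda>i a'. built l a' \<and> nsets a' \<le> i * n \<and> (\<forall>i'<i. \<forall>y<n. covers l a i' y a')"], goal_cases)
    case 6
    then show ?case using init by (simp add: built_def nsets_def)
  next
    case (7 i v1 a1)
    note o = this
    have wab: "{6, 7, 9, 10, 23} \<subseteq> {6, 7, 9, 10, 23::nat}" by simp
    have v1: "v1 6 = n" "v1 9 = e" "v1 11 = l" using o(5) v by auto
    show ?case
    proof (rule wp_for_const[where n = n and t = ?t and
          I = "\<lambda>j a'. built l a' \<and> nsets a' \<le> i * n + j \<and> (\<forall>i'<i. \<forall>y<n. covers l a i' y a') \<and> (\<forall>y<j. covers l a i y a')"], goal_cases)
      case (7 j v2 a2)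
      note o2 = this
      have v2: "v2 6 = n" "v2 9 = e" "v2 11 = l" "v2 12 = i" "v2 14 = j" using o2(3,5) v1 o(3) by auto
      have a2: "k' \<notin> {6, 7, 9, 10, 23} \<Longrightarrow> a2 k' = a k'" for k'
        using o2(6)[of k'] o(6)[of k'] wv_expand wv_register by simp
      define x where "x = a 2 i 0"
      have x: "x < n" using h(2)[OF o(1)] by (simp add: x_def)
      define q where "q = a2 10 0 0"
      have qb: "q \<le> i * n + j" using o2(2) by (simp add: nsets_def q_def)
      have ij: "i * n + j < n * n" using idx_bound[of i j] o(1) o2(1) h(1) by simp
      let ?Q = "\<lambda>(_ :: vars) a'. built l a' \<and> nsets a' \<le> i * n + Suc j \<and> (\<forall>i'<i. \<forall>y<n. covers l a i' y a') \<and> (\<forall>y<Suc j. covers l a i y a')"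
      have "wp (IfEq (Ld 5 (V 16) (V 14)) (V 11) (expand_code ;; register_code) Skip) (600 * l + 30) ?Q (v2(16 := x)) a2"
      proof (rule wp_IfEq[where ta = "580 * l"])
        assume "ev (Ld 5 (V 16) (V 14)) (v2(16 := x)) a2 = ev (V 11) (v2(16 := x)) a2"
        then have d: "a 5 x j = l" using v2 a2[of 5] by simp
        have md2: "mids e a2" using md a2[of 5] a2[of 4] unfolding mids_def mid_wit_def by simp
        have gd: "good l a2 = good l a" using a2[of 5] by (simp add: good_def fun_eq_iff)
        show "wp (expand_code ;; register_code) (580 * l) ?Q (v2(16 := x)) a2"
        proof (rule wp_seq_frame[where tb = "150 * l", OF wp_expand[where x = x and y = j and l = l and e = e and q = q]])
          fix v3 a3 assume 3: "v3 17 = q \<and> good l a2 (a3 23 q) x j \<and> (\<forall>q'. q' \<noteq> q \<longrightarrow> a3 23 q' = a2 23 q')"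
            and fr: "\<And>x'. x' \<notin> wv expand_code \<Longrightarrow> v3 x' = (v2(16 := x)) x'" "\<And>k'. k' \<notin> wa expand_code \<Longrightarrow> a3 k' = a2 k'"
          have "11 \<notin> wv expand_code" using wv_expand(1) by auto
          then have v3: "v3 11 = l" using fr(1)[of 11] v2 by simp
          have a3: "k' \<noteq> 23 \<Longrightarrow> a3 k' = a2 k'" for k' using fr(2)[of k'] wv_expand(2) by simp
          have g: "good l a (a3 23 q) x j" using 3 gd by simp
          have ij3: "inj_on (a3 23 q) {..<l}" by (rule inj[OF x o2(1) g d])
          have rg3: "a3 23 q t < n" if "t < l" for t using g that by (simp add: good_def)
          have len: "a3 7 x' 0 \<le> q" if "x' < n" for x'
          proof -
            have "a2 7 x' 0 = card {q'. q' < nsets a2 \<and> x' \<in> pset l a2 q'}" using o2(2) that by (simp add: built_def)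
            also have "\<dots> \<le> card {..<q}" by (rule card_mono) (auto simp: nsets_def q_def)
            finally show ?thesis using a3[of 7] by simp
          qed
          show "wp register_code (150 * l) ?Q v3 a3"
          proof (rule wp_frame[OF wp_register[where l = l and q = q]])
            fix v4 a4 assume 4: "(\<forall>x. a4 7 x 0 = a3 7 x 0 + of_bool (x \<in> a3 23 q ` {..<l})) \<and>
              (\<forall>x c. a4 6 x c = (if x \<in> a3 23 q ` {..<l} \<and> c = a3 7 x 0 then q else a3 6 x c)) \<and>
              (\<forall>q'. a4 9 q' 0 = (if q' = q then 1 else a3 9 q' 0)) \<and> a4 10 0 0 = Suc q"
              and fr4: "\<And>k'. k' \<notin> wa register_code \<Longrightarrow> a4 k' = a3 k'"
            have a23: "a4 23 = a3 23" using fr4[of 23] wv_register(2) by simp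
            have bl: "built l a4"
              by (rule built_add[where a = a2 and q = q]) (use 4 3 a23 ij3 rg3 a3 o2(2) in \<open>auto simp: nsets_def q_def\<close>)
            have N4: "nsets a4 = Suc q" "nsets a2 = q" using 4 by (auto simp: nsets_def q_def)
            have cov: "covers l a i' y a4" if "covers l a i' y a2" for i' y
              using that 3 unfolding covers_def N4 a23 by (metis less_Suc_eq nat_neq_iff)
            have "covers l a i j a4" using g unfolding covers_def N4 a23 x_def by blast
            then show "?Q v4 a4" using bl cov o2(2) N4 qb by (auto simp: less_Suc_eq)
          qed (use v3 3 qb ij l1 l(2) ij3 rg3 len in auto)
        qed (use v2 x o2(1) d a2[of 5] l ij qb B1 md2 in \<open>auto simp: q_def\<close>)
      next
        assume "ev (Ld 5 (V 16) (V 14)) (v2(16 := x)) a2 \<noteq> ev (V 11) (v2(16 := x)) a2"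
        then have "a 5 x j \<noteq> l" using v2 a2[of 5] by simp
        then have "covers l a i j a2" by (simp add: covers_def x_def)
        then have "?Q v a2" using o2(2) by (auto simp: less_Suc_eq)
        then show "wp Skip (580 * l) ?Q (v2(16 := x)) a2" by (intro wp_sp) auto
      qed (use v2 S0 o2(1) B1 in \<open>auto simp: K_def\<close>)
      then have "sp (16 ::= Ld 2 (V 12) (N 0))
         (wp (IfEq (Ld 5 (V 16) (V 14)) (V 11) (expand_code ;; register_code) Skip) (600 * l + 30) ?Q) v2 a2"
        using v2 a2[of 2] B1 S0 by (simp add: K_def x_def)
      then show ?case by (rule wp_sp_seq) simp
    next
      case 5
      then show ?case using wv_expand wv_register by auto
    next
      case (8 v' a')
      then show ?case by (auto simp: less_Suc_eq add.commute)
    qed (use v1 B1 o in auto)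
  next
    case 5
    then show ?case using wv_expand wv_register by auto
  next
    case 9
    have g: "x * (n * (600 * l + 40 + 10) + 8 + 10) \<le> 900 * (x * (n * l))" for x
    proof -
      have "n * (600 * l + 40 + 10) + 8 + 10 = 600 * (n * l) + 50 * n + 18" by (simp add: algebra_simps)
      moreover have "n \<le> n * l" "1 \<le> n * l" using l1 n3 by auto
      ultimately have "n * (600 * l + 40 + 10) + 8 + 10 \<le> 900 * (n * l)" by linarith
      then have "x * (n * (600 * l + 40 + 10) + 8 + 10) \<le> x * (900 * (n * l))" by (rule mult_left_mono) simp
      then show ?thesis by (simp add: mult.left_commute)
    qed
    have gen: "A \<le> D \<Longrightarrow> A + ecost (cell 3) + 7 \<le> D + 100" for A D by simp
    show ?case by (rule gen[OF g])
  qed (use v B1 S0 in \<open>auto simp: K_def\<close>)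
qed

end

section \<open>Greedy hitting sets\<close>

definition pick_code :: com where
  "pick_code =
     ((St 11 (cell 12) (N 0) (V 16) ;; set_cell 12 (cell 12 \<oplus> N 1)) ;;
      For 18 (Ld 7 (V 16) (N 0))
        (20 ::= Ld 6 (V 16) (V 18) ;;
         When (Ld 9 (V 20) (N 0))
           (St 9 (V 20) (N 0) (N 0) ;;
            For 22 (V 11) (24 ::= Ld 23 (V 20) (V 22) ;; St 8 (V 24) (N 0) (Ld 8 (V 24) (N 0) \<ominus> N 1)))))"

text \<open>The greedy rule up to a factor 2: the threshold halves from phase to phase, and a scan
  picks each node that still lies on at least that many live sets. This needs
  \<open>2 * L + 1\<close> scans and no priority queue. The exponent starts at \<open>2 * L\<close>
  because there are at most \<open>n * n\<close> sets.\<close>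

definition greedy_code :: com where
  "greedy_code = For 12 (V 4 \<oplus> V 4 \<oplus> N 1)
     (14 ::= Op Shl (N 1) ((V 4 \<oplus> V 4) \<ominus> V 12) ;;
      For 16 (V 6) (If (Less (Ld 8 (V 16) (N 0)) (V 14)) Skip pick_code))"

lemma double_count:
  assumes "finite R" "finite A" "\<And>q. q \<in> R \<Longrightarrow> ps q \<subseteq> A"
  shows "(\<Sum>x\<in>A. card {q \<in> R. x \<in> ps q}) = (\<Sum>q\<in>R. card (ps q))"
proof -
  have "(\<Sum>x\<in>A. card {q \<in> R. x \<in> ps q}) = (\<Sum>x\<in>A. \<Sum>q\<in>R. of_bool (x \<in> ps q))"
    using assms(1) by (intro sum.cong refl) (simp add: of_bool_def sum.If_cases Int_def)
  also have "\<dots> = (\<Sum>q\<in>R. \<Sum>x\<in>A. of_bool (x \<in> ps q))" by (rule sum.swap)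
  also have "\<dots> = (\<Sum>q\<in>R. card (ps q))"
  proof (intro sum.cong refl)
    fix q assume "q \<in> R"
    then have "A \<inter> ps q = ps q" using assms(3) by blast
    then show "(\<Sum>x\<in>A. of_bool (x \<in> ps q)) = card (ps q)"
      using assms(2) by (simp add: of_bool_def sum.If_cases Int_def)
  qed
  finally show ?thesis .
qed

definition alive :: "nat \<Rightarrow> arrs \<Rightarrow> nat set" where
  "alive M a = {q. q < M \<and> a 9 q 0 \<noteq> 0}"

lemma finite_alive [simp]: "finite (alive M a)"
  by (simp add: alive_def)

section \<open>Invariant, amortised cost and size of the greedy choice\<close>

context aeL
begin

definition cnt_ok :: "nat \<Rightarrow> (nat \<Rightarrow> nat set) \<Rightarrow> arrs \<Rightarrow> bool" where
  "cnt_ok M ps a \<longleftrightarrow> (\<forall>x<n. a 8 x 0 = card {q \<in> alive M a. x \<in> ps q})"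

text \<open>The last conjunct bounds the picks by \<open>n\<close>: each pick makes a nonzero
  counter 0, and counters never grow.\<close>

definition hitinv :: "nat \<Rightarrow> (nat \<Rightarrow> nat set) \<Rightarrow> arrs \<Rightarrow> bool" where
  "hitinv M ps a \<longleftrightarrow> cnt_ok M ps a \<and>
     (\<forall>q<M. q \<notin> alive M a \<longrightarrow> (\<exists>i<a 12 0 0. a 11 i 0 \<in> ps q)) \<and>
     (\<forall>i<a 12 0 0. a 11 i 0 < n) \<and> a 12 0 0 + card {x. x < n \<and> a 8 x 0 \<noteq> 0} \<le> n"

lemma wp_kill:
  assumes v: "v 11 = l" "v 20 = q" and l: "l \<le> n"
    and inj: "inj_on (a 23 q) {..<l}"
  shows "wp (For 22 (V 11) (24 ::= Ld 23 (V 20) (V 22) ;; St 8 (V 24) (N 0) (Ld 8 (V 24) (N 0) \<ominus> N 1)))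
    (50 * l + 8) (\<lambda>v' a'. \<forall>x. a' 8 x 0 = a 8 x 0 - of_bool (x \<in> a 23 q ` {..<l})) v a"
proof -
  have B1: "1 < B" "n < B" using B_big n_le by linarith+
  have S0: "0 < S" "n < S" using S_pos by auto
  let ?I = "\<lambda>t (a' :: arrs). \<forall>x. a' 8 x 0 = a 8 x 0 - of_bool (x \<in> a 23 q ` {..<t})"
  show ?thesis
  proof (rule wp_for_const[where n = l and t = 40 and I = ?I], goal_cases)
    case (7 t v1 a1)
    have v1: "v1 20 = q" "v1 22 = t" using 7(3,5) v by auto
    have a1: "a1 23 = a 23" using 7(6) by simp
    define x where "x = a 23 q t"
    have xt: "x \<notin> a 23 q ` {..<t}"
    proof
      assume "x \<in> a 23 q ` {..<t}"
      then obtain t' where t': "t' < t" "a 23 q t = a 23 q t'" by (auto simp: x_def)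
      then have "t = t'" using inj_onD[OF inj t'(2)] 7(1) by simp
      then show False using t' by simp
    qed
    have c: "a1 8 x 0 = a 8 x 0" using 7(2) xt by simp
    define G where "G = ?I (Suc t)"
    have "G (upd a1 8 x 0 (a 8 x 0 - 1))"
      using 7(2) xt unfolding G_def by (auto simp: upd_apply lessThan_Suc x_def)
    then have "sp (24 ::= Ld 23 (V 20) (V 22) ;; St 8 (V 24) (N 0) (Ld 8 (V 24) (N 0) \<ominus> N 1)) (\<lambda>_. G) v1 a1"
      using v1 a1 c S0 B1 7(1) l by (simp add: K_def x_def)
    then show ?case unfolding G_def by (rule wp_sp) simp
  qed (use v l B1 in auto)
qed

lemma wv_pick: "wv pick_code \<subseteq> {18..}" "wa pick_code = {8, 9, 11, 12}"
  by (auto simp: pick_code_def)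

lemma wp_pick:
  assumes v: "v 11 = l" "v 16 = x" and x: "x < n" and l: "l \<le> n"
    and bt: "\<And>q. q < M \<Longrightarrow> inj_on (a 23 q) {..<l}" "\<And>q. q < M \<Longrightarrow> ps q = a 23 q ` {..<l}" "\<And>q. q < M \<Longrightarrow> ps q \<subseteq> {..<n}"
    and lst: "a 6 x ` {..<a 7 x 0} = {q. q < M \<and> x \<in> ps q}" and len: "a 7 x 0 \<le> n * n"
    and inv: "hitinv M ps a" and pos: "a 8 x 0 \<noteq> 0"
  shows "wp pick_code (100 + 60 * a 7 x 0 + (50 * l + 60) * a 8 x 0)
    (\<lambda>v' a'. hitinv M ps a' \<and> a' 12 0 0 = Suc (a 12 0 0) \<and> alive M a' = alive M a - {q. x \<in> ps q} \<and>
       a' 8 x 0 = 0 \<and> (\<forall>y<n. a' 8 y 0 \<le> a 8 y 0)) v a"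
proof -
  have B1: "1 < B" "n < B" "n * n < B" "n + 1 < B" using B_big n_le by linarith+
  have S0: "0 < S" "n * n < S" using S_big by linarith+
  let ?h = "a 12 0 0"
  let ?a = "upd (upd a 11 ?h 0 x) 12 0 0 (Suc ?h)"
  let ?len = "a 7 x 0"
  have cnt: "cnt_ok M ps a" using inv by (simp add: hitinv_def)
  \<comment> \<open>\<open>x\<close> itself still has a nonzero counter, so the last conjunct of
    \<open>hitinv\<close> leaves room for one more pick.\<close>
  have h: "?h < n"
  proof -
    have "x \<in> {x. x < n \<and> a 8 x 0 \<noteq> 0}" using x pos by simp
    then have "0 < card {x. x < n \<and> a 8 x 0 \<noteq> 0}" by (auto simp: card_gt_0_iff)
    then show ?thesis using inv by (auto simp: hitinv_def)
  qed
  let ?body = "20 ::= Ld 6 (V 16) (V 18) ;;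
         When (Ld 9 (V 20) (N 0))
           (St 9 (V 20) (N 0) (N 0) ;;
            For 22 (V 11) (24 ::= Ld 23 (V 20) (V 22) ;; St 8 (V 24) (N 0) (Ld 8 (V 24) (N 0) \<ominus> N 1)))"
  let ?I = "\<lambda>i a'. cnt_ok M ps a' \<and> alive M a' = alive M a - a 6 x ` {..<i}"
  \<comment> \<open>Pays for the list entries still to be scanned and, with
    \<open>50 * l + 60\<close> each, for the live sets through \<open>x\<close> still to be
    killed.\<close>
  let ?pot = "\<lambda>i a'. (?len - i) * 60 + (50 * l + 60) * card {q \<in> alive M a'. x \<in> ps q}"
  let ?Q = "\<lambda>v' a'. hitinv M ps a' \<and> a' 12 0 0 = Suc ?h \<and> alive M a' = alive M a - {q. x \<in> ps q} \<and>
       a' 8 x 0 = 0 \<and> (\<forall>y<n. a' 8 y 0 \<le> a 8 y 0)"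
  have loop: "wp (For 18 (Ld 7 (V 16) (N 0)) ?body) (60 * ?len + (50 * l + 60) * a 8 x 0 + 20) ?Q v ?a"
  proof (rule wp_for[where n = ?len and I = ?I and pot = ?pot], goal_cases)
    case 6
    show ?case using cnt by (auto simp: cnt_ok_def alive_def upd_apply)
  next
    case (7 i v1 a1)
    have v1: "v1 11 = l" "v1 16 = x" "v1 18 = i" using 7(3,5) v by auto
    have a1: "a1 6 = a 6" "a1 23 = a 23" "a1 12 = ?a 12" "a1 11 = ?a 11" using 7(6) by simp_all
    define q where "q = a 6 x i"
    have "q \<in> a 6 x ` {..<?len}" using 7(1) by (simp add: q_def)
    then have q: "q < M" "x \<in> ps q" using lst by auto
    have im: "a 6 x ` {..<Suc i} = insert q (a 6 x ` {..<i})" by (simp add: lessThan_Suc q_def)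
    have S1: "i < S" using 7(1) len S0 by linarith
    have pot_i: "(?len - i) * 60 = (?len - Suc i) * 60 + 60" using 7(1) by (simp add: Suc_diff_Suc[symmetric])
    show ?case
    proof (cases "a1 9 q 0 = 0")
      case True
      then have "q \<notin> alive M a1" by (simp add: alive_def)
      then have I': "?I (Suc i) a1" using 7(2) im by auto
      let ?G = "\<lambda>(_ :: vars) a''. ?I (Suc i) a'' \<and> 40 + 10 + ?pot (Suc i) a'' \<le> ?pot i a1"
      have "?G v a1" using I' pot_i by simp
      then have "wp (When (Ld 9 (V 20) (N 0)) (St 9 (V 20) (N 0) (N 0) ;;
            For 22 (V 11) (24 ::= Ld 23 (V 20) (V 22) ;; St 8 (V 24) (N 0) (Ld 8 (V 24) (N 0) \<ominus> N 1)))) 20 ?G (v1(20 := q)) a1"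
        by (intro wp_If[where ta = 0] wp_sp) (use True S0 B1 in \<open>auto simp: K_def\<close>)
      then have "sp (20 ::= Ld 6 (V 16) (V 18)) (wp (When (Ld 9 (V 20) (N 0)) (St 9 (V 20) (N 0) (N 0) ;;
            For 22 (V 11) (24 ::= Ld 23 (V 20) (V 22) ;; St 8 (V 24) (N 0) (Ld 8 (V 24) (N 0) \<ominus> N 1)))) 20 ?G) v1 a1"
        using v1 a1 S1 by (simp add: K_def q_def)
      then have "wp ?body 40 ?G v1 a1" by (rule wp_sp_seq) simp
      then show ?thesis by blast
    next
      case False
      then have qal: "q \<in> alive M a1" using q by (simp add: alive_def)
      let ?t = "50 * l + 68"
      let ?G = "\<lambda>(_ :: vars) a''. ?I (Suc i) a'' \<and> ?t + 10 + ?pot (Suc i) a'' \<le> ?pot i a1"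
      let ?a1 = "upd a1 9 q 0 0"
      have kill: "wp (For 22 (V 11) (24 ::= Ld 23 (V 20) (V 22) ;; St 8 (V 24) (N 0) (Ld 8 (V 24) (N 0) \<ominus> N 1)))
        (50 * l + 8) ?G (v1(20 := q)) ?a1"
      proof (rule wp_frame[OF wp_kill[where l = l and q = q]])
        fix v2 a2 assume 2: "\<forall>y. a2 8 y 0 = ?a1 8 y 0 - of_bool (y \<in> ?a1 23 q ` {..<l})"
          and fr: "\<And>k'. k' \<notin> wa (For 22 (V 11) (24 ::= Ld 23 (V 20) (V 22) ;; St 8 (V 24) (N 0) (Ld 8 (V 24) (N 0) \<ominus> N 1))) \<Longrightarrow> a2 k' = ?a1 k'"
        have 9: "a2 9 = ?a1 9" using fr[of 9] by simp
        have al: "alive M a2 = alive M a1 - {q}" by (auto simp: alive_def 9 upd_apply)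
        have psq: "?a1 23 q ` {..<l} = ps q" using bt(2)[OF q(1)] a1 by simp
        have "a2 8 y 0 = card {q' \<in> alive M a2. y \<in> ps q'}" if "y < n" for y
        proof -
          have c1: "a1 8 y 0 = card {q' \<in> alive M a1. y \<in> ps q'}" using 7(2) that by (simp add: cnt_ok_def)
          show ?thesis
          proof (cases "y \<in> ps q")
            case True
            have "{q' \<in> alive M a2. y \<in> ps q'} = {q' \<in> alive M a1. y \<in> ps q'} - {q}" using al by auto
            then have "card {q' \<in> alive M a2. y \<in> ps q'} = card {q' \<in> alive M a1. y \<in> ps q'} - 1"
              using qal True by (simp add: card_Diff_singleton)
            then show ?thesis using 2 c1 psq True by (simp add: upd_apply)
          next
            case False
            then have "{q' \<in> alive M a2. y \<in> ps q'} = {q' \<in> alive M a1. y \<in> ps q'}" using al by auto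
            then show ?thesis using 2 c1 psq False by (simp add: upd_apply)
          qed
        qed
        then have I': "?I (Suc i) a2" using 7(2) im al by (auto simp: cnt_ok_def)
        have "card {q' \<in> alive M a1. x \<in> ps q'} = Suc (card {q' \<in> alive M a2. x \<in> ps q'})"
        proof -
          have "{q' \<in> alive M a1. x \<in> ps q'} = insert q {q' \<in> alive M a2. x \<in> ps q'}" using al qal q by auto
          moreover have "q \<notin> {q' \<in> alive M a2. x \<in> ps q'}" using al by auto
          ultimately show ?thesis by simp
        qed
        then show "?G v2 a2" using I' pot_i by simp
      qed (use v1 l bt(1)[OF q(1)] a1 in auto)
      have "wp (When (Ld 9 (V 20) (N 0)) (St 9 (V 20) (N 0) (N 0) ;;
            For 22 (V 11) (24 ::= Ld 23 (V 20) (V 22) ;; St 8 (V 24) (N 0) (Ld 8 (V 24) (N 0) \<ominus> N 1)))) (50 * l + 50) ?G (v1(20 := q)) a1"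
      proof (rule wp_If[where ta = "50 * l + 20"])
        have "sp (St 9 (V 20) (N 0) (N 0)) (wp (For 22 (V 11) (24 ::= Ld 23 (V 20) (V 22) ;; St 8 (V 24) (N 0) (Ld 8 (V 24) (N 0) \<ominus> N 1)))
        (50 * l + 8) ?G) (v1(20 := q)) a1" using kill S0 B1 by (simp add: K_def)
        then show "wp (St 9 (V 20) (N 0) (N 0) ;;
            For 22 (V 11) (24 ::= Ld 23 (V 20) (V 22) ;; St 8 (V 24) (N 0) (Ld 8 (V 24) (N 0) \<ominus> N 1))) (50 * l + 20) ?G (v1(20 := q)) a1"
          by (rule wp_sp_seq) simp
      qed (use False S0 B1 in \<open>auto simp: K_def\<close>)
      then have "sp (20 ::= Ld 6 (V 16) (V 18)) (wp (When (Ld 9 (V 20) (N 0)) (St 9 (V 20) (N 0) (N 0) ;;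
            For 22 (V 11) (24 ::= Ld 23 (V 20) (V 22) ;; St 8 (V 24) (N 0) (Ld 8 (V 24) (N 0) \<ominus> N 1)))) (50 * l + 50) ?G) v1 a1"
        using v1 a1 S1 by (simp add: K_def q_def)
      then have "wp ?body ?t ?G v1 a1" by (rule wp_sp_seq) simp
      then show ?thesis by blast
    qed
  next
    case (8 v' a')
    have a': "a' 11 = ?a 11" "a' 12 = ?a 12" using 8(3) by simp_all
    have al: "alive M a' = alive M a - {q. x \<in> ps q}" using 8(1) lst by (auto simp: alive_def)
    have c': "cnt_ok M ps a'" using 8(1) by simp
    have mono: "a' 8 y 0 \<le> a 8 y 0" if "y < n" for y
    proof -
      have "a' 8 y 0 = card {q \<in> alive M a'. y \<in> ps q}" "a 8 y 0 = card {q \<in> alive M a. y \<in> ps q}"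
        using c' cnt that by (auto simp: cnt_ok_def)
      then show ?thesis using al by (auto intro!: card_mono)
    qed
    have x0: "a' 8 x 0 = 0"
    proof -
      have "{q \<in> alive M a'. x \<in> ps q} = {}" using al by auto
      then show ?thesis using c' x unfolding cnt_ok_def by (metis card.empty)
    qed
    have dead: "\<exists>i<Suc ?h. a' 11 i 0 \<in> ps q" if "q < M" "q \<notin> alive M a'" for q
    proof (cases "q \<in> alive M a")
      case True
      then have "x \<in> ps q" using that al by auto
      then show ?thesis using a' by (intro exI[of _ ?h]) (simp add: upd_apply)
    next
      case False
      then have "\<exists>i<?h. a 11 i 0 \<in> ps q" using inv that(1) unfolding hitinv_def by blast
      then obtain i where "i < ?h" "a 11 i 0 \<in> ps q" by blast
      then show ?thesis using a' by (intro exI[of _ i]) (simp add: upd_apply)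
    qed
    have "{y. y < n \<and> a' 8 y 0 \<noteq> 0} \<subseteq> {y. y < n \<and> a 8 y 0 \<noteq> 0} - {x}" using mono x0 by fastforce
    then have "card {y. y < n \<and> a' 8 y 0 \<noteq> 0} \<le> card ({y. y < n \<and> a 8 y 0 \<noteq> 0} - {x})" by (intro card_mono) auto
    also have "\<dots> = card {y. y < n \<and> a 8 y 0 \<noteq> 0} - 1" using x pos by (simp add: card_Diff_singleton)
    finally have "Suc ?h + card {y. y < n \<and> a' 8 y 0 \<noteq> 0} \<le> n"
      using inv h by (auto simp: hitinv_def)
    then have "hitinv M ps a'"
      using c' dead a' inv x by (auto simp: hitinv_def upd_apply less_Suc_eq)
    then show ?case using a' al x0 mono by (simp add: upd_apply)
  next
    case 9
    have "card {q \<in> alive M ?a. x \<in> ps q} = a 8 x 0" using cnt x by (simp add: cnt_ok_def alive_def upd_apply)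
    then show ?case by simp
  qed (use v len B1 S0 in \<open>auto simp: K_def\<close>)
  have "sp (St 11 (cell 12) (N 0) (V 16) ;; set_cell 12 (cell 12 \<oplus> N 1))
     (wp (For 18 (Ld 7 (V 16) (N 0)) ?body) (60 * ?len + (50 * l + 60) * a 8 x 0 + 20) ?Q) v a"
    using loop v S0 B1 h by (simp add: K_def upd_apply)
  then show ?thesis unfolding pick_code_def by (rule wp_sp_seq) simp
qed

lemma wv_greedy: "wv greedy_code \<subseteq> {12..}" "wa greedy_code = {8, 9, 11, 12}"
  using wv_pick by (auto simp: greedy_code_def)

text \<open>Potential of the whole greedy run. The list of a node is scanned only when the node is
  picked, after which its counter stays 0; a set is killed only once, at a cost proportional to
  \<open>l\<close>. The initial value is proportional to the total size of the sets.\<close>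

definition phi :: "nat \<Rightarrow> nat \<Rightarrow> (nat \<Rightarrow> nat) \<Rightarrow> arrs \<Rightarrow> nat" where
  "phi l M len a = 60 * (\<Sum>x | x < n \<and> a 8 x 0 \<noteq> 0. len x) + (50 * l + 60) * card (alive M a)"

lemma phi_pick:
  assumes cnt: "cnt_ok M ps a" and x: "x < n" "a 8 x 0 \<noteq> 0" and al: "alive M a' = alive M a - {q. x \<in> ps q}"
    and x0: "a' 8 x 0 = 0" and mono: "\<And>y. y < n \<Longrightarrow> a' 8 y 0 \<le> a 8 y 0"
  shows "60 * len x + (50 * l + 60) * a 8 x 0 + phi l M len a' \<le> phi l M len a"
    "card (alive M a') + a 8 x 0 = card (alive M a)"
proof -
  let ?Y = "{x. x < n \<and> a 8 x 0 \<noteq> 0}"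
  have "{y. y < n \<and> a' 8 y 0 \<noteq> 0} \<subseteq> ?Y - {x}" using mono x0 by fastforce
  then have "(\<Sum>y | y < n \<and> a' 8 y 0 \<noteq> 0. len y) \<le> (\<Sum>y\<in>?Y - {x}. len y)" by (intro sum_mono2) auto
  moreover have "(\<Sum>y\<in>?Y. len y) = len x + (\<Sum>y\<in>?Y - {x}. len y)" using x by (intro sum.remove) auto
  ultimately have 1: "len x + (\<Sum>y | y < n \<and> a' 8 y 0 \<noteq> 0. len y) \<le> (\<Sum>y\<in>?Y. len y)" by linarith
  have "alive M a = alive M a' \<union> {q \<in> alive M a. x \<in> ps q}" using al by auto
  moreover have "alive M a' \<inter> {q \<in> alive M a. x \<in> ps q} = {}" using al by auto
  ultimately have "card (alive M a) = card (alive M a') + card {q \<in> alive M a. x \<in> ps q}"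
    by (metis card_Un_disjoint finite_Un finite_alive)
  then show 2: "card (alive M a') + a 8 x 0 = card (alive M a)" using cnt x by (simp add: cnt_ok_def)
  have "60 * len x + 60 * (\<Sum>y | y < n \<and> a' 8 y 0 \<noteq> 0. len y) \<le> 60 * (\<Sum>y\<in>?Y. len y)" using 1 by linarith
  moreover have "(50 * l + 60) * a 8 x 0 + (50 * l + 60) * card (alive M a') = (50 * l + 60) * card (alive M a)"
    unfolding 2[symmetric] by (simp add: algebra_simps)
  ultimately show "60 * len x + (50 * l + 60) * a 8 x 0 + phi l M len a' \<le> phi l M len a"
    unfolding phi_def by linarith
qed

text \<open>Counts the incidences between nodes and live sets in two ways.\<close>

lemma hitinv_sum:
  assumes cnt: "cnt_ok M ps a" and ps: "\<And>q. q < M \<Longrightarrow> ps q \<subseteq> {..<n} \<and> card (ps q) = l"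
  shows "(\<Sum>x<n. a 8 x 0) = card (alive M a) * l"
proof -
  have "(\<Sum>x<n. a 8 x 0) = (\<Sum>x<n. card {q \<in> alive M a. x \<in> ps q})" using cnt by (simp add: cnt_ok_def)
  also have "\<dots> = (\<Sum>q\<in>alive M a. card (ps q))"
    by (rule double_count) (use ps in \<open>auto simp: alive_def\<close>)
  also have "\<dots> = card (alive M a) * l" using ps by (simp add: alive_def)
  finally show ?thesis .
qed

text \<open>Each pick kills at least \<open>th\<close> live sets. As all counters start below
  \<open>2 * th\<close>, double counting bounds the live sets times \<open>l\<close> by
  \<open>n * (2 * th)\<close>. So the picks of a phase, times \<open>l\<close>, are at most
  \<open>2 * n\<close>.\<close>

lemma wp_phase:
  assumes v: "v 6 = n" "v 11 = l" "v 14 = th" and l: "1 \<le> l" "l \<le> n" and th: "1 \<le> th"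
    and bt: "\<And>q. q < M \<Longrightarrow> inj_on (a 23 q) {..<l}" "\<And>q. q < M \<Longrightarrow> ps q = a 23 q ` {..<l}" "\<And>q. q < M \<Longrightarrow> ps q \<subseteq> {..<n} \<and> card (ps q) = l"
    and lst: "\<And>x. x < n \<Longrightarrow> a 6 x ` {..<a 7 x 0} = {q. q < M \<and> x \<in> ps q}" "\<And>x. x < n \<Longrightarrow> a 7 x 0 \<le> n * n"
    and inv: "hitinv M ps a" and lt: "\<And>x. x < n \<Longrightarrow> a 8 x 0 < 2 * th"
  shows "\<exists>t. wp (For 16 (V 6) (If (Less (Ld 8 (V 16) (N 0)) (V 14)) Skip pick_code)) t
    (\<lambda>v' a'. (hitinv M ps a' \<and> (\<forall>x<n. a' 8 x 0 < th) \<and> a' 12 0 0 * l \<le> a 12 0 0 * l + 2 * n) \<and>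
      t + phi l M (\<lambda>x. a 7 x 0) a' \<le> n * 150 + phi l M (\<lambda>x. a 7 x 0) a + 8) v a"
proof -
  let ?len = "\<lambda>x. a 7 x 0"
  let ?R = "\<lambda>a'. card (alive M a')"
  have B1: "1 < B" "n < B" using B_big n_le by linarith+
  have S0: "0 < S" using S_pos by auto
  let ?I = "\<lambda>i a'. hitinv M ps a' \<and> (\<forall>y<i. a' 8 y 0 < th) \<and> (\<forall>y<n. a' 8 y 0 \<le> a 8 y 0) \<and>
    (\<exists>p. a' 12 0 0 = a 12 0 0 + p \<and> p * th + ?R a' \<le> ?R a)"
  let ?pot = "\<lambda>i a'. (n - i) * 150 + phi l M ?len a'"
  let ?body = "If (Less (Ld 8 (V 16) (N 0)) (V 14)) Skip pick_code"
  have "\<exists>t. wp (For 16 (V 6) ?body) t (\<lambda>v' a'. (hitinv M ps a' \<and> (\<forall>x<n. a' 8 x 0 < th) \<and> a' 12 0 0 * l \<le> a 12 0 0 * l + 2 * n) \<and>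
      t + ?pot n a' \<le> ?pot 0 a + ecost (V 6) + 7) v a"
  proof (rule wp_for_pot[where n = n and I = ?I and pot = ?pot], goal_cases)
    case 5
    then show ?case using wv_pick by auto
  next
    case 6
    then show ?case using inv by simp
  next
    case (7 x v1 a1)
    have v1: "v1 6 = n" "v1 11 = l" "v1 14 = th" "v1 16 = x" using 7(3,5) v by auto
    have a1: "a1 6 = a 6" "a1 7 = a 7" "a1 23 = a 23" using 7(6) wv_pick by simp_all
    have pot_x: "(n - x) * 150 = (n - Suc x) * 150 + 150" using 7(1) by (simp add: Suc_diff_Suc[symmetric])
    show ?case
    proof (cases "a1 8 x 0 < th")
      case True
      let ?G = "\<lambda>(_ :: vars) a''. ?I (Suc x) a'' \<and> 30 + 10 + ?pot (Suc x) a'' \<le> ?pot x a1"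
      have "?G v1 a1" using 7(2) True pot_x by (auto simp: less_Suc_eq)
      then have "wp ?body 30 ?G v1 a1"
        by (intro wp_If[where ta = 0] wp_sp) (use True v1 S0 B1 in \<open>auto simp: K_def\<close>)
      then show ?thesis by blast
    next
      case False
      let ?t = "130 + 60 * a1 7 x 0 + (50 * l + 60) * a1 8 x 0"
      let ?G = "\<lambda>(_ :: vars) a''. ?I (Suc x) a'' \<and> ?t + 10 + ?pot (Suc x) a'' \<le> ?pot x a1"
      have pos: "a1 8 x 0 \<noteq> 0" using False th by auto
      have hi: "hitinv M ps a1" using 7(2) by simp
      have "wp pick_code (100 + 60 * a1 7 x 0 + (50 * l + 60) * a1 8 x 0) ?G v1 a1"
      proof (rule wp_conseq[OF wp_pick[where l = l and x = x and M = M and ps = ps]])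
        fix v2 :: vars and a2
        assume 2: "hitinv M ps a2 \<and> a2 12 0 0 = Suc (a1 12 0 0) \<and> alive M a2 = alive M a1 - {q. x \<in> ps q} \<and>
          a2 8 x 0 = 0 \<and> (\<forall>y<n. a2 8 y 0 \<le> a1 8 y 0)"
        have cnt: "cnt_ok M ps a1" using hi by (simp add: hitinv_def)
        have p1: "60 * a1 7 x 0 + (50 * l + 60) * a1 8 x 0 + phi l M ?len a2 \<le> phi l M ?len a1"
          using phi_pick(1)[where a' = a2 and len = ?len and l = l, OF cnt 7(1) pos] 2 a1 by simp
        have p2: "?R a2 + a1 8 x 0 = ?R a1" using phi_pick(2)[where a' = a2, OF cnt 7(1) pos] 2 by simp
        obtain p where p: "a1 12 0 0 = a 12 0 0 + p" "p * th + ?R a1 \<le> ?R a" using 7(2) by auto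
        have "a2 12 0 0 = a 12 0 0 + Suc p" using 2 p by simp
        moreover have "Suc p * th + ?R a2 \<le> ?R a" using p p2 False by simp
        ultimately have ex: "\<exists>p. a2 12 0 0 = a 12 0 0 + p \<and> p * th + ?R a2 \<le> ?R a" by blast
        have m: "\<And>y. y < n \<Longrightarrow> a2 8 y 0 \<le> a1 8 y 0" "\<And>y. y < n \<Longrightarrow> a1 8 y 0 \<le> a 8 y 0" "a2 8 x 0 = 0" using 2 7(2) by auto
        have m1: "a2 8 y 0 < th" if "y < Suc x" for y
        proof (cases "y = x")
          case True
          then show ?thesis using m(3) th by simp
        next
          case False
          then have "y < x" using that by simp
          then have "a1 8 y 0 < th" "y < n" using 7(1,2) by auto
          then show ?thesis using m(1)[of y] by linarith
        qed
        have m2: "a2 8 y 0 \<le> a 8 y 0" if "y < n" for y using m(1,2)[OF that] by linarith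
        have "?t + 10 + ?pot (Suc x) a2 \<le> ?pot x a1" using p1 pot_x by linarith
        then show "?G v2 a2" using 2 ex m1 m2 by blast
      qed (use v1 7(1) l bt lst a1 hi pos in auto)
      then have "wp ?body ?t ?G v1 a1"
        by (intro wp_If[where ta = "100 + 60 * a1 7 x 0 + (50 * l + 60) * a1 8 x 0"]) (use False v1 S0 B1 in \<open>auto simp: K_def\<close>)
      then show ?thesis by blast
    qed
  next
    case (8 v' a')
    then obtain p where p: "a' 12 0 0 = a 12 0 0 + p" "p * th \<le> ?R a" by auto
    have "?R a * l = (\<Sum>x<n. a 8 x 0)" using hitinv_sum[of M ps a l] inv bt(3) by (simp add: hitinv_def)
    also have "\<dots> \<le> (\<Sum>x<n. 2 * th)" using lt by (intro sum_mono less_imp_le) auto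
    finally have "?R a * l \<le> n * (2 * th)" by simp
    moreover have "p * th * l \<le> ?R a * l" using p(2) by (rule mult_right_mono) simp
    ultimately have "p * th * l \<le> n * (2 * th)" by linarith
    then have "th * (p * l) \<le> th * (2 * n)" by (simp add: algebra_simps)
    then have "p * l \<le> 2 * n" using th by simp
    then show ?case using 8(1) p(1) by (simp add: add_mult_distrib)
  qed (use v B1 in auto)
  then show ?thesis by (simp add: add_ac)
qed

lemma wp_greedy:
  assumes g: "glob v" "v 11 = l" and l: "1 \<le> l" "l \<le> n" and M: "M \<le> n * n"
    and bt: "\<And>q. q < M \<Longrightarrow> inj_on (a 23 q) {..<l}" "\<And>q. q < M \<Longrightarrow> ps q = a 23 q ` {..<l}" "\<And>q. q < M \<Longrightarrow> ps q \<subseteq> {..<n} \<and> card (ps q) = l"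
    and lst: "\<And>x. x < n \<Longrightarrow> a 6 x ` {..<a 7 x 0} = {q. q < M \<and> x \<in> ps q}" "\<And>x. x < n \<Longrightarrow> a 7 x 0 = card {q. q < M \<and> x \<in> ps q}"
    and init: "\<And>q. q < M \<Longrightarrow> a 9 q 0 = 1" "\<And>x. x < n \<Longrightarrow> a 8 x 0 = a 7 x 0" "a 12 0 0 = 0"
  shows "wp greedy_code ((2 * L + 1) * (n * 200) + 170 * (M * l) + 100)
    (\<lambda>v' a'. (\<forall>q<M. \<exists>i<a' 12 0 0. a' 11 i 0 \<in> ps q) \<and> (\<forall>i<a' 12 0 0. a' 11 i 0 < n) \<and> a' 12 0 0 \<le> n \<and>
      a' 12 0 0 * l \<le> (2 * L + 1) * (2 * n)) v a"
proof -
  have B1: "1 < B" "n < B" "4 * (n * n) < B" "2 * L + 1 < B" using B_big n_le L by linarith+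
  have S0: "0 < S" using S_pos by auto
  have gv: "v 6 = n" "v 4 = L" using g by (auto simp: glob_def)
  have al: "alive M a = {..<M}" using init(1) by (auto simp: alive_def)
  have cle: "card {q. q < M \<and> x \<in> ps q} \<le> M" for x
    using card_mono[of "{..<M}" "{q. q < M \<and> x \<in> ps q}"] by auto
  have len_le: "a 7 x 0 \<le> n * n" if "x < n" for x using lst(2)[OF that] cle[of x] M by linarith
  have cnt: "cnt_ok M ps a" using init(2) lst(2) al by (simp add: cnt_ok_def)
  have hi: "hitinv M ps a"
  proof -
    have "card {x. x < n \<and> a 8 x 0 \<noteq> 0} \<le> card {..<n}" by (intro card_mono) auto
    then show ?thesis using cnt init(3) al by (auto simp: hitinv_def)
  qed
  have p2: "(2::nat) ^ (2 * L) = 2 ^ L * 2 ^ L" by (simp add: mult_2 power_add)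
  have nL: "n * n \<le> 2 ^ (2 * L)" unfolding p2 by (rule mult_le_mono[OF L2(1) L2(1)])
  have "(2::nat) ^ L * 2 ^ L \<le> (2 * n) * (2 * n)" using L2(2) by (intro mult_le_mono) auto
  then have pB: "(2::nat) ^ (2 * L) < B" unfolding p2 using B1 by linarith
  let ?len = "\<lambda>x. a 7 x 0"
  let ?P = "2 * L + 1"
  let ?pot = "\<lambda>j a'. (?P - j) * (n * 150 + 60) + phi l M ?len a'"
  let ?I = "\<lambda>j a'. hitinv M ps a' \<and> (\<forall>x<n. a' 8 x 0 < 2 ^ (?P - j)) \<and> a' 12 0 0 * l \<le> j * (2 * n)"
  have phi0: "phi l M ?len a \<le> 170 * (M * l)"
  proof -
    have "(\<Sum>x | x < n \<and> a 8 x 0 \<noteq> 0. ?len x) \<le> (\<Sum>x<n. ?len x)" by (intro sum_mono2) auto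
    also have "\<dots> = (\<Sum>x<n. a 8 x 0)" using init(2) by simp
    also have "\<dots> = M * l" using hitinv_sum[OF cnt, of l] bt(3) al by simp
    finally have "phi l M ?len a \<le> 60 * (M * l) + (50 * l + 60) * M" using al by (simp add: phi_def)
    also have "(50 * l + 60) * M \<le> 110 * (M * l)"
    proof -
      have "M \<le> M * l" using l by simp
      moreover have "(50 * l + 60) * M = 50 * (M * l) + 60 * M" by (simp add: algebra_simps)
      ultimately show ?thesis by linarith
    qed
    finally show ?thesis by linarith
  qed
  show ?thesis unfolding greedy_code_def
  proof (rule wp_for[where n = ?P and I = ?I and pot = ?pot], goal_cases)
    case 5
    then show ?case using wv_pick by auto
  next
    case 6
    have "a 8 x 0 < 2 ^ (?P - 0)" if "x < n" for x
    proof -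
      \<comment> \<open>There are at most \<open>n * n \<le> 2 ^ (2 * L)\<close> sets, so all
        counters are below twice the first threshold.\<close>
      have "a 8 x 0 \<le> 2 ^ (2 * L)" using init(2)[OF that] len_le[OF that] nL by linarith
      also have "\<dots> < 2 ^ (?P - 0)" by simp
      finally show ?thesis .
    qed
    then show ?case using hi init(3) by simp
  next
    case (7 j v1 a1)
    let ?th = "(2::nat) ^ (2 * L - j)"
    have j: "?P - j = Suc (2 * L - j)" "?P - Suc j = 2 * L - j" using 7(1) by auto
    have v1: "v1 6 = n" "v1 11 = l" "v1 12 = j" "v1 4 = L" using 7(3,5) gv g by auto
    have a1: "a1 6 = a 6" "a1 7 = a 7" "a1 23 = a 23" using 7(6) wv_pick by simp_all
    have thB: "?th < B"
    proof -
      have "?th \<le> 2 ^ (2 * L)" by (rule power_increasing) auto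
      then show ?thesis using pB by linarith
    qed
    have "\<exists>t. wp (For 16 (V 6) (If (Less (Ld 8 (V 16) (N 0)) (V 14)) Skip pick_code)) t
      (\<lambda>v' a'. (hitinv M ps a' \<and> (\<forall>x<n. a' 8 x 0 < ?th) \<and> a' 12 0 0 * l \<le> a1 12 0 0 * l + 2 * n) \<and>
      t + phi l M (\<lambda>x. a1 7 x 0) a' \<le> n * 150 + phi l M (\<lambda>x. a1 7 x 0) a1 + 8) (v1(14 := ?th)) a1"
      by (rule wp_phase) (use v1 l bt lst len_le a1 7(2) j in auto)
    then obtain t where t: "wp (For 16 (V 6) (If (Less (Ld 8 (V 16) (N 0)) (V 14)) Skip pick_code)) t
      (\<lambda>v' a'. (hitinv M ps a' \<and> (\<forall>x<n. a' 8 x 0 < ?th) \<and> a' 12 0 0 * l \<le> a1 12 0 0 * l + 2 * n) \<and>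
      t + phi l M (\<lambda>x. a1 7 x 0) a' \<le> n * 150 + phi l M (\<lambda>x. a1 7 x 0) a1 + 8) (v1(14 := ?th)) a1" by blast
    let ?G = "\<lambda>(_ :: vars) a''. ?I (Suc j) a'' \<and> (t + 20) + 10 + ?pot (Suc j) a'' \<le> ?pot j a1"
    have "wp (For 16 (V 6) (If (Less (Ld 8 (V 16) (N 0)) (V 14)) Skip pick_code)) t ?G (v1(14 := ?th)) a1"
    proof (rule wp_conseq[OF t])
      fix v2 :: vars and a2
      assume 2: "(hitinv M ps a2 \<and> (\<forall>x<n. a2 8 x 0 < ?th) \<and> a2 12 0 0 * l \<le> a1 12 0 0 * l + 2 * n) \<and>
        t + phi l M (\<lambda>x. a1 7 x 0) a2 \<le> n * 150 + phi l M (\<lambda>x. a1 7 x 0) a1 + 8"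
      have "(?P - j) * (n * 150 + 60) = (?P - Suc j) * (n * 150 + 60) + (n * 150 + 60)" unfolding j by simp
      then have "(t + 20) + 10 + ?pot (Suc j) a2 \<le> ?pot j a1" using 2 a1 by simp
      moreover have "a2 12 0 0 * l \<le> Suc j * (2 * n)" using 2 7(2) by simp
      ultimately show "?G v2 a2" using 2 j by simp
    qed simp
    then have "sp (14 ::= Op Shl (N 1) ((V 4 \<oplus> V 4) \<ominus> V 12))
      (wp (For 16 (V 6) (If (Less (Ld 8 (V 16) (N 0)) (V 14)) Skip pick_code)) t ?G) v1 a1"
      using v1 thB B1 by (simp add: push_bit_eq_mult mult_2)
    then have "wp (14 ::= Op Shl (N 1) ((V 4 \<oplus> V 4) \<ominus> V 12) ;;
      For 16 (V 6) (If (Less (Ld 8 (V 16) (N 0)) (V 14)) Skip pick_code)) (t + 20) ?G v1 a1"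
      by (rule wp_sp_seq) simp
    then show ?case by blast
  next
    case (8 v' a')
    \<comment> \<open>The last threshold is 1, so all counters are now 0; as every set is nonempty,
      none can be live.\<close>
    have z: "a' 8 x 0 = 0" if "x < n" for x using 8(1) that by auto
    have inv: "hitinv M ps a'" using 8(1) by simp
    have "q \<notin> alive M a'" if q: "q < M" for q
    proof
      assume qa: "q \<in> alive M a'"
      have "ps q \<noteq> {}" using bt(3)[OF q] l by auto
      then obtain x where x: "x \<in> ps q" "x < n" using bt(3)[OF q] by auto
      then have "{q \<in> alive M a'. x \<in> ps q} \<noteq> {}" using qa by auto
      then have "0 < card {q \<in> alive M a'. x \<in> ps q}" by (auto simp: card_gt_0_iff)
      moreover have "a' 8 x 0 = card {q \<in> alive M a'. x \<in> ps q}"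
        using inv x(2) unfolding hitinv_def cnt_ok_def by blast
      ultimately show False using z[OF x(2)] by linarith
    qed
    then show ?case using 8(1) unfolding hitinv_def by auto
  next
    case 9
    have "(2 * L + 1) * (n * 150 + 60) \<le> (2 * L + 1) * (n * 200)" using n3 by (intro mult_left_mono) auto
    then show ?case using phi0 by simp
  qed (use gv B1 in auto)
qed

end

section \<open>Exact distances and hubs\<close>

text \<open>Array 8 starts as a copy of array 7: it counts the live sets through a node and
  decreases, while array 7 stays the length of the list in array 6.\<close>

definition hit_code :: com where
  "hit_code =
     (For 12 (V 6) (St 7 (V 12) (N 0) (N 0)) ;;
      (set_cell 10 (N 0) ;; set_cell 12 (N 0)) ;;
      build_code ;;
      For 12 (V 6) (St 8 (V 12) (N 0) (Ld 7 (V 12) (N 0))) ;;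
      greedy_code ;;
      For 12 (cell 12) (St 2 (V 12) (N 0) (Ld 11 (V 12) (N 0))) ;;
      set_cell 3 (cell 12))"

text \<open>All that is used of a graph. The value \<open>n\<close> stands for an infinite distance,
  and \<open>d_split\<close> supplies a node at every intermediate position of a shortest
  path.\<close>

locale hop_metric =
  fixes n :: nat and d :: "nat \<Rightarrow> nat \<Rightarrow> nat"
  assumes d_refl: "u < n \<Longrightarrow> d u u = 0" and d_le: "d u v \<le> n"
    and d_tri: "u < n \<Longrightarrow> w < n \<Longrightarrow> v < n \<Longrightarrow> d u v \<le> d u w + d w v"
    and d_split: "u < n \<Longrightarrow> v < n \<Longrightarrow> d u v < n \<Longrightarrow> t \<le> d u v \<Longrightarrow> \<exists>w<n. d u w = t \<and> d w v = d u v - t"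
begin

definition exact :: "nat \<Rightarrow> (nat \<Rightarrow> nat \<Rightarrow> nat) \<Rightarrow> bool" where
  "exact r D \<longleftrightarrow> (\<forall>u<n. \<forall>v<n. d u v \<le> D u v \<and> D u v \<le> n \<and> (d u v \<le> r \<longrightarrow> D u v = d u v))"

definition bridge :: "nat \<Rightarrow> nat set \<Rightarrow> bool" where
  "bridge g H \<longleftrightarrow> H \<subseteq> {..<n} \<and> (\<forall>u<n. \<forall>v<n. d u v < n \<longrightarrow> g \<le> d u v \<longrightarrow>
     (\<exists>s\<in>H. d u s \<le> g \<and> d u s + d s v = d u v))"

lemma exact_mono: "exact r D \<Longrightarrow> r' \<le> r \<Longrightarrow> exact r' D"
  unfolding exact_def by fastforce

lemma exactD: "exact r D \<Longrightarrow> u < n \<Longrightarrow> v < n \<Longrightarrow> D u v \<le> r \<Longrightarrow> D u v = d u v"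
  unfolding exact_def by (meson le_trans)

lemma bridge_mono: "bridge g H \<Longrightarrow> g \<le> g' \<Longrightarrow> bridge g' H"
  unfolding bridge_def by (meson le_trans)

text \<open>The source itself is a hub on the path; this allows starting with all nodes as
  hubs.\<close>

lemma bridge_all: "bridge g {..<n}"
  unfolding bridge_def using d_refl by (auto intro!: bexI)

text \<open>Let \<open>r < d u v \<le> 2 * r - g\<close>. Walk \<open>r - g\<close> along a shortest
  path to \<open>w\<close>. A hub at most \<open>g\<close> further on is within \<open>r\<close> of
  \<open>u\<close>, and at most \<open>d u v - (r - g) \<le> r\<close> remains from it to
  \<open>v\<close>. Both parts are already exact, so the product finds their sum. A cap of
  \<open>n - 1\<close> excludes no finite distance.\<close>

lemma prod_exact:
  assumes ex: "exact r D" and br: "bridge g H" and g: "g \<le> r" and cap: "min r (n - 1) \<le> cap"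
    and D': "\<And>u v. u < n \<Longrightarrow> v < n \<Longrightarrow> D' u v \<le> D u v \<and>
       (\<forall>s\<in>H. D u s \<le> cap \<longrightarrow> D s v \<le> cap \<longrightarrow> D' u v \<le> D u s + D s v) \<and>
       (D' u v = D u v \<or> (\<exists>s\<in>H. D' u v = D u s + D s v))"
  shows "exact (2 * r - g) D'"
  unfolding exact_def
proof (intro allI impI)
  fix u v assume u: "u < n" and v: "v < n"
  have Hn: "s \<in> H \<Longrightarrow> s < n" for s using br by (auto simp: bridge_def)
  have ge: "d u v \<le> D u v" "D u v \<le> n" "\<And>u v. u < n \<Longrightarrow> v < n \<Longrightarrow> d u v \<le> D u v"
    using ex u v by (auto simp: exact_def)
  have 1: "d u v \<le> D' u v"
  proof -
    consider "D' u v = D u v" | s where "s \<in> H" "D' u v = D u s + D s v" using D'[OF u v] by auto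
    then show ?thesis
    proof cases
      case 2
      have "d u v \<le> d u s + d s v" using d_tri[OF u Hn[OF 2(1)] v] .
      also have "\<dots> \<le> D u s + D s v" using ge(3)[OF u Hn[OF 2(1)]] ge(3)[OF Hn[OF 2(1)] v] by simp
      finally show ?thesis using 2 by simp
    qed (use ge in simp)
  qed
  have 2: "D' u v \<le> n" using D'[OF u v] ge by linarith
  have 3: "D' u v = d u v" if le: "d u v \<le> 2 * r - g"
  proof -
    consider "d u v \<le> r" | "d u v = n" | "r < d u v" "d u v < n" using d_le[of u v] by linarith
    then have "D' u v \<le> d u v"
    proof cases
      case 1
      then have "D u v = d u v" using ex u v by (simp add: exact_def)
      then show ?thesis using D'[OF u v] by linarith
    next
      case 2
      then show ?thesis using \<open>D' u v \<le> n\<close> by simp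
    next
      case 3
      define x where "x = r - g"
      have x: "x \<le> d u v" using 3 by (simp add: x_def)
      obtain w where w: "w < n" "d u w = x" "d w v = d u v - x" using d_split[OF u v 3(2) x] by auto
      have "g \<le> d w v" "d w v < n" using w 3 g by (auto simp: x_def)
      then obtain s where s: "s \<in> H" "d w s \<le> g" "d w s + d s v = d w v" using br w(1) v unfolding bridge_def by blast
      have sn: "s < n" using Hn s by simp
      have a1: "d u s \<le> x + d w s" using d_tri[OF u w(1) sn] w by simp
      have a2: "d u v \<le> d u s + d s v" by (rule d_tri[OF u sn v])
      have sum: "d u s + d s v = d u v" using a1 a2 s(3) w x by linarith
      have us: "d u s \<le> r" using a1 s(2) g by (simp add: x_def)
      have sv: "d s v \<le> r" using s(3) w le g 3 by (simp add: x_def)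
      have D: "D u s = d u s" "D s v = d s v" using ex us sv u v sn by (auto simp: exact_def)
      have "d u s \<le> n - 1" "d s v \<le> n - 1" using sum 3(2) by linarith+
      then have "D u s \<le> cap" "D s v \<le> cap" using D us sv cap by auto
      then have "D' u v \<le> D u s + D s v" using D'[OF u v] s(1) by blast
      then show ?thesis using D sum by simp
    qed
    then show ?thesis using 1 by simp
  qed
  show "d u v \<le> D' u v \<and> D' u v \<le> n \<and> (d u v \<le> 2 * r - g \<longrightarrow> D' u v = d u v)"
    using 1 2 3 by blast
qed

lemma walk_bounds:
  assumes p: "\<And>t. t \<le> l \<Longrightarrow> p t < n" "\<And>t. t < l \<Longrightarrow> d (p t) (p (Suc t)) \<le> 1" and t: "t \<le> l"
  shows "d (p 0) (p t) \<le> t" "d (p t) (p l) \<le> l - t"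
proof -
  show "d (p 0) (p t) \<le> t" using t
  proof (induction t)
    case 0
    then show ?case using d_refl p(1)[of 0] by simp
  next
    case (Suc t)
    then have "d (p 0) (p (Suc t)) \<le> d (p 0) (p t) + d (p t) (p (Suc t))" by (intro d_tri p) auto
    then show ?case using Suc p(2)[of t] by simp
  qed
  have "d (p (l - k)) (p l) \<le> k" if "k \<le> l" for k using that
  proof (induction k)
    case 0
    then show ?case using d_refl p(1)[of l] by simp
  next
    case (Suc k)
    then have e: "l - k = Suc (l - Suc k)" by simp
    have "d (p (l - Suc k)) (p l) \<le> d (p (l - Suc k)) (p (l - k)) + d (p (l - k)) (p l)" by (intro d_tri p) auto
    moreover have "d (p (l - Suc k)) (p (l - k)) \<le> 1" using p(2)[of "l - Suc k"] Suc.prems e by simp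
    ultimately show ?case using Suc by simp
  qed
  from this[of "l - t"] t show "d (p t) (p l) \<le> l - t" by simp
qed

text \<open>A repeated node would allow a shortcut, against the distance \<open>l\<close> between
  the ends.\<close>

lemma walk_inj:
  assumes p: "\<And>t. t \<le> l \<Longrightarrow> p t < n" "\<And>t. t < l \<Longrightarrow> d (p t) (p (Suc t)) \<le> 1" and l: "d (p 0) (p l) = l"
  shows "inj_on p {..<l}"
proof -
  have "p t \<noteq> p t'" if "t < t'" "t' < l" for t t'
  proof
    assume e: "p t = p t'"
    have "d (p 0) (p l) \<le> d (p 0) (p t) + d (p t') (p l)" using d_tri[OF p(1)[of 0] p(1)[of t] p(1)[of l]] that e by simp
    also have "\<dots> \<le> t + (l - t')" using walk_bounds[where l = l and p = p, OF p] that by (intro add_mono) auto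
    also have "\<dots> < l" using that by simp
    finally show False using l by simp
  qed
  then show ?thesis unfolding inj_on_def by (metis lessThan_iff linorder_neqE_nat)
qed

text \<open>On the way from \<open>u\<close> to \<open>v\<close> an old hub \<open>s\<close> is met
  within distance \<open>g\<close>. Let \<open>y\<close> be \<open>l\<close> steps further on a
  shortest path from \<open>s\<close> to \<open>v\<close>. The recorded path from \<open>s\<close>
  to \<open>y\<close> has length \<open>l\<close>, so replacing that stretch by it keeps the path
  shortest; the new hub on it is within \<open>g + l\<close> of \<open>u\<close>.\<close>

lemma bridge_step:
  assumes br: "bridge g H" and ex: "exact r D" and l: "l \<le> r" and H': "H' \<subseteq> {..<n}"
    and hit: "\<And>x y. x \<in> H \<Longrightarrow> y < n \<Longrightarrow> D x y = l \<Longrightarrow> \<exists>p. p 0 = x \<and> p l = y \<and> (\<forall>t\<le>l. p t < n) \<and>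
       (\<forall>t<l. D (p t) (p (Suc t)) = 1) \<and> (\<exists>t<l. p t \<in> H')"
  shows "bridge (g + l) H'"
  unfolding bridge_def
proof (intro conjI allI impI H')
  fix u v assume u: "u < n" and v: "v < n" and fin: "d u v < n" and ge: "g + l \<le> d u v"
  obtain w where w: "w < n" "d u w = g" "d w v = d u v - g" using d_split[OF u v fin, of g] ge by auto
  obtain s where s: "s \<in> H" "d u s \<le> g" "d u s + d s w = g"
    using br u w(1,2) fin ge unfolding bridge_def by (metis add_leE le_less_trans le_refl)
  have sn: "s < n" using br s(1) by (auto simp: bridge_def)
  have "d s v \<le> d s w + d w v" by (rule d_tri[OF sn w(1) v])
  moreover have "d u v \<le> d u s + d s v" by (rule d_tri[OF u sn v])
  ultimately have sv: "d u s + d s v = d u v" using s(3) w ge by linarith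
  then have lsv: "l \<le> d s v" "d s v < n" using s(2) ge fin by linarith+
  obtain y where y: "y < n" "d s y = l" "d y v = d s v - l" using d_split[OF sn v lsv(2,1)] by auto
  have "D s y = l" using ex sn y l by (simp add: exact_def)
  from hit[OF s(1) y(1) this] obtain p t where p: "p 0 = s" "p l = y" "\<forall>t\<le>l. p t < n"
    "\<forall>t<l. D (p t) (p (Suc t)) = 1" and t: "t < l" "p t \<in> H'" by blast
  have "d (p t') (p (Suc t')) \<le> 1" if "t' < l" for t'
  proof -
    have "d (p t') (p (Suc t')) \<le> D (p t') (p (Suc t'))" using ex p(3) that by (simp add: exact_def)
    then show ?thesis using p(4) that by simp
  qed
  note wb = walk_bounds[of l p, OF _ this]
  have b: "d s (p t) \<le> t" "d (p t) y \<le> l - t" using wb[of t] p t by auto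
  have pn: "p t < n" using p(3) t by simp
  have "d u (p t) \<le> d u s + d s (p t)" by (rule d_tri[OF u sn pn])
  moreover have "d (p t) v \<le> d (p t) y + d y v" by (rule d_tri[OF pn y(1) v])
  moreover have "d u v \<le> d u (p t) + d (p t) v" by (rule d_tri[OF u pn v])
  ultimately have "d u (p t) \<le> g + l" "d u (p t) + d (p t) v = d u v"
    using b sv y lsv s(2) t(1) by linarith+
  then show "\<exists>s\<in>H'. d u s \<le> g + l \<and> d u s + d s v = d u v" using t(2) by blast
qed

end

section \<open>Replacing the hubs by a hitting set\<close>

context aeL
begin

lemma wv_hit: "wv hit_code \<subseteq> {12..}" "wa hit_code \<subseteq> {2, 3, 6, 7, 8, 9, 10, 11, 12, 23}"
  using wv_build wv_greedy by (fastforce simp: hit_code_def)+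

text \<open>The leading cost term comes from the total size of the sets, the other one from the
  \<open>2 * L + 1\<close> scans over the nodes.\<close>

theorem wp_hit:
  assumes g: "glob v" "v 9 = e" "v 11 = l" and l: "l = 2 ^ e" "l \<le> n" and md: "mids e a" and wf: "wf_state a"
    and inj: "\<And>p x y. x < n \<Longrightarrow> y < n \<Longrightarrow> good l a p x y \<Longrightarrow> a 5 x y = l \<Longrightarrow> inj_on p {..<l}"
  shows "wp hit_code (1100 * (a 3 0 0 * (n * l)) + 1100 * (n * L)) (\<lambda>v' a'. wf_state a' \<and>
    a' 3 0 0 * l \<le> 2 * (n * (2 * L + 1)) \<and>
    (\<forall>x\<in>Hset a. \<forall>y<n. a 5 x y = l \<longrightarrow> (\<exists>p. good l a p x y \<and> (\<exists>t<l. p t \<in> Hset a')))) v a"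
proof -
  let ?h = "a 3 0 0"
  have h: "?h \<le> n" "\<And>i. i < ?h \<Longrightarrow> a 2 i 0 < n" using wf by (auto simp: wf_state_def)
  have B1: "1 < B" "n < B" "0 < B" using B_big n_le by linarith+
  have S0: "0 < S" "n < S" using S_pos by auto
  have gv: "v 6 = n" "v 4 = L" using g by (auto simp: glob_def)
  have l1: "1 \<le> l" using l by simp
  define Q where "Q = (\<lambda>(v' :: vars) a'. wf_state a' \<and> a' 3 0 0 * l \<le> 2 * (n * (2 * L + 1)) \<and>
    (\<forall>x\<in>Hset a. \<forall>y<n. a 5 x y = l \<longrightarrow> (\<exists>p. good l a p x y \<and> (\<exists>t<l. p t \<in> Hset a'))))"
  let ?c7 = "For 12 (cell 12) (St 2 (V 12) (N 0) (Ld 11 (V 12) (N 0))) ;; set_cell 3 (cell 12)"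
  let ?t7 = "n * 40 + 100"
  let ?c6 = "greedy_code ;; ?c7"
  let ?t6 = "((2 * L + 1) * (n * 200) + 170 * ((?h * n) * l) + 100) + ?t7"
  let ?c5 = "For 12 (V 6) (St 8 (V 12) (N 0) (Ld 7 (V 12) (N 0))) ;; ?c6"
  let ?t5 = "(n * 40 + 8) + ?t6"
  let ?c4 = "build_code ;; ?c5"
  let ?t4 = "(900 * (?h * (n * l)) + 100) + ?t5"
  have s7: "wp ?c7 ?t7 Q v7 a7"
    if g7: "\<forall>q<M. \<exists>i<a7 12 0 0. a7 11 i 0 \<in> ps q" "\<forall>i<a7 12 0 0. a7 11 i 0 < n" "a7 12 0 0 \<le> n" "a7 12 0 0 * l \<le> (2 * L + 1) * (2 * n)"
      and cov: "\<And>x y. x \<in> Hset a \<Longrightarrow> y < n \<Longrightarrow> a 5 x y = l \<Longrightarrow> \<exists>q<M. \<exists>p. good l a p x y \<and> ps q = p ` {..<l}"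
      and a7: "a7 5 = a 5" for v7 a7 M ps
  proof (rule wp_seq_frame[where ta = "n * 40 + 20" and tb = 60, OF wp_for_const[where n = "a7 12 0 0" and t = 30 and
        I = "\<lambda>i a'. \<forall>j<i. a' 2 j 0 = a7 11 j 0" and Q = "\<lambda>_ a'. \<forall>j<a7 12 0 0. a' 2 j 0 = a7 11 j 0"]], goal_cases)
    case (7 i v1 a1)
    have a1: "a1 11 = a7 11" using 7(6) by simp
    have v1: "v1 12 = i" by (rule 7(3))
    show ?case
    proof (rule wp_sp, goal_cases)
      case 1
      show ?case using 7(2) v1 S0 B1 a1 by (auto simp: K_def upd_apply less_Suc_eq)
    qed simp
  next
    case (10 v1 a1)
    let ?a = "upd a1 3 0 0 (a7 12 0 0)"
    have a1: "a1 12 = a7 12" "a1 5 = a 5" using 10(3) a7 by simp_all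
    have H: "Hset ?a = {a7 11 i 0 | i. i < a7 12 0 0}" using 10(1) by (auto simp: Hset_def upd_apply) metis
    have "wf_state ?a" using g7 10(1) wf a1 by (auto simp: wf_state_def upd_apply)
    moreover have "?a 3 0 0 * l \<le> 2 * (n * (2 * L + 1))" using g7(4) by (simp add: upd_apply algebra_simps)
    moreover have "\<exists>p. good l a p x y \<and> (\<exists>t<l. p t \<in> Hset ?a)" if xy: "x \<in> Hset a" "y < n" "a 5 x y = l" for x y
    proof -
      obtain q p where q: "q < M" "good l a p x y" "ps q = p ` {..<l}" using cov[OF xy] by blast
      then obtain i where "i < a7 12 0 0" "a7 11 i 0 \<in> p ` {..<l}" using g7(1) by metis
      then have "\<exists>t<l. p t \<in> Hset ?a" unfolding H by force
      then show ?thesis using q(2) by blast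
    qed
    ultimately have "Q v1 ?a" unfolding Q_def by blast
    then have "sp (set_cell 3 (cell 12)) Q v1 a1" using S0 B1 a1 unfolding Q_def by (simp add: K_def)
    then show ?case by (rule wp_sp) simp
  qed (use g7 B1 S0 in \<open>auto simp: K_def\<close>)
  have s4: "wp ?c4 ?t4 Q v4 a4"
    if v4: "\<And>z. z < 12 \<Longrightarrow> v4 z = v z" and a4: "\<And>k'. k' \<notin> {7, 10, 12} \<Longrightarrow> a4 k' = a k'"
      and i4: "a4 10 0 0 = 0" "a4 12 0 0 = 0" "\<And>x. x < n \<Longrightarrow> a4 7 x 0 = 0" for v4 a4
  proof (rule wp_seq_frame[where tb = ?t5, OF wp_build[where e = e and l = l]])
    have gd: "good l a4 = good l a" using a4[of 5] by (simp add: good_def fun_eq_iff)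
    show "mids e a4" using md a4[of 5] a4[of 4] unfolding mids_def mid_wit_def by simp
    show "wf_state a4" using wf a4[of 5] a4[of 2] a4[of 3] by (simp add: wf_state_def)
    show "\<And>p x y. x < n \<Longrightarrow> y < n \<Longrightarrow> good l a4 p x y \<Longrightarrow> a4 5 x y = l \<Longrightarrow> inj_on p {..<l}"
      using inj gd a4[of 5] by simp
    show "900 * (a4 3 0 0 * (n * l)) + 100 + ?t5 \<le> ?t4" using a4[of 3] by simp
    fix v5 a5 assume b: "built l a5 \<and> nsets a5 \<le> a4 3 0 0 * n \<and> (\<forall>i<a4 3 0 0. \<forall>y<n. covers l a4 i y a5)"
      and f5: "\<And>x. x \<notin> wv build_code \<Longrightarrow> v5 x = v4 x" "\<And>k'. k' \<notin> wa build_code \<Longrightarrow> a5 k' = a4 k'"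
    have v5: "z < 12 \<Longrightarrow> v5 z = v z" for z using f5(1)[of z] v4[of z] wv_build(1) by fastforce
    have a5: "k' \<notin> {6, 7, 9, 10, 12, 23} \<Longrightarrow> a5 k' = a k'" "a5 12 = a4 12" for k'
    proof -
      have "12 \<notin> wa build_code" "k' \<notin> {6, 7, 9, 10, 23} \<Longrightarrow> k' \<notin> wa build_code" using wv_build(2) by auto
      then show "k' \<notin> {6, 7, 9, 10, 12, 23} \<Longrightarrow> a5 k' = a k'" "a5 12 = a4 12"
        using f5(2) a4[of k'] by auto
    qed
    define M where "M = nsets a5"
    define ps where "ps q = pset l a5 q" for q
    have Mle: "M \<le> ?h * n" using b a4[of 3] by (simp add: M_def)
    have Mn: "M \<le> n * n" using Mle mult_le_mono1[OF h(1), of n] by linarith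
    have bt: "\<And>q. q < M \<Longrightarrow> inj_on (a5 23 q) {..<l}" "\<And>q. q < M \<Longrightarrow> ps q = a5 23 q ` {..<l}"
      "\<And>q. q < M \<Longrightarrow> ps q \<subseteq> {..<n} \<and> card (ps q) = l"
      using b by (auto simp: built_def M_def ps_def pset_def card_image)
    have lst: "\<And>x. x < n \<Longrightarrow> a5 6 x ` {..<a5 7 x 0} = {q. q < M \<and> x \<in> ps q}"
      "\<And>x. x < n \<Longrightarrow> a5 7 x 0 = card {q. q < M \<and> x \<in> ps q}" "\<And>q. q < M \<Longrightarrow> a5 9 q 0 = 1"
      using b unfolding built_def M_def ps_def by blast+
    have cov: "\<exists>q<M. \<exists>p. good l a p x y \<and> ps q = p ` {..<l}" if hxy: "x \<in> Hset a" "y < n" "a 5 x y = l" for x y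
    proof -
      obtain i where i: "i < ?h" "x = a 2 i 0" using hxy(1) by (auto simp: Hset_def)
      then have "covers l a4 i y a5" using b a4[of 3] hxy(2) by simp
      then have "\<exists>q<M. good l a (a5 23 q) x y" using i hxy(3) a4[of 5] a4[of 2] gd by (simp add: covers_def M_def)
      then show ?thesis by (auto simp: ps_def pset_def)
    qed
    have v56: "v5 6 = n" using v5[of 6] gv by simp
    show "wp ?c5 ?t5 Q v5 a5"
    proof (rule wp_seq_frame[where ta = "n * 40 + 8" and tb = ?t6, OF wp_for_const[where n = n and t = 30 and
          I = "\<lambda>i a'. \<forall>j<i. a' 8 j 0 = a5 7 j 0" and Q = "\<lambda>_ a'. \<forall>j<n. a' 8 j 0 = a5 7 j 0"]], goal_cases)
      case (7 i v1 a1)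
      have a1: "a1 7 = a5 7" using 7(6) by simp
      show ?case
      proof (rule wp_sp, goal_cases)
        case 1
        show ?case using 7(2,3) S0 B1 a1 by (auto simp: K_def upd_apply less_Suc_eq)
      qed simp
    next
      case (10 v6 a6)
      have v6: "z < 12 \<Longrightarrow> v6 z = v z" for z using 10(2)[of z] v5[of z] by simp
      have a6: "k' \<noteq> 8 \<Longrightarrow> a6 k' = a5 k'" for k' using 10(3)[of k'] by simp
      show ?case
      proof (rule wp_seq_frame[where tb = ?t7, OF wp_greedy[where l = l and M = M and ps = ps]])
        fix v7 a7 assume 7: "(\<forall>q<M. \<exists>i<a7 12 0 0. a7 11 i 0 \<in> ps q) \<and> (\<forall>i<a7 12 0 0. a7 11 i 0 < n) \<and>
          a7 12 0 0 \<le> n \<and> a7 12 0 0 * l \<le> (2 * L + 1) * (2 * n)"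
          and f7: "\<And>k'. k' \<notin> wa greedy_code \<Longrightarrow> a7 k' = a6 k'"
        have "a7 5 = a 5" using f7[of 5] wv_greedy(2) a6[of 5] a5(1)[of 5] by simp
        note a75 = this
        have c: "\<forall>q<M. \<exists>i<a7 12 0 0. a7 11 i 0 \<in> ps q" "\<forall>i<a7 12 0 0. a7 11 i 0 < n"
          "a7 12 0 0 \<le> n" "a7 12 0 0 * l \<le> (2 * L + 1) * (2 * n)" using 7 by blast+
        show "wp ?c7 ?t7 Q v7 a7" by (rule s7[OF c cov a75])
      next
        have "170 * (M * l) \<le> 170 * ((?h * n) * l)" using Mle by (intro mult_left_mono mult_right_mono) auto
        then show "(2 * L + 1) * (n * 200) + 170 * (M * l) + 100 + ?t7 \<le> ?t6" by linarith
      next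
        show "glob v6" "v6 11 = l" using g v6 by (auto simp: glob_def)
      qed (use l1 l(2) Mn bt lst a6 10(1) a5(2) i4(2) in auto)
    qed (use v56 B1 in auto)
  qed (use v4 gv g l i4 in auto)
  have main: "wp hit_code (((n * 20 + 8) + 40) + ?t4) Q v a"
    unfolding hit_code_def
  proof (rule wp_seq_frame[where ta = "n * 20 + 8" and tb = "40 + ?t4", OF wp_for_const[where n = n and t = 10 and
        I = "\<lambda>i a'. \<forall>j<i. a' 7 j 0 = 0" and Q = "\<lambda>_ a'. \<forall>j<n. a' 7 j 0 = 0"]], goal_cases)
    case (7 i v1 a1)
    show ?case
    proof (rule wp_sp, goal_cases)
      case 1
      show ?case using 7(2,3) S0 B1 by (auto simp: K_def upd_apply less_Suc_eq)
    qed simp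
  next
    case (10 v1 a1)
    have v1: "z < 12 \<Longrightarrow> v1 z = v z" for z using 10(2)[of z] by simp
    have a1: "k' \<noteq> 7 \<Longrightarrow> a1 k' = a k'" for k' using 10(3)[of k'] by simp
    have "wp ?c4 ?t4 Q v1 (upd (upd a1 10 0 0 0) 12 0 0 0)"
      by (rule s4) (use v1 a1 10(1) in \<open>auto simp: upd_apply\<close>)
    then have "sp (set_cell 10 (N 0) ;; set_cell 12 (N 0)) (wp ?c4 ?t4 Q) v1 a1"
      using S0 B1 by (simp add: K_def)
    then show ?case by (rule wp_sp_seq) simp
  qed (use gv B1 in auto)
  have "((n * 20 + 8) + 40) + ?t4 \<le> 1100 * (?h * (n * l)) + 1100 * (n * L)"
  proof -
    have "n * 1 \<le> n * L" using L_pos by (rule mult_left_mono) simp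
    then have 1: "n \<le> n * L" "3 \<le> n * L" using n3 by linarith+
    have "(2 * L + 1) * (n * 200) = 400 * (n * L) + 200 * n" by (simp add: algebra_simps)
    moreover have "(?h * n) * l = ?h * (n * l)" by simp
    ultimately show ?thesis using 1 by linarith
  qed
  from wp_conseq[OF main _ this] have "wp hit_code (1100 * (?h * (n * l)) + 1100 * (n * L)) Q v a" .
  then show ?thesis unfolding Q_def .
qed

end

section \<open>Doubling\<close>

text \<open>In round \<open>i\<close> the path length is \<open>l = 2 ^ (i - 1)\<close>. The old
  hubs serve radius \<open>2 ^ (i - 1)\<close>, so hubs that hit these paths serve radius
  \<open>2 ^ i\<close>. For \<open>l = 1\<close> the paths are single edges without a
  midpoint.\<close>

definition refine_code :: "prog \<Rightarrow> nat \<Rightarrow> com" where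
  "refine_code P k =
     ((9 ::= V 7 \<ominus> N 1 ;; 11 ::= Op Shl (N 1) (V 9)) ;;
      If (V 9) (mid_code P k) Skip ;; hit_code)"

text \<open>Reducing the cap to \<open>n - 1\<close> loses nothing, as finite distances are below
  \<open>n\<close>. Round 0 keeps all nodes as hubs.\<close>

definition main_step :: "prog \<Rightarrow> nat \<Rightarrow> com" where
  "main_step P k =
     ((11 ::= Op Shl (N 1) (V 7) ;; 10 ::= V 11 \<oplus> V 11 ;;
       If (Less (V 10) (V 6)) Skip (10 ::= V 6 \<ominus> N 1)) ;;
      prod_code P k ;; prod_code P k ;; If (V 7) (refine_code P k) Skip)"

definition main_code :: "prog \<Rightarrow> nat \<Rightarrow> com" where
  "main_code P k = For 7 (V 4) (main_step P k)"

section \<open>Invariant and cost of the doubling rounds\<close>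

locale apsp = aeL B S n m L w \<tau> P k + hop_metric n d
  for B S n m L w \<tau> P k d
begin

text \<open>The counterpart of \<open>mids\<close> for true distances. It does not mention array 5
  and so survives every improvement of the distance matrix.\<close>

definition dmids :: "nat \<Rightarrow> arrs \<Rightarrow> bool" where
  "dmids e a \<longleftrightarrow> (\<forall>i. 1 \<le> i \<longrightarrow> i \<le> e \<longrightarrow> (\<forall>u<n. \<forall>v<n. d u v = 2 ^ i \<longrightarrow>
     a 4 (2 ^ i * n + u) v < n \<and> d u (a 4 (2 ^ i * n + u) v) = 2 ^ (i - 1) \<and> d (a 4 (2 ^ i * n + u) v) v = 2 ^ (i - 1)))"

lemma half_pow: "1 \<le> i \<Longrightarrow> (2::nat) ^ i div 2 = 2 ^ (i - 1)"
  by (cases i) auto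

lemma dmids_mids:
  assumes "dmids e a" "exact r (a 5)" "2 ^ e \<le> r"
  shows "mids e a"
  unfolding mids_def mid_wit_def
proof (intro allI impI)
  fix i u v assume i: "1 \<le> i" "i \<le> e" and uv: "u < n" "v < n" "a 5 u v = 2 ^ i"
  have ir: "(2::nat) ^ i \<le> r" using i assms(3) power_increasing[of i e "2::nat"] by linarith
  have ir': "(2::nat) ^ (i - 1) \<le> r" using ir power_increasing[of "i - 1" i "2::nat"] by linarith
  have "d u v = 2 ^ i" using exactD[OF assms(2) uv(1,2)] uv(3) ir by simp
  then have s: "a 4 (2 ^ i * n + u) v < n" "d u (a 4 (2 ^ i * n + u) v) = 2 ^ (i - 1)" "d (a 4 (2 ^ i * n + u) v) v = 2 ^ (i - 1)"
    using assms(1) i uv unfolding dmids_def by blast+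
  then show "a 4 (2 ^ i * n + u) v \<in> {s. s < n \<and> a 5 u s = 2 ^ i div 2 \<and> a 5 s v = 2 ^ i div 2}"
    using assms(2) uv ir' unfolding half_pow[OF i(1)] exact_def by simp
qed

lemma dmids_step:
  assumes md: "dmids (e - 1) a" and e: "1 \<le> e" and ex: "exact r (a 5)" "2 ^ e \<le> r" and fin: "2 ^ e < n"
    and new: "\<forall>u<n. \<forall>v<n. mid_wit (2 ^ e) a u v \<noteq> {} \<longrightarrow> a' 4 (2 ^ e * n + u) v \<in> mid_wit (2 ^ e) a u v"
    and old: "\<forall>r<2 ^ e * n. a' 4 r = a 4 r"
  shows "dmids e a'"
  unfolding dmids_def
proof (intro allI impI)
  fix i u v assume i: "1 \<le> i" "i \<le> e" and uv: "u < n" "v < n" "d u v = 2 ^ i"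
  show "a' 4 (2 ^ i * n + u) v < n \<and> d u (a' 4 (2 ^ i * n + u) v) = 2 ^ (i - 1) \<and> d (a' 4 (2 ^ i * n + u) v) v = 2 ^ (i - 1)"
  proof (cases "i = e")
    case True
    have h: "(2::nat) ^ (e - 1) \<le> 2 ^ e" by (rule power_increasing) auto
    have "d u v < n" "2 ^ (e - 1) \<le> d u v" using uv(3) True fin h by simp_all
    from d_split[OF uv(1,2) this] obtain s where s: "s < n" "d u s = 2 ^ (e - 1)" "d s v = 2 ^ e - 2 ^ (e - 1)"
      using uv(3) True by auto
    have "(2::nat) ^ e = 2 * 2 ^ (e - 1)" using e by (cases e) auto
    then have s3: "d s v = 2 ^ (e - 1)" using s(3) by simp
    have "(2::nat) ^ (e - 1) \<le> r" using h ex(2) by linarith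
    then have "s \<in> mid_wit (2 ^ e) a u v"
      using s(1,2) s3 uv(1,2) ex(1) unfolding mid_wit_def half_pow[OF e] exact_def by simp
    then have "a' 4 (2 ^ e * n + u) v \<in> mid_wit (2 ^ e) a u v" using new uv by blast
    then show ?thesis unfolding True mid_wit_def half_pow[OF e]
      using exactD[OF ex(1)] uv(1,2) \<open>(2::nat) ^ (e - 1) \<le> r\<close> by auto
  next
    case False
    then have ie: "i \<le> e - 1" "Suc i \<le> e" using i by auto
    \<comment> \<open>The rows of a shorter length end before row \<open>2 ^ e * n\<close>, where
      the new ones begin.\<close>
    have "(2::nat) ^ Suc i \<le> 2 ^ e" using ie by (intro power_increasing) auto
    then have "2 ^ Suc i * n \<le> 2 ^ e * n" by (rule mult_right_mono) simp
    then have "2 ^ i * n + n \<le> 2 ^ e * n"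
    proof -
      have "n \<le> 2 ^ i * n" by simp
      then have "2 ^ i * n + n \<le> 2 ^ Suc i * n" by simp
      then show ?thesis using \<open>2 ^ Suc i * n \<le> 2 ^ e * n\<close> by linarith
    qed
    then have "a' 4 (2 ^ i * n + u) = a 4 (2 ^ i * n + u)" using old uv(1) by simp
    then show ?thesis using md i(1) ie(1) uv unfolding dmids_def by simp
  qed
qed

text \<open>A bound on the epochs used by one descent. A round makes at most three of them, two
  products and one search for midpoints, hence the \<open>3 * E\<close> in the invariant.\<close>

definition E :: nat where "E = L * (450 * (n * n))"

text \<open>The greedy choice of the previous round guarantees \<open>2 * (n * (2 * L + 1))\<close>
  for hubs times \<open>l\<close>, and \<open>2 ^ i = 4 * l\<close>, whence the 8. Midpoints lag by
  two because round \<open>i\<close> records those of length \<open>2 ^ (i - 1)\<close>.\<close>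

definition INV :: "nat \<Rightarrow> arrs \<Rightarrow> bool" where
  "INV i a \<longleftrightarrow> exact (2 ^ i) (a 5) \<and> wf_state a \<and> bridge (2 ^ i div 2) (Hset a) \<and> dmids (i - 2) a \<and>
     a 3 0 0 * 2 ^ i \<le> 8 * (n * (2 * L + 1)) \<and> ep_ok a \<and> a 20 0 0 \<le> i * (3 * E)"

text \<open>This is where \<open>10000 * n ^ 4 < B\<close> is spent: since \<open>L \<le> n\<close>,
  all rounds together use at most \<open>1350 * n ^ 4\<close> epochs.\<close>

lemma E_bound: "i < L \<Longrightarrow> i * (3 * E) + 3 * E < B"
proof -
  assume "i < L"
  then have "Suc i * (3 * E) \<le> L * (3 * E)" by (intro mult_right_mono) auto
  also have "\<dots> = 1350 * ((L * L) * (n * n))" by (simp add: E_def algebra_simps)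
  also have "\<dots> \<le> 1350 * ((n * n) * (n * n))" using L by (intro mult_left_mono mult_right_mono mult_mono) auto
  also have "\<dots> = 1350 * n ^ 4" by (simp add: power4_eq_xxxx)
  also have "\<dots> < B" using B(3) by linarith
  finally show ?thesis by simp
qed

lemma wv_refine: "wv (refine_code P k) \<subseteq> {9..}" "wa (refine_code P k) \<subseteq> {2, 3, 4, 6, 7, 8, 9, 10, 11, 12, 23} \<union> {13..22}"
  using wv_mid wv_hit by (fastforce simp: refine_code_def)+

text \<open>By \<open>size\<close> the old hubs times \<open>l\<close> are O(n log n), so the paths
  recorded from them to all nodes have total length O(n^2 log n), which O(log n) units
  \<open>X\<close> pay for.\<close>

lemma wp_refine:
  assumes g: "glob v" "v 7 = i" "1 \<le> i" "i < L" and ex: "exact (2 * 2 ^ i) (a 5)" and wf: "wf_state a"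
    and br: "bridge (2 ^ i div 2) (Hset a)" and md: "dmids (i - 2) a" and size: "a 3 0 0 * 2 ^ i \<le> 8 * (n * (2 * L + 1))"
    and ep: "ep_ok a" "a 20 0 0 + E < B"
  shows "wp (refine_code P k) ((mid_cost + 28000) * (L * X)) (\<lambda>v' a'. wf_state a' \<and> bridge (2 ^ i) (Hset a') \<and>
    dmids (i - 1) a' \<and> a' 3 0 0 * 2 ^ Suc i \<le> 8 * (n * (2 * L + 1)) \<and> ep_ok a' \<and> a' 20 0 0 \<le> a 20 0 0 + E) v a"
proof -
  define e where "e = i - 1"
  define l where "l = (2::nat) ^ e"
  have i: "i = Suc e" using g(3) by (simp add: e_def)
  have li: "2 ^ i = 2 * l" "2 ^ i div 2 = l" by (simp_all add: i l_def)
  have ln: "2 * l < n" using pow_lt[OF g(4)] li by simp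
  have B1: "1 < B" "n < B" "l < B" using B_big n_le ln by linarith+
  have ex2: "exact (4 * l) (a 5)" using ex li by (simp add: mult.assoc[symmetric])
  let ?Q = "\<lambda>v' a'. wf_state a' \<and> bridge (2 ^ i) (Hset a') \<and>
    dmids (i - 1) a' \<and> a' 3 0 0 * 2 ^ Suc i \<le> 8 * (n * (2 * L + 1)) \<and> ep_ok a' \<and> a' 20 0 0 \<le> a 20 0 0 + E"
  let ?th = "1100 * (a 3 0 0 * (n * l)) + 1100 * (n * L)"
  let ?v = "v(9 := e, 11 := l)"
  have gv: "glob ?v" "?v 9 = e" "?v 11 = l" "v 7 = i" using g by (auto simp: glob_def)
  have m: "wp (If (V 9) (mid_code P k) Skip) (10 + mid_cost * (L * X))
     (\<lambda>v' a'. dmids e a' \<and> ep_ok a' \<and> a' 20 0 0 \<le> a 20 0 0 + E) ?v a"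
  proof (rule wp_If[where ta = "mid_cost * (L * X)"])
    assume "ev (V 9) ?v a \<noteq> 0"
    then have e1: "1 \<le> e" by simp
    have "wp (mid_code P k) (mid_cost * (L * X)) (\<lambda>v' a'.
      (\<forall>u<n. \<forall>v<n. mid_wit l a u v \<noteq> {} \<longrightarrow> a' 4 (l * n + u) v \<in> mid_wit l a u v) \<and>
      (\<forall>r<l * n. a' 4 r = a 4 r) \<and> ep_ok a' \<and> a' 20 0 0 \<le> a 20 0 0 + L * (450 * (n * n))) ?v a"
      by (rule wp_mid) (use gv ln ep in \<open>auto simp: E_def\<close>)
    then show "wp (mid_code P k) (mid_cost * (L * X)) (\<lambda>v' a'. dmids e a' \<and> ep_ok a' \<and> a' 20 0 0 \<le> a 20 0 0 + E) ?v a"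
    proof (rule wp_conseq)
      fix v' :: vars and a'
      assume 1: "(\<forall>u<n. \<forall>v<n. mid_wit l a u v \<noteq> {} \<longrightarrow> a' 4 (l * n + u) v \<in> mid_wit l a u v) \<and>
      (\<forall>r<l * n. a' 4 r = a 4 r) \<and> ep_ok a' \<and> a' 20 0 0 \<le> a 20 0 0 + L * (450 * (n * n))"
      have "dmids e a'"
        by (rule dmids_step[where a = a and r = "4 * l"]) (use 1 md e1 ex2 ln in \<open>auto simp: l_def e_def numeral_2_eq_2\<close>)
      then show "dmids e a' \<and> ep_ok a' \<and> a' 20 0 0 \<le> a 20 0 0 + E" using 1 by (simp add: E_def)
    qed simp
  next
    assume "ev (V 9) ?v a = 0"
    then have "dmids e a" by (simp add: dmids_def)
    then show "wp Skip (mid_cost * (L * X)) (\<lambda>v' a'. dmids e a' \<and> ep_ok a' \<and> a' 20 0 0 \<le> a 20 0 0 + E) ?v a"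
      using ep by (intro wp_sp) auto
  qed auto
  have main: "wp (If (V 9) (mid_code P k) Skip ;; hit_code) ((10 + mid_cost * (L * X)) + ?th) ?Q ?v a"
  proof (rule wp_seq_frame[OF m])
    fix v1 a1 assume 1: "dmids e a1 \<and> ep_ok a1 \<and> a1 20 0 0 \<le> a 20 0 0 + E"
      and fr: "\<And>x. x \<notin> wv (If (V 9) (mid_code P k) Skip) \<Longrightarrow> v1 x = ?v x"
        "\<And>k'. k' \<notin> wa (If (V 9) (mid_code P k) Skip) \<Longrightarrow> a1 k' = a k'"
    have v1: "z < 12 \<Longrightarrow> v1 z = ?v z" for z using fr(1)[of z] wv_mid(1) by fastforce
    have a1: "k' \<notin> insert 4 {13..22} \<Longrightarrow> a1 k' = a k'" for k' using fr(2)[of k'] subsetD[OF wv_mid(2)] by auto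
    have H: "Hset a1 = Hset a" using a1[of 2] a1[of 3] by (simp add: Hset_def)
    have ex1: "exact (4 * l) (a1 5)" using ex2 a1[of 5] by simp
    show "wp hit_code ?th ?Q v1 a1"
    proof (rule wp_frame[OF wp_hit[where e = e and l = l]])
      show "glob v1" "v1 9 = e" "v1 11 = l" using g v1 by (auto simp: glob_def)
      show "mids e a1" by (rule dmids_mids[where r = "4 * l"]) (use 1 ex1 in \<open>auto simp: l_def\<close>)
      show "wf_state a1" using wf a1[of 2] a1[of 3] a1[of 5] by (simp add: wf_state_def)
      show "1100 * (a1 3 0 0 * (n * l)) + 1100 * (n * L) \<le> ?th" using a1[of 3] by simp
      fix p x y assume xy: "x < n" "y < n" and gd: "good l a1 p x y" and l5: "a1 5 x y = l"
      have "d x y = l" using exactD[OF ex1 xy] l5 by simp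
      show "inj_on p {..<l}"
      proof (rule walk_inj)
        show "\<And>t. t \<le> l \<Longrightarrow> p t < n" using gd by (simp add: good_def)
        then show "\<And>t. t < l \<Longrightarrow> d (p t) (p (Suc t)) \<le> 1"
          using gd ex1 unfolding good_def exact_def by (metis Suc_leI less_imp_le)
        show "d (p 0) (p l) = l" using gd \<open>d x y = l\<close> by (simp add: good_def)
      qed
    next
      fix v2 a2 assume 2: "wf_state a2 \<and> a2 3 0 0 * l \<le> 2 * (n * (2 * L + 1)) \<and>
        (\<forall>x\<in>Hset a1. \<forall>y<n. a1 5 x y = l \<longrightarrow> (\<exists>p. good l a1 p x y \<and> (\<exists>t<l. p t \<in> Hset a2)))"
        and fr2: "\<And>k'. k' \<notin> wa hit_code \<Longrightarrow> a2 k' = a1 k'"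
      have a2: "k' \<notin> {2, 3, 6, 7, 8, 9, 10, 11, 12, 23} \<Longrightarrow> a2 k' = a1 k'" for k' using fr2[of k'] wv_hit(2) by auto
      have "bridge (l + l) (Hset a2)"
      proof (rule bridge_step[where H = "Hset a1" and r = "4 * l" and D = "a1 5"])
        show "bridge l (Hset a1)" using br H li by simp
        show "Hset a2 \<subseteq> {..<n}" using 2 by (auto simp: wf_state_def Hset_def)
        fix x y assume "x \<in> Hset a1" "y < n" "a1 5 x y = l"
        then obtain p where p: "good l a1 p x y" "\<exists>t<l. p t \<in> Hset a2" using 2 by blast
        then show "\<exists>p. p 0 = x \<and> p l = y \<and> (\<forall>t\<le>l. p t < n) \<and>
          (\<forall>t<l. a1 5 (p t) (p (Suc t)) = 1) \<and> (\<exists>t<l. p t \<in> Hset a2)" unfolding good_def by blast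
      qed (use ex1 in auto)
      then have "bridge (2 ^ i) (Hset a2)" using li by (simp add: mult_2)
      moreover have "dmids (i - 1) a2" using 1 a2[of 4] by (simp add: dmids_def e_def)
      moreover have "a2 3 0 0 * 2 ^ Suc i \<le> 8 * (n * (2 * L + 1))" using 2 li by simp
      ultimately show "?Q v2 a2" using 2 1 a2[of 20] a2[of 22] by (simp add: ep_ok_def)
    qed (use ln in \<open>auto simp: l_def\<close>)
  qed simp
  have "sp (9 ::= V 7 \<ominus> N 1 ;; 11 ::= Op Shl (N 1) (V 9))
    (wp (If (V 9) (mid_code P k) Skip ;; hit_code) ((10 + mid_cost * (L * X)) + ?th) ?Q) v a"
    using main gv(4) B1 i by (simp add: l_def push_bit_eq_mult)
  then show ?thesis unfolding refine_code_def
  proof (rule wp_sp_seq)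
    have "a 3 0 0 * l \<le> a 3 0 0 * 2 ^ i" using li by simp
    then have "a 3 0 0 * l \<le> 8 * (n * (2 * L + 1))" using size by linarith
    also have "\<dots> = 16 * (n * L) + 8 * n" by (simp add: algebra_simps)
    also have "\<dots> \<le> 24 * (n * L)" using L_pos by simp
    finally have "n * (a 3 0 0 * l) \<le> n * (24 * (n * L))" by (rule mult_left_mono) simp
    also have "\<dots> = 24 * (L * (n * n))" by simp
    also have "L * (n * n) \<le> L * X" by (rule mult_left_mono) (auto simp: X_def)
    finally have 1: "n * (a 3 0 0 * l) \<le> 24 * (L * X)" by simp
    have "L * n \<le> L * X" by (rule mult_left_mono) (use n_le(1) in \<open>auto simp: X_def intro: le_trans[OF le_square]\<close>)
    then have "n * L \<le> L * X" by (simp only: mult.commute)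
    moreover have "1 \<le> L * X" using L_pos by (simp add: X_def)
    moreover have "a 3 0 0 * (n * l) = n * (a 3 0 0 * l)" by simp
    ultimately have 2: "30 + ?th \<le> 28000 * (L * X)" using 1 by linarith
    have "ccost (9 ::= V 7 \<ominus> N 1 ;; 11 ::= Op Shl (N 1) (V 9)) + ((10 + mid_cost * (L * X)) + ?th) \<le> (30 + ?th) + mid_cost * (L * X)"
      by simp
    also have "\<dots> \<le> 28000 * (L * X) + mid_cost * (L * X)" using 2 by (rule add_right_mono)
    also have "\<dots> = (mid_cost + 28000) * (L * X)" by (simp add: algebra_simps)
    finally show "ccost (9 ::= V 7 \<ominus> N 1 ;; 11 ::= Op Shl (N 1) (V 9)) + ((10 + mid_cost * (L * X)) + ?th) \<le> (mid_cost + 28000) * (L * X)" .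
  qed
qed

definition step_cost :: nat where "step_cost = 2 * prod_cost + mid_cost + 28100"

text \<open>One product reaches only \<open>2 * r - gp\<close>. The second reaches
  \<open>4 * r - 3 * gp\<close>, which is at least \<open>2 * r\<close> because
  \<open>2 * gp \<le> r\<close>.\<close>

lemma wp_main_step:
  assumes g: "glob v" "v 7 = i" "i < L" and inv: "INV i a"
  shows "wp (main_step P k) (step_cost * (L * X)) (\<lambda>v' a'. INV (Suc i) a') v a"
proof -
  define r where "r = (2::nat) ^ i"
  define cap where "cap = (if 2 * r < n then 2 * r else n - 1)"
  define gp where "gp = r div 2"
  have rn: "r < n" using pow_lt[OF g(3)] by (simp add: r_def)
  have r1: "1 \<le> r" by (simp add: r_def)
  have capn: "cap < n" "cap \<le> 2 * r" using n3 rn by (auto simp: cap_def)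
  have B1: "1 < B" "n < B" "r < B" "r + r < B" using B_big n_le rn by linarith+
  have gv: "v 6 = n" using g by (auto simp: glob_def)
  have I: "exact r (a 5)" "wf_state a" "bridge gp (Hset a)" "dmids (i - 2) a" "a 3 0 0 * r \<le> 8 * (n * (2 * L + 1))"
    "ep_ok a" "a 20 0 0 \<le> i * (3 * E)" using inv by (auto simp: INV_def r_def gp_def)
  have EB: "a 20 0 0 + 3 * E < B" using E_bound[OF g(3)] I(7) by linarith
  have "a 3 0 0 * cap \<le> a 3 0 0 * (2 * r)" using capn(2) by (rule mult_left_mono) simp
  then have size: "a 3 0 0 * cap \<le> 16 * (n * (2 * L + 1))" using I(5) by linarith
  let ?v = "v(11 := r, 10 := cap)"
  have prod: "wp (prod_code P k) (prod_cost * (L * X)) (\<lambda>v' a'. exact (2 * \<rho> - gp) (a' 5) \<and> wf_state a' \<and> ep_ok a' \<and>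
      a' 20 0 0 \<le> aa 20 0 0 + E) vv aa"
    if vv: "glob vv" "vv 10 = cap" and aa: "aa 2 = a 2" "aa 3 = a 3" "wf_state aa" "ep_ok aa" "aa 20 0 0 + E < B"
      and ex: "exact \<rho> (aa 5)" and \<rho>: "gp \<le> \<rho>" "min \<rho> (n - 1) \<le> cap" for vv aa \<rho>
  proof (rule wp_frame[OF wp_prod[where cap = cap]])
    fix v2 a2 assume 2: "(\<forall>u<n. \<forall>v<n. a2 5 u v \<le> aa 5 u v \<and>
       (\<forall>s\<in>prod_wit cap aa u v. a2 5 u v \<le> aa 5 u s + aa 5 s v) \<and>
       (a2 5 u v = aa 5 u v \<or> (\<exists>s\<in>prod_wit cap aa u v. a2 5 u v = aa 5 u s + aa 5 s v))) \<and>
       ep_ok a2 \<and> a2 20 0 0 \<le> aa 20 0 0 + L * (450 * (n * n))"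
      and fr: "\<And>k'. k' \<notin> wa (prod_code P k) \<Longrightarrow> a2 k' = aa k'"
    have a2: "a2 2 = aa 2" "a2 3 = aa 3" using fr[of 2] fr[of 3] subsetD[OF wv_prod(2)] by fastforce+
    have H: "Hset aa = Hset a" using aa(1,2) by (simp add: Hset_def)
    have ex2: "exact (2 * \<rho> - gp) (a2 5)"
    proof (rule prod_exact[OF ex _ \<rho>])
      show "bridge gp (Hset aa)" using I(3) H by simp
      fix u v assume "u < n" "v < n"
      then show "a2 5 u v \<le> aa 5 u v \<and>
         (\<forall>s\<in>Hset aa. aa 5 u s \<le> cap \<longrightarrow> aa 5 s v \<le> cap \<longrightarrow> a2 5 u v \<le> aa 5 u s + aa 5 s v) \<and>
         (a2 5 u v = aa 5 u v \<or> (\<exists>s\<in>Hset aa. a2 5 u v = aa 5 u s + aa 5 s v))"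
        using 2 unfolding prod_wit_def by blast
    qed
    moreover have "wf_state a2" using ex2 aa(3) a2 by (simp add: wf_state_def exact_def)
    ultimately show "exact (2 * \<rho> - gp) (a2 5) \<and> wf_state a2 \<and> ep_ok a2 \<and> a2 20 0 0 \<le> aa 20 0 0 + E"
      using 2 by (simp add: E_def)
  qed (use vv aa capn size in \<open>auto simp: E_def\<close>)
  let ?Q = "\<lambda>v' a'. INV (Suc i) a'"
  let ?c3 = "If (V 7) (refine_code P k) Skip"
  let ?t3 = "(mid_cost + 28000) * (L * X) + 10"
  let ?p = "prod_cost * (L * X)"
  have gpr: "2 * gp \<le> r" by (simp add: gp_def)
  \<comment> \<open>The same cap has to serve the second product too, whose operands are exact up to
    \<open>2 * r - gp\<close>.\<close>
  have cap1: "min r (n - 1) \<le> cap" "min (2 * r - gp) (n - 1) \<le> cap" by (auto simp: cap_def)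
  have main: "wp (prod_code P k ;; prod_code P k ;; ?c3) (?p + (?p + ?t3)) ?Q ?v a"
  proof (rule wp_seq_frame)
    show "wp (prod_code P k) (prod_cost * (L * X)) (\<lambda>v' a'. exact (2 * r - gp) (a' 5) \<and> wf_state a' \<and> ep_ok a' \<and>
        a' 20 0 0 \<le> a 20 0 0 + E) ?v a"
      by (rule prod) (use g I EB gpr cap1 in \<open>auto simp: glob_def\<close>)
  next
    fix v1 a1 assume 1: "exact (2 * r - gp) (a1 5) \<and> wf_state a1 \<and> ep_ok a1 \<and> a1 20 0 0 \<le> a 20 0 0 + E"
      and fr1: "\<And>x. x \<notin> wv (prod_code P k) \<Longrightarrow> v1 x = ?v x" "\<And>k'. k' \<notin> wa (prod_code P k) \<Longrightarrow> a1 k' = a k'"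
    have v1: "z < 12 \<Longrightarrow> v1 z = ?v z" for z using fr1(1)[of z] wv_prod(1) by fastforce
    have a1: "k' \<notin> insert 5 {13..22} \<Longrightarrow> a1 k' = a k'" for k' using fr1(2)[of k'] subsetD[OF wv_prod(2)] by blast
    show "wp (prod_code P k ;; ?c3) (?p + ?t3) ?Q v1 a1"
    proof (rule wp_seq_frame)
      show "wp (prod_code P k) (prod_cost * (L * X)) (\<lambda>v' a'. exact (2 * (2 * r - gp) - gp) (a' 5) \<and> wf_state a' \<and> ep_ok a' \<and>
          a' 20 0 0 \<le> a1 20 0 0 + E) v1 a1"
        by (rule prod) (use v1 g 1 a1 EB gpr cap1 in \<open>auto simp: glob_def\<close>)
    next
      fix v2 a2 assume 2: "exact (2 * (2 * r - gp) - gp) (a2 5) \<and> wf_state a2 \<and> ep_ok a2 \<and> a2 20 0 0 \<le> a1 20 0 0 + E"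
        and fr2: "\<And>x. x \<notin> wv (prod_code P k) \<Longrightarrow> v2 x = v1 x" "\<And>k'. k' \<notin> wa (prod_code P k) \<Longrightarrow> a2 k' = a1 k'"
      have v2: "z < 12 \<Longrightarrow> v2 z = ?v z" for z using fr2(1)[of z] v1[of z] wv_prod(1) by fastforce
      have a2: "k' \<notin> insert 5 {13..22} \<Longrightarrow> a2 k' = a k'" for k' using fr2(2)[of k'] a1[of k'] subsetD[OF wv_prod(2)] by metis
      have ex2: "exact (2 * r) (a2 5)" by (rule exact_mono[OF conjunct1[OF 2]]) (use gpr in linarith)
      have H: "Hset a2 = Hset a" using a2[of 2] a2[of 3] by (simp add: Hset_def)
      have ep2: "a2 20 0 0 \<le> a 20 0 0 + 2 * E" using 1 2 by linarith
      have v27: "v2 7 = i" "glob v2" using v2 g by (auto simp: glob_def)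
      show "wp ?c3 ?t3 ?Q v2 a2"
      proof (rule wp_If[where ta = "(mid_cost + 28000) * (L * X)"])
        assume "ev (V 7) v2 a2 \<noteq> 0"
        then have i1: "1 \<le> i" using v27 by simp
        have "wp (refine_code P k) ((mid_cost + 28000) * (L * X)) (\<lambda>v' a'. wf_state a' \<and> bridge (2 ^ i) (Hset a') \<and>
          dmids (i - 1) a' \<and> a' 3 0 0 * 2 ^ Suc i \<le> 8 * (n * (2 * L + 1)) \<and> ep_ok a' \<and> a' 20 0 0 \<le> a2 20 0 0 + E) v2 a2"
        proof (rule wp_refine[OF v27(2,1) i1 g(3)])
          show "exact (2 * 2 ^ i) (a2 5)" using ex2 by (simp add: r_def)
          show "dmids (i - 2) a2" using I(4) a2[of 4] by (simp add: dmids_def)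
        qed (use 2 I(3,5) H a2[of 3] ep2 EB in \<open>auto simp: gp_def r_def\<close>)
        then show "wp (refine_code P k) ((mid_cost + 28000) * (L * X)) ?Q v2 a2"
        proof (rule wp_frame)
          fix v3 a3 assume 3: "wf_state a3 \<and> bridge (2 ^ i) (Hset a3) \<and>
            dmids (i - 1) a3 \<and> a3 3 0 0 * 2 ^ Suc i \<le> 8 * (n * (2 * L + 1)) \<and> ep_ok a3 \<and> a3 20 0 0 \<le> a2 20 0 0 + E"
            and fr3: "\<And>k'. k' \<notin> wa (refine_code P k) \<Longrightarrow> a3 k' = a2 k'"
          have "a3 5 = a2 5" using fr3[of 5] wv_refine(2) by fastforce
          then have "exact (2 ^ Suc i) (a3 5)" using ex2 by (simp add: r_def)
          moreover have "a3 20 0 0 \<le> Suc i * (3 * E)" using 3 ep2 I(7) by simp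
          ultimately show "INV (Suc i) a3" using 3 by (simp add: INV_def)
        qed simp
      next
        assume "ev (V 7) v2 a2 = 0"
        then have i0: "i = 0" using v27 by simp
        \<comment> \<open>The hubs are kept: serving radius 0, they also serve radius 1, which the
          next round requires.\<close>
        then have r1: "r = 1" "gp = 0" by (simp_all add: r_def gp_def)
        have "a2 3 0 0 \<le> n" using 2 by (simp add: wf_state_def)
        then have "a2 3 0 0 * 2 ^ Suc i \<le> 8 * (n * (2 * L + 1))" using i0 by simp
        moreover have "bridge (2 ^ Suc i div 2) (Hset a2)" using bridge_mono[OF I(3), of 1] r1 i0 H by simp
        moreover have "dmids (Suc i - 2) a2" using i0 by (simp add: dmids_def)
        ultimately have "INV (Suc i) a2" using ex2 2 ep2 I(7) i0 r1 by (simp add: INV_def)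
        then show "wp Skip ((mid_cost + 28000) * (L * X)) ?Q v2 a2" by (intro wp_sp) auto
      qed auto
    qed simp
  qed simp
  have "sp (11 ::= Op Shl (N 1) (V 7) ;; 10 ::= V 11 \<oplus> V 11 ;;
       If (Less (V 10) (V 6)) Skip (10 ::= V 6 \<ominus> N 1)) (wp (prod_code P k ;; prod_code P k ;; ?c3) (?p + (?p + ?t3)) ?Q) v a"
  proof -
    have rr: "push_bit i 1 = r" by (simp add: r_def push_bit_eq_mult)
    have "v 7 = i" using g by simp
    moreover define W where "W = wp (prod_code P k ;; prod_code P k ;; ?c3) (?p + (?p + ?t3)) ?Q"
    moreover have "W ?v a" using main unfolding W_def .
    moreover have "r + r < n \<longleftrightarrow> cap = r + r" "\<not> r + r < n \<Longrightarrow> cap = n - Suc 0" using n3 by (auto simp: cap_def)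
    ultimately show ?thesis unfolding W_def[symmetric] using gv B1 rr
      by (cases "r + r < n") (simp_all del: push_bit_of_1)
  qed
  then show ?thesis unfolding main_step_def
  proof (rule wp_sp_seq)
    have "1 \<le> L * X" using L_pos by (simp add: X_def)
    then have A: "c \<le> 50 \<Longrightarrow> c + 10 \<le> 100 * (L * X)" for c by linarith
    have "ccost (11 ::= Op Shl (N 1) (V 7) ;; 10 ::= V 11 \<oplus> V 11 ;; If (Less (V 10) (V 6)) Skip (10 ::= V 6 \<ominus> N 1)) + 10 \<le> 100 * (L * X)"
      by (rule A) simp
    moreover have "step_cost * (L * X) = ?p + (?p + (mid_cost + 28000) * (L * X)) + 100 * (L * X)"
      by (simp add: step_cost_def algebra_simps)
    ultimately show "ccost (11 ::= Op Shl (N 1) (V 7) ;; 10 ::= V 11 \<oplus> V 11 ;; If (Less (V 10) (V 6)) Skip (10 ::= V 6 \<ominus> N 1)) +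
      (?p + (?p + ?t3)) \<le> step_cost * (L * X)" by linarith
  qed
qed

lemma wv_main: "wv (main_code P k) \<subseteq> {7..}" "wa (main_code P k) \<subseteq> {2..23}"
  using wv_prod wv_refine by (fastforce simp: main_code_def main_step_def)+

text \<open>After \<open>L\<close> rounds the matrix is exact up to \<open>2 ^ L \<ge> n\<close>,
  which includes the value \<open>n\<close> of infinite distances.\<close>

theorem wp_main:
  assumes g: "glob v" and inv: "INV 0 a"
  shows "wp (main_code P k) ((step_cost + 20) * (L * (L * X))) (\<lambda>v' a'. \<forall>u<n. \<forall>v<n. a' 5 u v = d u v) v a"
  unfolding main_code_def
proof -
  have B1: "1 < B" "L < B" using B_big n_le L by linarith+
  show "wp (For 7 (V 4) (main_step P k)) ((step_cost + 20) * (L * (L * X))) (\<lambda>v' a'. \<forall>u<n. \<forall>v<n. a' 5 u v = d u v) v a"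
proof (rule wp_for_const[where n = L and t = "step_cost * (L * X)" and I = INV], goal_cases)
  case 5
  then show ?case using wv_prod wv_refine by (fastforce simp: main_step_def)
next
  case (7 i v1 a1)
  have "glob v1" using 7(5) g by (auto simp: glob_def)
  from wp_main_step[OF this 7(3,1,2)] show ?case .
next
  case (8 v' a')
  have "d u v \<le> 2 ^ L" for u v using d_le[of u v] L2(1) by linarith
  then show ?case using 8(1) by (simp add: INV_def exact_def)
next
  case 9
  have "1 \<le> L * X" using L_pos by (simp add: X_def)
  then have "L * (step_cost * (L * X) + 10) + 8 \<le> L * (step_cost * (L * X) + 10 * (L * X)) + 8 * (L * (L * X))"
    using L_pos by (intro add_mono mult_left_mono) auto
  also have "\<dots> \<le> (step_cost + 20) * (L * (L * X))" by (simp add: algebra_simps)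
  finally show ?case by simp
qed (use g inv B1 in \<open>auto simp: glob_def\<close>)
qed

end

section \<open>Input and output\<close>

definition log_code :: com where
  "log_code = ((4 ::= N 0 ;; 14 ::= N 1) ;;
     While (Less (V 14) (V 6)) (14 ::= V 14 \<oplus> V 14 ;; 4 ::= V 4 \<oplus> N 1))"

definition dist_init_code :: com where
  "dist_init_code = For 12 (V 6) (For 14 (V 6) (IfEq (V 12) (V 14) (St 5 (V 12) (V 14) (N 0))
     (If (Ld 0 (N 0) (N 1 \<oplus> (V 12 \<otimes> V 6 \<oplus> V 14))) (St 5 (V 12) (V 14) (N 1)) (St 5 (V 12) (V 14) (V 6)))))"

definition hub_init_code :: com where
  "hub_init_code = For 12 (V 6) (St 2 (V 12) (N 0) (V 12))"

definition output_code :: com where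
  "output_code = For 12 (V 6) (For 14 (V 6)
     (St 0 (N 0) ((N 1 \<oplus> V 2) \<oplus> (V 12 \<otimes> V 6 \<oplus> V 14)) (Ld 5 (V 12) (V 14))))"

definition solve_code :: "prog \<Rightarrow> nat \<Rightarrow> com" where
  "solve_code P k = log_code ;; (3 ::= Op Div (V 6) (N 3) ;; 5 ::= Op Div (V 6) (V 3) \<oplus> N 1) ;; main_code P k"

text \<open>For \<open>n \<le> 2\<close> the initial matrix is already the answer; otherwise the
  part size \<open>n div 3\<close> is positive.\<close>

definition apsp_code :: "prog \<Rightarrow> nat \<Rightarrow> com" where
  "apsp_code P k = (2 ::= V 6 \<otimes> V 6 ;; set_cell 3 (V 6)) ;; dist_init_code ;; hub_init_code ;;
     If (Less (N 2) (V 6)) (solve_code P k) Skip ;; output_code"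

definition start_vars :: "nat \<Rightarrow> nat \<Rightarrow> vars" where
  "start_vars n S = (\<lambda>_. 0)(0 := S, 6 := n)"

definition start_arrs :: "(nat \<Rightarrow> nat) \<Rightarrow> arrs" where
  "start_arrs M = (\<lambda>k i j. if k = 0 \<and> i = 0 then M j else 0)"

lemma row_major_le:
  assumes "i < n" "j < n"
  shows "i * n + j + 1 \<le> n * (n::nat)"
proof -
  have "(i + 1) * n \<le> n * n" by (rule mult_right_mono) (use assms in auto)
  then show ?thesis using assms(2) by simp
qed

section \<open>Initialisation, output and correctness of the structured program\<close>

locale apsp_io = lang +
  fixes n :: nat
  assumes n1: "1 \<le> n" and S: "S = 4 * (n + 1) * (n + 1)" and B: "10000 * n ^ 4 < B"
begin

lemma B_ge: "10000 * (n * n) < B" "10000 * n < B" "10000 < B" "n \<le> n * n" "1 \<le> n * n"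
proof -
  show 1: "n \<le> n * n" "1 \<le> n * n" using n1 by auto
  have "n * n * 1 \<le> n * n * (n * n)" using 1 by (intro mult_left_mono) auto
  then have "n * n \<le> n ^ 4" by (simp add: power4_eq_xxxx)
  then show "10000 * (n * n) < B" "10000 * n < B" "10000 < B" using B 1 n1 by linarith+
qed

lemma B_small: "1 < B" "2 < B" "3 < B" "n < B" "n + n < B"
  using B_ge by linarith+

lemma S_ge: "4 * (n * n) + 8 * n + 4 = S" "0 < S" "n < S"
proof -
  show "4 * (n * n) + 8 * n + 4 = S" by (simp add: S algebra_simps)
  then show "0 < S" "n < S" by auto
qed

lemma wp_log:
  assumes v: "v 6 = n" and L: "n \<le> 2 ^ l" "2 ^ l < 2 * n"
  shows "wp log_code (14 * l + 20) (\<lambda>v' a'. v' 4 = l \<and> a' = a) v a"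
  unfolding log_code_def
proof (rule wp_sp_seq)
  let ?I = "\<lambda>k (v' :: vars) (a' :: arrs). v' 4 \<le> l \<and> v' 14 = 2 ^ v' 4 \<and> v' 6 = n \<and> a' = a \<and> k = 14 * (l - v' 4)"
  let ?v = "v(4 := 0, 14 := 1)"
  have l: "l < B"
  proof -
    have "l < 2 ^ l" by simp
    then show ?thesis using L B_ge by linarith
  qed
  have "wp (While (Less (V 14) (V 6)) (14 ::= V 14 \<oplus> V 14 ;; 4 ::= V 4 \<oplus> N 1)) (14 * l + ecost (Less (V 14) (V 6)) + 1)
    (\<lambda>v' a'. ev (Less (V 14) (V 6)) v' a' = 0 \<and> (\<exists>k. ?I k v' a')) ?v a"
  proof (rule wp_while)
    show "?I (14 * l) ?v a" using v by simp
  next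
    fix k v' a' assume I: "?I k v' a'"
    show "ok (Less (V 14) (V 6)) v' a' \<and> (ev (Less (V 14) (V 6)) v' a' \<noteq> 0 \<longrightarrow>
        (\<exists>t. wp (14 ::= V 14 \<oplus> V 14 ;; 4 ::= V 4 \<oplus> N 1) t
          (\<lambda>v'' a''. \<exists>k'. ?I k' v'' a'' \<and> t + ecost (Less (V 14) (V 6)) + 3 + k' \<le> k) v' a'))"
    proof (intro conjI impI)
      assume "ev (Less (V 14) (V 6)) v' a' \<noteq> 0"
      then have lt: "2 ^ v' 4 < n" using I by simp
      then have "v' 4 \<noteq> l" using L by auto
      then have l4: "v' 4 < l" using I by simp
      have "wp (14 ::= V 14 \<oplus> V 14 ;; 4 ::= V 4 \<oplus> N 1) 8
          (\<lambda>v'' a''. \<exists>k'. ?I k' v'' a'' \<and> 8 + ecost (Less (V 14) (V 6)) + 3 + k' \<le> k) v' a'"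
        by (rule wp_sp) (use I lt l4 l B_small less_trans[OF add_strict_mono[OF lt lt] B_small(5)] in \<open>auto\<close>)
      then show "\<exists>t. wp (14 ::= V 14 \<oplus> V 14 ;; 4 ::= V 4 \<oplus> N 1) t
          (\<lambda>v'' a''. \<exists>k'. ?I k' v'' a'' \<and> t + ecost (Less (V 14) (V 6)) + 3 + k' \<le> k) v' a'" by blast
    qed simp
  qed
  then have "wp (While (Less (V 14) (V 6)) (14 ::= V 14 \<oplus> V 14 ;; 4 ::= V 4 \<oplus> N 1)) (14 * l + 4) (\<lambda>v' a'. v' 4 = l \<and> a' = a) ?v a"
  proof (rule wp_conseq)
    fix v' :: vars and a' :: arrs
    assume I: "ev (Less (V 14) (V 6)) v' a' = 0 \<and> (\<exists>k. ?I k v' a')"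
    then have "n \<le> 2 ^ v' 4" by simp
    \<comment> \<open>The loop stops at a power of two not below \<open>n\<close>; as
      \<open>2 ^ l < 2 * n\<close>, the exponent cannot be smaller than \<open>l\<close>.\<close>
    then have "(2::nat) ^ l < 2 ^ Suc (v' 4)" using L by simp
    then have "l < Suc (v' 4)" by (rule power_less_imp_less_exp[rotated]) simp
    then show "v' 4 = l \<and> a' = a" using I by simp
  qed simp
  then show "sp (4 ::= N 0 ;; 14 ::= N 1) (wp (While (Less (V 14) (V 6)) (14 ::= V 14 \<oplus> V 14 ;; 4 ::= V 4 \<oplus> N 1)) (14 * l + 4)
      (\<lambda>v' a'. v' 4 = l \<and> a' = a)) v a"
    using B_small by simp
qed simp

definition start_dist :: "(nat \<Rightarrow> nat) \<Rightarrow> nat \<Rightarrow> nat \<Rightarrow> nat" where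
  "start_dist M u v = (if u = v then 0 else if M (1 + (u * n + v)) \<noteq> 0 then 1 else n)"

lemma wp_dist_init:
  assumes v: "v 6 = n" and a: "a 0 0 = M"
  shows "wp dist_init_code (150 * (n * n))
    (\<lambda>v' a'. a' = a(5 := \<lambda>i j. if i < n \<and> j < n then start_dist M i j else a 5 i j)) v a"
  unfolding dist_init_code_def
proof (rule wp_matrix[where cc = 100])
  fix i j v' a' assume 1: "i < n" "j < n" "v' 12 = i" "v' 14 = j" "\<And>z. z < 12 \<Longrightarrow> v' z = v z" "\<And>k'. k' \<noteq> 5 \<Longrightarrow> a' k' = (a k' :: nat \<Rightarrow> nat \<Rightarrow> nat)"
  have "v' 6 = n" "a' 0 = a 0" using 1(5,6) v by auto
  moreover have "i * n + j + 1 \<le> n * n" using 1(1,2) by (rule row_major_le)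
  moreover from this have "i * n \<le> n * n" by linarith
  ultimately show "sp (IfEq (V 12) (V 14) (St 5 (V 12) (V 14) (N 0))
     (If (Ld 0 (N 0) (N 1 \<oplus> (V 12 \<otimes> V 6 \<oplus> V 14))) (St 5 (V 12) (V 14) (N 1)) (St 5 (V 12) (V 14) (V 6))))
     (\<lambda>_ a''. a'' = upd a' 5 i j (start_dist M i j)) v' a'"
    using 1(1-4) B_ge S_ge a by (auto simp: start_dist_def K_def)
next
  have "n * (n * (100 + 10) + 18) + 8 = 110 * (n * n) + 18 * n + 8" by (simp add: algebra_simps)
  then show "n * (n * (100 + 10) + 18) + 8 \<le> 150 * (n * n)" using B_ge(4,5) by linarith
qed (use v B_small in auto)

lemma wp_hub_init:
  assumes v: "v 6 = n"
  shows "wp hub_init_code (40 * (n * n))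
    (\<lambda>v' a'. (\<forall>i<n. a' 2 i 0 = i) \<and> (\<forall>k. k \<noteq> 2 \<longrightarrow> a' k = a k)) v a"
  unfolding hub_init_code_def
proof (rule wp_for_const[where n = n and t = 10 and
      I = "\<lambda>i a'. (\<forall>i'<i. a' 2 i' 0 = i') \<and> (\<forall>k. k \<noteq> 2 \<longrightarrow> a' k = a k)"], goal_cases)
  case (7 i v1 a1)
  then show ?case using S_ge B_ge by (intro wp_sp) (auto simp: upd_apply K_def less_Suc_eq)
next
  case 9
  have "n * (10 + 10) + ecost (V 6) + 7 = 20 * n + 8" by simp
  then show ?case using B_ge(4,5) by linarith
qed (use v B_small in auto)

lemma wp_output:
  assumes v: "v 6 = n" "v 2 = n * n"
  shows "wp output_code (100 * (n * n)) (\<lambda>v' a'. \<forall>i<n. \<forall>j<n. a' 0 0 (1 + n * n + (i * n + j)) = a 5 i j) v a"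
  unfolding output_code_def
proof (rule wp_for_const[where n = n and t = "n * 60 + 8" and
      I = "\<lambda>i a'. (\<forall>i'<i. \<forall>j<n. a' 0 0 (1 + n * n + (i' * n + j)) = a 5 i' j) \<and> a' 5 = a 5"], goal_cases)
  case (7 i v1 a1)
  note o = this
  have v1: "v1 6 = n" "v1 2 = n * n" using o(5)[of 6] o(5)[of 2] v by simp_all
  show ?case
  proof (rule wp_for_const[where n = n and t = 50 and
        I = "\<lambda>j a'. (\<forall>i'<i. \<forall>j<n. a' 0 0 (1 + n * n + (i' * n + j)) = a 5 i' j) \<and>
           (\<forall>j'<j. a' 0 0 (1 + n * n + (i * n + j')) = a 5 i j') \<and> a' 5 = a 5"], goal_cases)
    case (7 j v2 a2)
    have v2: "v2 6 = n" "v2 2 = n * n" "v2 12 = i" using 7(5)[of 6] 7(5)[of 2] 7(5)[of 12] v1 o(3) by simp_all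
    have b: "i * n + j + 1 \<le> n * n" using o(1) 7(1) by (rule row_major_le)
    then have b': "i * n \<le> n * n" by linarith
    have ne: "i' * n + j' \<noteq> i * n + j" if "i' < i" "j' < n" for i' j'
    proof -
      have "Suc i' * n \<le> i * n" by (rule mult_right_mono) (use that in auto)
      then show ?thesis using that by simp
    qed
    show ?case by (rule wp_sp) (use v2 7(1-3) b b' ne S_ge B_ge in \<open>auto simp: upd_apply K_def less_Suc_eq\<close>)
  next
    case (8 v' a')
    then show ?case by (auto simp: less_Suc_eq)
  qed (use o v1 B_small in auto)
next
  case 9
  have "n * (n * 60 + 8 + 10) + ecost (V 6) + 7 = 60 * (n * n) + 18 * n + 8" by (simp add: algebra_simps)
  then show ?case using B_ge(4,5) by linarith
qed (use v B_small in auto)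


theorem wp_apsp:
  assumes hop: "hop_metric n d"
    and adj: "\<And>u v. u < n \<Longrightarrow> v < n \<Longrightarrow> u \<noteq> v \<Longrightarrow> if M (1 + (u * n + v)) \<noteq> 0 then d u v = 1 else 2 \<le> d u v"
    and ap: "3 \<le> n \<Longrightarrow> apsp B S n (n div 3) l w \<tau> P k d"
    and l: "3 \<le> n \<Longrightarrow> n \<le> 2 ^ l \<and> 2 ^ l < 2 * n"
  shows "wp (apsp_code P k) ((apsp.step_cost P k + 500) * (l * (l * (n * n + \<tau> + 1))) + 500 * (n * n))
    (\<lambda>_ a'. \<forall>i<n. \<forall>j<n. a' 0 0 (1 + n * n + (i * n + j)) = d i j) (start_vars n S) (start_arrs M)"
  unfolding apsp_code_def
proof (rule wp_sp_seq)
  interpret hop_metric n d by (rule hop)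
  let ?Y = "(apsp.step_cost P k + 500) * (l * (l * (n * n + \<tau> + 1)))"
  let ?Q = "\<lambda>_ a'. \<forall>i<n. \<forall>j<n. a' 0 0 (1 + n * n + (i * n + j)) = d i j"
  let ?R = "\<lambda>v' a'. v' 2 = n * n \<and> v' 6 = n \<and> (\<forall>i<n. \<forall>j<n. a' 5 i j = d i j)"
  let ?v = "(start_vars n S)(2 := n * n)" and ?a = "upd (start_arrs M) 3 0 0 n"
  have v: "?v 6 = n" "?v 2 = n * n" by (simp_all add: start_vars_def)
  have ex: "exact 1 (start_dist M)"
    unfolding exact_def
  proof (intro allI impI)
    fix i j assume ij: "i < n" "j < n"
    show "d i j \<le> start_dist M i j \<and> start_dist M i j \<le> n \<and> (d i j \<le> 1 \<longrightarrow> start_dist M i j = d i j)"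
      using adj[OF ij] d_refl[OF ij(1)] d_le[of i j] n1 by (auto simp: start_dist_def split: if_splits)
  qed
  have "wp (dist_init_code ;; hub_init_code ;; If (Less (N 2) (V 6)) (solve_code P k) Skip ;; output_code)
      (?Y + 450 * (n * n)) ?Q ?v ?a"
  proof (rule wp_seq_frame[OF wp_dist_init[where M = M]])
    fix v1 a1 assume a1: "a1 = ?a(5 := \<lambda>i j. if i < n \<and> j < n then start_dist M i j else ?a 5 i j)"
      and "\<And>x. x \<notin> wv dist_init_code \<Longrightarrow> v1 x = ?v x"
    then have v1: "v1 6 = n" "v1 2 = n * n" using v by (auto simp: dist_init_code_def)
    show "wp (hub_init_code ;; If (Less (N 2) (V 6)) (solve_code P k) Skip ;; output_code) (?Y + 300 * (n * n)) ?Q v1 a1"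
    proof (rule wp_seq_frame[OF wp_hub_init])
      fix v2 a2 assume a2: "(\<forall>i<n. a2 2 i 0 = i) \<and> (\<forall>k. k \<noteq> 2 \<longrightarrow> a2 k = a1 k)"
        and "\<And>x. x \<notin> wv hub_init_code \<Longrightarrow> v2 x = v1 x"
      then have v2: "v2 6 = n" "v2 2 = n * n" using v1 by (auto simp: hub_init_code_def)
      have A: "a2 3 0 0 = n" "\<And>i j. i < n \<Longrightarrow> j < n \<Longrightarrow> a2 5 i j = start_dist M i j" "\<And>i. i < n \<Longrightarrow> a2 2 i 0 = i"
        "a2 20 0 0 = 0" "\<And>x. a2 22 x 0 = 0"
        using a1 a2 by (auto simp: upd_apply start_arrs_def)
      have ex2: "exact 1 (a2 5)" using ex A(2) by (simp add: exact_def)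
      show "wp (If (Less (N 2) (V 6)) (solve_code P k) Skip ;; output_code) (?Y + 200 * (n * n)) ?Q v2 a2"
      proof (rule wp_seq_frame)
        show "wp (If (Less (N 2) (V 6)) (solve_code P k) Skip) (6 + ?Y) ?R v2 a2"
        proof (rule wp_If[where ta = ?Y])
          assume "ev (Less (N 2) (V 6)) v2 a2 \<noteq> 0"
          then have n3: "3 \<le> n" using v2 by simp
          interpret apsp B S n "n div 3" l w \<tau> P k d by (rule ap[OF n3])
          note l = l[OF n3]
          have "1 \<le> l * X" using L_pos by (simp add: X_def)
          then have "l * 1 \<le> l * (l * X)" by (rule mult_left_mono) simp
          moreover have "1 \<le> l * (l * X)" using L_pos by (simp add: X_def)
          ultimately have t: "14 * l + 20 + (40 + (step_cost + 20) * (l * (l * X))) \<le> ?Y"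
            unfolding X_def[symmetric] add_mult_distrib by linarith
          show "wp (solve_code P k) ?Y ?R v2 a2"
            unfolding solve_code_def
          proof (rule wp_seq_frame[OF wp_log[where l = l]])
            fix v3 a3 assume 3: "v3 4 = l \<and> a3 = a2" and "\<And>x. x \<notin> wv log_code \<Longrightarrow> v3 x = v2 x"
            then have v3: "v3 6 = n" "v3 2 = n * n" using v2 by (auto simp: log_code_def)
            show "wp ((3 ::= Op Div (V 6) (N 3) ;; 5 ::= Op Div (V 6) (V 3) \<oplus> N 1) ;; main_code P k)
                (40 + (step_cost + 20) * (l * (l * X))) ?R v3 a3"
            proof (rule wp_sp_seq)
              let ?w = "v3(3 := n div 3, 5 := nb)"
              have "glob ?w" using v3 3 by (simp add: glob_def)
              moreover have "INV 0 a2"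
              proof -
                have "Hset a2 = {..<n}" using A(1,3) by (auto simp: Hset_def) (metis A(3))
                then have "bridge 0 (Hset a2)" using bridge_all by simp
                moreover have "n \<le> n * (2 * l + 1)" by simp
                ultimately show ?thesis using A ex2 by (auto simp: INV_def wf_state_def dmids_def ep_ok_def start_dist_def)
              qed
              ultimately have W: "wp (main_code P k) ((step_cost + 20) * (l * (l * X)))
                  (\<lambda>_ a'. \<forall>i<n. \<forall>j<n. a' 5 i j = d i j) ?w a2"
                by (rule wp_main)
              have nw: "2 \<notin> wv (main_code P k)" "6 \<notin> wv (main_code P k)"
                using subsetD[OF wv_main(1), of 2] subsetD[OF wv_main(1), of 6] by auto
              have "wp (main_code P k) ((step_cost + 20) * (l * (l * X))) ?R ?w a2"
                by (rule wp_frame[OF W]) (use v3 nw in simp_all)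
              then show "sp (3 ::= Op Div (V 6) (N 3) ;; 5 ::= Op Div (V 6) (V 3) \<oplus> N 1)
                  (wp (main_code P k) ((step_cost + 20) * (l * (l * X))) ?R) v3 a3"
                using v3 3 m_pos(4) B_big by (simp add: nb_def)
            qed simp
          qed (use v2 l t in simp_all)
        next
          assume "ev (Less (N 2) (V 6)) v2 a2 = 0"
          then have n2: "n \<le> 2" using v2 by simp
          \<comment> \<open>With at most two nodes, a non-adjacent pair has distance at least
            \<open>2 \<ge> n\<close>; it is infinite, and the initial entry \<open>n\<close> is
            right.\<close>
          have 2: "a2 5 i j = d i j" if ij: "i < n" "j < n" for i j
            using adj[OF ij] d_refl[OF ij(1)] d_le[of i j] A(2)[OF ij] n2 by (auto simp: start_dist_def split: if_splits)
          show "wp Skip ?Y ?R v2 a2" using 2 v2 by (intro wp_sp) auto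
        qed (use B_small v2 in auto)
      next
        fix v3 :: vars and a3 :: arrs
        assume 3: "?R v3 a3"
        from wp_output[of v3 a3] show "wp output_code (100 * (n * n)) ?Q v3 a3"
          using 3 by (auto elim!: wp_conseq)
      qed (use B_ge in linarith)
    qed (use v1 in auto)
  qed (use v in \<open>auto simp: start_arrs_def\<close>)
  then show "sp (2 ::= V 6 \<otimes> V 6 ;; set_cell 3 (V 6)) (wp (dist_init_code ;; hub_init_code ;;
      If (Less (N 2) (V 6)) (solve_code P k) Skip ;; output_code) (?Y + 450 * (n * n)) ?Q) (start_vars n S) (start_arrs M)"
    using B_ge B_small S_ge by (simp add: start_vars_def K_def)
  have "ccost (2 ::= V 6 \<otimes> V 6 ;; set_cell 3 (V 6)) \<le> 50" by simp
  then show "ccost (2 ::= V 6 \<otimes> V 6 ;; set_cell 3 (V 6)) + (?Y + 450 * (n * n)) \<le> ?Y + 500 * (n * n)"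
    using B_ge(5) by linarith
qed

end

section \<open>Shortest paths and the time lower bound\<close>

context pair_fin_digraph
begin

text \<open>Cycles are cut out, by induction on the length.\<close>

lemma awalk_shorten: "awalk u p v \<Longrightarrow> \<exists>q. apath u q v \<and> length q \<le> length p"
proof (induction "length p" arbitrary: p rule: less_induct)
  case less
  show ?case
  proof (cases "distinct (awalk_verts u p)")
    case True
    then show ?thesis using less.prems by (auto simp: apath_def)
  next
    case False
    from awalk_not_distinct_decomp[OF less.prems False] obtain q r s w where
      1: "p = q @ r @ s" "0 < length r" "awalk u q w" "awalk w s v" by blast
    have "length (q @ s) < length p" "awalk u (q @ s) v" using 1 awalk_appendI[of u q w s v] by auto
    from less.hyps[OF this] show ?thesis using \<open>length (q @ s) < length p\<close> by (meson le_trans less_imp_le)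
  qed
qed

definition dist_word :: "'a \<Rightarrow> 'a \<Rightarrow> nat" where
  "dist_word u v = distance_word (card (pverts G)) (INF p \<in> {p. apath u p v}. enat (length p))"

lemma dist_word_walk:
  assumes "awalk u p v"
  shows "\<exists>q. awalk u q v \<and> dist_word u v = length q" "dist_word u v \<le> length p" "dist_word u v < card (pverts G)"
proof -
  let ?L = "(\<lambda>p. enat (length p)) ` {p. apath u p v}"
  obtain q where q: "apath u q v" "length q \<le> length p" using awalk_shorten[OF assms] by blast
  then have "enat (length q) \<in> ?L" by auto
  then have "Inf ?L \<in> ?L" unfolding Inf_enat_def by (auto intro: LeastI simp del: image_iff)
  then obtain r where r: "apath u r v" "Inf ?L = enat (length r)" by auto
  have d: "dist_word u v = length r" using r by (simp add: dist_word_def distance_word_def)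
  show "\<exists>q. awalk u q v \<and> dist_word u v = length q" using d r(1) by (auto simp: apath_def)
  have "Inf ?L \<le> enat (length q)" using q(1) by (intro Inf_lower) auto
  then show "dist_word u v \<le> length p" using q(2) r(2) d by simp
  show "dist_word u v < card (pverts G)" using length_apath_less[OF r(1)] d by simp
qed

lemma dist_word_infinite:
  assumes "\<nexists>p. awalk u p v"
  shows "dist_word u v = card (pverts G)"
proof -
  have "{p. apath u p v} = {}" using assms by (auto simp: apath_def)
  then show ?thesis by (simp add: dist_word_def distance_word_def top_enat_def)
qed

lemma dist_word_awalk: "dist_word u v < card (pverts G) \<Longrightarrow> \<exists>p. awalk u p v \<and> dist_word u v = length p"
  using dist_word_infinite[of u v] dist_word_walk(1)[of u _ v] by fastforce

lemma dist_word_simps: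
  assumes "u \<in> pverts G"
  shows "dist_word u u = 0"
    and "(u, v) \<in> parcs G \<Longrightarrow> u \<noteq> v \<Longrightarrow> dist_word u v = 1"
    and "v \<in> pverts G \<Longrightarrow> (u, v) \<notin> parcs G \<Longrightarrow> u \<noteq> v \<Longrightarrow> 2 \<le> dist_word u v"
proof -
  have pos: "\<exists>p. awalk u p v \<and> length p = dist_word u v" "dist_word u v \<noteq> 0" if "awalk u p v" "u \<noteq> v" for v p
    using dist_word_walk(1)[OF that(1)] that(2) by (auto simp: awalk_Nil_iff)
  have "awalk u [] u" using assms by (simp add: awalk_Nil_iff)
  from dist_word_walk(2)[OF this] show "dist_word u u = 0" by simp
  {
    assume uv: "(u, v) \<in> parcs G" "u \<noteq> v"
    then have w: "awalk u [(u, v)] v" using arc_snd_in_verts[of "(u, v)"] by (simp add: awalk_Cons_iff awalk_Nil_iff)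
    show "dist_word u v = 1" using dist_word_walk(2)[OF w] pos(2)[OF w uv(2)] by simp
  }
  {
    assume v: "v \<in> pverts G" "(u, v) \<notin> parcs G" "u \<noteq> v"
    show "2 \<le> dist_word u v"
    proof (cases "\<exists>p. awalk u p v")
      case True
      then obtain p where p: "awalk u p v" "length p = dist_word u v" "dist_word u v \<noteq> 0" using pos v(3) by blast
      have "length p \<noteq> 1" using p(1) v(2) by (auto simp: length_Suc_conv awalk_Cons_iff awalk_Nil_iff)
      then show ?thesis using p by simp
    next
      case False
      have "card {u, v} \<le> card (pverts G)" using assms v(1) pair_finite_verts by (intro card_mono) auto
      then show ?thesis using dist_word_infinite[OF False] v(3) by simp
    qed
  }
qed

lemma dist_word_le: "dist_word u v \<le> card (pverts G)"
  using dist_word_infinite[of u v] dist_word_walk(3)[of u _ v] by (cases "\<exists>p. awalk u p v") (auto intro: less_imp_le)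

text \<open>An infinite part contributes the number of nodes, which bounds every distance word;
  finite parts are concatenated.\<close>

lemma dist_word_triangle: "dist_word u v \<le> dist_word u w + dist_word w v"
proof (cases "dist_word u w < card (pverts G) \<and> dist_word w v < card (pverts G)")
  case True
  then obtain p q where "awalk u p w" "dist_word u w = length p" "awalk w q v" "dist_word w v = length q"
    using dist_word_awalk by meson
  then show ?thesis using dist_word_walk(2)[of u "p @ q" v] awalk_appendI[of u p w q v] by simp
next
  case False
  then show ?thesis using dist_word_le[of u v] by linarith
qed

text \<open>Cut a shortest walk after \<open>t\<close> arcs. The pieces bound both distances from
  above, and the triangle inequality forces equality.\<close>

lemma dist_word_split:
  assumes "dist_word u v < card (pverts G)" "t \<le> dist_word u v"
  shows "\<exists>w\<in>pverts G. dist_word u w = t \<and> dist_word w v = dist_word u v - t"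
proof -
  obtain p where p: "awalk u p v" "dist_word u v = length p" using dist_word_awalk[OF assms(1)] by blast
  define w where "w = last (pawalk_verts u (take t p))"
  have "awalk u (take t p @ drop t p) v" using p(1) by simp
  then have w: "awalk u (take t p) w" "awalk w (drop t p) v" unfolding awalk_append_iff w_def by blast+
  have "dist_word u w \<le> t" "dist_word w v \<le> length p - t"
    using dist_word_walk(2)[OF w(1)] dist_word_walk(2)[OF w(2)] by auto
  moreover have "w \<in> pverts G" using w(2) by (rule awalk_hd_in_verts)
  ultimately show ?thesis using dist_word_triangle[of u v w] assms(2) p(2) by (intro bexI[of _ w]) linarith+
qed

end

lemma shortest_path_distances:
  assumes G: "pair_fin_digraph G" "pverts G = {..<n}"
  defines "d \<equiv> \<lambda>u v. distance_word n (shortest_path_length G u v)"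
  shows "hop_metric n d"
    and "u < n \<Longrightarrow> v < n \<Longrightarrow> u \<noteq> v \<Longrightarrow> if adjacency_matrix G u v \<noteq> 0 then d u v = 1 else 2 \<le> d u v"
proof -
  interpret pair_fin_digraph G by (rule G)
  have d: "d u v = dist_word u v" for u v
    using G(2) by (simp add: d_def dist_word_def shortest_path_length_def)
  have n: "card (pverts G) = n" using G(2) by simp
  show "hop_metric n d"
    using dist_word_simps(1) dist_word_le dist_word_triangle dist_word_split unfolding n
    by unfold_locales (auto simp: d G(2) Bex_def)
  show "u < n \<Longrightarrow> v < n \<Longrightarrow> u \<noteq> v \<Longrightarrow> if adjacency_matrix G u v \<noteq> 0 then d u v = 1 else 2 \<le> d u v"
    using dist_word_simps(2,3)[of u v] G(2) by (auto simp: d adjacency_matrix_def)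
qed

text \<open>With its nonzero entries as edges, such a matrix is the colour matrix of a legal
  instance. Since step counts are natural numbers, the time bound may be rounded down.\<close>

lemma colour_instance:
  assumes n: "1 \<le> n" and sym: "\<And>i j. i < n \<Longrightarrow> j < n \<Longrightarrow> A i j = A j i" and diag: "\<And>i. i < n \<Longrightarrow> A i i = 0"
    and le: "\<And>i j. i < n \<Longrightarrow> j < n \<Longrightarrow> A i j \<le> n * n"
    and solve: "\<forall>(n, A, S) \<in> AE_Mono_Triangle. \<exists>t M'. real t \<le> T n \<and>
               halts_after (W n) P (input_mem n A) t M' \<and> output_matrix n M' \<in> S"
  shows "\<exists>t M'. t \<le> nat \<lfloor>T n\<rfloor> \<and> halts_after (W n) P (input_mem n A) t M' \<and>
         (\<forall>i<n. \<forall>j<n. A i j \<noteq> 0 \<longrightarrow>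
            M' (1 + n * n + (i * n + j)) = of_bool (\<exists>x<n. A i j = A j x \<and> A j x = A i x))"
proof -
  define G where "G = \<lparr>pverts = {..<n}, parcs = {(i, j). i < n \<and> j < n \<and> A i j \<noteq> 0}\<rparr>"
  define c where "c = (\<lambda>(i, j). A i j)"
  have arcs: "(i, j) \<in> parcs G \<longleftrightarrow> i < n \<and> j < n \<and> A i j \<noteq> 0" for i j by (simp add: G_def)
  have V: "pverts G = {..<n}" by (simp add: G_def)
  have "finite (parcs G)" by (rule finite_subset[of _ "{..<n} \<times> {..<n}"]) (auto simp: G_def)
  then have "pair_graph G"
    using sym diag by unfold_locales (auto simp: arcs V symmetric_def sym_def; force simp: G_def)+
  then have col: "edge_coloured_graph n G c"
    using n sym le by (auto simp: edge_coloured_graph_def V arcs c_def power2_eq_square Suc_le_eq)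
  let ?S = "{B. \<forall>(u, v) \<in> parcs G. B u v = of_bool (\<exists>x. monochromatic_triangle G c u v x)}"
  have "(n, colour_matrix G c, ?S) \<in> AE_Mono_Triangle" using col unfolding AE_Mono_Triangle_def by blast
  then obtain t M' where 1: "real t \<le> T n" "halts_after (W n) P (input_mem n (colour_matrix G c)) t M'" "output_matrix n M' \<in> ?S"
    using solve by fast
  have "input_mem n (colour_matrix G c) a = input_mem n A a" for a
  proof (cases "a = 0 \<or> n\<^sup>2 < a")
    case False
    then have "(a - 1) div n < n" "(a - 1) mod n < n" using n by (auto simp: power2_eq_square div_less_iff_less_mult)
    then show ?thesis by (simp add: input_mem_def colour_matrix_def arcs c_def)
  qed (auto simp: input_mem_def)
  then have 2: "input_mem n (colour_matrix G c) = input_mem n A" by auto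
  have "M' (1 + n * n + (i * n + j)) = of_bool (\<exists>x<n. A i j = A j x \<and> A j x = A i x)"
    if "i < n" "j < n" "A i j \<noteq> 0" for i j
  proof -
    have "monochromatic_triangle G c i j x \<longleftrightarrow> x < n \<and> A i j = A j x \<and> A j x = A i x" for x
      using that by (auto simp: monochromatic_triangle_def arcs c_def)
    moreover have "output_matrix n M' i j = of_bool (\<exists>x. monochromatic_triangle G c i j x)"
      using bspec[OF 1(3)[unfolded mem_Collect_eq], of "(i, j)"] that by (simp add: arcs)
    ultimately show ?thesis by (simp add: output_matrix_def power2_eq_square add.assoc)
  qed
  moreover have "t \<le> nat \<lfloor>T n\<rfloor>" using 1(1) by (rule le_nat_floor)
  ultimately show ?thesis using 1(2)[unfolded 2] by blast
qed

section \<open>Lower bound on the running time of the triangle program\<close>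

lemma step_changes:
  assumes "step w P (pc, R, M) = Some (pc', R', M')"
  shows "\<exists>x. \<forall>y. y \<noteq> x \<longrightarrow> M' y = M y"
  using assms by (cases "P ! pc") (auto simp: step_def split: if_splits)

text \<open>A step changes at most one cell, so the number of changed cells is a lower bound on the
  time.\<close>

lemma reach_changes: "reach w P (pc, R, M) t (pc', R', M') \<Longrightarrow> finite {x. M' x \<noteq> M x} \<and> card {x. M' x \<noteq> M x} \<le> t"
proof (induction t arbitrary: pc R M)
  case (Suc t)
  then obtain pc1 R1 M1 where 1: "step w P (pc, R, M) = Some (pc1, R1, M1)" "reach w P (pc1, R1, M1) t (pc', R', M')"
    by (auto simp: reach_Suc)
  obtain x where x: "\<forall>y. y \<noteq> x \<longrightarrow> M1 y = M y" using step_changes[OF 1(1)] by blast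
  have IH: "finite {x. M' x \<noteq> M1 x}" "card {x. M' x \<noteq> M1 x} \<le> t" using Suc.IH[OF 1(2)] by auto
  have sub: "{x. M' x \<noteq> M x} \<subseteq> insert x {x. M' x \<noteq> M1 x}" using x by auto
  then have "card {x. M' x \<noteq> M x} \<le> card (insert x {x. M' x \<noteq> M1 x})" using IH(1) by (intro card_mono) auto
  also have "\<dots> \<le> Suc t" using IH by (simp add: card_insert_if)
  finally show ?case using finite_subset[OF sub] IH(1) by simp
qed simp

text \<open>On the complete graph with a single colour, every output entry off the diagonal has to be written.\<close>

lemma ae_time_lower_bound:
  assumes n: "3 \<le> n"
    and solve: "\<forall>(n, A, S) \<in> AE_Mono_Triangle. \<exists>t M'. real t \<le> T n \<and>
               halts_after (W n) P (input_mem n A) t M' \<and> output_matrix n M' \<in> S"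
  shows "n * n \<le> nat \<lfloor>T n\<rfloor> + n"
proof -
  let ?A = "\<lambda>i j. of_bool (i \<noteq> j) :: nat"
  have "\<exists>t M'. t \<le> nat \<lfloor>T n\<rfloor> \<and> halts_after (W n) P (input_mem n ?A) t M' \<and>
         (\<forall>i<n. \<forall>j<n. ?A i j \<noteq> 0 \<longrightarrow>
            M' (1 + n * n + (i * n + j)) = of_bool (\<exists>x<n. ?A i j = ?A j x \<and> ?A j x = ?A i x))"
  proof (rule colour_instance[OF _ _ _ _ solve])
    show "?A i j \<le> n * n" for i j using n by (cases "i = j") auto
  qed (use n in auto)
  then obtain t M' where 1: "t \<le> nat \<lfloor>T n\<rfloor>" "halts_after (W n) P (input_mem n ?A) t M'"
    "\<And>i j. i < n \<Longrightarrow> j < n \<Longrightarrow> i \<noteq> j \<Longrightarrow> M' (1 + n * n + (i * n + j)) = of_bool (\<exists>x<n. ?A i j = ?A j x \<and> ?A j x = ?A i x)"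
    by auto
  obtain pc R where "reach (W n) P (0, \<lambda>_. 0, input_mem n ?A) t (pc, R, M')"
    using 1(2) by (auto simp: halts_after_def reach_def)
  note ch = reach_changes[OF this]
  let ?D = "({..<n} \<times> {..<n}) - (\<lambda>i. (i, i)) ` {..<n}"
  let ?f = "\<lambda>(i, j). 1 + n * n + (i * n + j)"
  have img: "?f ` ?D \<subseteq> {x. M' x \<noteq> input_mem n ?A x}"
  proof safe
    fix i j assume ij: "i < n" "j < n" "(i, j) \<notin> (\<lambda>i. (i, i)) ` {..<n}" and eq: "M' (1 + n * n + (i * n + j)) = input_mem n ?A (1 + n * n + (i * n + j))"
    then have ne: "i \<noteq> j" by auto
    have "card {i, j} < card {..<n}" using n ne by simp
    \<comment> \<open>As \<open>3 \<le> n\<close>, a third node exists. The entry must therefore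
      become 1, whereas its cell initially holds 0.\<close>
    then obtain x where x: "x < n" "x \<noteq> i" "x \<noteq> j"
      by (metis (no_types, lifting) card_mono finite.emptyI finite_insert insertCI lessThan_iff linorder_not_less subsetI)
    have "M' (1 + n * n + (i * n + j)) = 1" using 1(3)[OF ij(1,2) ne] x ne by auto
    moreover have "input_mem n ?A (1 + n * n + (i * n + j)) = 0" by (simp add: input_mem_def power2_eq_square)
    ultimately show False using eq by simp
  qed
  have inj: "inj_on ?f ?D"
  proof (rule inj_onI, clarify)
    fix i j i' j' assume "j < n" "j' < n" "1 + n * n + (i * n + j) = 1 + n * n + (i' * n + j')"
    then have "(i * n + j) div n = (i' * n + j') div n" "(i * n + j) mod n = (i' * n + j') mod n" by simp_all
    then show "i = i' \<and> j = j'" using \<open>j < n\<close> \<open>j' < n\<close> by simp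
  qed
  have "card ?D = card (?f ` ?D)" by (rule card_image[OF inj, symmetric])
  also have "\<dots> \<le> card {x. M' x \<noteq> input_mem n ?A x}" by (rule card_mono[OF conjunct1[OF ch] img])
  finally have "card ?D \<le> card {x. M' x \<noteq> input_mem n ?A x}" .
  moreover have "card ?D = n * n - n"
    by (subst card_Diff_subset) (auto simp: card_image inj_on_def)
  ultimately show ?thesis using ch 1(1) by linarith
qed

section \<open>The word-RAM program\<close>

text \<open>Register 0 is initially 0, so \<open>n\<close> is loaded from address 0 into register
  13, which is variable 6. The rest leaves the stride in register 1, which is variable 0.\<close>

definition start_code :: "instr list" where
  "start_code = [Load 13 0, Const 0 1, Bin Add 2 13 0, Bin Mul 2 2 2, Const 0 4, Bin Mul 1 2 0]"

definition ram_prog :: "com \<Rightarrow> prog" where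
  "ram_prog c = start_code @ ccode c 6 @ [Halt]"

lemma wv_apsp_code: "0 \<notin> wv (apsp_code P k)"
proof -
  have "0 \<notin> wv (sim P k)" using wv_sim[of P k] by auto
  then show ?thesis
    by (simp add: apsp_code_def dist_init_code_def hub_init_code_def output_code_def solve_code_def log_code_def
        main_code_def main_step_def refine_code_def hit_code_def greedy_code_def pick_code_def build_code_def
        expand_code_def register_code_def mid_code_def prod_code_def fill_mid_def fill_prod_def descent_def
        descent_step_def bit_test_code_def eq_prod_def eq_block_def fill_instance_def read_answers_def colour_code_def
        order_code_def edge_code_def)
qed

locale apsp_ram = apsp_io B S n + compiled B S w for B S n w
begin

lemma halts_ram_prog:
  assumes wp: "wp c t Q (start_vars n S) (start_arrs M)" and c: "0 \<notin> wv c"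
    and M: "M 0 = n" "\<And>x. M x < B" "\<forall>x\<ge>S. M x = 0"
  shows "\<exists>t' M' v' a'. t' \<le> t + 6 \<and> halts_after w (ram_prog c) M t' M' \<and> Q v' a' \<and> (\<forall>j<S. M' j = a' 0 0 j)"
proof -
  obtain t1 v' a' where big: "big c (start_vars n S) (start_arrs M) t1 v' a'" "t1 \<le> t" "Q v' a'"
    using wp by (auto simp: wp_def)
  have bw: "B \<le> 2 ^ w" by (rule B_le)
  have SB: "S + 4 < B"
    using S_ge(1) B_ge by linarith
  let ?R = "(\<lambda>_. 0)(13 := n, 0 := 4, 2 := (n + 1) * (n + 1), 1 := S)"
  have S': "S = (n + 1) * (n + 1) * 4" unfolding S by (simp add: algebra_simps)
  have le: "n < 2 ^ w" "n + 1 < 2 ^ w" "(n + 1) * (n + 1) < 2 ^ w" "S < 2 ^ w" "1 < (2::nat) ^ w" "4 < (2::nat) ^ w"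
    using bw SB S' B_small by linarith+
  have ex: "execs w start_code (\<lambda>_. 0, M) = Some (?R, M)"
    using le M(1) S' by (simp add: start_code_def fun_eq_iff)
  have l: "length start_code = 6" by (simp add: start_code_def)
  have at: "code_at (ram_prog c) 0 start_code" "code_at (ram_prog c) 6 (ccode c 6)"
    and halt: "6 + length (ccode c 6) < length (ram_prog c)" "ram_prog c ! (6 + length (ccode c 6)) = Halt"
  proof -
    have "code_at (ram_prog c) 0 (start_code @ ccode c 6 @ [Halt])"
      unfolding code_at_def ram_prog_def by (intro exI[of _ "[]"]) simp
    then show "code_at (ram_prog c) 0 start_code" "code_at (ram_prog c) 6 (ccode c 6)"
      "6 + length (ccode c 6) < length (ram_prog c)" "ram_prog c ! (6 + length (ccode c 6)) = Halt"
      by (simp_all add: code_at_append code_at_Cons l)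
  qed
  have r1: "reach w (ram_prog c) (0, \<lambda>_. 0, M) 6 (6, ?R, M)"
    using reach_execs[OF ex at(1)] unfolding l add_0 .
  have rel: "rel (start_vars n S) (start_arrs M) ?R M"
    unfolding rel_def
  proof (intro conjI allI impI)
    fix x show "?R (2 * x + 1) = start_vars n S x"
      by (cases "x = 0 \<or> x = 6") (auto simp: start_vars_def)
  next
    fix k i j assume k: "k < K" and j: "j < S"
    show "M ((i * K + k) * S + j) = start_arrs M k i j"
    proof (cases "k = 0 \<and> i = 0")
      case False
      \<comment> \<open>Everything except row 0 of array 0 lies at addresses from \<open>S\<close>
        on, where the initial memory is empty.\<close>
      then have "1 \<le> i * K + k" by (auto simp: K_def)
      then have "1 * S \<le> (i * K + k) * S" by (rule mult_right_mono) simp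
      then have "S \<le> (i * K + k) * S + j" by linarith
      then have "M ((i * K + k) * S + j) = 0" using M(3) by blast
      then show ?thesis using False by (auto simp: start_arrs_def)
    qed (auto simp: start_arrs_def)
  qed
  have "valid (start_vars n S) (start_arrs M)"
    using SB B_small M(2) by (auto simp: valid_def start_vars_def start_arrs_def)
  from ccode_correct[OF big(1) this _ c at(2) rel] obtain R' M' where
    2: "reach w (ram_prog c) (6, ?R, M) t1 (6 + length (ccode c 6), R', M')" "rel v' a' R' M'"
    by (auto simp: start_vars_def)
  have "halts_after w (ram_prog c) M (6 + t1) M'"
    unfolding halts_after_def using reach_trans[OF r1 2(1)] halt unfolding reach_def by blast
  moreover have "M' j = a' 0 0 j" if "j < S" for j
  proof -
    have "M' ((0 * K + 0) * S + j) = a' 0 0 j" using 2(2) that unfolding rel_def by (metis K_pos)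
    then show ?thesis by simp
  qed
  ultimately show ?thesis using big(2,3) by (intro exI[of _ "6 + t1"]) auto
qed

end

section \<open>Word length and total running time\<close>

definition ceil_log :: "nat \<Rightarrow> nat" where
  "ceil_log n = (LEAST l. n \<le> 2 ^ l)"

lemma ceil_log:
  assumes "1 \<le> n"
  shows "n \<le> 2 ^ ceil_log n" "2 ^ ceil_log n < 2 * n" "real (ceil_log n) \<le> 1 + log 2 (real n)" "ceil_log n \<le> n"
proof -
  have "n \<le> 2 ^ n" by simp
  then show 1: "n \<le> 2 ^ ceil_log n" unfolding ceil_log_def by (rule LeastI)
  show "ceil_log n \<le> n" unfolding ceil_log_def by (rule Least_le) simp
  show 2: "2 ^ ceil_log n < 2 * n"
  proof (cases "ceil_log n")
    case (Suc l)
    then have "\<not> n \<le> 2 ^ l" using not_less_Least[of l "\<lambda>l. n \<le> 2 ^ l"] by (simp add: ceil_log_def)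
    then show ?thesis using Suc by simp
  qed (use assms in simp)
  then have "real (2 ^ ceil_log n) < real (2 * n)" by (simp only: of_nat_less_iff)
  then have "2 powr real (ceil_log n) < 2 * real n" by (simp add: powr_realpow)
  then have "real (ceil_log n) < log 2 (2 * real n)" using assms by (simp add: less_log_iff)
  then show "real (ceil_log n) \<le> 1 + log 2 (real n)" using assms by (simp add: log_mult)
qed

text \<open>Large enough at once for the words of the simulated program, for the polynomially
  bounded counters and for the simulated program counter.\<close>

definition word_bound :: "nat \<Rightarrow> nat \<Rightarrow> nat \<Rightarrow> nat" where
  "word_bound W c n = 2 ^ W + 10000 * n ^ 4 + c + 1"

definition stride :: "nat \<Rightarrow> nat" where
  "stride n = 4 * (n + 1) * (n + 1)"

text \<open>Of the six logarithms, four come from \<open>n ^ 4\<close> in the word bound and two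
  from the stride; 14 bits cover the factor 10000.\<close>

lemma word_size:
  assumes n: "1 \<le> n"
  shows "(word_bound W c n * K + K) * stride n + stride n \<le> 2 ^ (W + 6 * ceil_log n + (c + 30))"
proof -
  let ?l = "ceil_log n"
  let ?e = "W + (14 + ?l * 4) + (c + 1)"
  have nl: "n \<le> 2 ^ ?l" using ceil_log(1)[OF n] .
  have "n ^ 4 \<le> (2 ^ ?l) ^ 4" using nl by (rule power_mono) simp
  then have "10000 * n ^ 4 \<le> 2 ^ 14 * 2 ^ (?l * 4)" unfolding power_mult by (intro mult_mono) auto
  then have a: "10000 * n ^ 4 \<le> 2 ^ (14 + ?l * 4)" by (simp add: power_add)
  have "c + 1 < 2 ^ (c + 1)" by (rule less_exp)
  then have b: "c + 1 \<le> 2 ^ (c + 1)" by simp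
  have mono: "(2::nat) ^ W \<le> 2 ^ ?e" "(2::nat) ^ (14 + ?l * 4) \<le> 2 ^ ?e" "(2::nat) ^ (c + 1) \<le> 2 ^ ?e"
    by (rule power_increasing; simp)+
  have B: "word_bound W c n \<le> 4 * 2 ^ ?e"
    unfolding word_bound_def using a b mono by linarith
  have "(n + 1) * (n + 1) \<le> (2 * 2 ^ ?l) * (2 * 2 ^ ?l)" using nl n by (intro mult_mono) auto
  moreover have "stride n = 4 * ((n + 1) * (n + 1))" by (simp only: stride_def mult.assoc)
  ultimately have S: "stride n \<le> 16 * (2 ^ ?l * 2 ^ ?l)" by linarith
  have "1 \<le> word_bound W c n" by (simp add: word_bound_def)
  then have "word_bound W c n * K + K + 1 \<le> 64 * word_bound W c n" unfolding K_def by linarith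
  then have "word_bound W c n * K + K + 1 \<le> 256 * 2 ^ ?e" using B by linarith
  then have "(word_bound W c n * K + K + 1) * stride n \<le> (256 * 2 ^ ?e) * (16 * (2 ^ ?l * 2 ^ ?l))"
    using S by (rule mult_mono) auto
  also have "\<dots> = 2 ^ 12 * (2 ^ ?e * (2 ^ ?l * 2 ^ ?l))" by simp
  also have "\<dots> = 2 ^ (12 + (?e + (?l + ?l)))" by (simp only: power_add)
  also have "\<dots> \<le> 2 ^ (W + 6 * ?l + (c + 30))" by (rule power_increasing) auto
  finally show ?thesis by (simp add: algebra_simps)
qed

lemma ae_instance:
  assumes n: "3 \<le> n"
    and solve: "\<forall>(n, A, S) \<in> AE_Mono_Triangle. \<exists>t M'. real t \<le> T n \<and>
               halts_after (W n) P (input_mem n A) t M' \<and> output_matrix n M' \<in> S"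
    and k: "\<forall>i\<in>set P. regs_below k i"
    and d: "hop_metric n d"
  shows "apsp (word_bound (W n) (length P) n) (stride n) n (n div 3) (ceil_log n) (W n) (nat \<lfloor>T n\<rfloor>) P k d"
proof -
  interpret hop_metric n d by (rule d)
  show ?thesis
  proof unfold_locales
    show "n \<le> 2 ^ ceil_log n" "2 ^ ceil_log n < 2 * n" "ceil_log n \<le> n" using ceil_log n by simp_all
    show "stride n = 4 * (n + 1) * (n + 1)" by (simp add: stride_def)
    show "\<exists>t M'. t \<le> nat \<lfloor>T n\<rfloor> \<and> halts_after (W n) P (input_mem n A) t M' \<and>
         (\<forall>i<n. \<forall>j<n. A i j \<noteq> 0 \<longrightarrow>
            M' (1 + n * n + (i * n + j)) = of_bool (\<exists>x<n. A i j = A j x \<and> A j x = A i x))"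
      if "\<And>i j. i < n \<Longrightarrow> j < n \<Longrightarrow> A i j = A j i" "\<And>i. i < n \<Longrightarrow> A i i = 0" "\<And>i j. i < n \<Longrightarrow> j < n \<Longrightarrow> A i j \<le> n * n" for A
      by (rule colour_instance[OF _ that solve]) (use n in simp)
  qed (use n k in \<open>auto simp: word_bound_def\<close>)
qed

theorem apsp_prog_correct:
  assumes solve: "\<forall>(n, A, S) \<in> AE_Mono_Triangle. \<exists>t M'. real t \<le> T n \<and>
               halts_after (W n) P (input_mem n A) t M' \<and> output_matrix n M' \<in> S"
    and k: "\<forall>i\<in>set P. regs_below k i"
    and G: "1 \<le> n" "pair_fin_digraph G" "pverts G = {..<n}"
  shows "\<exists>t M'. t \<le> (apsp.step_cost P k + 500) * (ceil_log n * (ceil_log n * (n * n + nat \<lfloor>T n\<rfloor> + 1))) + 500 * (n * n) + 6 \<and>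
     halts_after (W n + 6 * ceil_log n + (length P + 30)) (ram_prog (apsp_code P k)) (input_mem n (adjacency_matrix G)) t M' \<and>
     (\<forall>u<n. \<forall>v<n. output_matrix n M' u v = distance_word n (shortest_path_length G u v))"
proof -
  let ?B = "word_bound (W n) (length P) n" and ?S = "stride n" and ?w = "W n + 6 * ceil_log n + (length P + 30)"
  let ?d = "\<lambda>u v. distance_word n (shortest_path_length G u v)"
  let ?M = "input_mem n (adjacency_matrix G)"
  interpret apsp_ram ?B ?S n ?w
    by unfold_locales (use G(1) word_size[OF G(1)] in \<open>auto simp: stride_def word_bound_def\<close>)
  have adj: "?M (1 + (u * n + v)) = adjacency_matrix G u v" if "u < n" "v < n" for u v
    using row_major_le[OF that] that by (simp add: input_mem_def power2_eq_square)
  note d = shortest_path_distances[OF G(2,3)]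
  have wp: "wp (apsp_code P k) ((apsp.step_cost P k + 500) * (ceil_log n * (ceil_log n * (n * n + nat \<lfloor>T n\<rfloor> + 1))) + 500 * (n * n))
    (\<lambda>_ a'. \<forall>i<n. \<forall>j<n. a' 0 0 (1 + n * n + (i * n + j)) = ?d i j) (start_vars n ?S) (start_arrs ?M)"
  proof (rule wp_apsp[OF d(1)])
    show "if ?M (1 + (u * n + v)) \<noteq> 0 then ?d u v = 1 else 2 \<le> ?d u v" if "u < n" "v < n" "u \<noteq> v" for u v
      unfolding adj[OF that(1,2)] using that by (rule d(2))
    show "apsp ?B ?S n (n div 3) (ceil_log n) (W n) (nat \<lfloor>T n\<rfloor>) P k ?d" if "3 \<le> n"
      by (rule ae_instance[OF that solve k d(1)])
    show "n \<le> 2 ^ ceil_log n \<and> 2 ^ ceil_log n < 2 * n" if "3 \<le> n" using ceil_log(1,2)[of n] that by simp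
  qed
  have M: "?M 0 = n" "\<And>x. ?M x < ?B" "\<forall>x\<ge>?S. ?M x = 0"
    using B_small S_ge(1) by (auto simp: input_mem_def adjacency_matrix_def power2_eq_square)
  from halts_ram_prog[OF wp wv_apsp_code M] obtain t M' v' a' where
    1: "t \<le> (apsp.step_cost P k + 500) * (ceil_log n * (ceil_log n * (n * n + nat \<lfloor>T n\<rfloor> + 1))) + 500 * (n * n) + 6"
      "halts_after ?w (ram_prog (apsp_code P k)) ?M t M'"
      "\<forall>i<n. \<forall>j<n. a' 0 0 (1 + n * n + (i * n + j)) = ?d i j" "\<forall>j<?S. M' j = a' 0 0 j"
    by (elim exE conjE) (rule that)
  have "output_matrix n M' u v = ?d u v" if uv: "u < n" "v < n" for u v
  proof -
    have "1 + n * n + (u * n + v) < ?S" using row_major_le[OF uv] S_ge(1) by linarith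
    then show ?thesis using 1(3,4) uv by (simp add: output_matrix_def power2_eq_square add.assoc)
  qed
  with 1(1,2) show ?thesis by (intro exI[of _ t] exI[of _ M'] conjI allI impI) simp_all
qed

lemma log_bigo_word:
  assumes "(\<lambda>n. real (W n)) \<in> O(\<lambda>n. log 2 (real n))"
  shows "(\<lambda>n. real (W n + 6 * ceil_log n + c)) \<in> O(\<lambda>n. log 2 (real n))"
proof -
  have "(\<lambda>n. real (6 * ceil_log n + c)) \<in> O(\<lambda>n. log 2 (real n))"
  proof (rule bigoI)
    show "eventually (\<lambda>n. norm (real (6 * ceil_log n + c)) \<le> (12 + real c) * norm (log 2 (real n))) at_top"
      using eventually_ge_at_top[of 2]
    proof eventually_elim
      case (elim n)
      then have l: "1 \<le> log 2 (real n)" by (simp add: le_log_iff)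
      have "real c * 1 \<le> real c * log 2 (real n)" using l by (rule mult_left_mono) simp
      moreover have "real (ceil_log n) \<le> 1 + log 2 (real n)" using elim by (intro ceil_log(3)) simp
      then have "6 * real (ceil_log n) \<le> 12 * log 2 (real n)" using l by linarith
      ultimately show ?case using l by (simp add: algebra_simps)
    qed
  qed
  from sum_in_bigo(1)[OF assms this] show ?thesis by (simp add: add.assoc)
qed

theorem theorem3:
  fixes T :: "nat \<Rightarrow> real"
  assumes "solvable_in_time AE_Mono_Triangle T"
  shows "\<exists>T'. T' \<in> O(\<lambda>n. T n * (log 2 (real n))\<^sup>2) \<and> solvable_in_time UnweightedAPSP T'"
proof -
  obtain P W where W: "(\<lambda>n. real (W n)) \<in> O(\<lambda>n. log 2 (real n))"
    and solve: "\<forall>(n, A, S) \<in> AE_Mono_Triangle. \<exists>t M'. real t \<le> T n \<and>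
               halts_after (W n) P (input_mem n A) t M' \<and> output_matrix n M' \<in> S"
    using assms unfolding solvable_in_time_def by blast
  obtain k where k: "\<forall>i\<in>set P. regs_below k i" using regs_below_exists by blast
  define C where "C = apsp.step_cost P k + 500"
  define T' where "T' n = C * (ceil_log n * (ceil_log n * (n * n + nat \<lfloor>T n\<rfloor> + 1))) + 500 * (n * n) + 6" for n
  have "solvable_in_time UnweightedAPSP (\<lambda>n. real (T' n))"
    unfolding solvable_in_time_def
  proof (intro exI conjI)
    show "(\<lambda>n. real (W n + 6 * ceil_log n + (length P + 30))) \<in> O(\<lambda>n. log 2 (real n))"
      by (rule log_bigo_word[OF W])
    show "\<forall>(n, A, S) \<in> UnweightedAPSP. \<exists>t M'. real t \<le> real (T' n) \<and>
        halts_after (W n + 6 * ceil_log n + (length P + 30)) (ram_prog (apsp_code P k)) (input_mem n A) t M' \<and> output_matrix n M' \<in> S"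
      unfolding UnweightedAPSP_def T'_def C_def of_nat_le_iff using apsp_prog_correct[OF solve k] by fast
  qed
  moreover have "(\<lambda>n. real (T' n)) \<in> O(\<lambda>n. T n * (log 2 (real n))\<^sup>2)"
  proof (rule bigoI)
    \<comment> \<open>The constant is \<open>4 * (4 * C + 1006)\<close>, the outer 4 being the
      square of the 2 in \<open>real ?l \<le> 2 * log 2 (real n)\<close>.\<close>
    show "eventually (\<lambda>n. norm (real (T' n)) \<le> real (16 * C + 4024) * norm (T n * (log 2 (real n))\<^sup>2)) at_top"
      using eventually_ge_at_top[of 3]
    proof eventually_elim
      case (elim n)
      let ?\<tau> = "nat \<lfloor>T n\<rfloor>" and ?l = "ceil_log n"
      \<comment> \<open>Turns the quadratic work of the reduction itself into a multiple of
        \<open>?\<tau>\<close>, and shows that \<open>T n\<close> is positive here.\<close>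
      have "n * n \<le> ?\<tau> + n" by (rule ae_time_lower_bound[OF elim solve])
      moreover have "3 * n \<le> n * n" using elim by simp
      ultimately have \<tau>: "n * n \<le> 2 * ?\<tau>" "1 \<le> ?\<tau>" using elim by linarith+
      then have X: "n * n + ?\<tau> + 1 \<le> 4 * ?\<tau>" by linarith
      have l: "1 \<le> ?l * ?l" using ceil_log(1)[of n] elim by (cases ?l) auto
      have "?\<tau> * 1 \<le> ?\<tau> * (?l * ?l)" using l by (rule mult_left_mono) simp
      then have "500 * (n * n) + 6 \<le> 1006 * (?\<tau> * (?l * ?l))" using \<tau> by linarith
      moreover have "C * (?l * (?l * (n * n + ?\<tau> + 1))) \<le> C * (?l * (?l * (4 * ?\<tau>)))"
        using X by (intro mult_left_mono) auto
      moreover have "C * (?l * (?l * (4 * ?\<tau>))) + 1006 * (?\<tau> * (?l * ?l)) = (4 * C + 1006) * (?\<tau> * (?l * ?l))"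
        by (simp add: algebra_simps)
      ultimately have "T' n \<le> (4 * C + 1006) * (?\<tau> * (?l * ?l))" unfolding T'_def by linarith
      then have "real (T' n) \<le> real ((4 * C + 1006) * (?\<tau> * (?l * ?l)))" by (simp only: of_nat_le_iff)
      also have "\<dots> = real (4 * C + 1006) * (real ?\<tau> * (real ?l * real ?l))" by (simp only: of_nat_mult)
      also have "\<dots> \<le> real (4 * C + 1006) * (T n * ((2 * log 2 (real n)) * (2 * log 2 (real n))))"
      proof (intro mult_left_mono mult_mono)
        have "1 \<le> log 2 (real n)" using elim by (simp add: le_log_iff)
        moreover have "real ?l \<le> 1 + log 2 (real n)" using elim by (intro ceil_log(3)) simp
        ultimately show "real ?l \<le> 2 * log 2 (real n)" by linarith
        then show "real ?l \<le> 2 * log 2 (real n)" .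
        show "real ?\<tau> \<le> T n" using \<tau>(2) by linarith
        then show "0 \<le> T n" by linarith
        show "0 \<le> 2 * log 2 (real n)" using \<open>1 \<le> log 2 (real n)\<close> by simp
      qed auto
      also have "\<dots> = real (16 * C + 4024) * (T n * (log 2 (real n))\<^sup>2)" by (simp add: power2_eq_square algebra_simps)
      also have "\<dots> \<le> real (16 * C + 4024) * norm (T n * (log 2 (real n))\<^sup>2)" by (intro mult_left_mono) auto
      finally show ?case by simp
    qed
  qed
  ultimately show ?thesis by blast
qed

end
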